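(* Let $\mathfrak g$ be a finite-dimensional complex simple Lie algebra, let $\Gamma'=[\mathrm{SL}(2,\mathbb Z),\mathrm{SL}(2,\mathbb Z)]$ be the commutator subgroup of the modular group, and let $\rho:\Gamma'\to\mathrm{Aut}(\mathfrak g)$ be the restriction to $\Gamma'$ of a homomorphism of complex Lie groups $\bar\rho:\mathrm{SL}(2,\mathbb C)\to\mathrm{Aut}(\mathfrak g)$. Then there is a Lie algebra isomorphism $$\mathfrak M^!_0(\mathfrak g,\Gamma',\rho)\cong\mathfrak g\otimes_{\mathbb C}M^!_0(\Gamma').$$ Moreover, the algebra $M^!_0(\Gamma')$ is isomorphic to $\mathbb C[x,y]$ with $x,y$ satisfying the relation $$y^2=4x^3-1,$$ that is, to $\mathbb C[x,y]/(y^2-4x^3+1)$, where $x=\wp(z)$, $y=\wp'(z)$ are the Weierstrass functions on the corresponding equianharmonic elliptic curve (the compactification of $\Gamma'\backslash\mathbb H^2$ by its single cusp, the cusp being the point $z=0$).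
   Context: $\mathbb H^2$ is the upper half-plane with the action $\gamma\tau=\frac{a\tau+b}{c\tau+d}$ of $\mathrm{SL}(2,\mathbb Z)$. A function $f$ on $\mathbb H^2$ with values in a finite-dimensional normed space has exponential growth at the cusp $s\in\mathbb Q\cup\{\infty\}$ if, for $g\in\mathrm{SL}(2,\mathbb Z)$ with $gs=\infty$ and $\tau_s=g\tau$, there are constants $C,M$ with $\|f(\tau)\|<Ce^{M|\tau_s|}$ whenever $\operatorname{Im}\tau_s$ is large enough. $\mathfrak M^!_0(\mathfrak g,\Gamma',\rho)$ is the Lie algebra, under the pointwise bracket, of holomorphic maps $f:\mathbb H^2\to\mathfrak g$ with $f(\gamma\tau)=\rho(\gamma)f(\tau)$ for all $\gamma\in\Gamma'$, with exponential growth at every cusp. $M^!_0(\Gamma')$ is the algebra of $\Gamma'$-invariant holomorphic functions $\mathbb H^2\to\mathbb C$ with exponential growth at every cusp. The equianharmonic elliptic curve is the one with Weierstrass invariant $g_2=0$, i.e. isomorphic to $\mathbb C/(\mathbb Z\oplus\mathbb Z e^{2\pi i/3})$; its lattice is scaled here so that $g_3=1$. *)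

theory Defs
  imports
    "HOL-Complex_Analysis.Complex_Analysis"
    "HOL-Algebra.QuotRing"
    "HOL-Algebra.Generated_Groups"
    "HOL-Algebra.Algebraic_Closure_Type"
    "HOL-Library.Poly_Mapping"
    "HOL-Library.Function_Algebras"
begin

unbundle no Formal_Power_Series.fps_syntax

section \<open>The modular group and its commutator subgroup\<close>

definition SL2 :: "('a::comm_ring_1 ^ 2 ^ 2) monoid" where
  "SL2 = \<lparr>carrier = {A. det A = 1}, mult = (**), one = mat 1\<rparr>"

abbreviation SL2Z :: "(int ^ 2 ^ 2) monoid" where "SL2Z \<equiv> SL2"

abbreviation SL2C :: "(complex ^ 2 ^ 2) monoid" where "SL2C \<equiv> SL2"

definition modular_commutator :: "(int ^ 2 ^ 2) set" where
  "modular_commutator = derived SL2Z (carrier SL2Z)"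

definition upper_half_plane :: "complex set" where
  "upper_half_plane = {\<tau>. Im \<tau> > 0}"

definition moebius :: "int ^ 2 ^ 2 \<Rightarrow> complex \<Rightarrow> complex" where
  "moebius g \<tau> = (of_int (g $ 1 $ 1) * \<tau> + of_int (g $ 1 $ 2)) /
                 (of_int (g $ 2 $ 1) * \<tau> + of_int (g $ 2 $ 2))"

text \<open>Cusps are elements of \<open>rat option\<close>, with \<open>None\<close> standing for the cusp at infinity.\<close>

definition cusp_act :: "int ^ 2 ^ 2 \<Rightarrow> rat option \<Rightarrow> rat option" where
  "cusp_act g s = (case s of
      None \<Rightarrow> if g $ 2 $ 1 = 0 then None
              else Some (of_int (g $ 1 $ 1) / of_int (g $ 2 $ 1))
    | Some p \<Rightarrow> if of_int (g $ 2 $ 1) * p + of_int (g $ 2 $ 2) = 0 then None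
              else Some ((of_int (g $ 1 $ 1) * p + of_int (g $ 1 $ 2)) /
                         (of_int (g $ 2 $ 1) * p + of_int (g $ 2 $ 2))))"

definition exponential_growth_at :: "rat option \<Rightarrow> (complex \<Rightarrow> 'v::real_normed_vector) \<Rightarrow> bool" where
  "exponential_growth_at s f \<longleftrightarrow>
     (\<forall>g\<in>carrier SL2Z. cusp_act g s = None \<longrightarrow>
        (\<exists>C M Y :: real. \<forall>\<tau>\<in>upper_half_plane. Im (moebius g \<tau>) > Y \<longrightarrow>
            norm (f \<tau>) < C * exp (M * cmod (moebius g \<tau>))))"


section \<open>Weakly holomorphic modular functions\<close>

text \<open>
  A function on the upper half-plane is represented by a total function that vanishes off
  the upper half-plane, so that equality of functions is equality on the upper half-plane.
\<close>

definition modular_functions :: "(int ^ 2 ^ 2) set \<Rightarrow> (complex \<Rightarrow> complex) set" where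
  "modular_functions \<Gamma> = {f.
      (\<forall>\<tau>. \<tau> \<notin> upper_half_plane \<longrightarrow> f \<tau> = 0) \<and>
      f holomorphic_on upper_half_plane \<and>
      (\<forall>\<gamma>\<in>\<Gamma>. \<forall>\<tau>\<in>upper_half_plane. f (moebius \<gamma> \<tau>) = f \<tau>) \<and>
      (\<forall>s. exponential_growth_at s f)}"

definition modular_function_ring :: "(int ^ 2 ^ 2) set \<Rightarrow> (complex \<Rightarrow> complex) ring" where
  "modular_function_ring \<Gamma> =
     \<lparr>carrier = modular_functions \<Gamma>,
      mult = (\<lambda>f g \<tau>. f \<tau> * g \<tau>), one = (\<lambda>\<tau>. if \<tau> \<in> upper_half_plane then 1 else 0),
      zero = (\<lambda>\<tau>. 0), add = (\<lambda>f g \<tau>. f \<tau> + g \<tau>)\<rparr>"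


section \<open>Complex Lie algebras\<close>

locale complex_normed_space = vector_space smul
  for smul :: "complex \<Rightarrow> 'g::real_normed_vector \<Rightarrow> 'g" +
  assumes smul_of_real: "smul (of_real r) v = r *\<^sub>R v"
    and norm_smul: "norm (smul c v) = cmod c * norm v"

text \<open>
  The norm is an arbitrary complex norm; on a finite-dimensional space all choices give the
  same holomorphic maps and the same growth conditions.
\<close>

locale fd_complex_lie_algebra = complex_normed_space smul
  for smul :: "complex \<Rightarrow> 'g::real_normed_vector \<Rightarrow> 'g" +
  fixes bracket :: "'g \<Rightarrow> 'g \<Rightarrow> 'g"
  assumes finite_dim: "\<exists>B. finite B \<and> span B = UNIV"
    and bracket_add_left: "bracket (u + v) w = bracket u w + bracket v w"
    and bracket_add_right: "bracket u (v + w) = bracket u v + bracket u w"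
    and bracket_smul_left: "bracket (smul c u) v = smul c (bracket u v)"
    and bracket_smul_right: "bracket u (smul c v) = smul c (bracket u v)"
    and bracket_self: "bracket u u = 0"
    and jacobi: "bracket u (bracket v w) + bracket v (bracket w u) + bracket w (bracket u v) = 0"

locale simple_fd_complex_lie_algebra = fd_complex_lie_algebra smul bracket
  for smul :: "complex \<Rightarrow> 'g::real_normed_vector \<Rightarrow> 'g" and bracket :: "'g \<Rightarrow> 'g \<Rightarrow> 'g" +
  assumes nonabelian: "\<exists>u v. bracket u v \<noteq> 0"
    and no_ideals: "subspace I \<Longrightarrow> (\<forall>u. \<forall>v\<in>I. bracket u v \<in> I) \<Longrightarrow> I = {0} \<or> I = UNIV"

definition lie_aut_group ::
    "(complex \<Rightarrow> 'g \<Rightarrow> 'g) \<Rightarrow> ('g \<Rightarrow> 'g \<Rightarrow> 'g) \<Rightarrow> ('g::real_normed_vector \<Rightarrow> 'g) monoid" where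
  "lie_aut_group smul bracket =
     \<lparr>carrier = {\<phi>. bij \<phi> \<and> (\<forall>u v. \<phi> (u + v) = \<phi> u + \<phi> v) \<and>
                    (\<forall>c v. \<phi> (smul c v) = smul c (\<phi> v)) \<and>
                    (\<forall>u v. \<phi> (bracket u v) = bracket (\<phi> u) (\<phi> v))},
      mult = (\<circ>), one = id\<rparr>"


section \<open>Holomorphic maps\<close>

definition complex_differentiable_at ::
    "(complex \<Rightarrow> 'v \<Rightarrow> 'v) \<Rightarrow> (complex \<Rightarrow> 'w \<Rightarrow> 'w) \<Rightarrow>
     ('v::real_normed_vector \<Rightarrow> 'w::real_normed_vector) \<Rightarrow> 'v \<Rightarrow> bool" where
  "complex_differentiable_at sV sW F x \<longleftrightarrow>
     (\<exists>D. (F has_derivative D) (at x) \<and> (\<forall>c h. D (sV c h) = sW c (D h)))"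

text \<open>
  Holomorphy on the complex submanifold \<open>SL(2,\<complex>)\<close> of the space of matrices means
  that the map extends locally to a holomorphic map on an open set of matrices. As the target is
  a finite-dimensional space of linear maps, this is required of \<open>A \<mapsto> r A v\<close> for each vector \<open>v\<close>.
\<close>

definition holomorphic_on_SL2C ::
    "(complex \<Rightarrow> 'g \<Rightarrow> 'g) \<Rightarrow> (complex ^ 2 ^ 2 \<Rightarrow> 'g \<Rightarrow> 'g::real_normed_vector) \<Rightarrow> bool" where
  "holomorphic_on_SL2C smul r \<longleftrightarrow>
     (\<forall>v. \<forall>A\<in>carrier SL2C. \<exists>U F. open U \<and> A \<in> U \<and>
        (\<forall>Z\<in>U. complex_differentiable_at (\<lambda>c. map_matrix ((*) c)) smul F Z) \<and>
        (\<forall>Z\<in>U \<inter> carrier SL2C. F Z = r Z v))"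


section \<open>The two Lie algebras\<close>

record 'a lie_structure = "'a partial_object" +
  lie_add :: "'a \<Rightarrow> 'a \<Rightarrow> 'a"
  lie_scale :: "complex \<Rightarrow> 'a \<Rightarrow> 'a"
  lie_bracket :: "'a \<Rightarrow> 'a \<Rightarrow> 'a"

definition lie_iso :: "'a lie_structure \<Rightarrow> 'b lie_structure \<Rightarrow> ('a \<Rightarrow> 'b) set" where
  "lie_iso L L' = {\<phi>. bij_betw \<phi> (carrier L) (carrier L') \<and>
      (\<forall>a\<in>carrier L. \<forall>b\<in>carrier L.
          \<phi> (lie_add L a b) = lie_add L' (\<phi> a) (\<phi> b) \<and>
          \<phi> (lie_bracket L a b) = lie_bracket L' (\<phi> a) (\<phi> b)) \<and>
      (\<forall>c. \<forall>a\<in>carrier L. \<phi> (lie_scale L c a) = lie_scale L' c (\<phi> a))}"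

definition equivariant_lie_algebra ::
    "(complex \<Rightarrow> 'g \<Rightarrow> 'g) \<Rightarrow> ('g \<Rightarrow> 'g \<Rightarrow> 'g) \<Rightarrow> (int ^ 2 ^ 2) set \<Rightarrow>
     (int ^ 2 ^ 2 \<Rightarrow> 'g \<Rightarrow> 'g) \<Rightarrow> (complex \<Rightarrow> 'g::real_normed_vector) lie_structure" where
  "equivariant_lie_algebra smul bracket \<Gamma> \<rho> =
     \<lparr>carrier = {f.
        (\<forall>\<tau>. \<tau> \<notin> upper_half_plane \<longrightarrow> f \<tau> = 0) \<and>
        (\<forall>\<tau>\<in>upper_half_plane. complex_differentiable_at (*) smul f \<tau>) \<and>
        (\<forall>\<gamma>\<in>\<Gamma>. \<forall>\<tau>\<in>upper_half_plane. f (moebius \<gamma> \<tau>) = \<rho> \<gamma> (f \<tau>)) \<and>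
        (\<forall>s. exponential_growth_at s f)},
      lie_add = (\<lambda>f g \<tau>. f \<tau> + g \<tau>),
      lie_scale = (\<lambda>c f \<tau>. smul c (f \<tau>)),
      lie_bracket = (\<lambda>f g \<tau>. bracket (f \<tau>) (g \<tau>))\<rparr>"

text \<open>
  The tensor product over the complex numbers of a complex vector space (the whole type \<open>'v\<close>,
  with scalar multiplication \<open>sV\<close>) and a complex vector space \<open>W\<close> (a set closed under the
  operations, with scalar multiplication \<open>sW\<close>) is the free vector space on \<open>UNIV \<times> W\<close>
  modulo the span of the bilinearity relations.
\<close>

definition tensor_relators ::
    "(complex \<Rightarrow> 'v \<Rightarrow> 'v) \<Rightarrow> (complex \<Rightarrow> 'w \<Rightarrow> 'w) \<Rightarrow> 'w set \<Rightarrow>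
     (('v::ab_group_add \<times> 'w::comm_ring) \<Rightarrow>\<^sub>0 complex) set" where
  "tensor_relators sV sW W =
     {Poly_Mapping.single (u + v, f) 1 - Poly_Mapping.single (u, f) 1 - Poly_Mapping.single (v, f) 1
        | u v f. f \<in> W} \<union>
     {Poly_Mapping.single (u, f + g) 1 - Poly_Mapping.single (u, f) 1 - Poly_Mapping.single (u, g) 1
        | u f g. f \<in> W \<and> g \<in> W} \<union>
     {Poly_Mapping.single (sV c u, f) 1 - Poly_Mapping.single (u, f) c | c u f. f \<in> W} \<union>
     {Poly_Mapping.single (u, sW c f) 1 - Poly_Mapping.single (u, f) c | c u f. f \<in> W}"

definition tensor_class ::
    "(complex \<Rightarrow> 'v \<Rightarrow> 'v) \<Rightarrow> (complex \<Rightarrow> 'w \<Rightarrow> 'w) \<Rightarrow> 'w set \<Rightarrow>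
     (('v::ab_group_add \<times> 'w::comm_ring) \<Rightarrow>\<^sub>0 complex) \<Rightarrow> (('v \<times> 'w) \<Rightarrow>\<^sub>0 complex) set" where
  "tensor_class sV sW W F =
     {G. G - F \<in> module.span (\<lambda>c. Poly_Mapping.map ((*) c)) (tensor_relators sV sW W)}"

text \<open>
  The bracket on the tensor product of a Lie algebra with a commutative algebra: the bilinear
  extension of \<open>[u \<otimes> f, v \<otimes> g] = [u, v] \<otimes> f g\<close>.
\<close>

definition free_bracket ::
    "('v \<Rightarrow> 'v \<Rightarrow> 'v) \<Rightarrow> (('v \<times> 'w::comm_ring) \<Rightarrow>\<^sub>0 complex) \<Rightarrow>
     (('v \<times> 'w) \<Rightarrow>\<^sub>0 complex) \<Rightarrow> (('v \<times> 'w) \<Rightarrow>\<^sub>0 complex)" where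
  "free_bracket bracket F G =
     (\<Sum>p\<in>Poly_Mapping.keys F. \<Sum>q\<in>Poly_Mapping.keys G.
        Poly_Mapping.single (bracket (fst p) (fst q), snd p * snd q)
          (Poly_Mapping.lookup F p * Poly_Mapping.lookup G q))"

definition tensor_lie_algebra ::
    "(complex \<Rightarrow> 'v \<Rightarrow> 'v) \<Rightarrow> ('v \<Rightarrow> 'v \<Rightarrow> 'v) \<Rightarrow> (complex \<Rightarrow> 'w \<Rightarrow> 'w) \<Rightarrow> 'w set \<Rightarrow>
     (('v::ab_group_add \<times> 'w::comm_ring) \<Rightarrow>\<^sub>0 complex) set lie_structure" where
  "tensor_lie_algebra sV bracket sW W =
     \<lparr>carrier = tensor_class sV sW W ` {F. Poly_Mapping.keys F \<subseteq> UNIV \<times> W},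
      lie_add = (\<lambda>S T. \<Union>F\<in>S. \<Union>G\<in>T. tensor_class sV sW W (F + G)),
      lie_scale = (\<lambda>c S. \<Union>F\<in>S. tensor_class sV sW W (Poly_Mapping.map ((*) c) F)),
      lie_bracket = (\<lambda>S T. \<Union>F\<in>S. \<Union>G\<in>T. tensor_class sV sW W (free_bracket bracket F G))\<rparr>"


section \<open>Polynomials in two variables\<close>

text \<open>
  The ring \<open>\<complex>[x,y]\<close> is \<open>complex poly poly\<close>: the outer indeterminate is \<open>y\<close>,
  the coefficients are polynomials in \<open>x\<close>.
\<close>

definition poly_X :: "complex poly poly" where "poly_X = [:[:0, 1:]:]"

definition poly_Y :: "complex poly poly" where "poly_Y = [:0, 1:]"

definition eval_xy :: "(complex \<Rightarrow> complex) \<Rightarrow> (complex \<Rightarrow> complex) \<Rightarrow> complex poly poly \<Rightarrow> complex \<Rightarrow> complex" where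
  "eval_xy x y p = (\<lambda>\<tau>. if \<tau> \<in> upper_half_plane then poly (poly p [:y \<tau>:]) (x \<tau>) else 0)"

definition weierstrass_ideal :: "complex poly poly set" where
  "weierstrass_ideal = PIdl\<^bsub>ring_of_type_algebra\<^esub> (poly_Y ^ 2 - 4 * poly_X ^ 3 + 1)"

definition weierstrass_coordinate_ring :: "complex poly poly set ring" where
  "weierstrass_coordinate_ring = ring_of_type_algebra Quot weierstrass_ideal"


section \<open>Elliptic functions\<close>

definition hexagonal_lattice :: "complex \<Rightarrow> complex set" where
  "hexagonal_lattice \<omega> =
     {\<omega> * (of_int m + of_int n * exp (2 * of_real pi * \<i> / 3)) | m n :: int. True}"

definition weierstrass_p :: "complex set \<Rightarrow> complex \<Rightarrow> complex" where
  "weierstrass_p \<Lambda> z = 1 / z ^ 2 + (\<Sum>\<^sub>\<infinity>w\<in>\<Lambda> - {0}. (1 / (z - w) ^ 2 - 1 / w ^ 2))"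

definition weierstrass_g2 :: "complex set \<Rightarrow> complex" where
  "weierstrass_g2 \<Lambda> = 60 * (\<Sum>\<^sub>\<infinity>w\<in>\<Lambda> - {0}. 1 / w ^ 4)"

definition weierstrass_g3 :: "complex set \<Rightarrow> complex" where
  "weierstrass_g3 \<Lambda> = 140 * (\<Sum>\<^sub>\<infinity>w\<in>\<Lambda> - {0}. 1 / w ^ 6)"

definition torus_point :: "complex set \<Rightarrow> complex \<Rightarrow> complex set" where
  "torus_point \<Lambda> w = {z. z - w \<in> \<Lambda>}"


section \<open>The compactified modular curve\<close>

definition orbit_point :: "(int ^ 2 ^ 2) set \<Rightarrow> complex \<Rightarrow> complex set" where
  "orbit_point \<Gamma> \<tau> = {moebius \<gamma> \<tau> | \<gamma>. \<gamma> \<in> \<Gamma>}"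

definition cusp_point :: "(int ^ 2 ^ 2) set \<Rightarrow> rat option \<Rightarrow> rat option set" where
  "cusp_point \<Gamma> s = {cusp_act \<gamma> s | \<gamma>. \<gamma> \<in> \<Gamma>}"

definition compactified_curve :: "(int ^ 2 ^ 2) set \<Rightarrow> (complex set + rat option set) set" where
  "compactified_curve \<Gamma> = (Inl ` orbit_point \<Gamma> ` upper_half_plane) \<union> (Inr ` range (cusp_point \<Gamma>))"

definition cusp_width :: "(int ^ 2 ^ 2) set \<Rightarrow> int ^ 2 ^ 2 \<Rightarrow> nat" where
  "cusp_width \<Gamma> g = (LEAST n. n > 0 \<and>
     (\<exists>\<gamma>\<in>\<Gamma>. \<forall>\<tau>\<in>upper_half_plane. moebius \<gamma> (moebius g \<tau>) = moebius g (\<tau> + of_nat n)))"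

text \<open>
  A biholomorphic map from the compactified curve of a group acting freely on the upper half-plane
  onto a complex torus is a bijection that, in terms of the standard charts, is locally given by
  holomorphic functions with nonvanishing derivative. Around the orbit of a point of the upper
  half-plane the chart is a local inverse of the projection to the orbit space; around the cusp
  \<open>g \<infinity>\<close> the coordinate of the orbit of \<open>g \<tau>\<close> is \<open>q = exp (2 \<pi> i \<tau> / n)\<close> with \<open>n\<close> the
  width of the cusp. The charts of the torus are local inverses of the projection from the plane,
  so that \<open>h\<close> represents the map if \<open>h\<close> takes its values in the cosets given by the map.
\<close>

definition biholomorphic_to_torus ::
    "(int ^ 2 ^ 2) set \<Rightarrow> complex set \<Rightarrow> (complex set + rat option set \<Rightarrow> complex set) \<Rightarrow> bool" where
  "biholomorphic_to_torus \<Gamma> \<Lambda> \<Phi> \<longleftrightarrow>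
     bij_betw \<Phi> (compactified_curve \<Gamma>) (range (torus_point \<Lambda>)) \<and>
     (\<forall>\<tau>0\<in>upper_half_plane. \<exists>r>0. \<exists>h.
        ball \<tau>0 r \<subseteq> upper_half_plane \<and> h holomorphic_on ball \<tau>0 r \<and> deriv h \<tau>0 \<noteq> 0 \<and>
        (\<forall>\<tau>\<in>ball \<tau>0 r. h \<tau> \<in> \<Phi> (Inl (orbit_point \<Gamma> \<tau>)))) \<and>
     (\<forall>g\<in>carrier SL2Z. \<exists>r>0. \<exists>h.
        h holomorphic_on ball 0 r \<and> deriv h 0 \<noteq> 0 \<and>
        h 0 \<in> \<Phi> (Inr (cusp_point \<Gamma> (cusp_act g None))) \<and>
        (\<forall>\<tau>\<in>upper_half_plane.
           (let q = exp (2 * of_real pi * \<i> * \<tau> / of_nat (cusp_width \<Gamma> g)) in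
             q \<in> ball 0 r \<longrightarrow> h q \<in> \<Phi> (Inl (orbit_point \<Gamma> (moebius g \<tau>))))))"

end

theory Submission
  imports Defs
begin

text \<open>
  The logarithmic derivative \<open>L\<close> of \<open>\<phi> = \<eta>\<^sup>2\<close> is a multiple of the weight two Eisenstein series, so \<open>\<phi>\<close> transforms
  under the modular group by the weight one factor and a character, which is trivial on commutators.
  Differentiating the transformation law of \<open>L\<close> yields the Eisenstein series \<open>E\<^sub>4\<close>; suitably scaled, \<open>x = E\<^sub>4 / \<phi>\<^sup>4\<close>
  and its derivative \<open>y\<close> with respect to \<open>\<integral> \<phi>\<^sup>2 d\<tau>\<close> satisfy \<open>y\<^sup>2 = 4 x\<^sup>3 - 1\<close>, with poles of order 2 and 3 at the
  only cusp, which has width 6.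

  Both the pair \<open>(x, y)\<close> and the pair \<open>(\<wp>, \<wp>')\<close> are local homeomorphisms onto the connected affine curve,
  proper modulo their symmetries and injective near infinity, hence bijective modulo the symmetries; comparing the two
  gives the biholomorphic map to the torus. Pole orders at the cusp show that \<open>x\<close> and \<open>y\<close> generate the ring.

  For the Lie algebras, the matrix with rows \<open>(\<tau> \<phi>, - (1 + \<tau> L) / \<phi>)\<close> and \<open>(\<phi>, - L / \<phi>)\<close> lies in \<open>SL(2, \<complex>)\<close>, is
  holomorphic and is multiplied by \<open>\<gamma>\<close> on the left when \<open>\<tau>\<close> is replaced by \<open>\<gamma> \<tau>\<close>. Applying the representation to it
  turns constant vectors into equivariant functions, and its image under a holomorphic representation
  grows at most exponentially because it is a product of values of one-parameter subgroups at arguments of linear growth.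
\<close>

section \<open>The modular group\<close>

text \<open>The thread is the differential phi^2 d\<tau>. As phi has weight one and trivial
  character on the commutator subgroup, this differential is invariant; it is the holomorphic
  differential of the elliptic curve. Differentiating along it preserves weight zero, which is where
  y comes from. It also explains the matrix: the first column is the vector phi (\<tau>, 1), which
  \<gamma> multiplies from the left, and the second is minus its derivative along phi^2 d\<tau>, so
  that the determinant is a Wronskian and equals 1.

  The weight two series converges only conditionally. The boundary term left by exchanging its two
  summations is the inhomogeneous term in its transformation law; without that term phi would have
  weight zero.

  Apart from a power of the local parameter q, the expansions of x and y at the cusp involve only
  powers of q^6. Hence cancelling the leading coefficient in a combination of y^2 and x^3, whose
  poles have order 6, cancels the whole pole, and no term linear in x is left. That the remaining
  constant is not zero has to be excluded separately: otherwise the curve would be a cuspidal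
  cubic.\<close>

definition mat2 :: "'a::zero \<Rightarrow> 'a \<Rightarrow> 'a \<Rightarrow> 'a \<Rightarrow> 'a ^ 2 ^ 2" where
  "mat2 a b c d = vector [vector [a, b], vector [c, d]]"

lemma mat2_nth [simp]:
  "mat2 a b c d $ 1 $ 1 = a" "mat2 a b c d $ 1 $ 2 = b"
  "mat2 a b c d $ 2 $ 1 = c" "mat2 a b c d $ 2 $ 2 = d"
  by (simp_all add: mat2_def)

lemma mat2_eq_iff: "A = B \<longleftrightarrow> A $ 1 $ 1 = B $ 1 $ 1 \<and> A $ 1 $ 2 = B $ 1 $ 2 \<and>
   A $ 2 $ 1 = B $ 2 $ 1 \<and> A $ 2 $ 2 = (B :: 'a ^ 2 ^ 2) $ 2 $ 2"
  by (auto simp: vec_eq_iff forall_2)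

lemma mat2_inject [simp]: "mat2 a b c d = mat2 a' b' c' d' \<longleftrightarrow> a = a' \<and> b = b' \<and> c = c' \<and> d = d'"
  by (auto simp: mat2_eq_iff)

lemma mat2_mult: "mat2 a b c d ** mat2 a' b' c' d' =
    mat2 (a * a' + b * c') (a * b' + b * d') (c * a' + d * c') (c * b' + d * (d' :: 'a :: comm_ring_1))"
  by (simp add: mat2_eq_iff matrix_matrix_mult_def sum_2)

lemma matrix2_mult_nth:
  "((A :: 'a::comm_ring_1 ^ 2 ^ 2) ** B) $ i $ j = A $ i $ 1 * B $ 1 $ j + A $ i $ 2 * B $ 2 $ j"
  by (simp add: matrix_matrix_mult_def sum_2)

lemma mat2_one: "mat 1 = mat2 1 0 0 (1 :: 'a :: comm_ring_1)"
  by (simp add: mat2_eq_iff mat_def)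

lemma det_mat2: "det (mat2 a b c d) = a * d - b * (c :: 'a :: comm_ring_1)"
  by (simp add: det_2)

lemma mat2_SL2_iff: "mat2 a b c d \<in> carrier SL2 \<longleftrightarrow> a * d - b * c = (1 :: 'a :: comm_ring_1)"
  by (simp add: SL2_def det_mat2)

lemma mat2_cases: obtains a b c d where "(A :: 'a::zero ^ 2 ^ 2) = mat2 a b c d"
proof
  show "A = mat2 (A $ 1 $ 1) (A $ 1 $ 2) (A $ 2 $ 1) (A $ 2 $ 2)"
    by (simp add: mat2_eq_iff)
qed

lemma SL2_cases:
  assumes "A \<in> carrier SL2"
  obtains a b c d where "(A :: 'a :: comm_ring_1 ^ 2 ^ 2) = mat2 a b c d" "a * d - b * c = 1"
  using assms mat2_cases mat2_SL2_iff by metis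

lemma group_SL2: "group (SL2 :: ('a :: comm_ring_1 ^ 2 ^ 2) monoid)"
proof (rule groupI)
  fix x :: "'a ^ 2 ^ 2" assume "x \<in> carrier SL2"
  then obtain a b c d where x: "x = mat2 a b c d" "a * d - b * c = 1" by (rule SL2_cases)
  show "\<exists>y\<in>carrier SL2. y \<otimes>\<^bsub>SL2\<^esub> x = \<one>\<^bsub>SL2\<^esub>"
  proof
    show "mat2 d (-b) (-c) a \<in> carrier SL2" using x by (simp add: mat2_SL2_iff algebra_simps)
    show "mat2 d (-b) (-c) a \<otimes>\<^bsub>SL2\<^esub> x = \<one>\<^bsub>SL2\<^esub>"
      using x(2) unfolding x(1) by (simp add: SL2_def mat2_mult mat2_one algebra_simps)
  qed
qed (auto simp: SL2_def det_mul matrix_mul_assoc)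

lemma SL2_simps: "A \<otimes>\<^bsub>SL2\<^esub> B = A ** B" "\<one>\<^bsub>SL2\<^esub> = mat 1"
  by (simp_all add: SL2_def)

lemma inv_SL2:
  assumes "a * d - b * c = (1 :: 'a :: comm_ring_1)"
  shows "inv\<^bsub>SL2\<^esub> (mat2 a b c d) = mat2 d (-b) (-c) a"
proof -
  interpret group "SL2 :: ('a ^ 2 ^ 2) monoid" by (rule group_SL2)
  show ?thesis
    by (rule inv_equality)
      (use assms in \<open>simp_all add: SL2_simps mat2_mult mat2_one mat2_SL2_iff algebra_simps\<close>)
qed

section \<open>Generators of the modular group and cosets of the commutator subgroup\<close>

interpretation SL2Z: group SL2Z by (rule group_SL2)

abbreviation matS :: "int ^ 2 ^ 2" where "matS \<equiv> mat2 0 (-1) 1 0"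

definition matT :: "int \<Rightarrow> int ^ 2 ^ 2" where "matT k = mat2 1 k 0 1"

lemma matT_in [simp]: "matT k \<in> carrier SL2Z" by (simp add: matT_def mat2_SL2_iff)
lemma matS_in [simp]: "matS \<in> carrier SL2Z" by (simp add: mat2_SL2_iff)
lemma SL2Z_mult_in: "A \<in> carrier SL2Z \<Longrightarrow> B \<in> carrier SL2Z \<Longrightarrow> A ** B \<in> carrier SL2Z"
  using SL2Z.m_closed[of A B] by (simp add: SL2_simps)
lemma matT_mult: "matT k ** matT l = matT (k + l)"
  by (simp add: matT_def mat2_mult add.commute)
lemma matT_0: "matT 0 = mat 1" by (simp add: matT_def mat2_one)

lemma modular_commutator_normal: "modular_commutator \<lhd> SL2Z"
  unfolding modular_commutator_def
  by (rule SL2Z.derived_self_is_normal)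

interpretation MC: subgroup modular_commutator SL2Z
  using modular_commutator_normal by (simp add: normal_def)

lemma modular_commutator_in_SL2Z: "\<gamma> \<in> modular_commutator \<Longrightarrow> \<gamma> \<in> carrier SL2Z"
  by (rule MC.mem_carrier)

lemma modular_commutator_mult:
  "\<gamma> \<in> modular_commutator \<Longrightarrow> \<delta> \<in> modular_commutator \<Longrightarrow> \<gamma> ** \<delta> \<in> modular_commutator"
  using MC.m_closed[of \<gamma> \<delta>] by (simp add: SL2_simps)

lemma modular_commutator_one: "mat 1 \<in> modular_commutator"
  using MC.one_closed by (simp add: SL2_simps)

lemma modular_commutator_inv:
  "\<gamma> \<in> modular_commutator \<Longrightarrow> inv\<^bsub>SL2Z\<^esub> \<gamma> \<in> modular_commutator"
  by (rule MC.m_inv_closed)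

lemma modular_commutator_conj:
  "\<gamma> \<in> modular_commutator \<Longrightarrow> g \<in> carrier SL2Z \<Longrightarrow> g ** \<gamma> ** inv\<^bsub>SL2Z\<^esub> g \<in> modular_commutator"
  using normal.inv_op_closed2[OF modular_commutator_normal, of g \<gamma>] by (simp add: SL2_simps)

lemma commutator_in:
  "g \<in> carrier SL2Z \<Longrightarrow> h \<in> carrier SL2Z \<Longrightarrow>
     g ** h ** inv\<^bsub>SL2Z\<^esub> g ** inv\<^bsub>SL2Z\<^esub> h \<in> modular_commutator"
  unfolding modular_commutator_def derived_def
  by (rule generate.incl) (force simp: SL2_simps)

text \<open>Modulo commutators, the relation \<open>(S T)\<^sup>3 = S\<^sup>2\<close> says that \<open>S\<close> is \<open>T\<^sup>-\<^sup>3\<close>.\<close>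

lemma ST3_in: "matS ** matT 3 \<in> modular_commutator"
proof -
  \<comment> \<open>This matrix is the commutator of S and T. Conjugating its inverse by T^(-2)
    gives S T^3.\<close>
  have "mat2 1 (-1) (-1) 2 \<in> modular_commutator"
    using commutator_in[of matS "matT 1"]
    by (simp add: matT_def inv_SL2 mat2_mult mat2_SL2_iff)
  from modular_commutator_conj[OF modular_commutator_inv[OF this], of "matT (-2)"]
  show ?thesis
    by (simp add: matT_def inv_SL2 mat2_mult mat2_SL2_iff)
qed

text \<open>A conjugate of S T^3 times S T^3 collapses to S^2 T^6 = - T^6. Since -1 acts trivially,
  the translation by 6 belongs to the action of the commutator subgroup.\<close>

lemma neg_T6_in: "mat2 (-1) (-6) 0 (-1) \<in> modular_commutator"
proof -
  have "matS ** (matS ** matT 3) ** inv\<^bsub>SL2Z\<^esub> matS ** (matS ** matT 3) \<in> modular_commutator"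
    by (intro modular_commutator_mult modular_commutator_conj ST3_in) auto
  then show ?thesis by (simp add: matT_def inv_SL2 mat2_mult)
qed

text \<open>That every element has this property says that the class of T generates the
  abelianisation. It is the reason why there is only one cusp.\<close>

definition T_coset :: "int ^ 2 ^ 2 \<Rightarrow> bool" where
  "T_coset g \<longleftrightarrow> (\<exists>\<gamma>\<in>modular_commutator. \<exists>k. g = \<gamma> ** matT k)"

lemma T_coset_T: "T_coset (matT k)"
  unfolding T_coset_def using modular_commutator_one by (force simp: matrix_mul_lid)

text \<open>By normality the factor from the commutator subgroup in \<open>h\<close> can be moved to
  the left past the power of T in \<open>g\<close>.\<close>

lemma T_coset_mult:
  assumes "T_coset g" "T_coset h" shows "T_coset (g ** h)"
proof -
  obtain \<gamma> k \<delta> l where *: "\<gamma> \<in> modular_commutator" "g = \<gamma> ** matT k"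
    "\<delta> \<in> modular_commutator" "h = \<delta> ** matT l"
    using assms unfolding T_coset_def by blast
  have inv: "inv\<^bsub>SL2Z\<^esub> (matT k) = matT (-k)" by (simp add: matT_def inv_SL2)
  have "\<gamma> ** (matT k ** \<delta> ** inv\<^bsub>SL2Z\<^esub> (matT k)) \<in> modular_commutator"
    using * by (intro modular_commutator_mult modular_commutator_conj) auto
  moreover have "g ** h = \<gamma> ** (matT k ** \<delta> ** matT (-k)) ** matT (k + l)"
  proof -
    have "\<gamma> ** (matT k ** \<delta> ** matT (-k)) ** matT (k + l) = \<gamma> ** (matT k ** (\<delta> ** (matT (-k) ** matT (k + l))))"
      by (simp add: matrix_mul_assoc)
    then show ?thesis using * by (simp add: matT_mult matrix_mul_assoc)
  qed
  ultimately show ?thesis unfolding T_coset_def inv by blast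
qed

lemma T_coset_S: "T_coset matS"
proof -
  have "matS = (matS ** matT 3) ** matT (-3)" by (simp add: matT_def mat2_mult)
  then show ?thesis unfolding T_coset_def using ST3_in by blast
qed

text \<open>The Euclidean algorithm on the first column: left multiplication by S T^j with j = - (a
  div c) replaces the lower left entry c by a mod c. When c = 0 the matrix is a translation up to
  sign, and the sign is S^2.\<close>

lemma SL2Z_induct [consumes 1, case_names S T mult]:
  assumes "g \<in> carrier SL2Z" "P matS" "\<And>k. P (matT k)"
    and mult: "\<And>g h. g \<in> carrier SL2Z \<Longrightarrow> h \<in> carrier SL2Z \<Longrightarrow> P g \<Longrightarrow> P h \<Longrightarrow> P (g ** h)"
  shows "P g"
  using assms(1)
proof (induction "nat \<bar>g $ 2 $ 1\<bar>" arbitrary: g rule: less_induct)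
  case less
  have SS: "P (matS ** matS)" by (intro mult assms) auto
  from less.prems obtain a b c d where g: "g = mat2 a b c d" "a * d - b * c = 1" by (rule SL2_cases)
  show ?case
  proof (cases "c = 0")
    case True
    with g have "a * d = 1" by simp
    then have "(a = 1 \<and> d = 1) \<or> (a = -1 \<and> d = -1)" by (simp add: zmult_eq_1_iff)
    moreover have "P (mat2 1 b 0 1)" using assms(3)[of b] by (simp add: matT_def)
    moreover have "P (matS ** matS ** matT (-b))"
      by (intro mult SS assms) (auto intro!: SL2Z_mult_in)
    then have "P (mat2 (-1) b 0 (-1))" by (simp add: matT_def mat2_mult)
    ultimately show ?thesis using g True by auto
  next
    case False
    define j where "j = - (a div c)"
    define h where "h = matS ** matT j ** g"
    have "h = mat2 (-c) (-d) (a + j * c) (b + j * d)"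
      by (simp add: h_def g matT_def mat2_mult)
    moreover have "a + j * c = a mod c" by (simp add: j_def minus_mult_div_eq_mod mult.commute)
    ultimately have "nat \<bar>h $ 2 $ 1\<bar> < nat \<bar>g $ 2 $ 1\<bar>"
      using False g by (simp add: abs_mod_less)
    moreover have h: "h \<in> carrier SL2Z" unfolding h_def using less.prems by (intro SL2Z_mult_in) auto
    ultimately have "P h" by (rule less.hyps)
    \<comment> \<open>The cube of S is its inverse, so closure under products alone recovers
      \<open>g\<close> from \<open>h\<close>.\<close>
    then have "P (matT (-j) ** matS ** (matS ** matS) ** h)"
      using h by (intro mult SS assms) (auto intro!: SL2Z_mult_in)
    moreover have "matT (-j) ** matS ** (matS ** matS) ** h = g"
      by (simp add: h_def g matT_def mat2_mult)
    ultimately show ?thesis by simp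
  qed
qed

lemma T_coset_all: "g \<in> carrier SL2Z \<Longrightarrow> T_coset g"
  by (induction rule: SL2Z_induct) (auto intro: T_coset_S T_coset_T T_coset_mult)

lemma SL2Z_decompose:
  assumes "g \<in> carrier SL2Z"
  obtains \<gamma> k where "\<gamma> \<in> modular_commutator" "g = \<gamma> ** matT k"
  using T_coset_all[OF assms] unfolding T_coset_def by blast

section \<open>The action on the upper half plane\<close>

definition automorphy :: "int ^ 2 ^ 2 \<Rightarrow> complex \<Rightarrow> complex" where
  "automorphy g \<tau> = of_int (g $ 2 $ 1) * \<tau> + of_int (g $ 2 $ 2)"

lemma moebius_automorphy: "moebius g \<tau> = (of_int (g $ 1 $ 1) * \<tau> + of_int (g $ 1 $ 2)) / automorphy g \<tau>"
  by (simp add: moebius_def automorphy_def)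

lemma automorphy_nonzero:
  assumes "g \<in> carrier SL2Z" "\<tau> \<in> upper_half_plane"
  shows "automorphy g \<tau> \<noteq> 0"
proof
  assume 0: "automorphy g \<tau> = 0"
  from assms(1) obtain a b c d where g: "g = mat2 a b c d" "a * d - b * c = 1" by (rule SL2_cases)
  from 0 have "Im (of_int c * \<tau> + of_int d) = 0" "Re (of_int c * \<tau> + of_int d) = 0"
    by (simp_all add: automorphy_def g)
  then show False using assms(2) g by (auto simp: upper_half_plane_def)
qed

lemma Im_moebius:
  assumes "g \<in> carrier SL2Z" "\<tau> \<in> upper_half_plane"
  shows "Im (moebius g \<tau>) = Im \<tau> / (cmod (automorphy g \<tau>))\<^sup>2"
proof -
  from assms(1) obtain a b c d where g: "g = mat2 a b c d" "a * d - b * c = 1" by (rule SL2_cases)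
  have d: "real_of_int a * real_of_int d - real_of_int b * real_of_int c = 1"
    using g by (metis of_int_1 of_int_diff of_int_mult)
  have "Im (moebius g \<tau>) = ((real_of_int a * Im \<tau>) * (of_int c * Re \<tau> + of_int d) -
      (of_int a * Re \<tau> + of_int b) * (of_int c * Im \<tau>)) / (cmod (automorphy g \<tau>))\<^sup>2"
    by (simp add: moebius_automorphy Im_divide cmod_def automorphy_def g real_sqrt_pow2)
  also have "(real_of_int a * Im \<tau>) * (of_int c * Re \<tau> + of_int d) -
      (of_int a * Re \<tau> + of_int b) * (of_int c * Im \<tau>) =
      (real_of_int a * real_of_int d - real_of_int b * real_of_int c) * Im \<tau>"
    by (simp add: algebra_simps)
  finally show ?thesis using d by simp
qed

lemma moebius_in:
  assumes "g \<in> carrier SL2Z" "\<tau> \<in> upper_half_plane"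
  shows "moebius g \<tau> \<in> upper_half_plane"
  using Im_moebius[OF assms] assms automorphy_nonzero[OF assms] by (simp add: upper_half_plane_def)

lemma moebius_numerator:
  assumes "h \<in> carrier SL2Z" "\<tau> \<in> upper_half_plane"
  shows "moebius h \<tau> * automorphy h \<tau> = of_int (h $ 1 $ 1) * \<tau> + of_int (h $ 1 $ 2)"
  using automorphy_nonzero[OF assms] by (simp add: moebius_automorphy)

lemma automorphy_mult:
  assumes "h \<in> carrier SL2Z" "\<tau> \<in> upper_half_plane"
  shows "automorphy (g ** h) \<tau> = automorphy g (moebius h \<tau>) * automorphy h \<tau>"
proof -
  have "automorphy g (moebius h \<tau>) * automorphy h \<tau> =
      of_int (g $ 2 $ 1) * (moebius h \<tau> * automorphy h \<tau>) + of_int (g $ 2 $ 2) * automorphy h \<tau>"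
    by (simp add: automorphy_def[of g] algebra_simps)
  also have "\<dots> = automorphy (g ** h) \<tau>"
    unfolding moebius_numerator[OF assms] by (simp add: automorphy_def matrix2_mult_nth algebra_simps)
  finally show ?thesis by simp
qed

lemma moebius_mult:
  assumes "g \<in> carrier SL2Z" "h \<in> carrier SL2Z" "\<tau> \<in> upper_half_plane"
  shows "moebius (g ** h) \<tau> = moebius g (moebius h \<tau>)"
proof -
  have nz: "automorphy h \<tau> \<noteq> 0" "automorphy g (moebius h \<tau>) \<noteq> 0"
    by (intro automorphy_nonzero moebius_in assms)+
  have "moebius (g ** h) \<tau> = (of_int ((g ** h) $ 1 $ 1) * \<tau> + of_int ((g ** h) $ 1 $ 2)) /
     (automorphy g (moebius h \<tau>) * automorphy h \<tau>)"
    by (simp add: moebius_automorphy[of "g ** h"] automorphy_mult assms)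
  also have "of_int ((g ** h) $ 1 $ 1) * \<tau> + of_int ((g ** h) $ 1 $ 2) =
     of_int (g $ 1 $ 1) * (of_int (h $ 1 $ 1) * \<tau> + of_int (h $ 1 $ 2)) + of_int (g $ 1 $ 2) * automorphy h \<tau>"
    by (simp add: automorphy_def matrix2_mult_nth algebra_simps)
  also have "\<dots> = (of_int (g $ 1 $ 1) * moebius h \<tau> + of_int (g $ 1 $ 2)) * automorphy h \<tau>"
    unfolding moebius_numerator[OF assms(2,3), symmetric] by (simp add: algebra_simps)
  finally show ?thesis using nz by (simp add: moebius_automorphy[of g])
qed

lemma moebius_T [simp]: "moebius (matT k) \<tau> = \<tau> + of_int k"
  by (simp add: moebius_def matT_def)
lemma moebius_S [simp]: "moebius matS \<tau> = - (1 / \<tau>)"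
  by (simp add: moebius_def)
lemma moebius_one [simp]: "moebius (mat 1) \<tau> = \<tau>"
  by (simp add: moebius_def mat2_one)
lemma automorphy_T [simp]: "automorphy (matT k) \<tau> = 1"
  by (simp add: automorphy_def matT_def)
lemma automorphy_S [simp]: "automorphy matS \<tau> = \<tau>"
  by (simp add: automorphy_def)
lemma automorphy_one [simp]: "automorphy (mat 1) \<tau> = 1"
  by (simp add: automorphy_def mat2_one)

lemma moebius_inv:
  assumes "g \<in> carrier SL2Z" "\<tau> \<in> upper_half_plane"
  shows "moebius (inv\<^bsub>SL2Z\<^esub> g) (moebius g \<tau>) = \<tau>" "moebius g (moebius (inv\<^bsub>SL2Z\<^esub> g) \<tau>) = \<tau>"
proof -
  have i: "inv\<^bsub>SL2Z\<^esub> g \<in> carrier SL2Z" using assms by simp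
  have "inv\<^bsub>SL2Z\<^esub> g ** g = mat 1" "g ** inv\<^bsub>SL2Z\<^esub> g = mat 1"
    using SL2Z.l_inv[OF assms(1)] SL2Z.r_inv[OF assms(1)] by (simp_all add: SL2_simps)
  then show "moebius (inv\<^bsub>SL2Z\<^esub> g) (moebius g \<tau>) = \<tau>" "moebius g (moebius (inv\<^bsub>SL2Z\<^esub> g) \<tau>) = \<tau>"
    using moebius_mult[OF i assms] moebius_mult[OF assms(1) i assms(2)] by simp_all
qed

lemma open_upper_half_plane: "open upper_half_plane"
  unfolding upper_half_plane_def by (rule open_halfspace_Im_gt)

lemma convex_upper_half_plane: "convex upper_half_plane"
  unfolding upper_half_plane_def by (rule convex_halfspace_Im_gt)

lemma connected_upper_half_plane: "connected upper_half_plane"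
  by (intro convex_connected convex_upper_half_plane)

lemma automorphy_has_derivative [derivative_intros]:
  "(automorphy g has_field_derivative of_int (g $ 2 $ 1)) (at \<tau> within A)"
  unfolding automorphy_def by (auto intro!: derivative_eq_intros)

lemma moebius_has_derivative:
  assumes "g \<in> carrier SL2Z" "\<tau> \<in> upper_half_plane"
  shows "(moebius g has_field_derivative 1 / (automorphy g \<tau>)\<^sup>2) (at \<tau>)"
proof -
  from assms(1) obtain a b c d where g: "g = mat2 a b c d" "a * d - b * c = 1" by (rule SL2_cases)
  have d: "complex_of_int a * of_int d - of_int b * of_int c = 1"
    using g by (metis of_int_1 of_int_diff of_int_mult)
  have "(of_int a * automorphy g \<tau> - (of_int a * \<tau> + of_int b) * of_int c) =
     complex_of_int a * of_int d - of_int b * of_int c"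
    by (simp add: automorphy_def g algebra_simps)
  then have eq: "(of_int a * automorphy g \<tau> - (of_int a * \<tau> + of_int b) * of_int c) = 1" using d by simp
  have "((\<lambda>\<tau>. (of_int a * \<tau> + of_int b) / automorphy g \<tau>) has_field_derivative
     (of_int a * automorphy g \<tau> - (of_int a * \<tau> + of_int b) * of_int c) / (automorphy g \<tau> * automorphy g \<tau>)) (at \<tau>)"
    using automorphy_nonzero[OF assms]
    by (intro DERIV_divide automorphy_has_derivative[THEN DERIV_cong]) (auto intro!: derivative_eq_intros simp: g)
  then show ?thesis
    unfolding eq by (simp add: moebius_automorphy[abs_def] g power2_eq_square)
qed

section \<open>Lattice bounds, reduction theory and proper discontinuity\<close>

lemma lattice_lower_bound:
  assumes "Im \<tau> > 0"
  obtains c :: real where "c > 0" "\<And>m n :: int. cmod (of_int m * \<tau> + of_int n) \<ge> c * of_int (max \<bar>m\<bar> \<bar>n\<bar>)"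
proof -
  \<comment> \<open>With z = m \<tau> + n, the imaginary part gives |m| Im \<tau> \<le> |z|, and the
    triangle inequality then gives |n| Im \<tau> \<le> |z| (|\<tau>| + Im \<tau>). The denominator
    is chosen to serve both estimates.\<close>
  define c where "c = Im \<tau> / (1 + cmod \<tau> + Im \<tau>)"
  have pos: "1 + cmod \<tau> + Im \<tau> > 0" using assms by (smt (verit) norm_ge_zero)
  have c: "c > 0" "c \<le> 1" "c \<le> Im \<tau>" using assms pos
    by (auto simp: c_def field_simps mult_nonneg_nonneg)
  show ?thesis
  proof
    show "c > 0" by fact
    fix m n :: int
    define z where "z = of_int m * \<tau> + of_int n"
    have m: "cmod z \<ge> \<bar>m\<bar> * Im \<tau>"
      using abs_Im_le_cmod[of z] assms by (simp add: z_def abs_mult)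
    have "real_of_int \<bar>n\<bar> = cmod (z - of_int m * \<tau>)" by (simp add: z_def)
    also have "\<dots> \<le> cmod z + \<bar>m\<bar> * cmod \<tau>"
      using norm_triangle_ineq4[of z "of_int m * \<tau>"] by (simp add: norm_mult)
    finally have "real_of_int \<bar>n\<bar> * Im \<tau> \<le> cmod z * Im \<tau> + (\<bar>m\<bar> * Im \<tau>) * cmod \<tau>"
      using mult_right_mono[of "real_of_int \<bar>n\<bar>" "cmod z + \<bar>m\<bar> * cmod \<tau>" "Im \<tau>"] assms
      by (simp add: algebra_simps)
    also have "\<dots> \<le> cmod z * Im \<tau> + cmod z * cmod \<tau>"
      using m assms by (intro add_mono mult_right_mono) auto
    also have "\<dots> \<le> cmod z * (1 + cmod \<tau> + Im \<tau>)" by (simp add: algebra_simps)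
    finally have "c * of_int \<bar>n\<bar> \<le> cmod z" using pos by (simp add: c_def field_simps)
    moreover have "c * of_int \<bar>m\<bar> \<le> \<bar>m\<bar> * Im \<tau>" using c(3) mult_right_mono[of c "Im \<tau>" "\<bar>real_of_int m\<bar>"] by (simp add: mult.commute)
    ultimately show "c * of_int (max \<bar>m\<bar> \<bar>n\<bar>) \<le> cmod (of_int m * \<tau> + of_int n)"
      using m unfolding z_def[symmetric] by (auto simp: max_def)
  qed
qed

lemma finite_lattice_bounded:
  assumes "Im \<tau> > 0"
  shows "finite {p :: int \<times> int. cmod (of_int (fst p) * \<tau> + of_int (snd p)) \<le> R}"
proof -
  from lattice_lower_bound[OF assms] obtain c :: real where
    c: "c > 0" "\<And>m n :: int. cmod (of_int m * \<tau> + of_int n) \<ge> c * of_int (max \<bar>m\<bar> \<bar>n\<bar>)" by metis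
  define K where "K = \<lceil>R / c\<rceil>"
  have "{p :: int \<times> int. cmod (of_int (fst p) * \<tau> + of_int (snd p)) \<le> R} \<subseteq> {-K..K} \<times> {-K..K}"
  proof safe
    fix m n :: int assume "cmod (of_int (fst (m, n)) * \<tau> + of_int (snd (m, n))) \<le> R"
    then have "c * of_int (max \<bar>m\<bar> \<bar>n\<bar>) \<le> R" using c(2)[of m n] by simp
    then have "of_int (max \<bar>m\<bar> \<bar>n\<bar>) \<le> R / c" using c(1) by (simp add: field_simps)
    then have "max \<bar>m\<bar> \<bar>n\<bar> \<le> K" unfolding K_def by linarith
    then show "m \<in> {-K..K}" "n \<in> {-K..K}" by auto
  qed
  then show ?thesis by (rule finite_subset) auto
qed

text \<open>The imaginary part of the image is Im \<tau> / |c \<tau> + d|^2, so it is largest for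
  the shortest vector c \<tau> + d with c and d coprime. Only finitely many such vectors have length
  at most 1, and (0, 1) is one of them. Bezout completes the minimal row to a matrix.\<close>

lemma max_Im_moebius:
  assumes "\<tau> \<in> upper_half_plane"
  obtains g where "g \<in> carrier SL2Z" "\<And>h. h \<in> carrier SL2Z \<Longrightarrow> Im (moebius h \<tau>) \<le> Im (moebius g \<tau>)"
proof -
  have t: "Im \<tau> > 0" using assms by (simp add: upper_half_plane_def)
  define A where "A = {p :: int \<times> int. coprime (fst p) (snd p) \<and> cmod (of_int (fst p) * \<tau> + of_int (snd p)) \<le> 1}"
  have "A \<subseteq> {p. cmod (of_int (fst p) * \<tau> + of_int (snd p)) \<le> 1}" by (auto simp: A_def)
  then have fin: "finite A" using finite_lattice_bounded[OF t, of 1] finite_subset by blast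
  have "(0, 1) \<in> A" by (simp add: A_def)
  then obtain p where "is_arg_min (\<lambda>p. cmod (of_int (fst p) * \<tau> + of_int (snd p))) (\<lambda>p. p \<in> A) p"
    using ex_is_arg_min_if_finite[OF fin] by blast
  then have p: "p \<in> A"
    "\<And>p'. p' \<in> A \<Longrightarrow> cmod (of_int (fst p) * \<tau> + of_int (snd p)) \<le> cmod (of_int (fst p') * \<tau> + of_int (snd p'))"
    unfolding is_arg_min_linorder by blast+
  obtain c d where cd: "p = (c, d)" by fastforce
  have "coprime c d" using p(1) cd by (simp add: A_def)
  then obtain u v where uv: "u * c + v * d = 1" by (metis bezout_int coprime_imp_gcd_eq_1)
  define g where "g = mat2 v (-u) c d"
  have g: "g \<in> carrier SL2Z" using uv by (simp add: g_def mat2_SL2_iff algebra_simps)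
  show ?thesis
  proof
    show "g \<in> carrier SL2Z" by fact
    fix h assume h: "h \<in> carrier SL2Z"
    then obtain a' b' c' d' where h': "h = mat2 a' b' c' d'" "a' * d' - b' * c' = 1" by (rule SL2_cases)
    have cop: "coprime c' d'"
      by (rule coprimeI) (metis h'(2) dvd_diff dvd_mult)
    have ga: "automorphy g \<tau> = of_int c * \<tau> + of_int d" by (simp add: automorphy_def g_def)
    have ha: "automorphy h \<tau> = of_int c' * \<tau> + of_int d'" by (simp add: automorphy_def h')
    have g1: "cmod (automorphy g \<tau>) \<le> 1" using p(1) cd ga by (simp add: A_def)
    have "cmod (automorphy g \<tau>) \<le> cmod (automorphy h \<tau>)"
    proof (cases "(c', d') \<in> A")
      case True then show ?thesis using p(2)[OF True] cd ga ha by simp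
    next
      case False then show ?thesis using cop g1 ha by (simp add: A_def)
    qed
    then have "(cmod (automorphy g \<tau>))\<^sup>2 \<le> (cmod (automorphy h \<tau>))\<^sup>2" by (intro power_mono) auto
    then show "Im (moebius h \<tau>) \<le> Im (moebius g \<tau>)"
      unfolding Im_moebius[OF g assms] Im_moebius[OF h assms]
      using t automorphy_nonzero[OF g assms] by (intro divide_left_mono) (auto simp: zero_less_mult_iff)
  qed
qed

text \<open>The matrix - T^6 and its inverse act as translations by 6 and -6, and induction in both
  directions does the rest. The formulation through the action absorbs the sign.\<close>

lemma T6_in_modular_commutator:
  "\<exists>\<delta>\<in>modular_commutator. \<forall>\<tau>\<in>upper_half_plane. moebius \<delta> \<tau> = \<tau> + of_int (6 * l)"
proof -
  let ?A = "mat2 (-1) (-6) 0 (-1) :: int ^ 2 ^ 2"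
  have A: "?A \<in> modular_commutator" by (rule neg_T6_in)
  have Ai: "mat2 (-1) 6 0 (-1) \<in> modular_commutator"
    using modular_commutator_inv[OF A] by (simp add: inv_SL2)
  have shift: "moebius ?A z = z + 6" "moebius (mat2 (-1) 6 0 (-1)) z = z - 6" for z
    by (simp_all add: moebius_def)
  show ?thesis
  proof (induction l rule: int_induct[where k = 0])
    case base then show ?case using modular_commutator_one by (intro bexI[of _ "mat 1"]) auto
  next
    case (step1 l)
    then obtain \<delta> where d: "\<delta> \<in> modular_commutator" "\<forall>\<tau>\<in>upper_half_plane. moebius \<delta> \<tau> = \<tau> + of_int (6 * l)" by blast
    show ?case
    proof (intro bexI[of _ "?A ** \<delta>"] ballI)
      show "?A ** \<delta> \<in> modular_commutator" using A d by (intro modular_commutator_mult)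
      fix \<tau> assume t: "\<tau> \<in> upper_half_plane"
      have "moebius (?A ** \<delta>) \<tau> = moebius ?A (moebius \<delta> \<tau>)"
        using A d t by (intro moebius_mult modular_commutator_in_SL2Z)
      then show "moebius (?A ** \<delta>) \<tau> = \<tau> + of_int (6 * (l + 1))" using d t by (simp add: shift)
    qed
  next
    case (step2 l)
    then obtain \<delta> where d: "\<delta> \<in> modular_commutator" "\<forall>\<tau>\<in>upper_half_plane. moebius \<delta> \<tau> = \<tau> + of_int (6 * l)" by blast
    show ?case
    proof (intro bexI[of _ "mat2 (-1) 6 0 (-1) ** \<delta>"] ballI)
      show "mat2 (-1) 6 0 (-1) ** \<delta> \<in> modular_commutator" using Ai d by (intro modular_commutator_mult)
      fix \<tau> assume t: "\<tau> \<in> upper_half_plane"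
      have "moebius (mat2 (-1) 6 0 (-1) ** \<delta>) \<tau> = moebius (mat2 (-1) 6 0 (-1)) (moebius \<delta> \<tau>)"
        using Ai d t by (intro moebius_mult modular_commutator_in_SL2Z)
      then show "moebius (mat2 (-1) 6 0 (-1) ** \<delta>) \<tau> = \<tau> + of_int (6 * (l - 1))" using d t by (simp add: shift)
    qed
  qed
qed

text \<open>At a point \<sigma> of maximal height in its orbit under the full modular group,
  translated to |Re \<sigma>| \<le> 1/2, the inversion S cannot increase the height, so |\<sigma>|
  \<ge> 1 and Im \<sigma> \<ge> 1/2. Returning to the commutator subgroup costs a power of T, which
  the translations by 6 reduce to real parts between 0 and 6.\<close>

lemma modular_commutator_reduce:
  assumes "\<tau> \<in> upper_half_plane"
  obtains \<gamma> where "\<gamma> \<in> modular_commutator" "Im (moebius \<gamma> \<tau>) \<ge> 1/2"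
    "0 \<le> Re (moebius \<gamma> \<tau>)" "Re (moebius \<gamma> \<tau>) \<le> 6"
proof -
  obtain g where g: "g \<in> carrier SL2Z" "\<And>h. h \<in> carrier SL2Z \<Longrightarrow> Im (moebius h \<tau>) \<le> Im (moebius g \<tau>)"
    by (rule max_Im_moebius[OF assms]) blast
  define j where "j = - round (Re (moebius g \<tau>))"
  define \<sigma> where "\<sigma> = moebius g \<tau> + of_int j"
  have \<sigma>_in: "\<sigma> \<in> upper_half_plane"
    using moebius_in[OF g(1) assms] by (simp add: \<sigma>_def upper_half_plane_def)
  have re: "\<bar>Re \<sigma>\<bar> \<le> 1/2"
    using of_int_round_abs_le[of "Re (moebius g \<tau>)"] by (simp add: \<sigma>_def j_def abs_minus_commute)
  have S: "moebius (matS ** (matT j ** g)) \<tau> = moebius matS \<sigma>"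
    using g(1) assms by (simp add: moebius_mult SL2Z_mult_in \<sigma>_def)
  have "Im (moebius matS \<sigma>) \<le> Im \<sigma>"
    using g(2)[of "matS ** (matT j ** g)"] S g(1) by (simp add: SL2Z_mult_in \<sigma>_def)
  then have "Im \<sigma> / (cmod \<sigma>)\<^sup>2 \<le> Im \<sigma>"
    using Im_moebius[OF matS_in \<sigma>_in] by simp
  then have "(cmod \<sigma>)\<^sup>2 \<ge> 1" 
  proof -
    have "\<sigma> \<noteq> 0" "Im \<sigma> > 0" using \<sigma>_in by (auto simp: upper_half_plane_def)
    then have "Im \<sigma> * 1 \<le> Im \<sigma> * (cmod \<sigma>)\<^sup>2" using \<open>Im \<sigma> / (cmod \<sigma>)\<^sup>2 \<le> Im \<sigma>\<close> by (simp add: divide_le_eq)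
    then show ?thesis using \<open>Im \<sigma> > 0\<close> by (subst (asm) mult_le_cancel_left_pos) auto
  qed
  then have "(Re \<sigma>)\<^sup>2 + (Im \<sigma>)\<^sup>2 \<ge> 1" by (simp add: cmod_def)
  moreover have "(Re \<sigma>)\<^sup>2 \<le> (1/2)\<^sup>2" using re by (subst abs_le_square_iff[symmetric]) auto
  ultimately have "(Im \<sigma>)\<^sup>2 \<ge> (1/2)\<^sup>2" by (simp add: power2_eq_square)
  then have im: "Im \<sigma> \<ge> 1/2" using \<sigma>_in by (intro power2_le_imp_le[of "1/2" "Im \<sigma>"]) (auto simp: upper_half_plane_def)
  obtain \<gamma> k where k: "\<gamma> \<in> modular_commutator" "inv\<^bsub>SL2Z\<^esub> (matT j ** g) = \<gamma> ** matT k"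
    by (rule SL2Z_decompose[of "inv\<^bsub>SL2Z\<^esub> (matT j ** g)"]) (use g in \<open>auto intro!: SL2Z.inv_closed SL2Z_mult_in\<close>)
  have mT: "moebius (inv\<^bsub>SL2Z\<^esub> (matT j ** g)) \<sigma> = \<tau>"
    using moebius_inv(1)[of "matT j ** g" \<tau>] g assms
    by (simp add: SL2Z_mult_in moebius_mult \<sigma>_def)
  have \<gamma>S: "\<gamma> \<in> carrier SL2Z" using k modular_commutator_in_SL2Z by blast
  have tau: "\<tau> = moebius \<gamma> (\<sigma> + of_int k)"
    using mT k(2) moebius_mult[OF \<gamma>S matT_in \<sigma>_in, of k] by simp
  have tk: "\<sigma> + of_int k \<in> upper_half_plane" using \<sigma>_in by (simp add: upper_half_plane_def)
  have i1: "moebius (inv\<^bsub>SL2Z\<^esub> \<gamma>) \<tau> = \<sigma> + of_int k" using moebius_inv(1)[OF \<gamma>S tk] tau by simp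
  obtain l where l: "0 \<le> Re (\<sigma> + of_int k + of_int (6 * l))" "Re (\<sigma> + of_int k + of_int (6 * l)) \<le> 6"
  proof
    let ?r = "Re (\<sigma> + of_int k) / 6"
    show "0 \<le> Re (\<sigma> + of_int k + of_int (6 * (- \<lfloor>?r\<rfloor>)))" using of_int_floor_le[of ?r] by simp
    show "Re (\<sigma> + of_int k + of_int (6 * (- \<lfloor>?r\<rfloor>))) \<le> 6" using floor_correct[of ?r] by (simp add: field_simps)
  qed
  obtain \<delta> where d: "\<delta> \<in> modular_commutator" "\<forall>\<tau>\<in>upper_half_plane. moebius \<delta> \<tau> = \<tau> + of_int (6 * l)"
    using T6_in_modular_commutator by blast
  have "moebius (\<delta> ** inv\<^bsub>SL2Z\<^esub> \<gamma>) \<tau> = \<sigma> + of_int k + of_int (6 * l)"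
    using d tk i1 k modular_commutator_inv
    by (subst moebius_mult) (auto simp: modular_commutator_in_SL2Z assms)
  then show ?thesis
    using l im d k that[of "\<delta> ** inv\<^bsub>SL2Z\<^esub> \<gamma>"] modular_commutator_inv modular_commutator_mult by simp
qed

text \<open>The action is properly discontinuous: a convergent sequence of pairs of equivalent points
  uses only finitely many matrices.\<close>

lemma modular_commutator_closed:
  assumes "\<And>n. \<sigma> n \<in> upper_half_plane" "\<And>n. \<gamma> n \<in> modular_commutator"
    and lim: "\<sigma> \<longlonglongrightarrow> \<tau>" "(\<lambda>n. moebius (\<gamma> n) (\<sigma> n)) \<longlonglongrightarrow> \<tau>'"
    and "\<tau> \<in> upper_half_plane" "\<tau>' \<in> upper_half_plane"
  obtains \<delta> where "\<delta> \<in> modular_commutator" "\<tau>' = moebius \<delta> \<tau>" "\<exists>\<^sub>F n in sequentially. \<gamma> n = \<delta>"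
proof -
  note gS = modular_commutator_in_SL2Z[OF assms(2)]
  define y where "y = Im \<tau> / 2"
  define y' where "y' = Im \<tau>' / 2"
  define B where "B = cmod \<tau> + 1"
  define B' where "B' = cmod \<tau>' + 1"
  have pos: "y > 0" "y' > 0" "B > 0" "B' > 0" using assms by (auto simp: y_def y'_def upper_half_plane_def B_def B'_def add_nonneg_pos)
  have "\<forall>\<^sub>F n in sequentially. Im (\<sigma> n) > y"
    using order_tendstoD(1)[OF tendsto_Im[OF lim(1)], of y] assms by (simp add: y_def upper_half_plane_def)
  moreover have "\<forall>\<^sub>F n in sequentially. Im (moebius (\<gamma> n) (\<sigma> n)) > y'"
    using order_tendstoD(1)[OF tendsto_Im[OF lim(2)], of y'] assms by (simp add: y'_def upper_half_plane_def)
  moreover have "\<forall>\<^sub>F n in sequentially. cmod (\<sigma> n) < B"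
    using order_tendstoD(2)[OF tendsto_norm[OF lim(1)], of B] by (simp add: B_def)
  moreover have "\<forall>\<^sub>F n in sequentially. cmod (moebius (\<gamma> n) (\<sigma> n)) < B'"
    using order_tendstoD(2)[OF tendsto_norm[OF lim(2)], of B'] by (simp add: B'_def)
  ultimately have ev: "\<forall>\<^sub>F n in sequentially. Im (\<sigma> n) > y \<and> Im (moebius (\<gamma> n) (\<sigma> n)) > y' \<and>
      cmod (\<sigma> n) < B \<and> cmod (moebius (\<gamma> n) (\<sigma> n)) < B'"
    by (intro eventually_conj)
  \<comment> \<open>The formula for the height of the image bounds the automorphy factor by
    \<open>R\<close>, and \<open>lin\<close> turns this into bounds for the lower row. The numerator
    is the image times the automorphy factor, hence at most B' R, which bounds the upper
    row.\<close>
  define R where "R = sqrt (B / y')"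
  define K where "K = max \<lceil>R / y\<rceil> (max \<lceil>R + R / y * B\<rceil> (max \<lceil>B' * R / y\<rceil> \<lceil>B' * R + B' * R / y * B\<rceil>))"
  define F where "F = (\<lambda>(a, b, c, d). mat2 a b c d) ` ({-K..K} \<times> {-K..K} \<times> {-K..K} \<times> {-K..K})"
  have fin: "finite F" unfolding F_def by simp
  have lin: "\<bar>real_of_int m\<bar> \<le> r / y \<and> \<bar>real_of_int n\<bar> \<le> r + r / y * B"
    if "cmod (of_int m * s + of_int n) \<le> r" "Im s > y" "cmod s < B" for m n r s
  proof -
    have "\<bar>real_of_int m\<bar> * y \<le> \<bar>real_of_int m\<bar> * Im s" using that by (intro mult_left_mono) auto
    also have "\<dots> = \<bar>Im (of_int m * s + of_int n)\<bar>" using that pos by (simp add: abs_mult)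
    also have "\<dots> \<le> r" using abs_Im_le_cmod that(1) order_trans by blast
    finally have 1: "\<bar>real_of_int m\<bar> \<le> r / y" using pos by (simp add: field_simps)
    have "\<bar>real_of_int n\<bar> = cmod ((of_int m * s + of_int n) - of_int m * s)" by simp
    also have "\<dots> \<le> r + \<bar>real_of_int m\<bar> * cmod s"
      using norm_triangle_ineq4[of "of_int m * s + of_int n" "of_int m * s"] that(1) by (simp add: norm_mult)
    also have "\<dots> \<le> r + r / y * B"
      using 1 that pos by (intro add_left_mono mult_mono) auto
    finally show ?thesis using 1 by blast
  qed
  have "\<forall>\<^sub>F n in sequentially. \<gamma> n \<in> F"
    using ev
  proof eventually_elim
    case (elim n)
    obtain a b c d where g: "\<gamma> n = mat2 a b c d" "a * d - b * c = 1" by (rule SL2_cases[OF gS[of n]])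
    let ?s = "\<sigma> n" and ?t = "moebius (\<gamma> n) (\<sigma> n)" and ?j = "automorphy (\<gamma> n) (\<sigma> n)"
    have jnz: "?j \<noteq> 0" by (intro automorphy_nonzero gS assms)
    have "Im ?s \<le> B" using elim abs_Im_le_cmod[of ?s] by linarith
    then have "y' * (cmod ?j)\<^sup>2 \<le> B"
      using elim Im_moebius[OF gS assms(1), of n n] jnz by (simp add: field_simps)
    then have "(cmod ?j)\<^sup>2 \<le> B / y'" using pos by (simp add: field_simps)
    then have j: "cmod ?j \<le> R" unfolding R_def by (rule real_le_rsqrt)
    have "of_int a * ?s + of_int b = ?t * ?j" using jnz by (simp add: moebius_automorphy g)
    then have i: "cmod (of_int a * ?s + of_int b) \<le> B' * R"
      using elim j pos by (auto simp: norm_mult intro!: mult_mono)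
    have "\<bar>real_of_int c\<bar> \<le> R / y \<and> \<bar>real_of_int d\<bar> \<le> R + R / y * B"
      using j elim by (intro lin[of c ?s d]) (auto simp: automorphy_def g)
    moreover have "\<bar>real_of_int a\<bar> \<le> B' * R / y \<and> \<bar>real_of_int b\<bar> \<le> B' * R + B' * R / y * B"
      using i elim by (intro lin[of a ?s b]) auto
    moreover have "\<bar>m\<bar> \<le> K" if "\<bar>real_of_int m\<bar> \<le> x" "\<lceil>x\<rceil> \<le> K" for m x
    proof -
      have "real_of_int \<bar>m\<bar> \<le> of_int \<lceil>x\<rceil>" using that(1) le_of_int_ceiling[of x] by linarith
      then show ?thesis using that(2) by linarith
    qed
    moreover have "\<lceil>R / y\<rceil> \<le> K" "\<lceil>R + R / y * B\<rceil> \<le> K" "\<lceil>B' * R / y\<rceil> \<le> K" "\<lceil>B' * R + B' * R / y * B\<rceil> \<le> K"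
      by (simp_all add: K_def)
    ultimately have "\<bar>a\<bar> \<le> K \<and> \<bar>b\<bar> \<le> K \<and> \<bar>c\<bar> \<le> K \<and> \<bar>d\<bar> \<le> K"
      by meson
    then show "\<gamma> n \<in> F" unfolding F_def g(1) by (intro image_eqI[of _ _ "(a, b, c, d)"]) auto
  qed
  then have "\<exists>\<^sub>F n in sequentially. \<gamma> n \<in> F" by (intro eventually_frequently) auto
  then have "\<exists>\<delta>\<in>F. \<exists>\<^sub>F n in sequentially. \<gamma> n = \<delta>"
    using frequently_bex_finite[OF fin, of "\<lambda>n \<delta>. \<gamma> n = \<delta>" sequentially] by simp
  then obtain \<delta> where freq: "\<exists>\<^sub>F n in sequentially. \<gamma> n = \<delta>" by blast
  then obtain n where n: "\<gamma> n = \<delta>" by (meson frequently_ex)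
  then have \<delta>: "\<delta> \<in> modular_commutator" using assms(2) by blast
  obtain r :: "nat \<Rightarrow> nat" where r: "strict_mono r" "\<And>n. \<gamma> (r n) = \<delta>"
  proof -
    have inf: "infinite {n. \<gamma> n = \<delta>}" using freq by (simp add: frequently_cofinite flip: cofinite_eq_sequentially)
    show ?thesis
      using that[OF strict_mono_enumerate[OF inf]] enumerate_in_set[OF inf] by simp
  qed
  have "isCont (moebius \<delta>) \<tau>"
    using moebius_has_derivative[OF modular_commutator_in_SL2Z[OF \<delta>] assms(5)] DERIV_isCont by blast
  then have "(\<lambda>n. moebius \<delta> (\<sigma> (r n))) \<longlonglongrightarrow> moebius \<delta> \<tau>"
    using LIMSEQ_subseq_LIMSEQ[OF lim(1) r(1)] isCont_tendsto_compose by (fastforce simp: o_def)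
  moreover have "(\<lambda>n. moebius \<delta> (\<sigma> (r n))) \<longlonglongrightarrow> \<tau>'"
    using LIMSEQ_subseq_LIMSEQ[OF lim(2) r(1)] r(2) by (simp add: o_def)
  ultimately have "\<tau>' = moebius \<delta> \<tau>" using LIMSEQ_unique by blast
  then show ?thesis using that \<delta> freq by blast
qed

text \<open>The basic sets are half planes, so limits along this filter are uniform in the real
  part.\<close>

definition at_cusp :: "complex filter" where
  "at_cusp = filtercomap Im at_top"

lemma eventually_at_cusp: "eventually P at_cusp \<longleftrightarrow> (\<exists>Y. \<forall>\<tau>. Im \<tau> > Y \<longrightarrow> P \<tau>)"
  unfolding at_cusp_def eventually_filtercomap_at_top_dense ..

text \<open>Together with the half plane above height \<open>Y\<close> it meets every orbit of the
  commutator subgroup in the upper half plane; width 6 and lower edge 1/2 are the constants of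
  \<open>modular_commutator_reduce\<close>.\<close>

definition fundamental_box :: "real \<Rightarrow> complex set" where
  "fundamental_box Y = cbox (Complex 0 (1 / 2)) (Complex 6 Y)"

lemma compact_fundamental_box: "compact (fundamental_box Y)"
  unfolding fundamental_box_def by (rule compact_cbox)

lemma fundamental_box_subset: "fundamental_box Y \<subseteq> upper_half_plane"
  by (auto simp: fundamental_box_def upper_half_plane_def in_cbox_complex_iff)

lemma modular_commutator_reduce_box:
  assumes "\<tau> \<in> upper_half_plane"
  obtains \<gamma> where "\<gamma> \<in> modular_commutator"
    "moebius \<gamma> \<tau> \<in> fundamental_box Y \<or> Im (moebius \<gamma> \<tau>) > Y"
proof -
  obtain \<gamma> where "\<gamma> \<in> modular_commutator" "Im (moebius \<gamma> \<tau>) \<ge> 1/2"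
    "0 \<le> Re (moebius \<gamma> \<tau>)" "Re (moebius \<gamma> \<tau>) \<le> 6"
    by (rule modular_commutator_reduce[OF assms])
  then show ?thesis
    by (intro that[of \<gamma>]) (auto simp: fundamental_box_def in_cbox_complex_iff)
qed

section \<open>Lattice sums\<close>

lemma has_sum_diff:
  fixes f :: "'b \<Rightarrow> 'a :: real_normed_vector"
  assumes "(f has_sum a) A" "(g has_sum b) A"
  shows "((\<lambda>x. f x - g x) has_sum (a - b)) A"
  using has_sum_add[OF assms(1), of "\<lambda>x. - g x" "- b"] assms(2) by (simp add: has_sum_uminus)

lemma summable_on_diff:
  fixes f :: "'b \<Rightarrow> 'a :: real_normed_vector"
  assumes "f summable_on A" "g summable_on A"
  shows "(\<lambda>x. f x - g x) summable_on A"
  using assms has_sum_diff unfolding summable_on_def by blast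

lemma has_sum_int_split:
  fixes f :: "int \<Rightarrow> 'a :: {topological_comm_monoid_add, t2_space}"
  assumes "((\<lambda>k. f (int k)) has_sum a) UNIV" "((\<lambda>k. f (- int k - 1)) has_sum b) UNIV"
  shows "(f has_sum (a + b)) UNIV"
proof -
  have "(f has_sum a) (range int)"
    using assms(1) has_sum_reindex[of int UNIV f a] by (simp add: o_def)
  moreover have "(f has_sum b) (range (\<lambda>k. - int k - 1))"
    using assms(2) has_sum_reindex[of "\<lambda>k. - int k - 1" UNIV f b] by (simp add: o_def inj_on_def)
  moreover have "range int \<inter> range (\<lambda>k. - int k - 1) = {}" by auto
  moreover have "range int \<union> range (\<lambda>k. - int k - 1) = UNIV"
  proof safe
    fix x :: int assume "x \<notin> range (\<lambda>k. - int k - 1)"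
    then have "x \<noteq> - int (nat (- x - 1)) - 1" by blast
    then have "x = int (nat x)" by linarith
    then show "x \<in> range int" by blast
  qed auto
  ultimately show ?thesis using has_sum_Un_disjoint[of f "range int" a "range (\<lambda>k. - int k - 1)" b] by metis
qed

lemma summable_on_int_split:
  fixes f :: "int \<Rightarrow> 'a :: {topological_comm_monoid_add, t2_space}"
  assumes "(\<lambda>k. f (int k)) summable_on UNIV" "(\<lambda>k. f (- int k - 1)) summable_on UNIV"
  shows "f summable_on UNIV"
  using assms has_sum_int_split unfolding summable_on_def by metis

lemma has_sum_int_partial_sums:
  assumes "(f has_sum S) (UNIV :: int set)"
  shows "(\<lambda>N. \<Sum>n\<in>{- int N..<int N}. f n) \<longlonglongrightarrow> S"
proof -
  have "filterlim (\<lambda>N. {- int N..<int N}) (finite_subsets_at_top UNIV) sequentially"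
    unfolding filterlim_finite_subsets_at_top
  proof safe
    fix A :: "int set" assume A: "finite A"
    obtain K where K: "\<And>x. x \<in> A \<Longrightarrow> \<bar>x\<bar> \<le> K" using A
      by (metis Max_ge finite_imageI imageI)
    show "\<forall>\<^sub>F N in sequentially. finite {- int N..<int N} \<and> A \<subseteq> {- int N..<int N} \<and> {- int N..<int N} \<subseteq> UNIV"
      using eventually_gt_at_top[of "nat K"]
      by eventually_elim (use K in fastforce)
  qed
  from filterlim_compose[OF assms[unfolded has_sum_def] this] show ?thesis .
qed

text \<open>The exponent is half of the exponent 3 of the lattice sums: a product of two such terms
  dominates an inverse cube of the maximum.\<close>

lemma summable_on_int_powr:
  "(\<lambda>n::int. (1 + \<bar>real_of_int n\<bar>) powr (- 3 / 2)) summable_on UNIV"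
proof -
  have 1: "summable (\<lambda>n. real (Suc n) powr (- 3 / 2))"
    by (subst summable_Suc_iff) (simp add: summable_real_powr_iff)
  have 2: "summable (\<lambda>n. real (Suc (Suc n)) powr (- 3 / 2))"
    using 1 by (subst summable_Suc_iff)
  show ?thesis
    by (rule summable_on_int_split)
      (use 1 2 in \<open>auto simp: summable_on_UNIV_nonneg_real_iff add_ac\<close>)
qed

text \<open>With M the maximum, (1 + |m|) (1 + |n|) \<le> (2 M)^2, and raising this to the power
  -3/2 compares the double series with a product of two simple ones. At the origin the term is 1 / 0
  = 0.\<close>

lemma summable_on_max_cube:
  "(\<lambda>(m::int, n::int). 1 / real_of_int (max \<bar>m\<bar> \<bar>n\<bar>) ^ 3) summable_on UNIV"
proof (rule summable_on_comparison_test)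
  let ?g = "\<lambda>n::int. (1 + \<bar>real_of_int n\<bar>) powr (- 3 / 2)"
  obtain S where S: "(?g has_sum S) UNIV" using summable_on_int_powr summable_on_def by blast
  have "(\<lambda>(m, n). ?g m * ?g n) summable_on UNIV \<times> UNIV"
  proof (rule summable_on_SigmaI)
    show "((\<lambda>n. case (m, n) of (m, n) \<Rightarrow> ?g m * ?g n) has_sum (?g m * S)) UNIV" for m
      using has_sum_cmult_right[OF S] by simp
    show "(\<lambda>m. ?g m * S) summable_on UNIV" by (intro summable_on_cmult_left summable_on_int_powr)
  qed auto
  from summable_on_cmult_right[OF this, of 8]
  show "(\<lambda>p. 8 * (case p of (m, n) \<Rightarrow> ?g m * ?g n)) summable_on UNIV" by simp
  fix p :: "int \<times> int"
  obtain m n where p: "p = (m, n)" by fastforce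
  define M where "M = real_of_int (max \<bar>m\<bar> \<bar>n\<bar>)"
  show "(case p of (m, n) \<Rightarrow> 1 / real_of_int (max \<bar>m\<bar> \<bar>n\<bar>) ^ 3) \<le> 8 * (case p of (m, n) \<Rightarrow> ?g m * ?g n)"
  proof (cases "M = 0")
    case True
    then have "m = 0" "n = 0" by (auto simp: M_def max_def split: if_splits)
    then show ?thesis by (simp add: p)
  next
    case False
    then have M: "M \<ge> 1" unfolding M_def by (auto simp: max_def)
    have "((1 + \<bar>real_of_int m\<bar>) * (1 + \<bar>real_of_int n\<bar>)) \<le> (2 * M) * (2 * M)"
      using M by (intro mult_mono) (auto simp: M_def)
    then have "((2 * M) * (2 * M)) powr (- 3 / 2) \<le> ((1 + \<bar>real_of_int m\<bar>) * (1 + \<bar>real_of_int n\<bar>)) powr (- 3 / 2)"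
      by (intro powr_mono2') (auto intro: mult_pos_pos add_pos_nonneg)
    also have "\<dots> = ?g m * ?g n" by (simp add: powr_mult)
    also have "((2 * M) * (2 * M)) powr (- 3 / 2) = (2 * M) powr (-3)"
    proof -
      have "(2 * M) * (2 * M) = (2 * M) powr 2" using M by (simp add: power2_eq_square)
      then show ?thesis by (simp only: powr_powr) simp
    qed
    also have "\<dots> = 1 / (8 * M ^ 3)"
      using M powr_minus_divide[of "2 * M" 3] by (simp add: power_mult_distrib)
    finally show ?thesis by (simp add: p flip: M_def)
  qed
qed auto

lemma summable_on_lattice_cube:
  assumes "Im \<tau> > 0"
  shows "(\<lambda>(m::int, n::int). 1 / cmod (of_int m * \<tau> + of_int n) ^ 3) summable_on UNIV"
proof -
  obtain c where c: "c > 0" "\<And>m n :: int. cmod (of_int m * \<tau> + of_int n) \<ge> c * of_int (max \<bar>m\<bar> \<bar>n\<bar>)"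
    using lattice_lower_bound[OF assms] by metis
  show ?thesis
  proof (rule summable_on_comparison_test)
    show "(\<lambda>p. (1 / c ^ 3) * (case p of (m, n) \<Rightarrow> 1 / real_of_int (max \<bar>m\<bar> \<bar>n\<bar>) ^ 3)) summable_on UNIV"
      by (intro summable_on_cmult_right summable_on_max_cube)
    fix p :: "int \<times> int"
    obtain m n where p: "p = (m, n)" by fastforce
    define M where "M = real_of_int (max \<bar>m\<bar> \<bar>n\<bar>)"
    show "(case p of (m, n) \<Rightarrow> 1 / cmod (of_int m * \<tau> + of_int n) ^ 3) \<le>
      (1 / c ^ 3) * (case p of (m, n) \<Rightarrow> 1 / real_of_int (max \<bar>m\<bar> \<bar>n\<bar>) ^ 3)"
    proof (cases "M = 0")
      case True then show ?thesis by (simp add: p M_def max_def split: if_splits)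
    next
      case False
      then have M: "M \<ge> 1" unfolding M_def by (auto simp: max_def)
      have cM: "c * M \<le> cmod (of_int m * \<tau> + of_int n)" unfolding M_def by (rule c(2))
      have "1 / cmod (of_int m * \<tau> + of_int n) ^ 3 \<le> 1 / (c * M) ^ 3"
        using M c(1) cM by (intro divide_left_mono power_mono mult_pos_pos zero_less_power)
          (use less_le_trans[OF mult_pos_pos[OF c(1), of M] cM] in auto)
      then show ?thesis by (simp add: p power_mult_distrib flip: M_def)
    qed
  qed (auto split: prod.splits)
qed

section \<open>Partial fractions of the cotangent\<close>

text \<open>Logarithmic derivative of the reflection formula for the Gamma function.\<close>

lemma Digamma_reflection_complex:
  assumes "(z :: complex) \<notin> \<int>"
  shows "Digamma (1 - z) - Digamma z = of_real pi * cot (of_real pi * z)"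
proof -
  have z: "z \<notin> \<int>\<^sub>\<le>\<^sub>0" "1 - z \<notin> \<int>\<^sub>\<le>\<^sub>0"
    using assms nonpos_Ints_subset_Ints[where 'a = complex] Ints_diff[OF Ints_1, of "1 - z"] by auto
  have s: "sin (of_real pi * z) \<noteq> 0" using assms by (auto simp: sin_eq_0)
  let ?g = "\<lambda>z::complex. Gamma z * Gamma (1 - z)"
  have "(?g has_field_derivative (?g z * (Digamma z - Digamma (1 - z)))) (at z)"
    using z by (auto intro!: derivative_eq_intros simp: algebra_simps)
  moreover have "((\<lambda>z. of_real pi / sin (of_real pi * z)) has_field_derivative
     - (of_real pi * (of_real pi * cos (of_real pi * z))) / (sin (of_real pi * z))\<^sup>2) (at z)"
    using s by (auto intro!: derivative_eq_intros simp: power2_eq_square)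
  ultimately have "?g z * (Digamma z - Digamma (1 - z)) =
      - (of_real pi * (of_real pi * cos (of_real pi * z))) / (sin (of_real pi * z))\<^sup>2"
    unfolding Gamma_reflection_complex by (rule DERIV_unique)
  then have "of_real pi * ((Digamma z - Digamma (1 - z)) * sin (of_real pi * z) + of_real pi * cos (of_real pi * z)) = 0"
    unfolding Gamma_reflection_complex using s by (simp add: field_simps power2_eq_square)
  then have "(Digamma z - Digamma (1 - z)) * sin (of_real pi * z) = - (of_real pi * cos (of_real pi * z))"
    by (simp add: add_eq_0_iff)
  then have "Digamma z - Digamma (1 - z) = - (of_real pi * cos (of_real pi * z) / sin (of_real pi * z))"
    using s by (simp add: field_simps)
  then show ?thesis by (simp add: cot_def algebra_simps)
qed

text \<open>In the difference of the Digamma series at 1 - z and at z, the harmonic terms and the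
  Euler constant cancel. The resulting pairing matches k with - (k + 1).\<close>

lemma cot_sums:
  assumes "(z :: complex) \<notin> \<int>"
  shows "(\<lambda>k. 1 / (z + of_nat k) + 1 / (z - of_nat (Suc k))) sums (of_real pi * cot (of_real pi * z))"
proof -
  have z: "z \<noteq> 0" "1 - z \<noteq> 0" using assms by auto
  have "(\<lambda>n. inverse (of_nat (Suc n)) - inverse (z + of_nat n)) sums (Digamma z + euler_mascheroni)"
    "(\<lambda>n. inverse (of_nat (Suc n)) - inverse (1 - z + of_nat n)) sums (Digamma (1 - z) + euler_mascheroni)"
    using summable_Digamma[OF z(1)] summable_Digamma[OF z(2)]
    by (simp_all add: Digamma_def[of z] Digamma_def[of "1 - z"] summable_sums del: of_nat_Suc)
  from sums_diff[OF this(2,1)] Digamma_reflection_complex[OF assms]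
  have "(\<lambda>n. inverse (z + of_nat n) - inverse (1 - z + of_nat n)) sums (of_real pi * cot (of_real pi * z))"
    by (simp del: of_nat_Suc)
  moreover have "inverse (z + of_nat n) - inverse (1 - z + of_nat n) = 1 / (z + of_nat n) + 1 / (z - of_nat (Suc n))" for n
  proof -
    have "1 - z + of_nat n = - (z - of_nat (Suc n))" by simp
    then show ?thesis by (simp only: inverse_eq_divide divide_minus_right) simp
  qed
  ultimately show ?thesis by (simp del: of_nat_Suc)
qed

lemma LIMSEQ_inverse_plus_nat: "(\<lambda>N. 1 / (z + of_nat N :: complex)) \<longlonglongrightarrow> 0"
  by (intro tendsto_divide_0[OF tendsto_const] tendsto_add_filterlim_at_infinity[OF tendsto_const] tendsto_of_nat)

lemma LIMSEQ_inverse_minus_nat: "(\<lambda>N. 1 / (z - of_nat N :: complex)) \<longlonglongrightarrow> 0"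
proof -
  have "1 / (z - of_nat N) = - (1 / (- z + of_nat N))" for N
    by (metis minus_diff_eq minus_divide_right uminus_add_conv_diff)
  then show ?thesis using tendsto_minus[OF LIMSEQ_inverse_plus_nat[of "- z"]] by simp
qed

text \<open>Shifting the first half of the series by one index adds a telescoping series with sum -
  1 / z.\<close>

lemma cot_sums_symmetric:
  assumes "(z :: complex) \<notin> \<int>"
  shows "(\<lambda>k. 1 / (z + of_nat (Suc k)) + 1 / (z - of_nat (Suc k))) sums
     (of_real pi * cot (of_real pi * z) - 1 / z)"
proof -
  have "(\<lambda>k. 1 / (z + of_nat (Suc k)) - 1 / (z + of_nat k)) sums (0 - 1 / (z + of_nat 0))"
    by (rule telescope_sums[OF LIMSEQ_inverse_plus_nat])
  from sums_add[OF this cot_sums[OF assms]] show ?thesis by (simp add: algebra_simps)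
qed

lemma norm_summable_inverse_square:
  "summable (\<lambda>k. norm (1 / (z + of_nat k :: complex)\<^sup>2))"
proof (rule summable_comparison_test_ev)
  show "\<forall>\<^sub>F k in sequentially. norm (norm (1 / (z + of_nat k)\<^sup>2)) \<le> 4 * (1 / real k ^ 2)"
    using eventually_gt_at_top[of "nat \<lceil>2 * cmod z\<rceil>"]
  proof eventually_elim
    case (elim k)
    then have k: "real k > 2 * cmod z" "k > 0" by linarith+
    have "real k / 2 \<le> cmod (z + of_nat k)"
      using norm_triangle_ineq4[of "z + of_nat k" z] k by simp
    then have "1 / (cmod (z + of_nat k))\<^sup>2 \<le> 1 / (real k / 2)\<^sup>2"
      using k by (intro divide_left_mono power_mono mult_pos_pos zero_less_power) auto
    then show ?case by (simp add: norm_divide norm_power power_divide)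
  qed
  show "summable (\<lambda>k. 4 * (1 / real k ^ 2))"
    using inverse_power_summable[of 2, where 'a = real] by (intro summable_mult) (simp add: inverse_eq_divide)
qed

lemma inverse_square_summable_on_int:
  "(\<lambda>n. 1 / (z + of_int n :: complex)\<^sup>2) summable_on UNIV"
proof (rule summable_on_int_split)
  show "(\<lambda>k. 1 / (z + of_int (int k))\<^sup>2) summable_on UNIV"
    using norm_summable_imp_summable_on[OF norm_summable_inverse_square[of z]] by simp
  have "1 / (z + of_int (- int k - 1))\<^sup>2 = 1 / ((1 - z) + of_nat k)\<^sup>2" for k
    by (rule arg_cong[of _ _ "\<lambda>x. 1 / x"]) (simp add: power2_eq_square algebra_simps)
  then show "(\<lambda>k. 1 / (z + of_int (- int k - 1))\<^sup>2) summable_on UNIV"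
    using norm_summable_imp_summable_on[OF norm_summable_inverse_square[of "1 - z"]] by simp
qed

text \<open>Minus the derivative of pi cot (pi z); at a non-integral z it is the sum of 1 / (z +
  n)^2 over all integers n.\<close>

definition csc2 :: "complex \<Rightarrow> complex" where
  "csc2 z = (of_real pi / sin (of_real pi * z))\<^sup>2"

lemma Polygamma_1_reflection_complex:
  assumes "(z :: complex) \<notin> \<int>"
  shows "Polygamma 1 z + Polygamma 1 (1 - z) = csc2 z"
proof -
  have z: "z \<notin> \<int>\<^sub>\<le>\<^sub>0" "1 - z \<notin> \<int>\<^sub>\<le>\<^sub>0"
    using assms nonpos_Ints_subset_Ints[where 'a = complex] Ints_diff[OF Ints_1, of "1 - z"] by auto
  have s: "sin (of_real pi * z) \<noteq> 0" using assms by (auto simp: sin_eq_0)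
  have 1: "((\<lambda>z. Digamma (1 - z) - Digamma z) has_field_derivative (- Polygamma 1 (1 - z) - Polygamma 1 z)) (at z)"
    using z by (auto intro!: derivative_eq_intros)
  define S C where "S = sin (of_real pi * z)" and "C = cos (of_real pi * z)"
  have SC: "S * S + C * C = 1"
    using sin_cos_squared_add[of "of_real pi * z"] by (simp add: S_def C_def power2_eq_square)
  have "((\<lambda>z. of_real pi * (cos (of_real pi * z) / sin (of_real pi * z))) has_field_derivative
      of_real pi * (((- S * of_real pi) * S - C * (C * of_real pi)) / (S * S))) (at z)"
    using s by (auto intro!: derivative_eq_intros simp: S_def C_def) (simp add: algebra_simps)
  moreover have "(- S * of_real pi) * S - C * (C * of_real pi) = - of_real pi * (S * S + C * C)"
    by (simp add: algebra_simps)
  ultimately have 2: "((\<lambda>z. of_real pi * cot (of_real pi * z)) has_field_derivative (- csc2 z)) (at z)"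
    unfolding SC by (simp add: cot_def csc2_def power2_eq_square flip: S_def)
  have "\<forall>\<^sub>F w in nhds z. w \<in> - \<int>"
    using assms by (intro eventually_nhds_in_open) (auto intro: closed_Ints)
  then have "\<forall>\<^sub>F w in nhds z. Digamma (1 - w) - Digamma w = of_real pi * cot (of_real pi * w)"
    by eventually_elim (simp add: Digamma_reflection_complex)
  from DERIV_unique[OF 1 DERIV_cong_ev[OF refl this refl, THEN iffD2, OF 2]] show ?thesis
    by (simp add: algebra_simps add_eq_0_iff)
qed

lemma has_sum_inverse_square:
  assumes "(z :: complex) \<notin> \<int>"
  shows "((\<lambda>n. 1 / (z + of_int n)\<^sup>2) has_sum csc2 z) UNIV"
proof -
  have z: "z \<noteq> 0" "1 - z \<noteq> 0" using assms by auto
  have *: "((\<lambda>k. 1 / (w + of_nat k)\<^sup>2) has_sum Polygamma 1 w) UNIV" if "w \<noteq> 0" for w :: complex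
    using norm_summable_imp_has_sum[OF norm_summable_inverse_square[of w]] Polygamma_LIMSEQ[OF that, of 1]
    by (simp add: inverse_eq_divide power2_eq_square)
  have "1 / (z + of_int (- int k - 1))\<^sup>2 = 1 / ((1 - z) + of_nat k)\<^sup>2" for k
    by (rule arg_cong[of _ _ "\<lambda>x. 1 / x"]) (simp add: power2_eq_square algebra_simps)
  then show ?thesis
    unfolding Polygamma_1_reflection_complex[OF assms, symmetric]
    using *[OF z(1)] *[OF z(2)] by (intro has_sum_int_split) simp_all
qed

section \<open>The weight two Eisenstein series\<close>

text \<open>The double series of 1 / (m \<tau> + n)^2, summed over n first. The inner sums are
  replaced by their values \<open>csc2 (m \<tau>)\<close>, and the constant is the row m = 0, twice
  zeta(2). What remains is an absolutely convergent simple series.\<close>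

definition G2 :: "complex \<Rightarrow> complex" where
  "G2 \<tau> = of_real (pi\<^sup>2 / 3) + (\<Sum>\<^sub>\<infinity>m\<in>-{0}. csc2 (of_int m * \<tau>))"

lemma nonint_Im: "Im z \<noteq> 0 \<Longrightarrow> z \<notin> \<int>"
  by (auto elim!: Ints_cases)

text \<open>|sin z|^2 is the sum of the squares of sin (Re z) and sinh (Im z). The linear bound
  makes the terms of \<open>G2\<close> of order 1 / m^2, which suffices for convergence.\<close>

lemma norm_sin_ge_Im: "cmod (sin z) \<ge> \<bar>Im z\<bar>"
proof -
  have "sin z = Complex (sin (Re z) * cosh (Im z)) (cos (Re z) * sinh (Im z))"
    by (simp add: complex_eq_iff Re_sin Im_sin cosh_def sinh_def field_simps)
  then have "(cmod (sin z))\<^sup>2 = (sin (Re z))\<^sup>2 * (cosh (Im z))\<^sup>2 + (cos (Re z))\<^sup>2 * (sinh (Im z))\<^sup>2"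
    by (simp add: cmod_def power_mult_distrib)
  also have "\<dots> = (sin (Re z))\<^sup>2 + ((sin (Re z))\<^sup>2 + (cos (Re z))\<^sup>2) * (sinh (Im z))\<^sup>2"
    by (simp only: cosh_square_eq distrib_left distrib_right mult_1_right add.assoc)
  finally have *: "(cmod (sin z))\<^sup>2 \<ge> (sinh (Im z))\<^sup>2"
    unfolding sin_cos_squared_add by simp
  have "\<bar>Im z\<bar> \<le> \<bar>sinh (Im z)\<bar>"
    using real_le_abs_sinh[of "Im z"] by (simp add: sinh_field_def exp_minus)
  moreover have "\<bar>sinh (Im z)\<bar> \<le> cmod (sin z)"
    using * by (metis abs_le_square_iff abs_norm_cancel)
  ultimately show ?thesis by linarith
qed


lemma norm_csc2_le:
  assumes "m \<noteq> 0" "Im \<tau> > 0"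
  shows "cmod (csc2 (of_int m * \<tau>)) \<le> (1 / (Im \<tau>)\<^sup>2) * (1 / (real_of_int m)\<^sup>2)"
proof -
  have pos: "pi * (\<bar>real_of_int m\<bar> * Im \<tau>) > 0" using assms by simp
  have "pi * (\<bar>real_of_int m\<bar> * Im \<tau>) \<le> cmod (sin (of_real pi * (of_int m * \<tau>)))"
    using norm_sin_ge_Im[of "of_real pi * (of_int m * \<tau>)"] assms by (simp add: abs_mult)
  then have "pi / cmod (sin (of_real pi * (of_int m * \<tau>))) \<le> pi / (pi * (\<bar>real_of_int m\<bar> * Im \<tau>))"
    using pos by (intro divide_left_mono mult_pos_pos[of _ "pi * (\<bar>real_of_int m\<bar> * Im \<tau>)"] less_le_trans[OF pos]) auto
  also have "\<dots> = 1 / (\<bar>real_of_int m\<bar> * Im \<tau>)" by simp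
  finally have "(pi / cmod (sin (of_real pi * (of_int m * \<tau>))))\<^sup>2 \<le> (1 / (\<bar>real_of_int m\<bar> * Im \<tau>))\<^sup>2"
    by (intro power_mono) auto
  then show ?thesis by (simp add: csc2_def norm_power norm_divide power_divide power_mult_distrib mult.commute)
qed

lemma has_sum_inverse_square_int: "((\<lambda>m. 1 / (of_int m)\<^sup>2) has_sum (pi\<^sup>2 / 3)) (- {0 :: int})"
proof -
  have "(\<lambda>n. 1 / (real n + 1)\<^sup>2) sums (pi\<^sup>2 / 6)" using inverse_squares_sums by (simp add: add.commute)
  then have 1: "((\<lambda>n. 1 / (real n + 1)\<^sup>2) has_sum (pi\<^sup>2 / 6)) UNIV"
    by (rule sums_nonneg_imp_has_sum) auto
  have "((\<lambda>m. 1 / (real_of_int m)\<^sup>2) has_sum (pi\<^sup>2 / 6)) {0<..}"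
    by (rule has_sum_reindex_bij_witness[of _ "\<lambda>n. int n + 1" "\<lambda>m. nat (m - 1)", THEN iffD2, OF _ _ _ _ _ refl 1]) auto
  moreover have "((\<lambda>m. 1 / (real_of_int m)\<^sup>2) has_sum (pi\<^sup>2 / 6)) {..<0}"
    by (rule has_sum_reindex_bij_witness[of _ "\<lambda>n. - int n - 1" "\<lambda>m. nat (- m - 1)", THEN iffD2, OF _ _ _ _ _ refl 1])
      (auto simp: power2_eq_square algebra_simps)
  ultimately have "((\<lambda>m. 1 / (real_of_int m)\<^sup>2) has_sum (pi\<^sup>2 / 6 + pi\<^sup>2 / 6)) ({0<..} \<union> {..<0})"
    by (rule has_sum_Un_disjoint) auto
  moreover have "{0<..} \<union> {..<0} = - {0 :: int}" by auto
  ultimately show ?thesis by simp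
qed

lemma csc2_summable:
  assumes "Im \<tau> > 0"
  shows "(\<lambda>m. csc2 (of_int m * \<tau>)) summable_on - {0 :: int}"
proof (rule Infinite_Sum.abs_summable_summable, rule Infinite_Sum.abs_summable_on_comparison_test')
  show "(\<lambda>m. (1 / (Im \<tau>)\<^sup>2) * (1 / (real_of_int m)\<^sup>2)) summable_on - {0 :: int}"
    using has_sum_inverse_square_int by (intro summable_on_cmult_right) (auto simp: summable_on_def)
qed (use norm_csc2_le assms in auto)

lemma G2_has_sum:
  assumes "Im \<tau> > 0"
  shows "((\<lambda>m. csc2 (of_int m * \<tau>)) has_sum (G2 \<tau> - of_real (pi\<^sup>2 / 3))) (- {0 :: int})"
  using csc2_summable[OF assms] by (simp add: G2_def)

text \<open>The true decay is exponential in Im \<tau>, but a bound that tends to 0 is enough to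
  find the limit at the cusp.\<close>

lemma norm_G2_diff_le:
  assumes "Im \<tau> > 0"
  shows "cmod (G2 \<tau> - of_real (pi\<^sup>2 / 3)) \<le> pi\<^sup>2 / 3 / (Im \<tau>)\<^sup>2"
proof -
  have "((\<lambda>m. (1 / (Im \<tau>)\<^sup>2) * (1 / (real_of_int m)\<^sup>2)) has_sum ((1 / (Im \<tau>)\<^sup>2) * (pi\<^sup>2 / 3))) (- {0})"
    by (intro has_sum_cmult_right has_sum_inverse_square_int)
  then have "cmod (\<Sum>\<^sub>\<infinity>m\<in>-{0}. csc2 (of_int m * \<tau>)) \<le> (1 / (Im \<tau>)\<^sup>2) * (pi\<^sup>2 / 3)"
    by (rule norm_infsum_le[OF has_sum_infsum[OF csc2_summable[OF assms]]]) (use norm_csc2_le assms in auto)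
  then show ?thesis by (simp add: G2_def)
qed

lemma csc2_plus_1: "csc2 (z + 1) = csc2 z"
  by (simp add: csc2_def distrib_left power_divide sin_plus_pi)

lemma csc2_plus_int: "csc2 (z + of_int k) = csc2 z"
proof (induction k rule: int_induct[where k = 0])
  case (step1 i)
  then show ?case using csc2_plus_1[of "z + of_int i"] by (simp add: add_ac)
next
  case (step2 i)
  then show ?case using csc2_plus_1[of "z + of_int i - 1"] by (simp add: algebra_simps)
qed simp

lemma csc2_minus: "csc2 (- z) = csc2 z"
  by (simp add: csc2_def)

lemma G2_plus_1: "G2 (\<tau> + 1) = G2 \<tau>"
  using csc2_plus_int[of "of_int m * \<tau>" m for m] by (simp add: G2_def distrib_left)

lemma G2_holomorphic: "G2 holomorphic_on upper_half_plane"
proof -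
  have "G2 field_differentiable (at z)" if z: "Im z > 0" for z
  proof -
    define r where "r = Im z / 2"
    have r: "r > 0" using z by (simp add: r_def)
    have im: "Im w \<ge> r" if "w \<in> cball z r" for w
      using that abs_Im_le_cmod[of "z - w"] by (auto simp: r_def dist_norm)
    have ul: "uniform_limit (cball z r) (\<lambda>A w. \<Sum>m\<in>A. csc2 (of_int m * w)) (\<lambda>w. \<Sum>\<^sub>\<infinity>m\<in>-{0}. csc2 (of_int m * w))
       (finite_subsets_at_top (-{0}))"
    proof (rule Weierstrass_m_test_general)
      show "(\<lambda>m. (1 / r\<^sup>2) * (1 / (real_of_int m)\<^sup>2)) summable_on - {0 :: int}"
        using has_sum_inverse_square_int by (intro summable_on_cmult_right) (auto simp: summable_on_def)
      fix m :: int and w assume m: "m \<in> - {0}" and w: "w \<in> cball z r"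
      have "cmod (csc2 (of_int m * w)) \<le> (1 / (Im w)\<^sup>2) * (1 / (real_of_int m)\<^sup>2)"
        using m im[OF w] r by (intro norm_csc2_le) auto
      also have "\<dots> \<le> (1 / r\<^sup>2) * (1 / (real_of_int m)\<^sup>2)"
        using im[OF w] r by (intro mult_right_mono divide_left_mono power_mono) auto
      finally show "cmod (csc2 (of_int m * w)) \<le> (1 / r\<^sup>2) * (1 / (real_of_int m)\<^sup>2)" .
    qed
    have hol: "(\<lambda>w. csc2 (of_int m * w)) holomorphic_on {w. Im w > 0}" if "m \<noteq> 0" for m
      unfolding csc2_def
    proof (intro holomorphic_intros)
      fix w assume "w \<in> {w. Im w > 0}"
      then show "sin (of_real pi * (of_int m * w)) \<noteq> 0"
        using norm_sin_ge_Im[of "of_real pi * (of_int m * w)"] that by auto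
    qed
    have "(\<lambda>w. \<Sum>m\<in>A. csc2 (of_int m * w)) holomorphic_on {w. Im w > 0}" if "A \<subseteq> - {0}" for A
      using that by (intro holomorphic_on_sum hol) auto
    moreover have cb: "cball z r \<subseteq> {w. Im w > 0}" and bb: "ball z r \<subseteq> {w. Im w > 0}"
      using im r by (auto intro: less_le_trans dest!: ball_subset_cball[THEN subsetD])
    ultimately have "\<forall>\<^sub>F A in finite_subsets_at_top (-{0}). continuous_on (cball z r) (\<lambda>w. \<Sum>m\<in>A. csc2 (of_int m * w)) \<and>
        (\<lambda>w. \<Sum>m\<in>A. csc2 (of_int m * w)) holomorphic_on ball z r"
      using cb bb by (intro eventually_finite_subsets_at_top_weakI conjI holomorphic_on_imp_continuous_on)
        (meson holomorphic_on_subset)+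
    then have "(\<lambda>w. \<Sum>\<^sub>\<infinity>m\<in>-{0}. csc2 (of_int m * w)) holomorphic_on ball z r"
      by (rule holomorphic_uniform_limit[OF _ ul finite_subsets_at_top_neq_bot])
    then have "G2 holomorphic_on ball z r"
      unfolding G2_def[abs_def] by (intro holomorphic_intros)
    then show ?thesis using r by (simp add: holomorphic_on_imp_differentiable_at)
  qed
  then show ?thesis
    using open_upper_half_plane by (auto simp: holomorphic_on_open field_differentiable_def upper_half_plane_def)
qed


text \<open>With w = m \<tau> + n, the term 1 / (w^2 (w + 1)) differs from 1 / w^2 by 1 / w - 1 / (w
  + 1), which telescopes in n. It decays like the inverse cube of w, so its double series converges
  absolutely and may be summed in either order.\<close>

lemma summable_eisenstein_auxiliary:
  assumes "Im \<tau> > 0"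
  shows "(\<lambda>(m, n). 1 / ((of_int m * \<tau> + of_int n)\<^sup>2 * (of_int m * \<tau> + of_int n + 1)))
     summable_on (- {0 :: int}) \<times> (UNIV :: int set)"
proof -
  obtain c where c: "c > 0" "\<And>m n :: int. cmod (of_int m * \<tau> + of_int n) \<ge> c * of_int (max \<bar>m\<bar> \<bar>n\<bar>)"
    using lattice_lower_bound[OF assms] by metis
  have sum: "(\<lambda>p. (2 / c ^ 3) * (case p of (m, n) \<Rightarrow> 1 / real_of_int (max \<bar>m\<bar> \<bar>n\<bar>) ^ 3)) summable_on
      (- {0 :: int}) \<times> (UNIV :: int set)"
    by (rule summable_on_subset[OF summable_on_cmult_right[OF summable_on_max_cube]]) auto
  show ?thesis
  proof (rule Infinite_Sum.abs_summable_summable, rule Infinite_Sum.abs_summable_on_comparison_test'[OF sum])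
    fix p :: "int \<times> int" assume p: "p \<in> (- {0}) \<times> UNIV"
    obtain m n where mn: "p = (m, n)" by fastforce
    with p have m: "m \<noteq> 0" by auto
    define M where "M = real_of_int (max \<bar>m\<bar> \<bar>n\<bar>)"
    have M: "M \<ge> 1" using m unfolding M_def by (auto simp: max_def)
    have 1: "c * M \<le> cmod (of_int m * \<tau> + of_int n)" unfolding M_def by (rule c(2))
    \<comment> \<open>As m is not 0, replacing n by n + 1 changes the maximum by at most a factor of
      2.\<close>
    have "max \<bar>m\<bar> \<bar>n\<bar> \<le> 2 * max \<bar>m\<bar> \<bar>n + 1\<bar>" using m by (auto simp: max_def abs_if split: if_splits)
    then have "M / 2 \<le> real_of_int (max \<bar>m\<bar> \<bar>n + 1\<bar>)" unfolding M_def by linarith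
    then have "c * (M / 2) \<le> c * real_of_int (max \<bar>m\<bar> \<bar>n + 1\<bar>)" using c(1) by (intro mult_left_mono) auto
    also have "\<dots> \<le> cmod (of_int m * \<tau> + of_int (n + 1))" by (rule c(2))
    finally have 2: "c * (M / 2) \<le> cmod (of_int m * \<tau> + of_int n + 1)" by (simp add: add_ac)
    have mono: "1 / (x ^ 2 * y) \<le> 1 / (u ^ 2 * v)" if "u > 0" "v > 0" "u \<le> x" "v \<le> y" for u v x y :: real
      using that by (intro divide_left_mono mult_mono power_mono mult_pos_pos zero_less_power) auto
    have pos: "c * M > 0" "c * (M / 2) > 0" using c(1) M by auto
    have "1 / (cmod (of_int m * \<tau> + of_int n) ^ 2 * cmod (of_int m * \<tau> + of_int n + 1)) \<le> 1 / ((c * M) ^ 2 * (c * (M / 2)))"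
      by (rule mono[OF pos 1 2])
    also have "\<dots> = (2 / c ^ 3) * (1 / M ^ 3)" using c(1) M by (simp add: field_simps power2_eq_square power3_eq_cube)
    finally show "cmod (case p of (m, n) \<Rightarrow> 1 / ((of_int m * \<tau> + of_int n)\<^sup>2 * (of_int m * \<tau> + of_int n + 1))) \<le>
       (2 / c ^ 3) * (case p of (m, n) \<Rightarrow> 1 / real_of_int (max \<bar>m\<bar> \<bar>n\<bar>) ^ 3)"
      by (simp add: mn norm_divide norm_mult norm_power flip: M_def)
  qed
qed

lemma sum_int_telescope:
  "(\<Sum>n\<in>{- int N..<int N}. g n - g (n + 1)) = g (- int N) - (g (int N) :: 'a :: ab_group_add)"
proof (induction N)
  case (Suc N)
  have "{- int (Suc N)..<int (Suc N)} = insert (- 1 - int N) (insert (int N) {- int N..<int N})" by auto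
  then show ?case using Suc by (simp add: algebra_simps)
qed simp

text \<open>In a row the telescoping part has sum 0, because its partial sums are 1 / (z - N) - 1 /
  (z + N). So the auxiliary term has the same row sum as 1 / (z + n)^2.\<close>

lemma csc2_row_sum:
  assumes "z \<notin> \<int>"
    and summable: "(\<lambda>n. 1 / ((z + of_int n)\<^sup>2 * (z + of_int n + 1))) summable_on UNIV"
  shows "((\<lambda>n. 1 / ((z + of_int n)\<^sup>2 * (z + of_int n + 1))) has_sum csc2 z) UNIV"
proof -
  have nz: "z + of_int n \<noteq> 0" "z + of_int n + 1 \<noteq> 0" for n
  proof -
    have "z = of_int (- n)" if "z + of_int n = 0" using that by (simp add: add_eq_0_iff2)
    moreover have "z = of_int (- n - 1)" if "z + of_int n + 1 = 0"
    proof -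
      have "z = (z + of_int n + 1) + of_int (- n - 1)" by simp
      then show ?thesis unfolding that by simp
    qed
    ultimately show "z + of_int n \<noteq> 0" "z + of_int n + 1 \<noteq> 0" using assms Ints_of_int by metis+
  qed
  let ?f = "\<lambda>n. 1 / ((z + of_int n)\<^sup>2 * (z + of_int n + 1))"
  let ?t = "\<lambda>n::int. 1 / (z + of_int n) - 1 / (z + of_int n + 1)"
  have ft: "?t n = 1 / (z + of_int n)\<^sup>2 - ?f n" for n
    using nz[of n] by (simp add: divide_simps power2_eq_square)
  have "?t summable_on UNIV"
    unfolding ft using summable inverse_square_summable_on_int
    by (intro summable_on_diff)
  then obtain s where s: "(?t has_sum s) UNIV" by (auto simp: summable_on_def)
  have "(\<lambda>N. \<Sum>n\<in>{- int N..<int N}. ?t n) \<longlonglongrightarrow> s" by (rule has_sum_int_partial_sums[OF s])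
  moreover have "(\<Sum>n\<in>{- int N..<int N}. ?t n) = 1 / (z - of_nat N) - 1 / (z + of_nat N)" for N
    using sum_int_telescope[of "\<lambda>n. 1 / (z + of_int n)" N] by (simp add: add_ac)
  moreover have "(\<lambda>N. 1 / (z - of_nat N) - 1 / (z + of_nat N)) \<longlonglongrightarrow> 0 - 0"
    by (intro tendsto_diff LIMSEQ_inverse_plus_nat LIMSEQ_inverse_minus_nat)
  ultimately have "s = 0" using LIMSEQ_unique by fastforce
  with s have "((\<lambda>n. 1 / (z + of_int n)\<^sup>2 - ?t n) has_sum (csc2 z - 0)) UNIV"
    by (intro has_sum_diff has_sum_inverse_square assms) auto
  then show ?thesis unfolding ft by simp
qed

text \<open>After taking out \<tau>^2, a column is a sum of inverse squares of n / \<tau> + m; the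
  subtracted term is the one with m = 0.\<close>

lemma has_sum_inverse_square_shifted:
  assumes "Im \<tau> > 0" "n \<noteq> 0"
  shows "((\<lambda>m. 1 / (of_int m * \<tau> + of_int n)\<^sup>2) has_sum (csc2 (of_int n / \<tau>) / \<tau>\<^sup>2 - 1 / (of_int n)\<^sup>2)) (- {0 :: int})"
proof -
  let ?f = "\<lambda>m :: int. 1 / (of_int m * \<tau> + of_int n)\<^sup>2"
  have [simp]: "\<tau> \<noteq> 0" using assms by auto
  have "Im (of_int n / \<tau>) \<noteq> 0" using assms by (simp add: Im_divide)
  then have "((\<lambda>m. 1 / (of_int n / \<tau> + of_int m)\<^sup>2) has_sum csc2 (of_int n / \<tau>)) UNIV"
    by (intro has_sum_inverse_square nonint_Im)
  from has_sum_cmult_left[OF this, of "1 / \<tau>\<^sup>2"]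
  have "((\<lambda>m. 1 / (of_int n / \<tau> + of_int m)\<^sup>2 * (1 / \<tau>\<^sup>2)) has_sum csc2 (of_int n / \<tau>) * (1 / \<tau>\<^sup>2)) UNIV" .
  moreover have "1 / (of_int n / \<tau> + of_int m)\<^sup>2 * (1 / \<tau>\<^sup>2) = ?f m" for m :: int
  proof -
    have "(of_int n / \<tau> + of_int m)\<^sup>2 * \<tau>\<^sup>2 = (of_int m * \<tau> + of_int n)\<^sup>2"
      by (simp add: power_mult_distrib[symmetric] distrib_right add.commute)
    then show ?thesis by simp
  qed
  ultimately have all: "(?f has_sum csc2 (of_int n / \<tau>) / \<tau>\<^sup>2) UNIV" by simp
  then obtain s where s: "(?f has_sum s) (- {0})"
    by (meson summable_on_def summable_on_subset subset_UNIV)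
  have "(?f has_sum (?f 0 + s)) (insert 0 (- {0}))" by (intro has_sum_insert s) auto
  moreover have "insert 0 (- {0 :: int}) = UNIV" by auto
  ultimately have "?f 0 + s = csc2 (of_int n / \<tau>) / \<tau>\<^sup>2" using all has_sum_unique by metis
  then have "s = csc2 (of_int n / \<tau>) / \<tau>\<^sup>2 - 1 / (of_int n)\<^sup>2" by (simp add: algebra_simps)
  with s show ?thesis by simp
qed

lemma has_sum_inverse_square_int_complex:
  "((\<lambda>m. 1 / (of_int m :: complex)\<^sup>2) has_sum of_real (pi\<^sup>2 / 3)) (- {0 :: int})"
  using has_sum_of_real[OF has_sum_inverse_square_int, where 'a = complex] by simp

text \<open>The boundary term that remains when the order of summation in the conditionally convergent
  double series for \<open>G\<^sub>2\<close> is reversed.\<close>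

lemma boundary_term:
  assumes "Im \<tau> > 0" "N > 0"
    and "((\<lambda>m. 1 / (of_int m * \<tau> - of_nat N) - 1 / (of_int m * \<tau> + of_nat N)) has_sum s) (- {0 :: int})"
  shows "s = - (2 / \<tau>) * (of_real pi * cot (of_real pi * (of_nat N / \<tau>)) - \<tau> / of_nat N)"
proof -
  let ?f = "\<lambda>m :: int. 1 / (of_int m * \<tau> - of_nat N) - 1 / (of_int m * \<tau> + of_nat N)"
  let ?z = "of_nat N / \<tau>"
  have [simp]: "\<tau> \<noteq> 0" using assms by auto
  have "Im ?z \<noteq> 0" using assms by (simp add: Im_divide)
  then have cot: "(\<lambda>k. 1 / (?z + of_nat (Suc k)) + 1 / (?z - of_nat (Suc k))) sums
      (of_real pi * cot (of_real pi * ?z) - 1 / ?z)"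
    by (intro cot_sums_symmetric nonint_Im)
  have even: "?f (- m) = ?f m" for m
  proof -
    have "of_int (- m) * \<tau> - of_nat N = - (of_int m * \<tau> + of_nat N)"
      "of_int (- m) * \<tau> + of_nat N = - (of_int m * \<tau> - of_nat N)" by simp_all
    then show ?thesis by (simp only: divide_minus_right) simp
  qed
  obtain a where a: "(?f has_sum a) {0<..}"
    using summable_on_subset[of ?f "- {0}" "{0<..}"] assms(3) by (auto simp: summable_on_def)
  have "(?f has_sum a) {..<0}"
    by (rule has_sum_reindex_bij_witness[of _ uminus uminus, THEN iffD2, OF _ _ _ _ _ refl a]) (use even in auto)
  with a have "(?f has_sum (a + a)) ({0<..} \<union> {..<0})" by (intro has_sum_Un_disjoint) auto
  moreover have "{0<..} \<union> {..<0} = - {0 :: int}" by auto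
  ultimately have s: "s = 2 * a" using assms(3) has_sum_unique by force
  have "((\<lambda>k. ?f (int k + 1)) has_sum a) UNIV"
    by (rule has_sum_reindex_bij_witness[of _ "\<lambda>m. nat (m - 1)" "\<lambda>n. int n + 1", THEN iffD2, OF _ _ _ _ _ refl a]) auto
  then have "(\<lambda>k. ?f (int k + 1)) sums a" by (rule has_sum_imp_sums)
  moreover have "?f (int k + 1) = - (1 / \<tau>) * (1 / (?z + of_nat (Suc k)) + 1 / (?z - of_nat (Suc k)))" for k
  proof -
    have "of_int (int k + 1) * \<tau> - of_nat N = - (\<tau> * (?z - of_nat (Suc k)))"
      "of_int (int k + 1) * \<tau> + of_nat N = \<tau> * (?z + of_nat (Suc k))"
      by (simp_all add: right_diff_distrib distrib_left distrib_right)
    moreover have "1 / - (t * w) - 1 / (t * v) = - (1 / t) * (1 / v + 1 / w)" for t w v :: complex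
      by (simp add: divide_simps)
    ultimately show ?thesis by (simp only:)
  qed
  ultimately have "a = - (1 / \<tau>) * (of_real pi * cot (of_real pi * ?z) - 1 / ?z)"
    using sums_mult[OF cot, of "- (1 / \<tau>)"] sums_unique2 by simp
  then show ?thesis by (simp add: s)
qed

text \<open>Since Im \<tau> > 0, the number exp (2 pi i / \<tau>) has modulus greater than 1. So the
  cotangent, written as i (e^(2 i w) + 1) / (e^(2 i w) - 1), tends to i along w = pi N /
  \<tau>.\<close>

lemma LIMSEQ_boundary_term:
  assumes "Im \<tau> > 0"
  shows "(\<lambda>N. - (2 / \<tau>) * (of_real pi * cot (of_real pi * (of_nat N / \<tau>)) - \<tau> / of_nat N)) \<longlonglongrightarrow> - (2 * of_real pi * \<i> / \<tau>)"
proof -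
  define E where "E = exp (2 * \<i> * of_real pi / \<tau>)"
  have "Re (2 * \<i> * of_real pi / \<tau>) > 0"
    using assms by (auto simp: Re_divide intro!: divide_pos_pos add_nonneg_pos)
  then have E: "cmod E > 1" by (simp add: E_def)
  have cot: "cot (of_real pi * (of_nat N / \<tau>)) = \<i> + 2 * \<i> / (E ^ N - 1)" if "N > 0" for N
  proof -
    let ?w = "of_real pi * (of_nat N / \<tau>)"
    have EN: "exp (2 * \<i> * ?w) = E ^ N"
    proof -
      have "2 * \<i> * ?w = of_nat N * (2 * \<i> * of_real pi / \<tau>)" by simp
      then show ?thesis unfolding E_def by (simp only: exp_of_nat_mult)
    qed
    have "cmod (E ^ N) > 1" using E that by (simp add: norm_power)
    then have ne: "E ^ N \<noteq> 1" by auto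
    define e where "e = exp (\<i> * ?w)"
    have e: "e \<noteq> 0" "e * e = E ^ N" "exp (- (\<i> * ?w)) = 1 / e"
    proof -
      have "e * e = exp (\<i> * ?w + \<i> * ?w)" by (simp only: e_def exp_add)
      also have "\<i> * ?w + \<i> * ?w = 2 * \<i> * ?w" by simp
      finally show "e * e = E ^ N" using EN by simp
    qed (simp_all add: e_def exp_minus inverse_eq_divide)
    have "cot ?w = ((e + 1 / e) / 2) / ((e - 1 / e) / (2 * \<i>))"
      unfolding cot_def cos_exp_eq sin_exp_eq e(3)[symmetric] by (simp only: e_def)
    also have "\<dots> = \<i> * ((e * e + 1) / (e * e - 1))"
      using e ne by (simp add: field_simps)
    also have "\<dots> = \<i> + 2 * \<i> / (E ^ N - 1)" using ne unfolding e(2) by (simp add: field_simps)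
    finally show ?thesis .
  qed
  have "(\<lambda>N. 2 * \<i> / (- 1 + E ^ N)) \<longlonglongrightarrow> 0"
    by (intro tendsto_divide_0[OF tendsto_const] tendsto_add_filterlim_at_infinity[OF tendsto_const]
          filterlim_realpow_sequentially_gt1 E)
  then have "(\<lambda>N. - (2 / \<tau>) * (of_real pi * (\<i> + 2 * \<i> / (- 1 + E ^ N)) - \<tau> * (1 / (0 + of_nat N)))) \<longlonglongrightarrow>
     - (2 / \<tau>) * (of_real pi * (\<i> + 0) - \<tau> * 0)"
    by (intro tendsto_intros LIMSEQ_inverse_plus_nat)
  then show ?thesis
    by (rule Lim_transform_eventually[THEN tendsto_eq_rhs])
      (auto intro!: eventually_mono[OF eventually_gt_at_top[of 0]] simp: cot[simplified])
qed

text \<open>The absolutely convergent auxiliary series is summed in both orders. By rows it gives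
  \<open>G2 \<tau>\<close> without its constant. By columns it gives \<open>h n\<close> minus the
  column sum of \<open>t n\<close>; the sums of the latter over -N \<le> n < N are the boundary
  terms, with limit - 2 pi i / \<tau>.\<close>

lemma G2_S:
  assumes "Im \<tau> > 0"
  shows "G2 \<tau> = G2 (- (1 / \<tau>)) / \<tau>\<^sup>2 + 2 * of_real pi * \<i> / \<tau>"
proof -
  let ?b = "\<lambda>m n. 1 / ((of_int m * \<tau> + of_int n)\<^sup>2 * (of_int m * \<tau> + of_int n + 1))"
  have [simp]: "\<tau> \<noteq> 0" using assms by auto
  have nonint: "of_int m * \<tau> \<notin> \<int>" if "m \<noteq> 0" for m
    using assms that by (intro nonint_Im) simp
  obtain S where S: "((\<lambda>(m, n). ?b m n) has_sum S) ((- {0 :: int}) \<times> (UNIV :: int set))"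
    using summable_eisenstein_auxiliary[OF assms] by (auto simp: summable_on_def)
  have row: "((\<lambda>n. ?b m n) has_sum csc2 (of_int m * \<tau>)) UNIV" if "m \<in> - {0}" for m
    using summable_on_SigmaD1[OF summable_eisenstein_auxiliary[OF assms] that] that
    by (intro csc2_row_sum nonint) auto
  have "((\<lambda>m. csc2 (of_int m * \<tau>)) has_sum S) (- {0})"
    by (rule has_sum_Sigma'[OF S]) (use row in auto)
  with G2_has_sum[OF assms] have S_eq: "S = G2 \<tau> - of_real (pi\<^sup>2 / 3)" by (rule has_sum_unique[symmetric])
  have S': "((\<lambda>(n, m). ?b m n) has_sum S) ((UNIV :: int set) \<times> (- {0 :: int}))"
    using S by (subst (asm) has_sum_swap) (simp add: case_prod_unfold)
  define B where "B n = (\<Sum>\<^sub>\<infinity>m\<in>-{0}. ?b m n)" for n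
  have col: "((\<lambda>m. ?b m n) has_sum B n) (- {0})" for n
    using summable_on_SigmaD1[of "\<lambda>n m. ?b m n", OF has_sum_imp_summable[OF S'] UNIV_I] by (simp add: B_def)
  have BS: "(B has_sum S) UNIV"
    by (rule has_sum_Sigma'[OF S']) (use col in auto)
  \<comment> \<open>\<open>h n\<close> is the sum of 1 / (m \<tau> + n)^2 over m \<noteq> 0. The
    column n = 0 becomes the constant term of the transformed series, and the other columns lose
    their term with m = 0.\<close>
  define h :: "int \<Rightarrow> complex" where "h n = (if n = 0 then of_real (pi\<^sup>2 / 3) / \<tau>\<^sup>2
      else csc2 (of_int n / \<tau>) / \<tau>\<^sup>2 - 1 / (of_int n)\<^sup>2)" for n
  have h: "((\<lambda>m. 1 / (of_int m * \<tau> + of_int n)\<^sup>2) has_sum h n) (- {0})" for n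
  proof (cases "n = 0")
    case True
    then show ?thesis using has_sum_cmult_left[OF has_sum_inverse_square_int_complex, of "1 / \<tau>\<^sup>2"]
      by (simp add: h_def power_mult_distrib)
  next
    case False
    then show ?thesis using has_sum_inverse_square_shifted[OF assms False] by (simp add: h_def)
  qed
  define t where "t n m = 1 / (of_int m * \<tau> + of_int n) - 1 / (of_int m * \<tau> + of_int (n + 1))" for n m
  have t: "(t n has_sum (h n - B n)) (- {0})" for n
  proof -
    have "((\<lambda>m. 1 / (of_int m * \<tau> + of_int n)\<^sup>2 - ?b m n) has_sum (h n - B n)) (- {0})"
      by (intro has_sum_diff h col)
    moreover have "1 / (of_int m * \<tau> + of_int n)\<^sup>2 - ?b m n = t n m" if "m \<in> - {0}" for m
    proof -
      have "Im (of_int m * \<tau> + of_int n) \<noteq> 0" "Im (of_int m * \<tau> + of_int n + 1) \<noteq> 0" using assms that by auto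
      then have "of_int m * \<tau> + of_int n \<noteq> 0" "of_int m * \<tau> + of_int n + 1 \<noteq> 0" by (metis zero_complex.sel(2))+
      then show ?thesis by (simp add: t_def divide_simps power2_eq_square add_ac)
    qed
    ultimately show ?thesis by (subst has_sum_cong[symmetric]) auto
  qed
  have im: "Im (- (1 / \<tau>)) > 0"
    using assms by (auto simp: Im_divide intro!: divide_pos_pos add_nonneg_pos)
  have "((\<lambda>n. csc2 (of_int n * (- (1 / \<tau>))) * (1 / \<tau>\<^sup>2) - 1 / (of_int n)\<^sup>2) has_sum
      ((G2 (- (1 / \<tau>)) - of_real (pi\<^sup>2 / 3)) * (1 / \<tau>\<^sup>2) - of_real (pi\<^sup>2 / 3))) (- {0 :: int})"
    by (intro has_sum_diff has_sum_cmult_left G2_has_sum im has_sum_inverse_square_int_complex)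
  moreover have "csc2 (of_int n * (- (1 / \<tau>))) * (1 / \<tau>\<^sup>2) - 1 / (of_int n)\<^sup>2 = h n" if "n \<in> - {0}" for n
    using that csc2_minus[of "of_int n / \<tau>"] by (simp add: h_def)
  ultimately have "(h has_sum ((G2 (- (1 / \<tau>)) - of_real (pi\<^sup>2 / 3)) * (1 / \<tau>\<^sup>2) - of_real (pi\<^sup>2 / 3))) (- {0})"
    by (subst has_sum_cong[symmetric]) auto
  then have "(h has_sum (h 0 + ((G2 (- (1 / \<tau>)) - of_real (pi\<^sup>2 / 3)) * (1 / \<tau>\<^sup>2) - of_real (pi\<^sup>2 / 3)))) (insert 0 (- {0}))"
    by (intro has_sum_insert) auto
  moreover have "insert 0 (- {0 :: int}) = UNIV" by auto
  moreover have "h 0 + ((G2 (- (1 / \<tau>)) - of_real (pi\<^sup>2 / 3)) * (1 / \<tau>\<^sup>2) - of_real (pi\<^sup>2 / 3)) =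
      G2 (- (1 / \<tau>)) / \<tau>\<^sup>2 - of_real (pi\<^sup>2 / 3)"
    by (simp add: h_def diff_divide_distrib)
  ultimately have hS: "(h has_sum (G2 (- (1 / \<tau>)) / \<tau>\<^sup>2 - of_real (pi\<^sup>2 / 3))) UNIV" by (simp only:)
  have "(\<lambda>N. \<Sum>n\<in>{- int N..<int N}. h n - B n) \<longlonglongrightarrow> G2 (- (1 / \<tau>)) / \<tau>\<^sup>2 - of_real (pi\<^sup>2 / 3) - S"
    by (intro has_sum_int_partial_sums has_sum_diff hS BS)
  moreover have "(\<Sum>n\<in>{- int N..<int N}. h n - B n) =
     - (2 / \<tau>) * (of_real pi * cot (of_real pi * (of_nat N / \<tau>)) - \<tau> / of_nat N)" if "N > 0" for N
  proof (rule boundary_term[OF assms that])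
    have fin: "((\<lambda>m. \<Sum>n\<in>A. t n m) has_sum (\<Sum>n\<in>A. h n - B n)) (- {0})" if "finite A" for A
      using that by (induction rule: finite_induct) (auto intro!: has_sum_add t)
    have "(\<Sum>n\<in>{- int N..<int N}. t n m) = 1 / (of_int m * \<tau> - of_nat N) - 1 / (of_int m * \<tau> + of_nat N)" for m
      using sum_int_telescope[of "\<lambda>n. 1 / (of_int m * \<tau> + of_int n)" N] by (simp add: t_def)
    with fin[of "{- int N..<int N}"]
    show "((\<lambda>m. 1 / (of_int m * \<tau> - of_nat N) - 1 / (of_int m * \<tau> + of_nat N)) has_sum
        (\<Sum>n\<in>{- int N..<int N}. h n - B n)) (- {0})" by simp
  qed
  then have "\<forall>\<^sub>F N in sequentially. - (2 / \<tau>) * (of_real pi * cot (of_real pi * (of_nat N / \<tau>)) - \<tau> / of_nat N) =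
      (\<Sum>n\<in>{- int N..<int N}. h n - B n)"
    by (intro eventually_mono[OF eventually_gt_at_top[of 0]]) (simp only:)
  then have "(\<lambda>N. \<Sum>n\<in>{- int N..<int N}. h n - B n) \<longlonglongrightarrow> - (2 * of_real pi * \<i> / \<tau>)"
    by (rule Lim_transform_eventually[OF LIMSEQ_boundary_term[OF assms]])
  ultimately have "G2 (- (1 / \<tau>)) / \<tau>\<^sup>2 - of_real (pi\<^sup>2 / 3) - S = - (2 * of_real pi * \<i> / \<tau>)"
    by (rule LIMSEQ_unique)
  then show ?thesis by (simp add: S_eq algebra_simps)
qed


text \<open>The logarithmic derivative of \<open>\<eta>\<^sup>2\<close>.\<close>

definition eta_log_deriv :: "complex \<Rightarrow> complex" where
  "eta_log_deriv \<tau> = \<i> / (2 * of_real pi) * G2 \<tau>"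

lemma eta_log_deriv_holomorphic: "eta_log_deriv holomorphic_on upper_half_plane"
  unfolding eta_log_deriv_def[abs_def] by (intro holomorphic_intros G2_holomorphic)

lemma eta_log_deriv_plus_1: "eta_log_deriv (\<tau> + 1) = eta_log_deriv \<tau>"
  by (simp add: eta_log_deriv_def G2_plus_1)

text \<open>The normalisation i / (2 pi) turns the inhomogeneous term into exactly \<tau>, as it
  must be for the logarithmic derivative of a form of weight one.\<close>

lemma eta_log_deriv_S:
  assumes "\<tau> \<in> upper_half_plane"
  shows "eta_log_deriv (- (1 / \<tau>)) = \<tau>\<^sup>2 * eta_log_deriv \<tau> + \<tau>"
proof -
  have t: "Im \<tau> > 0" "\<tau> \<noteq> 0" using assms by (auto simp: upper_half_plane_def)
  have "eta_log_deriv \<tau> = \<i> / (2 * of_real pi) * G2 (- (1 / \<tau>)) / \<tau>\<^sup>2 + \<i> / (2 * of_real pi) * (2 * of_real pi * \<i> / \<tau>)"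
    unfolding eta_log_deriv_def G2_S[OF t(1)] by (simp add: distrib_left)
  also have "\<i> / (2 * of_real pi) * (2 * of_real pi * \<i> / \<tau>) = - (1 / \<tau>)" by simp
  finally show ?thesis using t(2) by (simp add: eta_log_deriv_def power2_eq_square field_simps)
qed

lemma eta_log_deriv_bound:
  assumes "Im \<tau> > 0"
  shows "cmod (eta_log_deriv \<tau> - 2 * of_real pi * \<i> / 12) \<le> pi / (6 * (Im \<tau>)\<^sup>2)"
proof -
  have "eta_log_deriv \<tau> - 2 * of_real pi * \<i> / 12 = \<i> / (2 * of_real pi) * (G2 \<tau> - of_real (pi\<^sup>2 / 3))"
    by (simp add: eta_log_deriv_def power2_eq_square field_simps)
  then have "cmod (eta_log_deriv \<tau> - 2 * of_real pi * \<i> / 12) = 1 / (2 * pi) * cmod (G2 \<tau> - of_real (pi\<^sup>2 / 3))"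
    by (simp add: norm_mult norm_divide)
  also have "\<dots> \<le> 1 / (2 * pi) * (pi\<^sup>2 / 3 / (Im \<tau>)\<^sup>2)"
    by (intro mult_left_mono norm_G2_diff_le assms) auto
  finally show ?thesis by (simp add: power2_eq_square)
qed

section \<open>Liouville theorems\<close>

text \<open>If some value has distance e > 0 from \<open>c\<close>, all values at distance at least
  e are attained on the compact set \<open>K\<close>. So |f - c| has a maximum on \<open>M\<close>,
  f is constant by the maximum principle, and this contradicts the values close to \<open>c\<close>.
  The symmetries enter only through equal values of f, so the lemma serves the modular group and the
  lattice alike.\<close>

lemma constant_if_compact_mod_symmetry:
  fixes f :: "complex \<Rightarrow> complex"
  assumes hol: "f holomorphic_on M" and M: "open M" "connected M"
    and red: "\<And>e. e > 0 \<Longrightarrow> \<exists>K. compact K \<and> K \<subseteq> M \<and> (\<forall>z\<in>M. \<exists>w\<in>M. f w = f z \<and> (w \<in> K \<or> dist (f w) c < e))"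
    and lim: "\<And>e. e > 0 \<Longrightarrow> \<exists>z\<in>M. dist (f z) c < e"
    and z: "z \<in> M"
  shows "f z = c"
proof (rule ccontr)
  assume ne: "f z \<noteq> c"
  define e where "e = dist (f z) c"
  have e: "e > 0" using ne by (simp add: e_def)
  obtain K where K: "compact K" "K \<subseteq> M" "\<And>z. z \<in> M \<Longrightarrow> \<exists>w\<in>M. f w = f z \<and> (w \<in> K \<or> dist (f w) c < e)"
    using red[OF e] by blast
  have zK: "\<exists>w\<in>K. f w = f z" using K(3)[OF z] by (auto simp: e_def)
  have "continuous_on K (\<lambda>w. dist (f w) c)"
    using hol K(2) by (intro continuous_intros holomorphic_on_imp_continuous_on) (rule holomorphic_on_subset)
  then obtain m where m: "m \<in> K" "\<And>w. w \<in> K \<Longrightarrow> dist (f w) c \<le> dist (f m) c"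
    using continuous_attains_sup[OF K(1)] zK by blast
  have em: "e \<le> dist (f m) c" using zK m(2) by (metis e_def)
  have max: "cmod (f w - c) \<le> cmod (f m - c)" if "w \<in> M" for w
    using K(3)[OF that] m(2) em by (force simp: dist_norm)
  have "(\<lambda>w. f w - c) constant_on M"
  proof (rule maximum_modulus_principle)
    show "m \<in> M" using m(1) K(2) by blast
  qed (use hol M max in \<open>auto intro!: holomorphic_intros\<close>)
  then obtain d where d: "\<And>w. w \<in> M \<Longrightarrow> f w - c = d" unfolding constant_on_def by blast
  have "e = cmod d" using d[OF z] by (simp add: e_def dist_norm)
  moreover obtain w where "w \<in> M" "dist (f w) c < e" using lim[OF e] by blast
  then have "cmod d < e" using d by (simp add: dist_norm)
  ultimately show False by simp
qed

lemma modular_function_constant: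
  assumes hol: "f holomorphic_on upper_half_plane"
    and inv: "\<And>\<gamma> \<tau>. \<gamma> \<in> modular_commutator \<Longrightarrow> \<tau> \<in> upper_half_plane \<Longrightarrow> f (moebius \<gamma> \<tau>) = f \<tau>"
    and lim: "(f \<longlongrightarrow> c) at_cusp"
    and "\<tau> \<in> upper_half_plane"
  shows "f \<tau> = c"
proof (rule constant_if_compact_mod_symmetry[OF hol open_upper_half_plane connected_upper_half_plane _ _ assms(4)])
  fix e :: real assume "e > 0"
  then obtain Y where Y: "\<And>\<tau>. Im \<tau> > Y \<Longrightarrow> dist (f \<tau>) c < e"
    using lim by (auto simp: tendsto_iff eventually_at_cusp)
  show "\<exists>K. compact K \<and> K \<subseteq> upper_half_plane \<and>
      (\<forall>z\<in>upper_half_plane. \<exists>w\<in>upper_half_plane. f w = f z \<and> (w \<in> K \<or> dist (f w) c < e))"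
  proof (intro exI conjI ballI)
    show "compact (fundamental_box Y)" "fundamental_box Y \<subseteq> upper_half_plane"
      by (rule compact_fundamental_box fundamental_box_subset)+
    fix z assume z: "z \<in> upper_half_plane"
    obtain \<gamma> where g: "\<gamma> \<in> modular_commutator" "moebius \<gamma> z \<in> fundamental_box Y \<or> Im (moebius \<gamma> z) > Y"
      by (rule modular_commutator_reduce_box[OF z])
    show "\<exists>w\<in>upper_half_plane. f w = f z \<and> (w \<in> fundamental_box Y \<or> dist (f w) c < e)"
      using g z inv[OF g(1) z] Y[of "moebius \<gamma> z"]
      by (intro bexI[of _ "moebius \<gamma> z"]) (auto intro: moebius_in modular_commutator_in_SL2Z)
  qed
  show "\<exists>z\<in>upper_half_plane. dist (f z) c < e"
    using Y[of "\<i> * of_real (max 1 (Y + 1))"]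
    by (intro bexI[of _ "\<i> * of_real (max 1 (Y + 1))"]) (auto simp: upper_half_plane_def)
qed

text \<open>Comparing the orders of vanishing \<open>2 (n - 1)\<close> and \<open>3 n\<close>.\<close>

lemma no_zero_of_square_deriv_eq_cube:
  fixes f :: "complex \<Rightarrow> complex"
  assumes hol: "f holomorphic_on M" and M: "open M" "connected M"
    and k: "k holomorphic_on M"
    and ode: "\<And>z. z \<in> M \<Longrightarrow> (deriv f z)\<^sup>2 = k z * f z ^ 3"
    and nonzero: "\<exists>z\<in>M. f z \<noteq> 0" and z: "z \<in> M"
  shows "f z \<noteq> 0"
proof
  assume z0: "f z = 0"
  have "\<not> f constant_on M" using nonzero z z0 unfolding constant_on_def by metis
  then obtain g r n where n: "0 < n" and r: "0 < r" "ball z r \<subseteq> M"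
    and g: "g holomorphic_on ball z r" "\<And>w. w \<in> ball z r \<Longrightarrow> f w = (w - z)^n * g w"
      "\<And>w. w \<in> ball z r \<Longrightarrow> g w \<noteq> 0"
    using holomorphic_factor_zero_nonconstant[OF hol M z z0] by metis
  have d: "deriv f w = (w - z) ^ (n - 1) * (of_nat n * g w + (w - z) * deriv g w)" if w: "w \<in> ball z r" for w
  proof -
    have "(g has_field_derivative deriv g w) (at w)"
      using g(1) w by (simp add: holomorphic_derivI)
    then have "((\<lambda>w. (w - z)^n * g w) has_field_derivative
        (of_nat n * (w - z) ^ (n - 1)) * g w + deriv g w * (w - z) ^ n) (at w)"
      by (auto intro!: derivative_eq_intros)
    then have "(f has_field_derivative (of_nat n * (w - z) ^ (n - 1)) * g w + deriv g w * (w - z) ^ n) (at w)"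
      by (rule has_field_derivative_transform_within_open[OF _ open_ball w]) (simp add: g)
    moreover have "(w - z) ^ n = (w - z) ^ (n - 1) * (w - z)" using n by (metis power_minus_mult)
    ultimately show ?thesis by (simp add: DERIV_imp_deriv algebra_simps)
  qed
  have eq: "(of_nat n * g w + (w - z) * deriv g w)\<^sup>2 = k w * (w - z) ^ (n + 2) * g w ^ 3" if w: "w \<in> ball z r - {z}" for w
  proof -
    have nz: "(w - z) ^ (2 * (n - 1)) \<noteq> 0" using w by simp
    have "3 * n = 2 * (n - 1) + (n + 2)" using n by simp
    then have p: "((w - z) ^ n) ^ 3 = (w - z) ^ (2 * (n - 1)) * (w - z) ^ (n + 2)"
      by (metis power_add power_mult mult.commute)
    have "((w - z) ^ (n - 1))\<^sup>2 = (w - z) ^ (2 * (n - 1))" by (simp flip: power_mult add: mult.commute)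
    then have "(w - z) ^ (2 * (n - 1)) * (of_nat n * g w + (w - z) * deriv g w)\<^sup>2 =
       (w - z) ^ (2 * (n - 1)) * (k w * (w - z) ^ (n + 2) * g w ^ 3)"
      using ode[of w] d[of w] g(2)[of w] w r p by (auto simp: power_mult_distrib mult_ac)
    with nz show ?thesis by (metis mult_left_cancel)
  qed
  have cont: "isCont g z" "isCont (deriv g) z" "isCont k z"
    using g(1) r k M z by (auto intro!: holomorphic_on_imp_differentiable_at[THEN field_differentiable_imp_continuous_at] holomorphic_deriv)
  have l1: "((\<lambda>w. (of_nat n * g w + (w - z) * deriv g w)\<^sup>2) \<longlongrightarrow> (of_nat n * g z + (z - z) * deriv g z)\<^sup>2) (at z)"
    using cont by (intro tendsto_intros) (auto simp: isCont_def)
  have l2: "((\<lambda>w. k w * (w - z) ^ (n + 2) * g w ^ 3) \<longlongrightarrow> k z * (z - z) ^ (n + 2) * g z ^ 3) (at z)"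
    using cont by (intro tendsto_intros) (auto simp: isCont_def)
  have ev: "\<forall>\<^sub>F w in at z. (of_nat n * g w + (w - z) * deriv g w)\<^sup>2 = k w * (w - z) ^ (n + 2) * g w ^ 3"
    using eventually_at_ball'[OF r(1), of z] by eventually_elim (use eq in auto)
  \<comment> \<open>Both sides of \<open>eq\<close> extend continuously to z. There the right side
    vanishes, whereas the left side is the square of n g(z).\<close>
  have "(of_nat n * g z + (z - z) * deriv g z)\<^sup>2 = k z * (z - z) ^ (n + 2) * g z ^ 3"
    by (rule LIM_unique[OF Lim_transform_eventually[OF l1 ev] l2])
  then show False using g(3)[of z] n r by simp
qed

section \<open>Expansions at the cusp\<close>

lemma periodic_of_int:
  assumes "\<And>\<tau>. Im \<tau> > 0 \<Longrightarrow> f (\<tau> + of_real p) = (f \<tau> :: 'a)" "Im \<tau> > 0"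
  shows "f (\<tau> + of_int k * of_real p) = f \<tau>"
proof (induction k rule: int_induct[where k = 0])
  case (step1 i)
  then show ?case using assms(1)[of "\<tau> + of_int i * of_real p"] assms(2) by (simp add: algebra_simps)
next
  case (step2 i)
  then show ?case using assms(1)[of "\<tau> + of_int (i - 1) * of_real p"] assms(2) by (simp add: algebra_simps)
qed simp

text \<open>The usual parameter q for functions of period \<open>p\<close>. Period 6 gives the local
  parameter at the cusp, period 1 its sixth power, in which the functions invariant under \<tau> + 1
  expand.\<close>

definition cusp_coord :: "real \<Rightarrow> complex \<Rightarrow> complex" where
  "cusp_coord p \<tau> = exp (2 * of_real pi * \<i> * \<tau> / of_real p)"

lemma norm_cusp_coord: "cmod (cusp_coord p \<tau>) = exp (- (2 * pi * Im \<tau> / p))"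
  by (simp add: cusp_coord_def Re_divide_of_real)

lemma cusp_coord_nonzero [simp]: "cusp_coord p \<tau> \<noteq> 0"
  by (simp add: cusp_coord_def)

lemma cusp_coord_in_ball: "p > 0 \<Longrightarrow> Im \<tau> > 0 \<Longrightarrow> cusp_coord p \<tau> \<in> ball 0 1 - {0}"
  by (simp add: norm_cusp_coord)

lemma cusp_coord_has_derivative [derivative_intros]:
  "p \<noteq> 0 \<Longrightarrow> (cusp_coord p has_field_derivative (2 * of_real pi * \<i> / of_real p * cusp_coord p \<tau>)) (at \<tau> within A)"
  unfolding cusp_coord_def by (auto intro!: derivative_eq_intros)

lemma cusp_coord_tendsto: "p > 0 \<Longrightarrow> (cusp_coord p \<longlongrightarrow> 0) at_cusp"
proof -
  assume p: "p > 0"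
  have "((\<lambda>y. exp (- (2 * pi * y / p))) \<longlongrightarrow> 0) at_top"
    using p by real_asymp
  then have "((\<lambda>\<tau>. cmod (cusp_coord p \<tau>)) \<longlongrightarrow> 0) at_cusp"
    unfolding norm_cusp_coord at_cusp_def by (rule filterlim_compose[OF _ filterlim_filtercomap])
  then show ?thesis by (simp add: tendsto_norm_zero_iff)
qed

lemma cusp_coord_surj:
  assumes "p > 0" "q \<in> ball 0 1 - {0}"
  obtains \<tau> where "Im \<tau> > 0" "cusp_coord p \<tau> = q" "Im \<tau> = - p * ln (cmod q) / (2 * pi)"
proof -
  define \<tau> where "\<tau> = of_real p * Ln q / (2 * of_real pi * \<i>)"
  have im: "Im \<tau> = - p * ln (cmod q) / (2 * pi)"
    using assms(2) by (simp add: \<tau>_def Im_divide power2_eq_square)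
  moreover have "ln (cmod q) < 0" using assms(2) by auto
  then have "Im \<tau> > 0" unfolding im using assms(1) by (simp add: mult_pos_neg divide_neg_pos)
  moreover have "cusp_coord p \<tau> = q"
    using assms by (simp add: cusp_coord_def \<tau>_def)
  ultimately show ?thesis using that by blast
qed

text \<open>\<open>h\<close> evaluates f at an arbitrarily chosen preimage of q; periodicity makes
  this independent of the choice, and a local branch of the logarithm gives holomorphy.\<close>

lemma periodic_expansion:
  assumes p: "p > 0" and hol: "f holomorphic_on upper_half_plane"
    and per: "\<And>\<tau>. Im \<tau> > 0 \<Longrightarrow> f (\<tau> + of_real p) = f \<tau>"
  obtains h where "h holomorphic_on ball 0 1 - {0}" "\<And>\<tau>. Im \<tau> > 0 \<Longrightarrow> f \<tau> = h (cusp_coord p \<tau>)"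
proof -
  define h where "h q = f (SOME \<tau>. Im \<tau> > 0 \<and> cusp_coord p \<tau> = q)" for q
  have h: "f \<tau> = h (cusp_coord p \<tau>)" if t: "Im \<tau> > 0" for \<tau>
  proof -
    define \<sigma> where "\<sigma> = (SOME \<sigma>. Im \<sigma> > 0 \<and> cusp_coord p \<sigma> = cusp_coord p \<tau>)"
    have s: "Im \<sigma> > 0" "cusp_coord p \<sigma> = cusp_coord p \<tau>"
      using someI[of "\<lambda>\<sigma>. Im \<sigma> > 0 \<and> cusp_coord p \<sigma> = cusp_coord p \<tau>" \<tau>] t by (auto simp: \<sigma>_def)
    then obtain n :: int where "2 * of_real pi * \<i> * \<sigma> / of_real p = 2 * of_real pi * \<i> * \<tau> / of_real p + (of_int (2 * n) * pi) * \<i>"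
      unfolding cusp_coord_def exp_eq by auto
    then have "2 * of_real pi * \<i> * \<sigma> = 2 * of_real pi * \<i> * (\<tau> + of_int n * of_real p)" using p by (simp add: field_simps)
    then have "\<sigma> = \<tau> + of_int n * of_real p" by simp
    then have "f \<sigma> = f \<tau>" using periodic_of_int[of f p \<tau> n] per t by simp
    then show ?thesis by (simp add: h_def \<sigma>_def)
  qed
  have "h field_differentiable (at q)" if q: "q \<in> ball 0 1 - {0}" for q
  proof -
    \<comment> \<open>A local right inverse of \<open>cusp_coord p\<close>. Splitting off Ln q keeps
      the variable argument of Ln near 1, away from the branch cut, wherever q lies.\<close>
    define g where "g w = of_real p * (Ln (w / q) + Ln q) / (2 * of_real pi * \<i>)" for w
    have nz: "q \<noteq> 0" using q by auto
    have cg: "cusp_coord p (g w) = w" if "w \<noteq> 0" for w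
      using that nz p by (simp add: cusp_coord_def g_def exp_add)
    have gq: "g field_differentiable (at q)"
    proof -
      have "((\<lambda>w. of_real p * (Ln (w / q) + Ln q) / (2 * of_real pi * \<i>)) has_field_derivative
         of_real p * (1 / q) / (2 * of_real pi * \<i>)) (at q)"
        using nz by (auto intro!: derivative_eq_intros)
      then show ?thesis unfolding g_def[abs_def] field_differentiable_def by blast
    qed
    have "Im (g q) > 0"
    proof -
      have "cmod q < 1" using q by simp
      then have "exp (- (2 * pi * Im (g q) / p)) < exp 0" using cg[OF nz] norm_cusp_coord[of p "g q"] by simp
      then have "2 * pi * Im (g q) / p > 0" by (simp only: exp_less_cancel_iff neg_less_0_iff_less)
      then show ?thesis using p by (simp add: zero_less_mult_iff zero_less_divide_iff)
    qed
    then have fg: "(f \<circ> g) field_differentiable (at q)"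
      using hol open_upper_half_plane gq
      by (intro field_differentiable_compose) (auto simp: upper_half_plane_def intro: holomorphic_on_imp_differentiable_at)
    have "\<forall>\<^sub>F w in nhds q. Im (g w) > 0 \<and> w \<noteq> 0"
    proof (intro eventually_conj)
      have "isCont g q" using gq by (rule field_differentiable_imp_continuous_at)
      then have "(g \<longlongrightarrow> g q) (nhds q)" by (simp add: tendsto_at_iff_tendsto_nhds isCont_def)
      then show "\<forall>\<^sub>F w in nhds q. Im (g w) > 0"
        using order_tendstoD(1)[OF tendsto_Im \<open>Im (g q) > 0\<close>] by blast
      show "\<forall>\<^sub>F w in nhds q. w \<noteq> 0" using nz by (rule t1_space_nhds)
    qed
    then have "\<forall>\<^sub>F w in nhds q. (f \<circ> g) w = h w"
      by eventually_elim (use h cg in auto)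
    with fg show ?thesis
      unfolding field_differentiable_def using DERIV_cong_ev[OF refl _ refl] by blast
  qed
  then have "h holomorphic_on ball 0 1 - {0}"
    unfolding holomorphic_on_def using field_differentiable_at_within by blast
  with h that show ?thesis by blast
qed

lemma periodic_expansion_limit:
  fixes f h :: "complex \<Rightarrow> complex"
  assumes p: "p > 0" and "\<And>\<tau>. Im \<tau> > 0 \<Longrightarrow> f \<tau> = h (cusp_coord p \<tau>)"
    and "(f \<longlongrightarrow> c) at_cusp"
  shows "(h \<longlongrightarrow> c) (at 0)"
proof (rule tendstoI)
  fix e :: real assume "e > 0"
  then obtain Y where Y: "\<And>\<tau>. Im \<tau> > Y \<Longrightarrow> dist (f \<tau>) c < e"
    using assms(3) by (auto simp: tendsto_iff eventually_at_cusp)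
  define r where "r = min 1 (exp (- (2 * pi * Y / p)))"
  have "dist (h q) c < e" if q: "q \<noteq> 0" "cmod q < r" for q
  proof -
    obtain \<tau> where t: "Im \<tau> > 0" "cusp_coord p \<tau> = q"
    proof (rule cusp_coord_surj[OF p, of q])
      show "q \<in> ball 0 1 - {0}" using q by (simp add: r_def)
    qed
    have "exp (- (2 * pi * Im \<tau> / p)) < exp (- (2 * pi * Y / p))"
      using q(2) t(2) norm_cusp_coord[of p \<tau>] by (simp add: r_def)
    then have "2 * pi * Y / p < 2 * pi * Im \<tau> / p" by (simp only: exp_less_cancel_iff neg_less_iff_less)
    then have "Im \<tau> > Y" using p by (simp add: divide_less_cancel)
    then show ?thesis using Y assms(2)[OF t(1)] t(2) by metis
  qed
  moreover have "r > 0" by (simp add: r_def)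
  ultimately show "\<forall>\<^sub>F q in at 0. dist (h q) c < e"
    unfolding eventually_at by (intro exI[of _ r]) auto
qed

lemma periodic_expansion_extended:
  assumes p: "p > 0" and hol: "f holomorphic_on upper_half_plane"
    and per: "\<And>\<tau>. Im \<tau> > 0 \<Longrightarrow> f (\<tau> + of_real p) = f \<tau>"
    and lim: "(f \<longlongrightarrow> c) at_cusp"
  obtains h where "h holomorphic_on ball 0 1" "h 0 = c" "\<And>\<tau>. Im \<tau> > 0 \<Longrightarrow> f \<tau> = h (cusp_coord p \<tau>)"
proof -
  obtain h where h: "h holomorphic_on ball 0 1 - {0}" "\<And>\<tau>. Im \<tau> > 0 \<Longrightarrow> f \<tau> = h (cusp_coord p \<tau>)"
    using periodic_expansion[OF p hol per] by blast
  have "(h \<longlongrightarrow> c) (at 0)" by (rule periodic_expansion_limit[OF p h(2) lim])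
  then have "(\<lambda>q. if q = 0 then c else h q) holomorphic_on ball 0 1"
    by (intro removable_singularity h) auto
  then show ?thesis by (rule that) (auto simp: h(2))
qed

lemma tendsto_cusp_coord_compose:
  assumes "p > 0" "h holomorphic_on ball 0 1"
  shows "((\<lambda>\<tau>. h (cusp_coord p \<tau>)) \<longlongrightarrow> h 0) at_cusp"
proof -
  have "isCont h 0"
    using assms(2) by (intro field_differentiable_imp_continuous_at holomorphic_on_imp_differentiable_at[of _ "ball 0 1"]) auto
  then show ?thesis using cusp_coord_tendsto[OF assms(1)] by (rule isCont_tendsto_compose)
qed

section \<open>The form \<open>\<eta>\<^sup>2\<close> of weight one\<close>

abbreviation "eta_rate \<equiv> 2 * of_real pi * \<i> / 12 :: complex"

lemma eta_log_deriv_tendsto: "(eta_log_deriv \<longlongrightarrow> eta_rate) at_cusp"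
proof -
  have "((\<lambda>y. pi / (6 * y\<^sup>2)) \<longlongrightarrow> 0) at_top" by real_asymp
  then have "((\<lambda>\<tau>. pi / (6 * (Im \<tau>)\<^sup>2)) \<longlongrightarrow> 0) at_cusp"
    unfolding at_cusp_def by (rule filterlim_compose[OF _ filterlim_filtercomap])
  moreover have "\<forall>\<^sub>F \<tau> in at_cusp. cmod (eta_log_deriv \<tau> - eta_rate) \<le> pi / (6 * (Im \<tau>)\<^sup>2)"
    unfolding eventually_at_cusp using eta_log_deriv_bound by blast
  ultimately have "((\<lambda>\<tau>. eta_log_deriv \<tau> - eta_rate) \<longlongrightarrow> 0) at_cusp"
    by (rule Lim_null_comparison[rotated])
  then show ?thesis by (simp add: LIM_zero_iff)
qed

text \<open>\<open>A\<close> is the logarithmic derivative as a function of q, and \<open>v\<close>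
  integrates the part of it that vanishes at the cusp. So eta_rate \<tau> + v(q) is a primitive, and
  its exponential takes the place of the infinite product for the square of eta.\<close>

lemma eta_expansions:
  obtains A v where "A holomorphic_on ball 0 1" "v holomorphic_on ball 0 1" "A 0 = eta_rate"
    "\<And>\<tau>. Im \<tau> > 0 \<Longrightarrow> eta_log_deriv \<tau> = A (cusp_coord 1 \<tau>)"
    "\<And>q. q \<in> ball 0 1 \<Longrightarrow> A q = eta_rate + 2 * of_real pi * \<i> * q * deriv v q"
proof -
  obtain A where A: "A holomorphic_on ball 0 1" "A 0 = eta_rate"
    "\<And>\<tau>. Im \<tau> > 0 \<Longrightarrow> eta_log_deriv \<tau> = A (cusp_coord 1 \<tau>)"
    by (rule periodic_expansion_extended[OF _ eta_log_deriv_holomorphic _ eta_log_deriv_tendsto, of 1])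
      (auto simp: eta_log_deriv_plus_1)
  define u where "u q = (if q = 0 then deriv A 0 else (A q - A 0) / (q - 0)) / (2 * of_real pi * \<i>)" for q
  have "(\<lambda>q. if q = 0 then deriv A 0 else (A q - A 0) / (q - 0)) holomorphic_on ball 0 1"
    using pole_lemma_open[OF A(1) open_ball, of 0] by simp
  then have "u holomorphic_on ball 0 1" unfolding u_def[abs_def] by (intro holomorphic_intros) auto
  then obtain v where v: "\<And>q. q \<in> ball 0 1 \<Longrightarrow> (v has_field_derivative u q) (at q within ball 0 1)"
    using holomorphic_convex_primitive'[of "ball 0 1" u] by auto
  then have v': "(v has_field_derivative u q) (at q)" if "q \<in> ball 0 1" for q
    using v[OF that] that by (simp add: at_within_open[OF that])
  have "v holomorphic_on ball 0 1" using v' by (meson holomorphic_on_open open_ball)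
  moreover have "A q = eta_rate + 2 * of_real pi * \<i> * q * deriv v q" if "q \<in> ball 0 1" for q
    unfolding DERIV_imp_deriv[OF v'[OF that]] by (simp add: u_def A(2))
  ultimately show ?thesis using that A by blast
qed

definition eta_expansion_spec :: "(complex \<Rightarrow> complex) \<times> (complex \<Rightarrow> complex) \<Rightarrow> bool" where
  "eta_expansion_spec p \<longleftrightarrow> fst p holomorphic_on ball 0 1 \<and> snd p holomorphic_on ball 0 1 \<and> fst p 0 = eta_rate \<and>
    (\<forall>\<tau>. Im \<tau> > 0 \<longrightarrow> eta_log_deriv \<tau> = fst p (cusp_coord 1 \<tau>)) \<and>
    (\<forall>q\<in>ball 0 1. fst p q = eta_rate + 2 * of_real pi * \<i> * q * deriv (snd p) q)"

definition eta_A :: "complex \<Rightarrow> complex" where "eta_A = fst (SOME p. eta_expansion_spec p)"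
definition eta_v :: "complex \<Rightarrow> complex" where "eta_v = snd (SOME p. eta_expansion_spec p)"

lemma eta_A_v: "eta_expansion_spec (eta_A, eta_v)"
proof -
  obtain A v where "A holomorphic_on ball 0 1" "v holomorphic_on ball 0 1" "A 0 = eta_rate"
    "\<And>\<tau>. Im \<tau> > 0 \<Longrightarrow> eta_log_deriv \<tau> = A (cusp_coord 1 \<tau>)"
    "\<And>q. q \<in> ball 0 1 \<Longrightarrow> A q = eta_rate + 2 * of_real pi * \<i> * q * deriv v q"
    using eta_expansions by metis
  then have "eta_expansion_spec (A, v)"
    unfolding eta_expansion_spec_def fst_conv snd_conv by blast
  then have "eta_expansion_spec (SOME p. eta_expansion_spec p)" by (rule someI)
  then show ?thesis by (simp add: eta_A_def eta_v_def)
qed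

lemma eta_A_holomorphic: "eta_A holomorphic_on ball 0 1"
  and eta_v_holomorphic: "eta_v holomorphic_on ball 0 1"
  and eta_A_0: "eta_A 0 = eta_rate"
  and eta_log_deriv_eq: "Im \<tau> > 0 \<Longrightarrow> eta_log_deriv \<tau> = eta_A (cusp_coord 1 \<tau>)"
  and eta_A_eq: "q \<in> ball 0 1 \<Longrightarrow> eta_A q = eta_rate + 2 * of_real pi * \<i> * q * deriv eta_v q"
  using eta_A_v by (auto simp: eta_expansion_spec_def)

text \<open>A global logarithm of \<open>eta_sq\<close>; it serves later as the argument of a
  one-parameter subgroup in the factorisation of the frame.\<close>

definition eta_sq_log :: "complex \<Rightarrow> complex" where
  "eta_sq_log \<tau> = eta_rate * \<tau> + eta_v (cusp_coord 1 \<tau>)"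

definition eta_sq :: "complex \<Rightarrow> complex" where
  "eta_sq \<tau> = exp (eta_sq_log \<tau>)"

lemma eta_sq_nonzero [simp]: "eta_sq \<tau> \<noteq> 0" by (simp add: eta_sq_def)

lemma eta_sq_has_derivative:
  assumes "Im \<tau> > 0"
  shows "(eta_sq has_field_derivative eta_log_deriv \<tau> * eta_sq \<tau>) (at \<tau>)"
proof -
  have q: "cusp_coord 1 \<tau> \<in> ball 0 1" using cusp_coord_in_ball[of 1 \<tau>] assms by auto
  have "(eta_v has_field_derivative deriv eta_v (cusp_coord 1 \<tau>)) (at (cusp_coord 1 \<tau>))"
    using eta_v_holomorphic q by (simp add: holomorphic_derivI)
  then have "((\<lambda>\<tau>. eta_v (cusp_coord 1 \<tau>)) has_field_derivative
      deriv eta_v (cusp_coord 1 \<tau>) * (2 * of_real pi * \<i> / of_real 1 * cusp_coord 1 \<tau>)) (at \<tau>)"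
    by (rule DERIV_chain2) (rule cusp_coord_has_derivative, simp)
  then have "(eta_sq has_field_derivative exp (eta_sq_log \<tau>) *
     (eta_rate + deriv eta_v (cusp_coord 1 \<tau>) * (2 * of_real pi * \<i> / of_real 1 * cusp_coord 1 \<tau>))) (at \<tau>)"
    unfolding eta_sq_def[abs_def] eta_sq_log_def by (auto intro!: derivative_eq_intros)
  moreover have "eta_rate + deriv eta_v (cusp_coord 1 \<tau>) * (2 * of_real pi * \<i> / of_real 1 * cusp_coord 1 \<tau>) = eta_log_deriv \<tau>"
    unfolding eta_log_deriv_eq[OF assms] eta_A_eq[OF q] by simp
  ultimately show ?thesis by (simp add: eta_sq_def mult.commute)
qed

lemma eta_sq_holomorphic: "eta_sq holomorphic_on upper_half_plane"
  using eta_sq_has_derivative open_upper_half_plane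
  by (auto simp: holomorphic_on_open upper_half_plane_def)

lemma cusp_coord_plus: "cusp_coord p (\<tau> + \<sigma>) = cusp_coord p \<tau> * cusp_coord p \<sigma>"
  by (simp add: cusp_coord_def distrib_left add_divide_distrib exp_add)

lemma cusp_coord_period: "p \<noteq> 0 \<Longrightarrow> cusp_coord p (of_real p * of_int k) = 1"
  using exp_integer_2pi[of "of_int k"] by (simp add: cusp_coord_def mult_ac)

lemma eta_sq_plus_int: "eta_sq (\<tau> + of_int k) = exp (eta_rate * of_int k) * eta_sq \<tau>"
  using cusp_coord_period[of 1 k] by (simp add: eta_sq_def eta_sq_log_def cusp_coord_plus distrib_left exp_add)

text \<open>By the law for the logarithmic derivative the quotient of the two sides has derivative
  0. The constant is read off at the fixed point i of S.\<close>

lemma eta_sq_S: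
  assumes "\<tau> \<in> upper_half_plane"
  shows "eta_sq (- (1 / \<tau>)) = - \<i> * (\<tau> * eta_sq \<tau>)"
proof -
  let ?f = "\<lambda>\<tau>. eta_sq (- (1 / \<tau>)) / (\<tau> * eta_sq \<tau>)"
  have S: "- (1 / \<tau>) \<in> upper_half_plane" if "\<tau> \<in> upper_half_plane" for \<tau>
    using moebius_in[OF matS_in that] by simp
  have d: "(?f has_field_derivative 0) (at \<tau>)" if t: "\<tau> \<in> upper_half_plane" for \<tau>
  proof -
    have [simp]: "\<tau> \<noteq> 0" using t by (auto simp: upper_half_plane_def)
    have "((\<lambda>\<tau>. - (1 / \<tau>)) has_field_derivative 1 / \<tau>\<^sup>2) (at \<tau>)"
      by (auto intro!: derivative_eq_intros simp: power2_eq_square)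
    from DERIV_chain2[OF eta_sq_has_derivative this]
    have 1: "((\<lambda>\<tau>. eta_sq (- (1 / \<tau>))) has_field_derivative
        (\<tau>\<^sup>2 * eta_log_deriv \<tau> + \<tau>) * eta_sq (- (1 / \<tau>)) * (1 / \<tau>\<^sup>2)) (at \<tau>)"
      using S[OF t] eta_log_deriv_S[OF t] by (simp add: upper_half_plane_def)
    have 2: "((\<lambda>\<tau>. \<tau> * eta_sq \<tau>) has_field_derivative (1 * eta_sq \<tau> + (eta_log_deriv \<tau> * eta_sq \<tau>) * \<tau>)) (at \<tau>)"
      using eta_sq_has_derivative[of \<tau>] t by (intro DERIV_mult DERIV_ident) (simp add: upper_half_plane_def)
    have "(?f has_field_derivative ((\<tau>\<^sup>2 * eta_log_deriv \<tau> + \<tau>) * eta_sq (- (1 / \<tau>)) * (1 / \<tau>\<^sup>2) * (\<tau> * eta_sq \<tau>) -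
        eta_sq (- (1 / \<tau>)) * (1 * eta_sq \<tau> + (eta_log_deriv \<tau> * eta_sq \<tau>) * \<tau>)) / ((\<tau> * eta_sq \<tau>) * (\<tau> * eta_sq \<tau>))) (at \<tau>)"
      by (rule DERIV_divide[OF 1 2]) simp
    moreover have "(\<tau>\<^sup>2 * eta_log_deriv \<tau> + \<tau>) * eta_sq (- (1 / \<tau>)) * (1 / \<tau>\<^sup>2) * (\<tau> * eta_sq \<tau>) -
        eta_sq (- (1 / \<tau>)) * (1 * eta_sq \<tau> + (eta_log_deriv \<tau> * eta_sq \<tau>) * \<tau>) = 0"
      by (simp add: field_simps power2_eq_square)
    ultimately show ?thesis by simp
  qed
  obtain c where c: "\<And>\<tau>. \<tau> \<in> upper_half_plane \<Longrightarrow> ?f \<tau> = c"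
    using has_field_derivative_zero_constant[OF convex_upper_half_plane, of ?f] d
    by (meson has_field_derivative_at_within)
  have i: "\<i> \<in> upper_half_plane" by (simp add: upper_half_plane_def)
  have "c = - \<i>" using c[OF i] by simp
  then have "eta_sq (- (1 / \<tau>)) / (\<tau> * eta_sq \<tau>) = - \<i>" using c[OF assms] by simp
  moreover have "\<tau> * eta_sq \<tau> \<noteq> 0" using assms by (auto simp: upper_half_plane_def)
  ultimately show ?thesis by (metis nonzero_divide_eq_eq)
qed

lemma eta_sq_transform:
  assumes "g \<in> carrier SL2Z"
  obtains m where "m \<noteq> 0" "\<And>\<tau>. \<tau> \<in> upper_half_plane \<Longrightarrow> eta_sq (moebius g \<tau>) = m * (automorphy g \<tau> * eta_sq \<tau>)"
proof -
  have "\<exists>m. m \<noteq> 0 \<and> (\<forall>\<tau>\<in>upper_half_plane. eta_sq (moebius g \<tau>) = m * (automorphy g \<tau> * eta_sq \<tau>))"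
    using assms
  proof (induction rule: SL2Z_induct)
    case S then show ?case using eta_sq_S by (intro exI[of _ "- \<i>"]) simp
  next
    case (T k) then show ?case using eta_sq_plus_int by (intro exI[of _ "exp (eta_rate * of_int k)"]) simp
  next
    case (mult g h)
    then obtain m m' where
      "m \<noteq> 0" "\<And>\<tau>. \<tau> \<in> upper_half_plane \<Longrightarrow> eta_sq (moebius g \<tau>) = m * (automorphy g \<tau> * eta_sq \<tau>)"
      "m' \<noteq> 0" "\<And>\<tau>. \<tau> \<in> upper_half_plane \<Longrightarrow> eta_sq (moebius h \<tau>) = m' * (automorphy h \<tau> * eta_sq \<tau>)" by blast
    with mult.hyps show ?case
      by (intro exI[of _ "m * m'"]) (auto simp: moebius_mult automorphy_mult moebius_in)
  qed
  then show ?thesis using that by blast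
qed

text \<open>The multiplier is a character, so it is trivial on commutators.\<close>

lemma eta_sq_modular:
  assumes "\<gamma> \<in> modular_commutator" "\<tau> \<in> upper_half_plane"
  shows "eta_sq (moebius \<gamma> \<tau>) = automorphy \<gamma> \<tau> * eta_sq \<tau>"
proof -
  define good where "good g \<longleftrightarrow> g \<in> carrier SL2Z \<and> (\<forall>\<tau>\<in>upper_half_plane. eta_sq (moebius g \<tau>) = automorphy g \<tau> * eta_sq \<tau>)"
    for g :: "int ^ 2 ^ 2"
  have good_mult: "good (g ** h)" if "good g" "good h" for g h
    using that by (auto simp: good_def moebius_mult automorphy_mult moebius_in SL2Z_mult_in)
  have good_inv: "good (inv\<^bsub>SL2Z\<^esub> g)" if "good g" for g
  proof -
    let ?i = "inv\<^bsub>SL2Z\<^esub> g"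
    have g: "g \<in> carrier SL2Z" "?i \<in> carrier SL2Z" using that by (auto simp: good_def)
    have "eta_sq (moebius ?i \<tau>) = automorphy ?i \<tau> * eta_sq \<tau>" if t: "\<tau> \<in> upper_half_plane" for \<tau>
    proof -
      have "g ** ?i = mat 1" using SL2Z.r_inv[OF g(1)] by (simp add: SL2_simps)
      then have 1: "automorphy g (moebius ?i \<tau>) * automorphy ?i \<tau> = 1"
        using automorphy_mult[OF g(2) t, of g] by simp
      have 2: "eta_sq \<tau> = automorphy g (moebius ?i \<tau>) * eta_sq (moebius ?i \<tau>)"
        using \<open>good g\<close> moebius_in[OF g(2) t] moebius_inv(2)[OF g(1) t] unfolding good_def by metis
      have "automorphy ?i \<tau> * eta_sq \<tau> = (automorphy g (moebius ?i \<tau>) * automorphy ?i \<tau>) * eta_sq (moebius ?i \<tau>)"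
        by (subst 2) (simp only: mult_ac)
      then show ?thesis unfolding 1 by simp
    qed
    then show ?thesis using g by (simp add: good_def)
  qed
  have comm: "good (g ** h ** inv\<^bsub>SL2Z\<^esub> g ** inv\<^bsub>SL2Z\<^esub> h)" if g: "g \<in> carrier SL2Z" and h: "h \<in> carrier SL2Z" for g h
  proof -
    let ?c = "g ** h ** inv\<^bsub>SL2Z\<^esub> g ** inv\<^bsub>SL2Z\<^esub> h"
    have c: "?c \<in> carrier SL2Z" using g h by (intro SL2Z_mult_in) auto
    \<comment> \<open>Both g h and h g have multiplier \<open>a * b\<close>, so the commutator
      relating them must have multiplier 1.\<close>
    have e: "?c ** (h ** g) = g ** h"
    proof -
      have "?c ** (h ** g) = g ** h ** (inv\<^bsub>SL2Z\<^esub> g ** (inv\<^bsub>SL2Z\<^esub> h ** h) ** g)"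
        by (simp only: matrix_mul_assoc)
      then show ?thesis
        using SL2Z.l_inv[OF h] SL2Z.l_inv[OF g] by (simp add: SL2_simps matrix_mul_rid)
    qed
    obtain a where a: "a \<noteq> 0" "\<And>\<tau>. \<tau> \<in> upper_half_plane \<Longrightarrow> eta_sq (moebius g \<tau>) = a * (automorphy g \<tau> * eta_sq \<tau>)"
      using eta_sq_transform[OF g] by metis
    obtain b where b: "b \<noteq> 0" "\<And>\<tau>. \<tau> \<in> upper_half_plane \<Longrightarrow> eta_sq (moebius h \<tau>) = b * (automorphy h \<tau> * eta_sq \<tau>)"
      using eta_sq_transform[OF h] by metis
    obtain x where x: "x \<noteq> 0" "\<And>\<tau>. \<tau> \<in> upper_half_plane \<Longrightarrow> eta_sq (moebius ?c \<tau>) = x * (automorphy ?c \<tau> * eta_sq \<tau>)"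
      using eta_sq_transform[OF c] by metis
    have i: "\<i> \<in> upper_half_plane" by (simp add: upper_half_plane_def)
    have hg: "h ** g \<in> carrier SL2Z" "g ** h \<in> carrier SL2Z" using g h by (auto intro: SL2Z_mult_in)
    have "eta_sq (moebius (g ** h) \<i>) = a * b * (automorphy (g ** h) \<i> * eta_sq \<i>)"
      using a b g h i by (simp add: moebius_mult automorphy_mult moebius_in)
    moreover have "eta_sq (moebius (?c ** (h ** g)) \<i>) = x * (a * b) * (automorphy (?c ** (h ** g)) \<i> * eta_sq \<i>)"
      using a b x g h c hg i by (simp add: moebius_mult[of ?c "h ** g"] automorphy_mult[of "h ** g" _ ?c] moebius_mult automorphy_mult moebius_in)
    ultimately have "x = 1" using a(1) b(1) automorphy_nonzero[OF hg(2) i] unfolding e by simp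
    then show ?thesis using c x by (simp add: good_def)
  qed
  have "\<gamma> \<in> generate SL2Z (\<Union>g\<in>carrier SL2Z. \<Union>h\<in>carrier SL2Z. {g \<otimes>\<^bsub>SL2Z\<^esub> h \<otimes>\<^bsub>SL2Z\<^esub> inv\<^bsub>SL2Z\<^esub> g \<otimes>\<^bsub>SL2Z\<^esub> inv\<^bsub>SL2Z\<^esub> h})"
    using assms(1) unfolding modular_commutator_def derived_def .
  then have "good \<gamma>"
  proof (induction rule: generate.induct)
    case one then show ?case using SL2Z.one_closed by (simp add: good_def SL2_simps)
  next
    case (incl h) then show ?case using comm by (auto simp: SL2_simps)
  next
    case (inv h) then show ?case using comm good_inv by (auto simp: SL2_simps)
  next
    case (eng h1 h2) then show ?case using good_mult by (simp add: SL2_simps)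
  qed
  then show ?thesis using assms(2) by (simp add: good_def)
qed

section \<open>The coordinate functions\<close>

lemma eta_log_deriv_modular:
  assumes g: "\<gamma> \<in> modular_commutator" and t: "\<tau> \<in> upper_half_plane"
  shows "eta_log_deriv (moebius \<gamma> \<tau>) =
    (automorphy \<gamma> \<tau>)\<^sup>2 * eta_log_deriv \<tau> + of_int (\<gamma> $ 2 $ 1) * automorphy \<gamma> \<tau>"
proof -
  note gS = modular_commutator_in_SL2Z[OF g]
  let ?j = "automorphy \<gamma> \<tau>"
  have j: "?j \<noteq> 0" by (rule automorphy_nonzero[OF gS t])
  have im: "Im \<tau> > 0" "Im (moebius \<gamma> \<tau>) > 0"
    using t moebius_in[OF gS t] by (simp_all add: upper_half_plane_def)
  have "((\<lambda>\<tau>. eta_sq (moebius \<gamma> \<tau>)) has_field_derivative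
      eta_log_deriv (moebius \<gamma> \<tau>) * eta_sq (moebius \<gamma> \<tau>) * (1 / ?j\<^sup>2)) (at \<tau>)"
    by (rule DERIV_chain2[OF eta_sq_has_derivative[OF im(2)] moebius_has_derivative[OF gS t]])
  moreover have "((\<lambda>\<tau>. automorphy \<gamma> \<tau> * eta_sq \<tau>) has_field_derivative
      of_int (\<gamma> $ 2 $ 1) * eta_sq \<tau> + (eta_log_deriv \<tau> * eta_sq \<tau>) * ?j) (at \<tau>)"
    by (intro DERIV_mult automorphy_has_derivative eta_sq_has_derivative im)
  then have "((\<lambda>\<tau>. eta_sq (moebius \<gamma> \<tau>)) has_field_derivative
      of_int (\<gamma> $ 2 $ 1) * eta_sq \<tau> + (eta_log_deriv \<tau> * eta_sq \<tau>) * ?j) (at \<tau>)"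
    by (rule has_field_derivative_transform_within_open[OF _ open_upper_half_plane t])
      (simp add: eta_sq_modular[OF g])
  ultimately have "eta_log_deriv (moebius \<gamma> \<tau>) * eta_sq (moebius \<gamma> \<tau>) * (1 / ?j\<^sup>2) =
      of_int (\<gamma> $ 2 $ 1) * eta_sq \<tau> + (eta_log_deriv \<tau> * eta_sq \<tau>) * ?j"
    by (rule DERIV_unique)
  then have "(eta_log_deriv (moebius \<gamma> \<tau>)) * (?j * eta_sq \<tau>) =
      (of_int (\<gamma> $ 2 $ 1) * eta_sq \<tau> + (eta_log_deriv \<tau> * eta_sq \<tau>) * ?j) * ?j\<^sup>2"
    using j by (simp add: eta_sq_modular[OF g t] field_simps)
  also have "\<dots> = (?j\<^sup>2 * eta_log_deriv \<tau> + of_int (\<gamma> $ 2 $ 1) * ?j) * (?j * eta_sq \<tau>)"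
    by (simp add: algebra_simps power2_eq_square)
  finally show ?thesis using j by simp
qed

text \<open>Up to a constant, \<open>eisenstein4\<close> is the Eisenstein series of weight four, by Ramanujan's
  differential equation for \<open>E\<^sub>2\<close>.\<close>

definition eisenstein4 :: "complex \<Rightarrow> complex" where
  "eisenstein4 \<tau> = (eta_log_deriv \<tau>)\<^sup>2 - deriv eta_log_deriv \<tau>"

text \<open>Squaring the law for L and differentiating it produce the same inhomogeneous terms 2 c
  j^3 L + c^2 j^2, which cancel in the difference.\<close>

lemma eisenstein4_modular:
  assumes g: "\<gamma> \<in> modular_commutator" and t: "\<tau> \<in> upper_half_plane"
  shows "eisenstein4 (moebius \<gamma> \<tau>) = (automorphy \<gamma> \<tau>) ^ 4 * eisenstein4 \<tau>"
proof -
  note gS = modular_commutator_in_SL2Z[OF g]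
  let ?j = "automorphy \<gamma> \<tau>" and ?c = "of_int (\<gamma> $ 2 $ 1) :: complex"
  have j: "?j \<noteq> 0" by (rule automorphy_nonzero[OF gS t])
  have D: "(eta_log_deriv has_field_derivative deriv eta_log_deriv \<sigma>) (at \<sigma>)" if "\<sigma> \<in> upper_half_plane" for \<sigma>
    by (rule holomorphic_derivI[OF eta_log_deriv_holomorphic open_upper_half_plane that])
  have "((\<lambda>\<tau>. eta_log_deriv (moebius \<gamma> \<tau>)) has_field_derivative
      deriv eta_log_deriv (moebius \<gamma> \<tau>) * (1 / ?j\<^sup>2)) (at \<tau>)"
    by (rule DERIV_chain2[OF D[OF moebius_in[OF gS t]] moebius_has_derivative[OF gS t]])
  moreover have "((\<lambda>\<tau>. (automorphy \<gamma> \<tau>)\<^sup>2 * eta_log_deriv \<tau> + ?c * automorphy \<gamma> \<tau>) has_field_derivative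
      2 * ?j * ?c * eta_log_deriv \<tau> + ?j\<^sup>2 * deriv eta_log_deriv \<tau> + ?c\<^sup>2) (at \<tau>)"
    by (rule derivative_eq_intros refl automorphy_has_derivative D[OF t])+ (simp add: algebra_simps power2_eq_square)
  then have "((\<lambda>\<tau>. eta_log_deriv (moebius \<gamma> \<tau>)) has_field_derivative
      2 * ?j * ?c * eta_log_deriv \<tau> + ?j\<^sup>2 * deriv eta_log_deriv \<tau> + ?c\<^sup>2) (at \<tau>)"
    by (rule has_field_derivative_transform_within_open[OF _ open_upper_half_plane t])
      (simp add: eta_log_deriv_modular[OF g])
  ultimately have "deriv eta_log_deriv (moebius \<gamma> \<tau>) * (1 / ?j\<^sup>2) =
      2 * ?j * ?c * eta_log_deriv \<tau> + ?j\<^sup>2 * deriv eta_log_deriv \<tau> + ?c\<^sup>2"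
    by (rule DERIV_unique)
  then have "deriv eta_log_deriv (moebius \<gamma> \<tau>) =
      (2 * ?j * ?c * eta_log_deriv \<tau> + ?j\<^sup>2 * deriv eta_log_deriv \<tau> + ?c\<^sup>2) * ?j\<^sup>2"
    using j by (simp add: divide_simps)
  then show ?thesis
    unfolding eisenstein4_def eta_log_deriv_modular[OF g t]
    by (simp add: algebra_simps power2_eq_square power4_eq_xxxx)
qed

text \<open>Unnormalised coordinates: up to constants, \<open>E\<^sub>4 / \<eta>\<^sup>8\<close> and its derivative with respect to \<open>\<integral> \<eta>\<^sup>4 d\<tau>\<close>.\<close>

definition coord_P :: "complex \<Rightarrow> complex" where
  "coord_P \<tau> = eisenstein4 \<tau> / eta_sq \<tau> ^ 4"

definition coord_Q :: "complex \<Rightarrow> complex" where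
  "coord_Q \<tau> = deriv coord_P \<tau> / (eta_sq \<tau>)\<^sup>2"

lemma coord_P_holomorphic: "coord_P holomorphic_on upper_half_plane"
  unfolding coord_P_def[abs_def] eisenstein4_def
  by (intro holomorphic_intros eta_log_deriv_holomorphic eta_sq_holomorphic open_upper_half_plane) simp

lemma coord_Q_holomorphic: "coord_Q holomorphic_on upper_half_plane"
  unfolding coord_Q_def[abs_def]
  by (intro holomorphic_intros coord_P_holomorphic eta_sq_holomorphic open_upper_half_plane) simp

lemma coord_P_has_derivative:
  "\<tau> \<in> upper_half_plane \<Longrightarrow> (coord_P has_field_derivative (eta_sq \<tau>)\<^sup>2 * coord_Q \<tau>) (at \<tau>)"
  using holomorphic_derivI[OF coord_P_holomorphic open_upper_half_plane] by (simp add: coord_Q_def)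

lemma coord_P_modular:
  assumes "\<gamma> \<in> modular_commutator" "\<tau> \<in> upper_half_plane"
  shows "coord_P (moebius \<gamma> \<tau>) = coord_P \<tau>"
  using automorphy_nonzero[OF modular_commutator_in_SL2Z[OF assms(1)] assms(2)]
  by (simp add: coord_P_def eisenstein4_modular eta_sq_modular assms power_mult_distrib)

text \<open>Differentiating the invariance of \<open>coord_P\<close> gives a factor 1 / j^2, which
  cancels the factor j^2 of the square of \<open>eta_sq\<close>.\<close>

lemma coord_Q_modular:
  assumes g: "\<gamma> \<in> modular_commutator" and t: "\<tau> \<in> upper_half_plane"
  shows "coord_Q (moebius \<gamma> \<tau>) = coord_Q \<tau>"
proof -
  note gS = modular_commutator_in_SL2Z[OF g]
  let ?j = "automorphy \<gamma> \<tau>"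
  have j: "?j \<noteq> 0" by (rule automorphy_nonzero[OF gS t])
  have "((\<lambda>\<tau>. coord_P (moebius \<gamma> \<tau>)) has_field_derivative
      (eta_sq (moebius \<gamma> \<tau>))\<^sup>2 * coord_Q (moebius \<gamma> \<tau>) * (1 / ?j\<^sup>2)) (at \<tau>)"
    by (rule DERIV_chain2[OF coord_P_has_derivative[OF moebius_in[OF gS t]] moebius_has_derivative[OF gS t]])
  moreover have "((\<lambda>\<tau>. coord_P (moebius \<gamma> \<tau>)) has_field_derivative (eta_sq \<tau>)\<^sup>2 * coord_Q \<tau>) (at \<tau>)"
    by (rule has_field_derivative_transform_within_open[OF coord_P_has_derivative[OF t] open_upper_half_plane t])
      (simp add: coord_P_modular[OF g])
  ultimately have "(eta_sq (moebius \<gamma> \<tau>))\<^sup>2 * coord_Q (moebius \<gamma> \<tau>) * (1 / ?j\<^sup>2) = (eta_sq \<tau>)\<^sup>2 * coord_Q \<tau>"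
    by (rule DERIV_unique)
  then show ?thesis using j by (simp add: eta_sq_modular[OF g t] power_mult_distrib)
qed

text \<open>\<open>coord_P\<close> multiplied by q^2, as a function of w = q^6. The logarithmic
  derivative is \<open>eta_A w\<close>, and its derivative in \<tau> is 2 pi i w times that of
  \<open>eta_A\<close>.\<close>

definition hat_P :: "complex \<Rightarrow> complex" where
  "hat_P w = ((eta_A w)\<^sup>2 - 2 * of_real pi * \<i> * w * deriv eta_A w) / exp (eta_v w) ^ 4"

text \<open>The result of differentiating hat_P(q^6) / q^2 along the invariant differential. The
  summand with 1/3 comes from the factor q^(-2), as the derivative of q is (2 pi i / 6) q.\<close>

definition hat_Q :: "complex \<Rightarrow> complex" where
  "hat_Q w = 2 * of_real pi * \<i> * (w * deriv hat_P w - hat_P w / 3) / (exp (eta_v w))\<^sup>2"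

lemma hat_P_holomorphic: "hat_P holomorphic_on ball 0 1"
  unfolding hat_P_def[abs_def]
  by (intro holomorphic_intros eta_A_holomorphic eta_v_holomorphic open_ball) simp

lemma hat_Q_holomorphic: "hat_Q holomorphic_on ball 0 1"
  unfolding hat_Q_def[abs_def]
  by (intro holomorphic_intros hat_P_holomorphic eta_v_holomorphic open_ball) simp_all

lemma hat_P_0: "hat_P 0 \<noteq> 0" and hat_Q_0: "hat_Q 0 \<noteq> 0"
  by (simp_all add: hat_P_def hat_Q_def eta_A_0)

lemma cusp_coord_6: "cusp_coord 6 \<tau> ^ 6 = cusp_coord 1 \<tau>"
proof -
  have "of_nat 6 * (2 * of_real pi * \<i> * \<tau> / of_real 6) = 2 * of_real pi * \<i> * \<tau> / of_real 1" by simp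
  then show ?thesis unfolding cusp_coord_def exp_of_nat_mult[symmetric] by (simp add: mult_ac)
qed

lemma eta_sq_expansion: "(eta_sq \<tau>)\<^sup>2 = cusp_coord 6 \<tau> * (exp (eta_v (cusp_coord 1 \<tau>)))\<^sup>2"
proof -
  have "(eta_sq \<tau>)\<^sup>2 = exp (2 * (eta_rate * \<tau>) + 2 * eta_v (cusp_coord 1 \<tau>))"
    by (simp only: eta_sq_def eta_sq_log_def exp_double[symmetric] distrib_left)
  also have "\<dots> = exp (2 * (eta_rate * \<tau>)) * (exp (eta_v (cusp_coord 1 \<tau>)))\<^sup>2"
    by (simp only: exp_add exp_double)
  also have "2 * (eta_rate * \<tau>) = 2 * of_real pi * \<i> * \<tau> / of_real 6" by simp
  finally show ?thesis by (simp only: cusp_coord_def)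
qed

lemma eta_log_deriv_deriv:
  assumes "Im \<tau> > 0"
  shows "deriv eta_log_deriv \<tau> = 2 * of_real pi * \<i> * cusp_coord 1 \<tau> * deriv eta_A (cusp_coord 1 \<tau>)"
proof -
  have q: "cusp_coord 1 \<tau> \<in> ball 0 1" using cusp_coord_in_ball[of 1 \<tau>] assms by auto
  have "(eta_A has_field_derivative deriv eta_A (cusp_coord 1 \<tau>)) (at (cusp_coord 1 \<tau>))"
    using eta_A_holomorphic q by (simp add: holomorphic_derivI)
  then have "((\<lambda>\<tau>. eta_A (cusp_coord 1 \<tau>)) has_field_derivative
      deriv eta_A (cusp_coord 1 \<tau>) * (2 * of_real pi * \<i> / of_real 1 * cusp_coord 1 \<tau>)) (at \<tau>)"
    by (rule DERIV_chain2) (rule cusp_coord_has_derivative, simp)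
  then have "(eta_log_deriv has_field_derivative
      deriv eta_A (cusp_coord 1 \<tau>) * (2 * of_real pi * \<i> / of_real 1 * cusp_coord 1 \<tau>)) (at \<tau>)"
    by (rule has_field_derivative_transform_within_open[OF _ open_upper_half_plane])
      (use assms in \<open>auto simp: eta_log_deriv_eq upper_half_plane_def\<close>)
  then show ?thesis by (simp add: DERIV_imp_deriv)
qed

lemma coord_P_expansion:
  assumes "Im \<tau> > 0"
  shows "coord_P \<tau> = hat_P (cusp_coord 1 \<tau>) / (cusp_coord 6 \<tau>)\<^sup>2"
proof -
  have "eta_sq \<tau> ^ 4 = ((eta_sq \<tau>)\<^sup>2)\<^sup>2" by simp
  also have "\<dots> = (cusp_coord 6 \<tau>)\<^sup>2 * exp (eta_v (cusp_coord 1 \<tau>)) ^ 4"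
    unfolding eta_sq_expansion by (simp add: power_mult_distrib flip: power_mult)
  finally show ?thesis
    by (simp add: coord_P_def eisenstein4_def hat_P_def eta_log_deriv_eq[OF assms] eta_log_deriv_deriv[OF assms])
qed

lemma coord_Q_expansion:
  assumes "Im \<tau> > 0"
  shows "coord_Q \<tau> = hat_Q (cusp_coord 1 \<tau>) / cusp_coord 6 \<tau> ^ 3"
proof -
  let ?q = "cusp_coord 6 \<tau>" and ?w = "cusp_coord 1 \<tau>"
  have q: "?w \<in> ball 0 1" using cusp_coord_in_ball[of 1 \<tau>] assms by auto
  have "(hat_P has_field_derivative deriv hat_P ?w) (at ?w)"
    using hat_P_holomorphic q by (simp add: holomorphic_derivI)
  then have 1: "((\<lambda>\<tau>. hat_P (cusp_coord 1 \<tau>)) has_field_derivative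
      deriv hat_P ?w * (2 * of_real pi * \<i> / of_real 1 * ?w)) (at \<tau>)"
    by (rule DERIV_chain2) (rule cusp_coord_has_derivative, simp)
  have 2: "((\<lambda>\<tau>. (cusp_coord 6 \<tau>)\<^sup>2) has_field_derivative
      of_nat 2 * ((2 * of_real pi * \<i> / of_real 6 * ?q) * ?q ^ (2 - Suc 0))) (at \<tau>)"
    by (rule DERIV_power[OF cusp_coord_has_derivative]) simp
  have "((\<lambda>\<tau>. hat_P (cusp_coord 1 \<tau>) / (cusp_coord 6 \<tau>)\<^sup>2) has_field_derivative
      (deriv hat_P ?w * (2 * of_real pi * \<i> / of_real 1 * ?w) * ?q\<^sup>2 -
        hat_P ?w * (of_nat 2 * ((2 * of_real pi * \<i> / of_real 6 * ?q) * ?q ^ (2 - Suc 0)))) / (?q\<^sup>2 * ?q\<^sup>2)) (at \<tau>)"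
    by (rule DERIV_divide[OF 1 2]) simp
  also have "(deriv hat_P ?w * (2 * of_real pi * \<i> / of_real 1 * ?w) * ?q\<^sup>2 -
        hat_P ?w * (of_nat 2 * ((2 * of_real pi * \<i> / of_real 6 * ?q) * ?q ^ (2 - Suc 0)))) / (?q\<^sup>2 * ?q\<^sup>2) =
      2 * of_real pi * \<i> * (?w * deriv hat_P ?w - hat_P ?w / 3) / ?q\<^sup>2"
    by (simp add: field_simps power2_eq_square)
  finally have "(coord_P has_field_derivative 2 * of_real pi * \<i> * (?w * deriv hat_P ?w - hat_P ?w / 3) / ?q\<^sup>2) (at \<tau>)"
    by (rule has_field_derivative_transform_within_open[OF _ open_upper_half_plane])
      (use assms in \<open>auto simp: coord_P_expansion upper_half_plane_def\<close>)
  then have "coord_Q \<tau> = (2 * of_real pi * \<i> * (?w * deriv hat_P ?w - hat_P ?w / 3) / ?q\<^sup>2) / (?q * (exp (eta_v ?w))\<^sup>2)"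
    unfolding coord_Q_def eta_sq_expansion[symmetric] by (simp add: DERIV_imp_deriv)
  then show ?thesis by (simp add: hat_Q_def power2_eq_square power3_eq_cube)
qed

text \<open>The choice of \<open>b\<close> makes \<open>B\<close> vanish at 0. The difference is
  then B(w) / w with w = q^6, holomorphic at the cusp, hence constant. If the constant
  \<open>c\<close> were 0, the comparison of orders of vanishing would show that
  \<open>coord_P\<close> has no zero; its reciprocal would be invariant with limit 0 at the cusp,
  hence identically 0.\<close>

lemma coord_relation:
  obtains b c where "b \<noteq> 0" "c \<noteq> 0" "\<And>\<tau>. \<tau> \<in> upper_half_plane \<Longrightarrow> (coord_Q \<tau>)\<^sup>2 = b * coord_P \<tau> ^ 3 + c"
proof -
  define b where "b = (hat_Q 0)\<^sup>2 / hat_P 0 ^ 3"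
  have b: "b \<noteq> 0" using hat_P_0 hat_Q_0 by (simp add: b_def)
  define B where "B w = (hat_Q w)\<^sup>2 - b * hat_P w ^ 3" for w
  have B: "B holomorphic_on ball 0 1" "B 0 = 0"
  proof -
    show "B holomorphic_on ball 0 1"
      unfolding B_def[abs_def] by (intro holomorphic_intros hat_P_holomorphic hat_Q_holomorphic)
    have "b * hat_P 0 ^ 3 = (hat_Q 0)\<^sup>2" using hat_P_0 by (simp add: b_def)
    then show "B 0 = 0" by (simp add: B_def)
  qed
  define B1 where "B1 w = (if w = 0 then deriv B 0 else (B w - B 0) / (w - 0))" for w
  have B1: "B1 holomorphic_on ball 0 1"
    unfolding B1_def[abs_def] by (rule pole_lemma_open[OF B(1) open_ball])
  define c where "c = B1 0"
  let ?f = "\<lambda>\<tau>. (coord_Q \<tau>)\<^sup>2 - b * coord_P \<tau> ^ 3"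
  have f: "?f \<tau> = B1 (cusp_coord 1 \<tau>)" if "Im \<tau> > 0" for \<tau>
    unfolding coord_P_expansion[OF that] coord_Q_expansion[OF that]
  proof -
    have "B1 (cusp_coord 1 \<tau>) = B (cusp_coord 1 \<tau>) / cusp_coord 1 \<tau>" by (simp add: B1_def B(2))
    also have "\<dots> = (hat_Q (cusp_coord 1 \<tau>))\<^sup>2 / cusp_coord 6 \<tau> ^ 6 - b * hat_P (cusp_coord 1 \<tau>) ^ 3 / cusp_coord 6 \<tau> ^ 6"
      by (simp add: B_def diff_divide_distrib cusp_coord_6)
    finally show "(hat_Q (cusp_coord 1 \<tau>) / cusp_coord 6 \<tau> ^ 3)\<^sup>2 - b * (hat_P (cusp_coord 1 \<tau>) / (cusp_coord 6 \<tau>)\<^sup>2) ^ 3 =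
      B1 (cusp_coord 1 \<tau>)" by (simp add: power_divide flip: power_mult)
  qed
  have "\<forall>\<^sub>F \<tau> in at_cusp. B1 (cusp_coord 1 \<tau>) = ?f \<tau>"
    unfolding eventually_at_cusp using f by (intro exI[of _ 0]) simp
  then have lim: "(?f \<longlongrightarrow> c) at_cusp"
    unfolding c_def by (rule Lim_transform_eventually[OF tendsto_cusp_coord_compose[OF _ B1], rotated]) simp
  have const: "?f \<tau> = c" if "\<tau> \<in> upper_half_plane" for \<tau>
    by (rule modular_function_constant[OF _ _ lim that])
      (auto intro!: holomorphic_intros coord_P_holomorphic coord_Q_holomorphic simp: coord_P_modular coord_Q_modular)
  have "c \<noteq> 0"
  proof
    assume "c = 0"
    then have rel: "(coord_Q \<tau>)\<^sup>2 = b * coord_P \<tau> ^ 3" if "\<tau> \<in> upper_half_plane" for \<tau>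
      using const[OF that] by simp
    have "((\<lambda>\<tau>. hat_P (cusp_coord 1 \<tau>)) \<longlongrightarrow> hat_P 0) at_cusp"
      by (rule tendsto_cusp_coord_compose[OF _ hat_P_holomorphic]) simp
    then have "\<forall>\<^sub>F \<tau> in at_cusp. hat_P (cusp_coord 1 \<tau>) \<noteq> 0"
      using hat_P_0 by (rule tendsto_imp_eventually_ne)
    then obtain Y where Y: "\<And>\<tau>. Im \<tau> > Y \<Longrightarrow> hat_P (cusp_coord 1 \<tau>) \<noteq> 0" by (auto simp: eventually_at_cusp)
    define \<tau>0 where "\<tau>0 = \<i> * of_real (max 1 (Y + 1))"
    have t0: "Im \<tau>0 > 0" "Im \<tau>0 > Y" by (auto simp: \<tau>0_def)
    have nz: "coord_P \<tau> \<noteq> 0" if t: "\<tau> \<in> upper_half_plane" for \<tau>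
    proof (rule no_zero_of_square_deriv_eq_cube[OF coord_P_holomorphic open_upper_half_plane connected_upper_half_plane _ _ _ t])
      show "(\<lambda>\<tau>. eta_sq \<tau> ^ 4 * b) holomorphic_on upper_half_plane"
        by (intro holomorphic_intros eta_sq_holomorphic)
      show "(deriv coord_P z)\<^sup>2 = eta_sq z ^ 4 * b * coord_P z ^ 3" if "z \<in> upper_half_plane" for z
        using DERIV_imp_deriv[OF coord_P_has_derivative[OF that]] rel[OF that]
        by (simp add: power_mult_distrib flip: power_mult)
      show "\<exists>z\<in>upper_half_plane. coord_P z \<noteq> 0"
        using t0 Y[OF t0(2)] by (intro bexI[of _ \<tau>0]) (auto simp: coord_P_expansion upper_half_plane_def)
    qed
    have i: "\<i> \<in> upper_half_plane" by (simp add: upper_half_plane_def)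
    have "((\<lambda>\<tau>. (cusp_coord 6 \<tau>)\<^sup>2 / hat_P (cusp_coord 1 \<tau>)) \<longlongrightarrow> 0\<^sup>2 / hat_P 0) at_cusp"
      by (intro tendsto_intros cusp_coord_tendsto tendsto_cusp_coord_compose hat_P_holomorphic hat_P_0) simp_all
    moreover have "\<forall>\<^sub>F \<tau> in at_cusp. (cusp_coord 6 \<tau>)\<^sup>2 / hat_P (cusp_coord 1 \<tau>) = 1 / coord_P \<tau>"
      unfolding eventually_at_cusp by (intro exI[of _ 0]) (simp add: coord_P_expansion)
    ultimately have "((\<lambda>\<tau>. 1 / coord_P \<tau>) \<longlongrightarrow> 0) at_cusp"
      using Lim_transform_eventually by fastforce
    then have "1 / coord_P \<i> = 0"
      by (rule modular_function_constant[rotated 2])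
        (auto intro!: holomorphic_intros coord_P_holomorphic i simp: nz coord_P_modular)
    then show False using nz[OF i] by simp
  qed
  moreover have "(coord_Q \<tau>)\<^sup>2 = b * coord_P \<tau> ^ 3 + c" if "\<tau> \<in> upper_half_plane" for \<tau>
    using const[OF that] by (simp add: algebra_simps)
  ultimately show ?thesis using that b by blast
qed

text \<open>These functions will be the pullbacks of the two Weierstrass functions. The constant
  \<open>c\<close> compares invariant differentials, dx / y = c phi^2 d\<tau>, and
  \<open>hx\<close>, \<open>hy\<close> are the expansions in q^6 once the poles are removed.\<close>

locale modular_coordinates =
  fixes x y :: "complex \<Rightarrow> complex" and c :: complex and hx hy :: "complex \<Rightarrow> complex"
  assumes c_nonzero: "c \<noteq> 0"
    and x_holomorphic: "x holomorphic_on upper_half_plane"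
    and y_holomorphic: "y holomorphic_on upper_half_plane"
    and x_modular: "\<And>\<gamma> \<tau>. \<gamma> \<in> modular_commutator \<Longrightarrow> \<tau> \<in> upper_half_plane \<Longrightarrow> x (moebius \<gamma> \<tau>) = x \<tau>"
    and y_modular: "\<And>\<gamma> \<tau>. \<gamma> \<in> modular_commutator \<Longrightarrow> \<tau> \<in> upper_half_plane \<Longrightarrow> y (moebius \<gamma> \<tau>) = y \<tau>"
    and curve: "\<And>\<tau>. \<tau> \<in> upper_half_plane \<Longrightarrow> (y \<tau>)\<^sup>2 = 4 * x \<tau> ^ 3 - 1"
    and x_derivative: "\<And>\<tau>. \<tau> \<in> upper_half_plane \<Longrightarrow> (x has_field_derivative c * (eta_sq \<tau>)\<^sup>2 * y \<tau>) (at \<tau>)"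
    and hx_holomorphic: "hx holomorphic_on ball 0 1" and hy_holomorphic: "hy holomorphic_on ball 0 1"
    and hx_0: "hx 0 \<noteq> 0" and hy_0: "hy 0 \<noteq> 0"
    and x_expansion: "\<And>\<tau>. \<tau> \<in> upper_half_plane \<Longrightarrow> x \<tau> = hx (cusp_coord 1 \<tau>) / (cusp_coord 6 \<tau>)\<^sup>2"
    and y_expansion: "\<And>\<tau>. \<tau> \<in> upper_half_plane \<Longrightarrow> y \<tau> = hy (cusp_coord 1 \<tau>) / cusp_coord 6 \<tau> ^ 3"
    and x_outside: "\<And>\<tau>. \<tau> \<notin> upper_half_plane \<Longrightarrow> x \<tau> = 0"
    and y_outside: "\<And>\<tau>. \<tau> \<notin> upper_half_plane \<Longrightarrow> y \<tau> = 0"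

lemma modular_coordinates_exist: "\<exists>x y c hx hy. modular_coordinates x y c hx hy"
proof -
  obtain b d where bd: "b \<noteq> 0" "d \<noteq> 0"
    "\<And>\<tau>. \<tau> \<in> upper_half_plane \<Longrightarrow> (coord_Q \<tau>)\<^sup>2 = b * coord_P \<tau> ^ 3 + d"
    using coord_relation by metis
  \<comment> \<open>From coord_Q^2 = b coord_P^3 + d: scaling by \<open>s\<close> turns d into -1,
    and scaling \<open>coord_P\<close> by \<open>a\<close> with 4 a^3 = s^2 b produces the
    coefficient 4.\<close>
  define s where "s = csqrt (- (1 / d))"
  define a where "a = exp (Ln (s\<^sup>2 * b / 4) / 3)"
  have s: "s\<^sup>2 = - (1 / d)" "s \<noteq> 0" using bd by (auto simp: s_def)
  have "a ^ 3 = exp (Ln (s\<^sup>2 * b / 4))" by (simp add: a_def exp_of_nat_mult[symmetric])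
  then have a: "a ^ 3 = s\<^sup>2 * b / 4" "a \<noteq> 0" using s(2) bd by (simp_all add: a_def)
  define x where "x \<tau> = (if \<tau> \<in> upper_half_plane then a * coord_P \<tau> else 0)" for \<tau>
  define y where "y \<tau> = (if \<tau> \<in> upper_half_plane then s * coord_Q \<tau> else 0)" for \<tau>
  have "modular_coordinates x y (a / s) (\<lambda>w. a * hat_P w) (\<lambda>w. s * hat_Q w)"
  proof
    show "a / s \<noteq> 0" using a s by simp
    show "x holomorphic_on upper_half_plane" "y holomorphic_on upper_half_plane"
      by (rule holomorphic_transform[of "\<lambda>\<tau>. a * coord_P \<tau>"] holomorphic_transform[of "\<lambda>\<tau>. s * coord_Q \<tau>"];
          auto intro!: holomorphic_intros coord_P_holomorphic coord_Q_holomorphic simp: x_def y_def)+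
    fix \<tau> assume t: "\<tau> \<in> upper_half_plane"
    show "x (moebius \<gamma> \<tau>) = x \<tau>" "y (moebius \<gamma> \<tau>) = y \<tau>" if "\<gamma> \<in> modular_commutator" for \<gamma>
      using that t moebius_in[OF modular_commutator_in_SL2Z[OF that] t]
      by (simp_all add: x_def y_def coord_P_modular coord_Q_modular)
    show "(y \<tau>)\<^sup>2 = 4 * x \<tau> ^ 3 - 1"
      using t bd(2) by (simp add: x_def y_def power_mult_distrib bd(3) a(1) s(1) distrib_left)
    have "((\<lambda>\<tau>. a * coord_P \<tau>) has_field_derivative a * ((eta_sq \<tau>)\<^sup>2 * coord_Q \<tau>)) (at \<tau>)"
      by (intro DERIV_cmult coord_P_has_derivative t)
    then have "(x has_field_derivative a * ((eta_sq \<tau>)\<^sup>2 * coord_Q \<tau>)) (at \<tau>)"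
      by (rule has_field_derivative_transform_within_open[OF _ open_upper_half_plane t]) (simp add: x_def)
    then show "(x has_field_derivative a / s * (eta_sq \<tau>)\<^sup>2 * y \<tau>) (at \<tau>)"
      using s(2) t by (simp add: y_def mult_ac)
    show "x \<tau> = a * hat_P (cusp_coord 1 \<tau>) / (cusp_coord 6 \<tau>)\<^sup>2"
      "y \<tau> = s * hat_Q (cusp_coord 1 \<tau>) / cusp_coord 6 \<tau> ^ 3"
      using t by (simp_all add: x_def y_def coord_P_expansion coord_Q_expansion upper_half_plane_def)
  qed (use a s hat_P_0 hat_Q_0 in \<open>auto intro!: holomorphic_intros hat_P_holomorphic hat_Q_holomorphic simp: x_def y_def\<close>)
  then show ?thesis by blast
qed

text \<open>Differentiating the equation of the curve gives 2 y y' = 12 x^2 k y, which determines y'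
  where y is not 0. These points form a nonempty open set, and analytic continuation extends the
  formula.\<close>

lemma curve_second_derivative:
  fixes x y k :: "complex \<Rightarrow> complex"
  assumes M: "open M" "connected M" and hol: "x holomorphic_on M" "y holomorphic_on M" "k holomorphic_on M"
    and curve: "\<And>z. z \<in> M \<Longrightarrow> (y z)\<^sup>2 = 4 * x z ^ 3 - 1"
    and dx: "\<And>z. z \<in> M \<Longrightarrow> (x has_field_derivative k z * y z) (at z)"
    and nz: "z0 \<in> M" "y z0 \<noteq> 0" and z: "z \<in> M"
  shows "(y has_field_derivative k z * (6 * (x z)\<^sup>2)) (at z)"
proof -
  have D: "(y has_field_derivative deriv y s) (at s)" if "s \<in> M" for s
    by (rule holomorphic_derivI[OF hol(2) M(1) that])
  have eq: "deriv y s = k s * (6 * (x s)\<^sup>2)" if s: "s \<in> M" and "y s \<noteq> 0" for s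
  proof -
    have "((\<lambda>s. (y s)\<^sup>2) has_field_derivative 2 * y s * deriv y s) (at s)"
      by (rule derivative_eq_intros refl D[OF s])+ simp
    moreover have "((\<lambda>s. 4 * x s ^ 3 - 1) has_field_derivative 12 * (x s)\<^sup>2 * (k s * y s)) (at s)"
      by (rule derivative_eq_intros refl dx[OF s])+ simp
    then have "((\<lambda>s. (y s)\<^sup>2) has_field_derivative 12 * (x s)\<^sup>2 * (k s * y s)) (at s)"
      by (rule has_field_derivative_transform_within_open[OF _ M(1) s]) (simp add: curve)
    ultimately have "2 * y s * deriv y s = 12 * (x s)\<^sup>2 * (k s * y s)" by (rule DERIV_unique)
    then have "(2 * y s) * deriv y s = (2 * y s) * (k s * (6 * (x s)\<^sup>2))" by (simp add: mult_ac)
    then show ?thesis using that(2) by (subst (asm) mult_left_cancel) auto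
  qed
  have "open (M \<inter> y -` (- {0}))"
    using continuous_open_preimage[OF holomorphic_on_imp_continuous_on[OF hol(2)] M(1), of "- {0}"] by blast
  moreover have "M \<inter> y -` (- {0}) \<noteq> {}" using nz by blast
  ultimately have "deriv y z = k z * (6 * (x z)\<^sup>2)"
    by (rule analytic_continuation_open[OF _ M(1) _ M(2) _ _ _ _ z])
      (use eq in \<open>auto intro!: holomorphic_intros hol M\<close>)
  then show ?thesis using D[OF z] by simp
qed

section \<open>The hexagonal lattice\<close>

abbreviation "hex_unit \<equiv> exp (2 * of_real pi * \<i> / 3) :: complex"

lemma hex_unit_Im: "Im hex_unit > 0"
proof -
  have "sin (2 * pi / 3) > 0" by (rule sin_gt_zero) auto
  then show ?thesis by (simp add: Im_exp)
qed

lemma hex_unit_norm: "cmod hex_unit = 1"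
  by simp

lemma hex_unit_cube: "hex_unit ^ 3 = 1"
proof -
  have "hex_unit ^ 3 = exp (of_nat 3 * (2 * of_real pi * \<i> / 3))" by (simp only: exp_of_nat_mult)
  also have "of_nat 3 * (2 * of_real pi * \<i> / 3) = 2 * of_real pi * \<i>" by simp
  finally show ?thesis by (simp only: exp_two_pi_i)
qed

lemma hex_unit_square: "hex_unit * hex_unit = - hex_unit - 1"
proof -
  have "(hex_unit - 1) * (hex_unit * hex_unit + hex_unit + 1) = hex_unit ^ 3 - 1"
    by (simp add: algebra_simps power3_eq_cube)
  moreover have "hex_unit \<noteq> 1" using hex_unit_Im by (metis less_irrefl one_complex.sel(2))
  ultimately have "hex_unit * hex_unit + hex_unit + 1 = 0" using hex_unit_cube by simp
  then show ?thesis by (simp add: eq_neg_iff_add_eq_0 algebra_simps)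
qed

lemma inverse_square_has_derivative:
  assumes "z \<noteq> (w :: complex)"
  shows "((\<lambda>z. 1 / (z - w) ^ 2) has_field_derivative - 2 / (z - w) ^ 3) (at z)"
proof -
  have D: "((\<lambda>z. 1 / (z - w) ^ 2) has_field_derivative (0 * (z - w) ^ 2 - 1 * (2 * (z - w))) / ((z - w) ^ 2 * (z - w) ^ 2)) (at z)"
    using assms by (intro DERIV_divide DERIV_const) (auto intro!: derivative_eq_intros)
  have key: "(0 * u ^ 2 - 1 * (2 * u)) / (u ^ 2 * u ^ 2) = - 2 / u ^ 3" if "u \<noteq> 0" for u :: complex
    using that by (simp add: field_simps power2_eq_square power3_eq_cube)
  have eq: "(0 * (z - w) ^ 2 - 1 * (2 * (z - w))) / ((z - w) ^ 2 * (z - w) ^ 2) = - 2 / (z - w) ^ 3"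
    by (rule key) (use assms in simp)
  show ?thesis using D unfolding eq .
qed

definition wp_term :: "complex \<Rightarrow> complex \<Rightarrow> complex" where
  "wp_term z w = 1 / (z - w) ^ 2 - 1 / w ^ 2"

locale hexagonal =
  fixes \<omega> :: complex
  assumes omega_nonzero: "\<omega> \<noteq> 0"
begin

abbreviation "\<Lambda> \<equiv> hexagonal_lattice \<omega>"

text \<open>The order of the coordinates is that of m \<tau> + n with the cube root of unity as
  \<tau>, so that the lattice estimates for points of the upper half plane apply.\<close>

definition lat :: "int \<times> int \<Rightarrow> complex" where
  "lat p = \<omega> * (of_int (fst p) * hex_unit + of_int (snd p))"

lemma lattice_eq: "\<Lambda> = range lat"
proof -
  have "\<omega> * (of_int m + of_int n * exp (2 * of_real pi * \<i> / 3)) = lat (n, m)" for m n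
    by (simp add: lat_def)
  then show ?thesis unfolding hexagonal_lattice_def by (auto simp: image_iff) 
qed

lemma lat_cases: assumes "w \<in> \<Lambda>" obtains m n where "w = lat (m, n)"
  using assms unfolding lattice_eq by auto

lemma lat_in [simp]: "lat p \<in> \<Lambda>" by (simp add: lattice_eq)

lemma lattice_0 [simp]: "0 \<in> \<Lambda>"
  using lat_in[of "(0, 0)"] by (simp add: lat_def)

lemma lattice_add: "w \<in> \<Lambda> \<Longrightarrow> w' \<in> \<Lambda> \<Longrightarrow> w + w' \<in> \<Lambda>"
proof -
  assume "w \<in> \<Lambda>" "w' \<in> \<Lambda>"
  then obtain m n m' n' where "w = lat (m, n)" "w' = lat (m', n')" by (meson lat_cases)
  then have "w + w' = lat (m + m', n + n')" by (simp add: lat_def algebra_simps)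
  then show ?thesis by simp
qed

lemma lattice_minus: "w \<in> \<Lambda> \<Longrightarrow> - w \<in> \<Lambda>"
proof -
  assume "w \<in> \<Lambda>"
  then obtain m n where "w = lat (m, n)" by (meson lat_cases)
  then have "- w = lat (- m, - n)" by (simp add: lat_def algebra_simps)
  then show ?thesis by simp
qed

lemma lattice_minus_iff [simp]: "- w \<in> \<Lambda> \<longleftrightarrow> w \<in> \<Lambda>"
  using lattice_minus[of w] lattice_minus[of "- w"] by auto

lemma lattice_diff: "w \<in> \<Lambda> \<Longrightarrow> w' \<in> \<Lambda> \<Longrightarrow> w - w' \<in> \<Lambda>"
  using lattice_add[of w "- w'"] by simp

lemma lattice_add_iff: "w \<in> \<Lambda> \<Longrightarrow> z + w \<in> \<Lambda> \<longleftrightarrow> z \<in> \<Lambda>"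
  using lattice_add[of z w] lattice_diff[of "z + w" w] by auto

text \<open>Complex multiplication by a cube root of unity; this symmetry is what makes g2
  vanish.\<close>

lemma lattice_hex: "w \<in> \<Lambda> \<Longrightarrow> hex_unit * w \<in> \<Lambda>"
proof -
  assume "w \<in> \<Lambda>"
  then obtain m n where w: "w = lat (m, n)" by (meson lat_cases)
  have "hex_unit * w = \<omega> * (of_int m * (hex_unit * hex_unit) + of_int n * hex_unit)"
    by (simp add: w lat_def algebra_simps)
  also have "\<dots> = lat (n - m, - m)"
    unfolding hex_unit_square by (simp add: lat_def algebra_simps)
  finally show ?thesis by simp
qed

lemma lat_norm: "cmod (lat (m, n)) = cmod \<omega> * cmod (of_int m * hex_unit + of_int n)"
  by (simp add: lat_def norm_mult)

lemma lat_eq_0_iff: "lat p = 0 \<longleftrightarrow> p = (0, 0)"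
proof
  assume "lat p = 0"
  then have 0: "of_int (fst p) * hex_unit + of_int (snd p) = 0" using omega_nonzero by (simp add: lat_def)
  from arg_cong[OF 0, of Im] have "fst p = 0" using hex_unit_Im by simp
  with 0 show "p = (0, 0)" by (simp add: prod_eq_iff)
qed (simp add: lat_def)

lemma lat_inj: "inj lat"
proof (rule injI)
  fix p p' assume "lat p = lat p'"
  then have "lat (fst p - fst p', snd p - snd p') = 0" by (simp add: lat_def algebra_simps)
  then show "p = p'" unfolding lat_eq_0_iff by (simp add: prod_eq_iff)
qed

lemma finite_lattice_le: "finite {w \<in> \<Lambda>. cmod w \<le> R}"
proof -
  have "{w \<in> \<Lambda>. cmod w \<le> R} \<subseteq> lat ` {p. cmod (of_int (fst p) * hex_unit + of_int (snd p)) \<le> R / cmod \<omega>}"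
    using omega_nonzero by (auto simp: lattice_eq lat_norm field_simps)
  then show ?thesis
    using finite_lattice_bounded[OF hex_unit_Im] finite_subset by blast
qed

lemma lattice_min_norm:
  obtains d where "d > 0" "\<And>w. w \<in> \<Lambda> \<Longrightarrow> w \<noteq> 0 \<Longrightarrow> cmod w \<ge> d"
proof -
  define A where "A = cmod ` ({w \<in> \<Lambda>. cmod w \<le> 1} - {0})"
  have fin: "finite A" unfolding A_def using finite_lattice_le by blast
  show ?thesis
  proof
    show "Min (insert 1 A) > 0" using fin by (subst Min_gr_iff) (auto simp: A_def)
    fix w assume w: "w \<in> \<Lambda>" "w \<noteq> 0"
    show "cmod w \<ge> Min (insert 1 A)"
    proof (cases "cmod w \<le> 1")
      case True
      then have "cmod w \<in> A" using w by (auto simp: A_def)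
      then show ?thesis using fin by (intro Min_le) auto
    next
      case False
      have "Min (insert 1 A) \<le> 1" using fin by (intro Min_le) auto
      then show ?thesis using False by simp
    qed
  qed
qed

lemma lattice_closed_subset: assumes "A \<subseteq> \<Lambda>" shows "closed A"
proof -
  obtain d where d: "d > 0" "\<And>w. w \<in> \<Lambda> \<Longrightarrow> w \<noteq> 0 \<Longrightarrow> cmod w \<ge> d" using lattice_min_norm by blast
  show ?thesis
  proof (rule discrete_imp_closed[OF d(1)], intro ballI impI)
    fix x y assume "x \<in> A" "y \<in> A" "dist y x < d"
    then show "y = x" using d(2)[of "y - x"] lattice_diff assms by (force simp: dist_norm)
  qed
qed

lemma lattice_closed: "closed \<Lambda>" by (rule lattice_closed_subset) simp

lemma lattice_compl_open: "open (- \<Lambda>)" using lattice_closed by blast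

lemma lattice_compl_connected: "connected (- \<Lambda>)"
proof -
  have "countable \<Lambda>" unfolding lattice_eq by auto
  then show ?thesis by (intro path_connected_imp_connected path_connected_complement_countable) auto
qed

text \<open>Rounding down both real coordinates leaves two fractional parts, multiplied by vectors
  of length \<open>cmod \<omega>\<close>.\<close>

lemma lattice_covering: obtains w where "w \<in> \<Lambda>" "cmod (z - w) \<le> 2 * cmod \<omega>"
proof -
  define s where "s = Im (z / \<omega>) / Im hex_unit"
  define t where "t = Re (z / \<omega>) - s * Re hex_unit"
  have "z / \<omega> = of_real s * hex_unit + of_real t"
    using hex_unit_Im by (simp add: complex_eq_iff s_def t_def)
  then have z: "z = \<omega> * (of_real s * hex_unit + of_real t)" using omega_nonzero by (simp add: field_simps)
  define w where "w = lat (\<lfloor>s\<rfloor>, \<lfloor>t\<rfloor>)"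
  have "z - w = \<omega> * (of_real (s - \<lfloor>s\<rfloor>) * hex_unit + of_real (t - \<lfloor>t\<rfloor>))"
    by (simp add: w_def lat_def z algebra_simps)
  then have "cmod (z - w) = cmod \<omega> * cmod (of_real (s - \<lfloor>s\<rfloor>) * hex_unit + of_real (t - \<lfloor>t\<rfloor>))"
    by (simp add: norm_mult)
  also have "cmod (of_real (s - \<lfloor>s\<rfloor>) * hex_unit + of_real (t - \<lfloor>t\<rfloor>)) \<le> \<bar>s - \<lfloor>s\<rfloor>\<bar> + \<bar>t - \<lfloor>t\<rfloor>\<bar>"
    using norm_triangle_ineq[of "of_real (s - \<lfloor>s\<rfloor>) * hex_unit" "of_real (t - \<lfloor>t\<rfloor>)"]
    by (simp only: norm_mult hex_unit_norm norm_of_real mult_1_right)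
  also have "\<dots> \<le> 2" by linarith
  finally have "cmod (z - w) \<le> 2 * cmod \<omega>" by (simp add: mult_left_mono)
  then show ?thesis using that[of w] by (simp add: w_def)
qed

lemma lattice_cube_summable: "(\<lambda>w. 1 / cmod w ^ 3) summable_on \<Lambda>"
proof -
  have "(\<lambda>p. (1 / cmod \<omega> ^ 3) * (case p of (m, n) \<Rightarrow> 1 / cmod (of_int m * hex_unit + of_int n) ^ 3)) summable_on UNIV"
    by (intro summable_on_cmult_right summable_on_lattice_cube hex_unit_Im)
  also have "(\<lambda>p. (1 / cmod \<omega> ^ 3) * (case p of (m, n) \<Rightarrow> 1 / cmod (of_int m * hex_unit + of_int n) ^ 3)) =
     (\<lambda>w. 1 / cmod w ^ 3) \<circ> lat"
    by (auto simp: fun_eq_iff lat_norm power_mult_distrib)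
  finally show ?thesis unfolding lattice_eq by (subst summable_on_reindex[OF lat_inj])
qed

text \<open>The points of the covering disc outside small discs about the lattice form a compact
  set. All other points can be translated next to 0, where f is close to c.\<close>

lemma elliptic_constant:
  assumes hol: "f holomorphic_on - \<Lambda>" and per: "\<And>z w. z \<notin> \<Lambda> \<Longrightarrow> w \<in> \<Lambda> \<Longrightarrow> f (z + w) = f z"
    and lim: "(f \<longlongrightarrow> c) (at 0)" and z: "z \<notin> \<Lambda>"
  shows "f z = c"
proof (rule constant_if_compact_mod_symmetry[OF hol lattice_compl_open lattice_compl_connected])
  fix e :: real assume "e > 0"
  then obtain r where r: "r > 0" "\<And>z. z \<noteq> 0 \<Longrightarrow> dist z 0 < r \<Longrightarrow> dist (f z) c < e"
    using tendstoD[OF lim] unfolding eventually_at by (metis UNIV_I)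
  define K where "K = cball 0 (2 * cmod \<omega>) - (\<Union>w\<in>\<Lambda>. ball w r)"
  show "\<exists>K. compact K \<and> K \<subseteq> - \<Lambda> \<and> (\<forall>z\<in>- \<Lambda>. \<exists>w\<in>- \<Lambda>. f w = f z \<and> (w \<in> K \<or> dist (f w) c < e))"
  proof (intro exI[of _ K] conjI ballI)
    show "compact K" unfolding K_def by (intro compact_diff compact_cball) auto
    show "K \<subseteq> - \<Lambda>" using r(1) by (auto simp: K_def)
    fix z assume z: "z \<in> - \<Lambda>"
    obtain w where w: "w \<in> \<Lambda>" "cmod (z - w) \<le> 2 * cmod \<omega>" by (rule lattice_covering)
    have zw: "z - w \<notin> \<Lambda>" "f (z - w) = f z"
      using z w(1) per[of z "- w"] lattice_add_iff[of "- w" z] by auto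
    show "\<exists>w\<in>- \<Lambda>. f w = f z \<and> (w \<in> K \<or> dist (f w) c < e)"
    proof (cases "z - w \<in> K")
      case True then show ?thesis using zw by (intro bexI[of _ "z - w"]) auto
    next
      case False
      then obtain u where u: "u \<in> \<Lambda>" "dist u (z - w) < r" using w by (auto simp: K_def)
      have zu: "z - w - u \<notin> \<Lambda>" "f (z - w - u) = f (z - w)"
        using zw(1) u(1) per[of "z - w" "- u"] lattice_add_iff[of "- u" "z - w"] by auto
      then have "z - w - u \<noteq> 0" by (metis lattice_0)
      then have "dist (f (z - w - u)) c < e" using u(2) by (intro r(2)) (auto simp: dist_norm norm_minus_commute)
      then show ?thesis using zu zw by (intro bexI[of _ "z - w - u"]) auto
    qed
  qed
  obtain d where d: "d > 0" "\<And>w. w \<in> \<Lambda> \<Longrightarrow> w \<noteq> 0 \<Longrightarrow> cmod w \<ge> d" using lattice_min_norm by blast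
  define z where "z = complex_of_real (min r d / 2)"
  have "cmod z = min r d / 2" using r(1) d(1) by (simp add: z_def)
  then have "z \<noteq> 0" "cmod z < r" "cmod z < d" using r(1) d(1) by auto
  then show "\<exists>z\<in>- \<Lambda>. dist (f z) c < e" using d(2)[of z] r(2)[of z] by (intro bexI[of _ z]) auto
qed (use z in auto)

section \<open>The Weierstrass function\<close>

abbreviation "wp \<equiv> weierstrass_p \<Lambda>"

lemma wp_term_bound:
  assumes "cmod z \<le> R" "cmod w \<ge> 2 * R" "w \<noteq> 0" "R > 0"
  shows "cmod (wp_term z w) \<le> 10 * R * (1 / cmod w ^ 3)"
proof -
  have zw: "cmod (z - w) \<ge> cmod w / 2"
    using norm_triangle_ineq2[of w z] assms by (simp add: norm_minus_commute)
  have nz: "z - w \<noteq> 0" using zw assms by auto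
  have w: "cmod w > 0" using assms by simp
  have "wp_term z w = z * (2 * w - z) / ((z - w)^2 * w^2)"
    using nz assms(3) by (simp add: wp_term_def divide_simps) (simp add: power2_eq_square algebra_simps)
  then have "cmod (wp_term z w) = cmod z * cmod (2 * w - z) / (cmod (z - w) ^ 2 * cmod w ^ 2)"
    by (simp add: norm_mult norm_divide norm_power)
  also have "\<dots> \<le> R * (5 / 2 * cmod w) / ((cmod w / 2) ^ 2 * cmod w ^ 2)"
  proof (intro frac_le mult_mono power_mono zw)
    show "cmod (2 * w - z) \<le> 5 / 2 * cmod w"
      using norm_triangle_ineq4[of "2 * w" z] assms by (simp add: norm_mult)
  qed (use assms w in auto)
  also have "\<dots> = 10 * R * (1 / cmod w ^ 3)" using w by (simp add: field_simps power2_eq_square power3_eq_cube)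
  finally show ?thesis .
qed

text \<open>Lattice points of modulus at least 2 R contribute no pole in the disc of radius R. The
  series over them converges uniformly there, so it is differentiated term by term, and the derived
  series converges as an unordered sum.\<close>

lemma wp_tail:
  assumes R: "R > 0" and A: "A \<subseteq> \<Lambda> - {0}" "\<And>w. w \<in> A \<Longrightarrow> cmod w \<ge> 2 * R"
  obtains S' where "\<And>z. z \<in> ball 0 R \<Longrightarrow> (wp_term z has_sum (\<Sum>\<^sub>\<infinity>w\<in>A. wp_term z w)) A"
    "\<And>z. z \<in> ball 0 R \<Longrightarrow> ((\<lambda>z. \<Sum>\<^sub>\<infinity>w\<in>A. wp_term z w) has_field_derivative S' z) (at z)"
    "\<And>z. z \<in> ball 0 R \<Longrightarrow> ((\<lambda>w. - 2 / (z - w) ^ 3) has_sum S' z) A"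
proof -
  have sum: "(\<lambda>w. 10 * R * (1 / cmod w ^ 3)) summable_on A"
    using A(1) by (intro summable_on_cmult_right summable_on_subset[OF lattice_cube_summable]) auto
  have bound: "cmod (wp_term z w) \<le> 10 * R * (1 / cmod w ^ 3)" if "w \<in> A" "z \<in> cball 0 R" for w z
    using that A R by (intro wp_term_bound) auto
  have ul: "uniform_limit (cball 0 R) (\<lambda>B z. \<Sum>w\<in>B. wp_term z w) (\<lambda>z. \<Sum>\<^sub>\<infinity>w\<in>A. wp_term z w) (finite_subsets_at_top A)"
    by (rule Weierstrass_m_test_general[OF bound sum])
  have ne: "z - w \<noteq> 0" if "w \<in> A" "z \<in> cball 0 R" for w z
    using that A(2)[OF that(1)] R by auto
  have D: "((\<lambda>z. wp_term z w) has_field_derivative (- 2 / (z - w) ^ 3)) (at z)" if "w \<in> A" "z \<in> cball 0 R" for w z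
    unfolding wp_term_def
    using DERIV_diff[OF inverse_square_has_derivative[of z w] DERIV_const] ne[OF that] by simp
  have "\<forall>\<^sub>F B in finite_subsets_at_top A. continuous_on (cball 0 R) (\<lambda>z. \<Sum>w\<in>B. wp_term z w) \<and>
      (\<forall>z\<in>ball 0 R. ((\<lambda>z. \<Sum>w\<in>B. wp_term z w) has_field_derivative (\<Sum>w\<in>B. - 2 / (z - w) ^ 3)) (at z))"
  proof (intro eventually_finite_subsets_at_top_weakI conjI ballI)
    fix B assume B: "finite B" "B \<subseteq> A"
    show "continuous_on (cball 0 R) (\<lambda>z. \<Sum>w\<in>B. wp_term z w)"
      using D B by (intro continuous_on_sum continuous_at_imp_continuous_on) (meson DERIV_isCont subsetD)
    fix z :: complex assume "z \<in> ball 0 R"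
    then show "((\<lambda>z. \<Sum>w\<in>B. wp_term z w) has_field_derivative (\<Sum>w\<in>B. - 2 / (z - w) ^ 3)) (at z)"
      using B by (intro DERIV_sum D) auto
  qed
  from has_complex_derivative_uniform_limit[OF this ul finite_subsets_at_top_neq_bot R]
  obtain S' where S': "\<And>z. z \<in> ball 0 R \<Longrightarrow> ((\<lambda>z. \<Sum>\<^sub>\<infinity>w\<in>A. wp_term z w) has_field_derivative S' z) (at z) \<and>
      ((\<lambda>B. \<Sum>w\<in>B. - 2 / (z - w) ^ 3) \<longlongrightarrow> S' z) (finite_subsets_at_top A)" by metis
  show ?thesis
  proof
    fix z :: complex assume z: "z \<in> ball 0 R"
    show "((\<lambda>z. \<Sum>\<^sub>\<infinity>w\<in>A. wp_term z w) has_field_derivative S' z) (at z)"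
      "((\<lambda>w. - 2 / (z - w) ^ 3) has_sum S' z) A"
      using S'[OF z] by (auto simp: has_sum_def)
    show "(wp_term z has_sum (\<Sum>\<^sub>\<infinity>w\<in>A. wp_term z w)) A"
    proof -
      have "(\<lambda>w. cmod (wp_term z w)) summable_on A"
        by (rule Infinite_Sum.abs_summable_on_comparison_test'[OF sum]) (use z bound in auto)
      then show ?thesis by (intro has_sum_infsum) (rule Infinite_Sum.abs_summable_summable)
    qed
  qed
qed

lemma wp_eq: "wp z = 1 / z ^ 2 + (\<Sum>\<^sub>\<infinity>w\<in>\<Lambda> - {0}. wp_term z w)"
  by (simp add: weierstrass_p_def wp_term_def)

lemma wp_derivative_aux:
  assumes z: "z \<notin> \<Lambda>"
  obtains D where "(wp has_field_derivative D) (at z)" "((\<lambda>w. - 2 / (z - w) ^ 3) has_sum D) \<Lambda>"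
proof -
  define R where "R = cmod z + 1"
  have R: "R > 0" "z \<in> ball 0 R" by (auto simp: R_def add_nonneg_pos)
  define F where "F = {w \<in> \<Lambda> - {0}. cmod w < 2 * R}"
  define A where "A = {w \<in> \<Lambda> - {0}. cmod w \<ge> 2 * R}"
  have fin: "finite F" by (rule finite_subset[OF _ finite_lattice_le[of "2 * R"]]) (auto simp: F_def)
  have FA: "F \<union> A = \<Lambda> - {0}" "F \<inter> A = {}" by (auto simp: F_def A_def)
  obtain S' where S': "\<And>z. z \<in> ball 0 R \<Longrightarrow> (wp_term z has_sum (\<Sum>\<^sub>\<infinity>w\<in>A. wp_term z w)) A"
    "\<And>z. z \<in> ball 0 R \<Longrightarrow> ((\<lambda>z. \<Sum>\<^sub>\<infinity>w\<in>A. wp_term z w) has_field_derivative S' z) (at z)"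
    "\<And>z. z \<in> ball 0 R \<Longrightarrow> ((\<lambda>w. - 2 / (z - w) ^ 3) has_sum S' z) A"
    by (rule wp_tail[OF R(1), of A]) (auto simp: A_def)
  have wp: "wp u = 1 / u ^ 2 + (\<Sum>w\<in>F. wp_term u w) + (\<Sum>\<^sub>\<infinity>w\<in>A. wp_term u w)" if "u \<in> ball 0 R - \<Lambda>" for u
  proof -
    have "(wp_term u has_sum ((\<Sum>w\<in>F. wp_term u w) + (\<Sum>\<^sub>\<infinity>w\<in>A. wp_term u w))) (F \<union> A)"
      using that fin by (intro has_sum_Un_disjoint FA S' has_sum_finite) auto
    then show ?thesis unfolding FA wp_eq by (simp add: infsumI)
  qed
  have "z \<noteq> 0" using z by auto
  have D1: "((\<lambda>u. 1 / u ^ 2) has_field_derivative (- 2 / (z - 0) ^ 3)) (at z)"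
    using inverse_square_has_derivative[OF \<open>z \<noteq> 0\<close>] by simp
  have D2: "((\<lambda>u. \<Sum>w\<in>F. wp_term u w) has_field_derivative (\<Sum>w\<in>F. - 2 / (z - w) ^ 3)) (at z)"
  proof (intro DERIV_sum)
    fix w assume "w \<in> F"
    then have "z \<noteq> w" using z by (auto simp: F_def)
    then show "((\<lambda>u. wp_term u w) has_field_derivative (- 2 / (z - w) ^ 3)) (at z)"
      unfolding wp_term_def
      using DERIV_diff[OF inverse_square_has_derivative DERIV_const] by simp
  qed
  show ?thesis
  proof
    have "open (ball 0 R - \<Lambda>)" using lattice_closed by blast
    then show "(wp has_field_derivative (- 2 / (z - 0) ^ 3 + (\<Sum>w\<in>F. - 2 / (z - w) ^ 3) + S' z)) (at z)"
      by (rule has_field_derivative_transform_within_open[OF DERIV_add[OF DERIV_add[OF D1 D2] S'(2)[OF R(2)]]])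
        (use z R wp in auto)
    have "((\<lambda>w. - 2 / (z - w) ^ 3) has_sum ((\<Sum>w\<in>F. - 2 / (z - w) ^ 3) + S' z)) (F \<union> A)"
      using R(2) fin by (intro has_sum_Un_disjoint FA S' has_sum_finite) auto
    then have "((\<lambda>w. - 2 / (z - w) ^ 3) has_sum (- 2 / (z - 0) ^ 3 + ((\<Sum>w\<in>F. - 2 / (z - w) ^ 3) + S' z))) (insert 0 (\<Lambda> - {0}))"
      unfolding FA by (intro has_sum_insert) auto
    moreover have "insert 0 (\<Lambda> - {0}) = \<Lambda>" by auto
    ultimately show "((\<lambda>w. - 2 / (z - w) ^ 3) has_sum (- 2 / (z - 0) ^ 3 + (\<Sum>w\<in>F. - 2 / (z - w) ^ 3) + S' z)) \<Lambda>"
      by (simp add: algebra_simps)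
  qed
qed

abbreviation "wp' \<equiv> deriv wp"

lemma wp_has_derivative: "z \<notin> \<Lambda> \<Longrightarrow> (wp has_field_derivative wp' z) (at z)"
  and wp'_has_sum: "z \<notin> \<Lambda> \<Longrightarrow> ((\<lambda>w. - 2 / (z - w) ^ 3) has_sum wp' z) \<Lambda>"
  using wp_derivative_aux[of z] DERIV_imp_deriv by metis+

lemma wp_holomorphic: "wp holomorphic_on - \<Lambda>"
  using wp_has_derivative lattice_compl_open by (auto simp: holomorphic_on_open)

lemma wp'_holomorphic: "wp' holomorphic_on - \<Lambda>"
  by (intro holomorphic_deriv wp_holomorphic lattice_compl_open)

lemma wp_even: "wp (- z) = wp z"
proof -
  have "(\<Sum>\<^sub>\<infinity>w\<in>\<Lambda> - {0}. wp_term (- z) w) = (\<Sum>\<^sub>\<infinity>w\<in>\<Lambda> - {0}. wp_term z w)"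
    by (rule infsum_reindex_bij_witness[of _ uminus uminus])
      (auto simp: wp_term_def power2_eq_square square_diff_square_factored algebra_simps)
  then show ?thesis by (simp add: wp_eq)
qed

lemma wp'_odd: assumes "z \<notin> \<Lambda>" shows "wp' (- z) = - wp' z"
proof -
  have "((\<lambda>z. wp (- z)) has_field_derivative wp' (- z) * (- 1)) (at z)"
    by (rule DERIV_chain2[OF wp_has_derivative]) (use assms in \<open>auto intro!: derivative_eq_intros\<close>)
  then have "(wp has_field_derivative - wp' (- z)) (at z)" by (simp add: wp_even)
  then show ?thesis using wp_has_derivative[OF assms] DERIV_unique by force
qed

lemma wp'_periodic: assumes "z \<notin> \<Lambda>" "l \<in> \<Lambda>" shows "wp' (z + l) = wp' z"
proof -
  have "z + l \<notin> \<Lambda>" using assms lattice_add_iff by blast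
  then have "((\<lambda>w. - 2 / (z + l - w) ^ 3) has_sum wp' (z + l)) \<Lambda>" by (rule wp'_has_sum)
  also have "((\<lambda>w. - 2 / (z + l - w) ^ 3) has_sum wp' (z + l)) \<Lambda> = ((\<lambda>w. - 2 / (z - w) ^ 3) has_sum wp' (z + l)) \<Lambda>"
    by (rule has_sum_reindex_bij_witness[of _ "\<lambda>w. w + l" "\<lambda>w. w - l"])
      (use assms in \<open>auto intro: lattice_add lattice_diff simp: algebra_simps\<close>)
  finally have "((\<lambda>w. - 2 / (z - w) ^ 3) has_sum wp' (z + l)) \<Lambda>" .
  then show ?thesis using wp'_has_sum[OF assms(1)] has_sum_unique by blast
qed

text \<open>The difference wp(z + l) - wp(z) has derivative 0 and is a constant c on the connected
  complement of the lattice. Evaluating at - (z + l) and using evenness gives c = - c. The point - l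
  / 2 would not do, since it may lie in the lattice.\<close>

lemma wp_periodic: assumes "z \<notin> \<Lambda>" "l \<in> \<Lambda>" shows "wp (z + l) = wp z"
proof -
  have const: "\<exists>c. \<forall>z. z \<notin> \<Lambda> \<longrightarrow> wp (z + l) - wp z = c" if l: "l \<in> \<Lambda>" for l
  proof -
    have D: "((\<lambda>z. wp (z + l) - wp z) has_field_derivative 0) (at z)" if z: "z \<in> - \<Lambda>" for z
    proof -
      have "((\<lambda>z. wp (z + l)) has_field_derivative wp' (z + l) * 1) (at z)"
        by (rule DERIV_chain2[OF wp_has_derivative])
          (use z l lattice_add_iff in \<open>auto intro!: derivative_eq_intros\<close>)
      from DERIV_diff[OF this wp_has_derivative[of z]] show ?thesis
        using wp'_periodic[of z l] z l by simp
    qed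
    have "(\<lambda>z. wp (z + l) - wp z) constant_on - \<Lambda>"
      by (rule DERIV_zero_connected_constant_on[OF lattice_compl_connected lattice_compl_open, of "{}"])
        (use D in \<open>auto intro!: continuous_at_imp_continuous_on DERIV_isCont\<close>)
    then show ?thesis unfolding constant_on_def by blast
  qed
  obtain c where c: "\<And>z. z \<notin> \<Lambda> \<Longrightarrow> wp (z + l) - wp z = c" using const[OF assms(2)] by blast
  have "wp (- (z + l) + l) - wp (- (z + l)) = c"
    using assms by (intro c) (simp only: lattice_minus_iff lattice_add_iff not_False_eq_True)
  moreover have "- (z + l) + l = - z" by simp
  ultimately have "wp z - wp (z + l) = c" by (simp only: wp_even)
  moreover have "wp (z + l) - wp z = c" using c assms by blast
  ultimately have "(wp (z + l) - wp z) + (wp (z + l) - wp z) = 0" by (simp add: algebra_simps)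
  then show ?thesis by (simp flip: mult_2)
qed

end
subsection \<open>Expansion at the origin\<close>

text \<open>The expansion of 1 / (z - w)^2 in powers of z up to the fourth, with the remainder in
  closed form.\<close>

lemma wp_term_expansion:
  assumes "z \<noteq> w" "w \<noteq> 0"
  shows "wp_term z w - (2 * z * (1 / w ^ 3) + 3 * z ^ 2 * (1 / w ^ 4) + 4 * z ^ 3 * (1 / w ^ 5) + 5 * z ^ 4 * (1 / w ^ 6)) =
    z ^ 5 * ((6 * w - 5 * z) / (w ^ 6 * (z - w) ^ 2))"
proof -
  define u where "u = 1 / (z - w)"
  define v where "v = 1 / w"
  have u: "(z - w) * u = 1" and v: "w * v = 1" using assms by (simp_all add: u_def v_def)
  have v': "w ^ 6 * v ^ 6 = 1" "w ^ 4 * v ^ 6 = v ^ 2" "w ^ 3 * v ^ 6 = v ^ 3" "w ^ 2 * v ^ 6 = v ^ 4" "w * v ^ 6 = v ^ 5"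
  proof -
    have "w ^ k * v ^ k = 1" for k unfolding power_mult_distrib[symmetric] v by simp
    then have "w ^ k * v ^ (k + j) = v ^ j" for k j by (simp add: power_add mult.assoc[symmetric])
    from this[of 6 0] this[of 4 2] this[of 3 3] this[of 2 4] this[of 1 5]
    show "w ^ 6 * v ^ 6 = 1" "w ^ 4 * v ^ 6 = v ^ 2" "w ^ 3 * v ^ 6 = v ^ 3" "w ^ 2 * v ^ 6 = v ^ 4" "w * v ^ 6 = v ^ 5" by simp_all
  qed
  have u': "(z - w) ^ 2 * u ^ 2 = 1" unfolding power_mult_distrib[symmetric] u by simp
  have "w ^ 6 - (z - w) ^ 2 * (w ^ 4 + 2 * z * w ^ 3 + 3 * z ^ 2 * w ^ 2 + 4 * z ^ 3 * w + 5 * z ^ 4) = z ^ 5 * (6 * w - 5 * z)"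
    by (simp add: algebra_simps eval_nat_numeral)
  then have "z ^ 5 * (6 * w - 5 * z) * (v ^ 6 * u ^ 2) =
      (w ^ 6 - (z - w) ^ 2 * (w ^ 4 + 2 * z * w ^ 3 + 3 * z ^ 2 * w ^ 2 + 4 * z ^ 3 * w + 5 * z ^ 4)) * (v ^ 6 * u ^ 2)" by simp
  also have "\<dots> = (w ^ 6 * v ^ 6) * u ^ 2 - ((z - w) ^ 2 * u ^ 2) * ((w ^ 4 * v ^ 6) + 2 * z * (w ^ 3 * v ^ 6) +
      3 * z ^ 2 * (w ^ 2 * v ^ 6) + 4 * z ^ 3 * (w * v ^ 6) + 5 * z ^ 4 * v ^ 6)"
    by (simp only: algebra_simps)
  also have "\<dots> = u ^ 2 - (v ^ 2 + 2 * z * v ^ 3 + 3 * z ^ 2 * v ^ 4 + 4 * z ^ 3 * v ^ 5 + 5 * z ^ 4 * v ^ 6)"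
    unfolding v' u' by simp
  finally show ?thesis
    by (simp add: wp_term_def u_def v_def power_one_over mult.commute)
qed

context hexagonal begin

abbreviation "G k \<equiv> (\<Sum>\<^sub>\<infinity>w\<in>\<Lambda> - {0}. 1 / w ^ k)"

lemma lattice_power_summable:
  assumes "k \<ge> 3" shows "(\<lambda>w. 1 / cmod w ^ k) summable_on \<Lambda> - {0}"
proof -
  obtain d where d: "d > 0" "\<And>w. w \<in> \<Lambda> \<Longrightarrow> w \<noteq> 0 \<Longrightarrow> cmod w \<ge> d" using lattice_min_norm by blast
  show ?thesis
  proof (rule summable_on_comparison_test)
    show "(\<lambda>w. (1 / d ^ (k - 3)) * (1 / cmod w ^ 3)) summable_on \<Lambda> - {0}"
      by (intro summable_on_cmult_right summable_on_subset[OF lattice_cube_summable]) auto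
    fix w assume w: "w \<in> \<Lambda> - {0}"
    then have dw: "d \<le> cmod w" using d by auto
    have "1 / cmod w ^ k = 1 / (cmod w ^ (k - 3) * cmod w ^ 3)"
      using assms by (simp flip: power_add)
    also have "\<dots> \<le> 1 / (d ^ (k - 3) * cmod w ^ 3)"
      using d(1) dw w by (intro divide_left_mono mult_right_mono power_mono mult_pos_pos zero_less_power) auto
    finally show "1 / cmod w ^ k \<le> (1 / d ^ (k - 3)) * (1 / cmod w ^ 3)" by simp
  qed auto
qed

lemma G_has_sum: assumes "k \<ge> 3" shows "((\<lambda>w. 1 / w ^ k) has_sum G k) (\<Lambda> - {0})"
proof -
  have "(\<lambda>w. cmod (1 / w ^ k)) summable_on \<Lambda> - {0}"
    using lattice_power_summable[OF assms] by (simp add: norm_divide norm_power)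
  then show ?thesis by (intro has_sum_infsum) (rule Infinite_Sum.abs_summable_summable)
qed

lemma G_odd: assumes "odd k" shows "G k = 0"
proof -
  have "G k = (\<Sum>\<^sub>\<infinity>w\<in>\<Lambda> - {0}. - (1 / w ^ k))"
    by (rule infsum_reindex_bij_witness[of _ uminus uminus]) (use assms in auto)
  then show ?thesis by (simp add: infsum_uminus)
qed

text \<open>Multiplication by the cube root of unity permutes the lattice and multiplies the fourth
  power of w by that root, so the sum equals itself times a factor other than 1.\<close>

lemma G_4: "G 4 = 0"
proof -
  have h: "hex_unit * (hex_unit * (hex_unit * w)) = w" for w
    using hex_unit_cube by (simp add: power3_eq_cube mult.assoc[symmetric])
  have h4: "(hex_unit * w) ^ 4 = hex_unit * w ^ 4" for w
  proof -
    have "u ^ 4 = u ^ 3 * u" for u :: complex by (simp add: eval_nat_numeral)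
    then have "hex_unit ^ 4 = hex_unit" by (simp only: hex_unit_cube mult_1_left)
    then show ?thesis by (simp only: power_mult_distrib)
  qed
  have "G 4 = (\<Sum>\<^sub>\<infinity>w\<in>\<Lambda> - {0}. hex_unit * (1 / w ^ 4))"
  proof (rule infsum_reindex_bij_witness[of _ "\<lambda>w. hex_unit * (hex_unit * w)" "\<lambda>w. hex_unit * w"])
    fix w assume "w \<in> \<Lambda> - {0}"
    show "hex_unit * (1 / (hex_unit * w) ^ 4) = 1 / w ^ 4" unfolding h4 by simp
  qed (use h lattice_hex in auto)
  also have "\<dots> = hex_unit * G 4" by (rule infsum_cmult_right')
  finally have "(hex_unit - 1) * G 4 = 0" by (simp add: algebra_simps)
  moreover have "hex_unit - 1 \<noteq> 0" using hex_unit_Im by (metis eq_iff_diff_eq_0 less_irrefl one_complex.sel(2))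
  ultimately show ?thesis by (simp only: mult_eq_0_iff) blast
qed

definition reg :: "complex \<Rightarrow> complex" where
  "reg z = (\<Sum>\<^sub>\<infinity>w\<in>\<Lambda> - {0}. wp_term z w)"

lemma wp_reg: "wp z = 1 / z ^ 2 + reg z"
  by (simp add: wp_eq reg_def)

text \<open>Of the coefficients up to z^4, those with \<open>G 3\<close> and \<open>G 5\<close>
  vanish by oddness and the one with \<open>G 4\<close> by the hexagonal symmetry; only 5 G 6 is
  left.\<close>

lemma reg_properties:
  obtains d B where "d > 0" "reg holomorphic_on ball 0 d" "ball 0 d \<inter> \<Lambda> = {0}"
    "\<And>z. z \<in> ball 0 d \<Longrightarrow> cmod (reg z - 5 * z ^ 4 * G 6) \<le> B * cmod z ^ 5"
proof -
  obtain d where d: "d > 0" "\<And>w. w \<in> \<Lambda> \<Longrightarrow> w \<noteq> 0 \<Longrightarrow> cmod w \<ge> d" using lattice_min_norm by blast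
  obtain S' where S': "\<And>z. z \<in> ball 0 (d / 2) \<Longrightarrow> (wp_term z has_sum (\<Sum>\<^sub>\<infinity>w\<in>\<Lambda> - {0}. wp_term z w)) (\<Lambda> - {0})"
    "\<And>z. z \<in> ball 0 (d / 2) \<Longrightarrow> ((\<lambda>z. \<Sum>\<^sub>\<infinity>w\<in>\<Lambda> - {0}. wp_term z w) has_field_derivative S' z) (at z)"
    "\<And>z. z \<in> ball 0 (d / 2) \<Longrightarrow> ((\<lambda>w. - 2 / (z - w) ^ 3) has_sum S' z) (\<Lambda> - {0})"
    by (rule wp_tail[of "d / 2" "\<Lambda> - {0}"]) (use d in auto)
  \<comment> \<open>For |z| \<le> |w| / 2 the numerator 6 w - 5 z of the remainder is at most 17/2
    |w|, and |z - w|^2 is at least |w|^2 / 4; the quotient of the two constants is 34.\<close>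
  define B where "B = (\<Sum>\<^sub>\<infinity>w\<in>\<Lambda> - {0}. 34 * (1 / cmod w ^ 7))"
  have Bsum: "((\<lambda>w. 34 * (1 / cmod w ^ 7)) has_sum B) (\<Lambda> - {0})"
    unfolding B_def by (intro has_sum_infsum summable_on_cmult_right lattice_power_summable) auto
  show ?thesis
  proof
    show "d / 2 > 0" using d by simp
    show "reg holomorphic_on ball 0 (d / 2)"
      using S'(2) unfolding reg_def[abs_def] by (meson holomorphic_on_open open_ball)
    show "ball 0 (d / 2) \<inter> \<Lambda> = {0}" using d by force
    fix z :: complex assume z: "z \<in> ball 0 (d / 2)"
    have "((\<lambda>w. wp_term z w - (2 * z * (1 / w ^ 3) + 3 * z ^ 2 * (1 / w ^ 4) + 4 * z ^ 3 * (1 / w ^ 5) + 5 * z ^ 4 * (1 / w ^ 6))) has_sum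
        (reg z - (2 * z * G 3 + 3 * z ^ 2 * G 4 + 4 * z ^ 3 * G 5 + 5 * z ^ 4 * G 6))) (\<Lambda> - {0})"
      unfolding reg_def by (intro has_sum_diff has_sum_add has_sum_cmult_right G_has_sum S' z) auto
    then have "((\<lambda>w. wp_term z w - (2 * z * (1 / w ^ 3) + 3 * z ^ 2 * (1 / w ^ 4) + 4 * z ^ 3 * (1 / w ^ 5) + 5 * z ^ 4 * (1 / w ^ 6))) has_sum
        (reg z - 5 * z ^ 4 * G 6)) (\<Lambda> - {0})"
      by (simp add: G_odd G_4)
    moreover have "((\<lambda>w. cmod z ^ 5 * (34 * (1 / cmod w ^ 7))) has_sum (cmod z ^ 5 * B)) (\<Lambda> - {0})"
      by (intro has_sum_cmult_right Bsum)
    ultimately have "cmod (reg z - 5 * z ^ 4 * G 6) \<le> cmod z ^ 5 * B"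
    proof (rule norm_infsum_le)
      fix w assume w: "w \<in> \<Lambda> - {0}"
      then have dw: "cmod w \<ge> d" "cmod w > 0" using d by auto
      have zw: "cmod z \<le> cmod w / 2" using z dw by simp
      then have zw2: "cmod w / 2 \<le> cmod (z - w)"
        using norm_triangle_ineq2[of w z] by (simp add: norm_minus_commute)
      then have ne: "z \<noteq> w" "w \<noteq> 0" using dw by auto
      have "cmod (6 * w - 5 * z) \<le> 17 / 2 * cmod w"
        using norm_triangle_ineq4[of "6 * w" "5 * z"] zw by (simp add: norm_mult)
      then have "cmod (6 * w - 5 * z) / (cmod w ^ 6 * cmod (z - w) ^ 2) \<le> (17 / 2 * cmod w) / (cmod w ^ 6 * (cmod w / 2) ^ 2)"
        using dw zw2 by (intro frac_le mult_mono power_mono) auto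
      also have "\<dots> = 34 * (1 / cmod w ^ 7)" using dw by (simp add: field_simps eval_nat_numeral)
      finally have "cmod z ^ 5 * (cmod (6 * w - 5 * z) / (cmod w ^ 6 * cmod (z - w) ^ 2)) \<le> cmod z ^ 5 * (34 * (1 / cmod w ^ 7))"
        by (intro mult_left_mono) auto
      then show "cmod (wp_term z w - (2 * z * (1 / w ^ 3) + 3 * z ^ 2 * (1 / w ^ 4) + 4 * z ^ 3 * (1 / w ^ 5) + 5 * z ^ 4 * (1 / w ^ 6)))
          \<le> cmod z ^ 5 * (34 * (1 / cmod w ^ 7))"
        unfolding wp_term_expansion[OF ne] by (simp add: norm_mult norm_divide norm_power)
    qed
    then show "cmod (reg z - 5 * z ^ 4 * G 6) \<le> B * cmod z ^ 5" by (simp add: mult.commute)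
  qed
qed

lemma wp_near_0:
  obtains d Q where "d > 0" "ball 0 d \<inter> \<Lambda> = {0}" "Q holomorphic_on ball 0 d" "Q 0 = 5 * G 6"
    "\<And>z. z \<in> ball 0 d \<Longrightarrow> z \<noteq> 0 \<Longrightarrow> wp z = 1 / z ^ 2 + z ^ 4 * Q z"
    "\<And>z. z \<in> ball 0 d \<Longrightarrow> z \<noteq> 0 \<Longrightarrow> wp' z = - 2 / z ^ 3 + 4 * z ^ 3 * Q z + z ^ 4 * deriv Q z"
proof -
  obtain d B where d: "d > 0" "reg holomorphic_on ball 0 d" "ball 0 d \<inter> \<Lambda> = {0}"
    and B: "\<And>z. z \<in> ball 0 d \<Longrightarrow> cmod (reg z - 5 * z ^ 4 * G 6) \<le> B * cmod z ^ 5"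
    by (rule reg_properties) (rule that)
  define Q where "Q z = (if z = 0 then 5 * G 6 else reg z / z ^ 4)" for z
  have "((\<lambda>z. reg z / z ^ 4 - 5 * G 6) \<longlongrightarrow> 0) (at 0)"
  proof (rule Lim_null_comparison)
    show "\<forall>\<^sub>F z in at 0. cmod (reg z / z ^ 4 - 5 * G 6) \<le> B * cmod z"
      using eventually_at_ball'[OF d(1), of 0 UNIV]
    proof eventually_elim
      case (elim z)
      then have z: "z \<in> ball 0 d" "z \<noteq> 0" by auto
      have "reg z / z ^ 4 - 5 * G 6 = (reg z - 5 * z ^ 4 * G 6) / z ^ 4" using z(2) by (simp add: field_simps)
      then have "cmod (reg z / z ^ 4 - 5 * G 6) = cmod (reg z - 5 * z ^ 4 * G 6) / cmod z ^ 4"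
        by (simp only: norm_divide norm_power)
      also have "\<dots> \<le> (B * cmod z ^ 5) / cmod z ^ 4" by (intro divide_right_mono B z) auto
      also have "\<dots> = B * cmod z" using z(2) by (simp add: eval_nat_numeral)
      finally show ?case .
    qed
    show "((\<lambda>z. B * cmod z) \<longlongrightarrow> 0) (at 0)" by (auto intro!: tendsto_eq_intros)
  qed
  then have lim: "((\<lambda>z. reg z / z ^ 4) \<longlongrightarrow> 5 * G 6) (at 0)" by (simp add: LIM_zero_iff)
  have Q: "Q holomorphic_on ball 0 d"
    unfolding Q_def[abs_def]
    by (rule removable_singularity[OF _ open_ball lim])
      (auto intro!: holomorphic_intros holomorphic_on_subset[OF d(2)])
  have eq: "wp z = 1 / z ^ 2 + z ^ 4 * Q z" if "z \<noteq> 0" for z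
    using that by (simp add: wp_reg Q_def)
  have "wp' z = - 2 / z ^ 3 + 4 * z ^ 3 * Q z + z ^ 4 * deriv Q z" if z: "z \<in> ball 0 d" "z \<noteq> 0" for z
  proof (rule DERIV_imp_deriv)
    have 1: "((\<lambda>z. 1 / z ^ 2) has_field_derivative - 2 / z ^ 3) (at z)"
      using inverse_square_has_derivative[of z 0] z(2) by simp
    have 2: "((\<lambda>z. z ^ 4 * Q z) has_field_derivative 4 * z ^ 3 * Q z + z ^ 4 * deriv Q z) (at z)"
      by (rule derivative_eq_intros refl holomorphic_derivI[OF Q open_ball z(1)])+ simp
    have "((\<lambda>z. 1 / z ^ 2 + z ^ 4 * Q z) has_field_derivative - 2 / z ^ 3 + (4 * z ^ 3 * Q z + z ^ 4 * deriv Q z)) (at z)"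
      by (rule DERIV_add[OF 1 2])
    then show "(wp has_field_derivative - 2 / z ^ 3 + 4 * z ^ 3 * Q z + z ^ 4 * deriv Q z) (at z)"
      by (rule has_field_derivative_transform_within_open[of _ _ _ "- {0}", THEN DERIV_cong]) (use z(2) eq in auto)
  qed
  then show ?thesis using that d(1,3) Q eq by (simp add: Q_def)
qed

text \<open>As \<open>wp\<close> is z^(-2) + O(z^4), all negative powers of z cancel in the
  difference, which tends to - 28 Q(0) = - 140 G 6 at 0. An elliptic function with a finite limit at
  the lattice points is constant.\<close>

lemma wp_ode:
  assumes "z \<notin> \<Lambda>" shows "(wp' z)\<^sup>2 = 4 * wp z ^ 3 - 140 * G 6"
proof -
  obtain d Q where d: "d > 0" "ball 0 d \<inter> \<Lambda> = {0}" and Q: "Q holomorphic_on ball 0 d" "Q 0 = 5 * G 6"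
    and w: "\<And>z. z \<in> ball 0 d \<Longrightarrow> z \<noteq> 0 \<Longrightarrow> wp z = 1 / z ^ 2 + z ^ 4 * Q z"
    and w': "\<And>z. z \<in> ball 0 d \<Longrightarrow> z \<noteq> 0 \<Longrightarrow> wp' z = - 2 / z ^ 3 + 4 * z ^ 3 * Q z + z ^ 4 * deriv Q z"
    by (rule wp_near_0) (rule that)
  have "(wp' z)\<^sup>2 - 4 * wp z ^ 3 = - 140 * G 6"
  proof (rule elliptic_constant[OF _ _ _ assms])
    show "(\<lambda>z. (wp' z)\<^sup>2 - 4 * wp z ^ 3) holomorphic_on - \<Lambda>"
      by (intro holomorphic_intros wp_holomorphic wp'_holomorphic)
    show "(wp' (z + u))\<^sup>2 - 4 * wp (z + u) ^ 3 = (wp' z)\<^sup>2 - 4 * wp z ^ 3" if "z \<notin> \<Lambda>" "u \<in> \<Lambda>" for z u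
      using that by (simp add: wp_periodic wp'_periodic)
    let ?g = "\<lambda>z. - 28 * Q z - 4 * z * deriv Q z + (4 * z ^ 3 * Q z + z ^ 4 * deriv Q z)\<^sup>2 - 12 * z ^ 6 * (Q z)\<^sup>2 - 4 * z ^ 12 * Q z ^ 3"
    have "isCont Q 0" "isCont (deriv Q) 0"
      using Q(1) d(1) by (auto intro!: field_differentiable_imp_continuous_at holomorphic_on_imp_differentiable_at[of _ "ball 0 d"] holomorphic_deriv)
    then have "(?g \<longlongrightarrow> - 28 * Q 0 - 4 * 0 * deriv Q 0 + (4 * 0 ^ 3 * Q 0 + 0 ^ 4 * deriv Q 0)\<^sup>2 - 12 * 0 ^ 6 * (Q 0)\<^sup>2 - 4 * 0 ^ 12 * Q 0 ^ 3) (at 0)"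
      by (intro tendsto_intros) (auto simp: isCont_def)
    then have "(?g \<longlongrightarrow> - 140 * G 6) (at 0)" by (simp add: Q(2))
    moreover have "\<forall>\<^sub>F z in at 0. ?g z = (wp' z)\<^sup>2 - 4 * wp z ^ 3"
      using eventually_at_ball'[OF d(1), of 0 UNIV]
    proof eventually_elim
      case (elim z)
      then have z: "z \<in> ball 0 d" "z \<noteq> 0" by auto
      define p where "p = 1 / z"
      have zp: "z * p = 1" using z(2) by (simp add: p_def)
      have zp': "z ^ k * p ^ k = 1" for k unfolding power_mult_distrib[symmetric] zp by simp
      define a where "a = 4 * z ^ 3 * Q z + z ^ 4 * deriv Q z"
      define b where "b = z ^ 4 * Q z"
      have "(wp' z)\<^sup>2 - 4 * wp z ^ 3 = (- 2 * p ^ 3 + a)\<^sup>2 - 4 * (p ^ 2 + b) ^ 3"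
      proof -
        have "wp z = p ^ 2 + b" using w[OF z] by (simp add: b_def p_def power_one_over)
        moreover have "wp' z = - 2 * p ^ 3 + a" using w'[OF z] by (simp add: a_def p_def power_one_over)
        ultimately show ?thesis by (simp only:)
      qed
      also have "\<dots> = - 4 * (a * p ^ 3) + a\<^sup>2 - 12 * (b * p ^ 4) - 12 * (b\<^sup>2 * p\<^sup>2) - 4 * b ^ 3"
        by (simp add: algebra_simps eval_nat_numeral)
      also have "a * p ^ 3 = (z ^ 3 * p ^ 3) * (4 * Q z + z * deriv Q z)"
        by (simp add: a_def algebra_simps eval_nat_numeral)
      also have "b * p ^ 4 = (z ^ 4 * p ^ 4) * Q z" by (simp add: b_def)
      also have "b\<^sup>2 * p\<^sup>2 = (z ^ 2 * p ^ 2) * (z ^ 6 * (Q z)\<^sup>2)"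
        by (simp add: b_def algebra_simps eval_nat_numeral)
      also have "b ^ 3 = z ^ 12 * Q z ^ 3" by (simp add: b_def power_mult_distrib flip: power_mult)
      finally show ?case unfolding zp' a_def by (simp add: algebra_simps)
    qed
    ultimately show "((\<lambda>z. (wp' z)\<^sup>2 - 4 * wp z ^ 3) \<longlongrightarrow> - 140 * G 6) (at 0)"
      by (rule Lim_transform_eventually)
  qed
  then show ?thesis by (simp add: algebra_simps)
qed

lemma wp_at_0: "filterlim wp at_infinity (at 0)"
proof -
  obtain d Q where d: "d > 0" "ball 0 d \<inter> \<Lambda> = {0}" and Q: "Q holomorphic_on ball 0 d" "Q 0 = 5 * G 6"
    and w: "\<And>z. z \<in> ball 0 d \<Longrightarrow> z \<noteq> 0 \<Longrightarrow> wp z = 1 / z ^ 2 + z ^ 4 * Q z"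
    by (rule wp_near_0) (rule that)
  have "isCont Q 0"
    using Q(1) d(1) by (auto intro!: field_differentiable_imp_continuous_at holomorphic_on_imp_differentiable_at[of _ "ball 0 d"])
  then have "((\<lambda>z. 1 + z ^ 6 * Q z) \<longlongrightarrow> 1 + 0 ^ 6 * Q 0) (at 0)"
    by (intro tendsto_intros) (auto simp: isCont_def)
  moreover have "filterlim (\<lambda>z::complex. z ^ 2) (at 0) (at 0)"
    by (auto simp: filterlim_at eventually_at_filter intro!: tendsto_eq_intros)
  ultimately have "filterlim (\<lambda>z. (1 + z ^ 6 * Q z) / z ^ 2) at_infinity (at 0)"
    by (intro filterlim_divide_at_infinity) auto
  moreover have "\<forall>\<^sub>F z in at 0. (1 + z ^ 6 * Q z) / z ^ 2 = wp z"
    using eventually_at_ball'[OF d(1), of 0 UNIV]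
    by eventually_elim (auto simp: w add_divide_distrib eval_nat_numeral)
  ultimately show ?thesis by (rule filterlim_cong[OF refl refl, THEN iffD1, rotated])
qed

lemma wp_inverse_at_0: "((\<lambda>z. 1 / (wp z - a)) \<longlongrightarrow> 0) (at 0)"
  using tendsto_add_filterlim_at_infinity[OF tendsto_const[of "- a"] wp_at_0]
  by (intro tendsto_divide_0[OF tendsto_const]) simp

text \<open>If the value \<open>a\<close> were omitted, 1 / (wp - a) would be holomorphic and
  elliptic with limit 0 at the lattice points, hence 0.\<close>

lemma wp_surj: obtains z where "z \<notin> \<Lambda>" "wp z = a"
proof -
  have "\<exists>z. z \<notin> \<Lambda> \<and> wp z = a"
  proof (rule ccontr)
    assume no: "\<not> ?thesis"
    \<comment> \<open>A half period provides a point outside the lattice, at which the reciprocal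
      can be evaluated.\<close>
    have "2 * \<omega> * (1 / 4) \<notin> \<Lambda>"
    proof
      assume "2 * \<omega> * (1 / 4) \<in> \<Lambda>"
      then obtain m n where "2 * \<omega> * (1 / 4) = lat (m, n)" by (meson lat_cases)
      then have 0: "1 / 2 = of_int m * hex_unit + of_int n" using omega_nonzero by (simp add: lat_def)
      from arg_cong[OF 0, of Im] have "m = 0" using hex_unit_Im by simp
      with arg_cong[OF 0, of Re] have "1 / 2 = real_of_int n" by simp
      then show False by (metis Ints_of_int fraction_not_in_Ints[of 2 1, where 'a = real] of_int_1 of_int_numeral zero_neq_numeral one_dvd odd_one dvd_def numeral_One)
    qed
    then obtain z where z: "z \<notin> \<Lambda>" by blast
    have "1 / (wp z - a) = 0"
      by (rule elliptic_constant[OF _ _ wp_inverse_at_0 z])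
        (use no in \<open>auto intro!: holomorphic_intros wp_holomorphic simp: wp_periodic\<close>)
    then have "wp z = a" by simp
    with no z show False by blast
  qed
  then show ?thesis using that by blast
qed

text \<open>Otherwise the square of \<open>wp'\<close> would be 4 wp^3, and comparing orders of
  vanishing would leave no zero of \<open>wp\<close>, contrary to \<open>wp_surj\<close>.\<close>

lemma G_6_nonzero: "G 6 \<noteq> 0"
proof
  assume "G 6 = 0"
  then have ode: "(wp' z)\<^sup>2 = 4 * wp z ^ 3" if "z \<notin> \<Lambda>" for z
    using wp_ode[OF that] by simp
  obtain z0 where z0: "z0 \<notin> \<Lambda>" "wp z0 = 0" by (rule wp_surj)
  obtain z1 where z1: "z1 \<notin> \<Lambda>" "wp z1 = 1" by (rule wp_surj)
  have "wp z0 \<noteq> 0"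
  proof (rule no_zero_of_square_deriv_eq_cube[OF wp_holomorphic lattice_compl_open lattice_compl_connected, of "\<lambda>_. 4"])
    show "\<exists>z\<in>- \<Lambda>. wp z \<noteq> 0" using z1 by (intro bexI[of _ z1]) auto
  qed (use ode z0 in auto)
  then show False using z0 by simp
qed

lemma g2_eq: "weierstrass_g2 \<Lambda> = 0"
  by (simp add: weierstrass_g2_def G_4)

lemma g3_eq: "weierstrass_g3 \<Lambda> = 140 * G 6"
  by (simp add: weierstrass_g3_def)

end

lemma hexagonal_lattice_scale:
  assumes "a \<noteq> 0" shows "hexagonal_lattice a = (*) a ` hexagonal_lattice 1"
  by (auto simp: hexagonal_lattice_def image_iff)

text \<open>Scaling the lattice by \<omega> divides g3 by the sixth power of \<omega>, so \<omega>
  is a sixth root of g3 of the unscaled lattice.\<close>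

lemma hexagonal_lattice_normalised:
  obtains \<omega> where "\<omega> \<noteq> 0" "weierstrass_g3 (hexagonal_lattice \<omega>) = 1"
proof -
  interpret H1: hexagonal 1 by standard simp
  define c where "c = 140 * H1.G 6"
  define \<omega> where "\<omega> = exp (Ln c / 6)"
  have c: "c \<noteq> 0" using H1.G_6_nonzero by (simp add: c_def)
  have "\<omega> ^ 6 = exp (of_nat 6 * (Ln c / 6))" unfolding \<omega>_def by (simp only: exp_of_nat_mult)
  then have \<omega>6: "\<omega> ^ 6 = c" using c by simp
  have \<omega>: "\<omega> \<noteq> 0" by (simp add: \<omega>_def)
  have "(\<Sum>\<^sub>\<infinity>w\<in>hexagonal_lattice \<omega> - {0}. 1 / w ^ 6) = (\<Sum>\<^sub>\<infinity>w\<in>hexagonal_lattice 1 - {0}. 1 / c * (1 / w ^ 6))"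
    by (rule infsum_reindex_bij_witness[of _ "\<lambda>w. \<omega> * w" "\<lambda>w. w / \<omega>"])
      (use \<omega> c in \<open>auto simp: hexagonal_lattice_scale[OF \<omega>] power_mult_distrib power_divide \<omega>6\<close>)
  also have "\<dots> = 1 / c * H1.G 6" by (rule infsum_cmult_right')
  finally have "weierstrass_g3 (hexagonal_lattice \<omega>) = 140 * (1 / c * H1.G 6)"
    by (simp only: weierstrass_g3_def)
  also have "\<dots> = 1" using c by (simp add: c_def)
  finally have "weierstrass_g3 (hexagonal_lattice \<omega>) = 1" .
  with \<omega> show ?thesis using that by blast
qed

section \<open>Uniformisations of the affine curve\<close>

definition affine_curve :: "(complex \<times> complex) set" where
  "affine_curve = {(a, b). b\<^sup>2 = 4 * a ^ 3 - 1}"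

text \<open>For distinct cube roots of one number, a^2 + a c + c^2 vanishes; but for a and c this
  close to p it is close to 3 p^2.\<close>

lemma cube_root_near:
  fixes a c p :: complex
  assumes "a ^ 3 = c ^ 3" "cmod (a - p) < cmod p / 4" "cmod (c - p) < cmod p / 4"
  shows "a = c"
proof (rule ccontr)
  assume ne: "a \<noteq> c"
  have p: "p \<noteq> 0" using assms by auto
  have "(a - c) * (a\<^sup>2 + a * c + c\<^sup>2) = 0"
    using assms(1) by (simp add: algebra_simps power2_eq_square power3_eq_cube)
  then have 0: "a\<^sup>2 + a * c + c\<^sup>2 = 0" using ne by simp
  define s where "s = (a - p) / p"
  define t where "t = (c - p) / p"
  have st: "cmod s < 1 / 4" "cmod t < 1 / 4" using assms p by (simp_all add: s_def t_def norm_divide field_simps)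
  have a: "a = p * (1 + s)" and c: "c = p * (1 + t)" using p by (simp_all add: s_def t_def field_simps)
  have "p\<^sup>2 * (3 + (3 * s + 3 * t + s * s + s * t + t * t)) = 0"
    using 0 unfolding a c by (simp add: algebra_simps power2_eq_square)
  then have "3 + (3 * s + 3 * t + s * s + s * t + t * t) = 0" using p by simp
  then have "3 * s + 3 * t + s * s + s * t + t * t = - 3" by (simp only: add_eq_0_iff)
  then have "3 = cmod (3 * s + 3 * t + s * s + s * t + t * t)" by (simp only: norm_minus_cancel norm_numeral)
  also have "\<dots> \<le> cmod (3 * s) + cmod (3 * t) + cmod (s * s) + cmod (s * t) + cmod (t * t)"
    by (intro norm_triangle_le add_mono order_refl)
  also have "\<dots> = 3 * cmod s + 3 * cmod t + cmod s * cmod s + cmod s * cmod t + cmod t * cmod t"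
    by (simp add: norm_mult)
  also have "\<dots> \<le> 3 * (1 / 4) + 3 * (1 / 4) + (1 / 4) * (1 / 4) + (1 / 4) * (1 / 4) + (1 / 4) * (1 / 4)"
    using st by (intro add_mono mult_mono) auto
  finally show False by simp
qed

lemma square_root_near:
  fixes a c p :: complex
  assumes "a\<^sup>2 = c\<^sup>2" "cmod (a - p) < cmod p / 2" "cmod (c - p) < cmod p / 2"
  shows "a = c"
proof (rule ccontr)
  assume "a \<noteq> c"
  then have "a = - c" using assms(1) by (metis power2_eq_iff)
  then have "2 * p = - ((a - p) + (c - p))" by simp
  then have "cmod (2 * p) = cmod ((a - p) + (c - p))" by (metis norm_minus_cancel)
  also have "\<dots> \<le> cmod (a - p) + cmod (c - p)" by (rule norm_triangle_ineq)
  finally show False using assms(2,3) norm_ge_zero[of p] by (simp add: norm_mult)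
qed

text \<open>On the curve, \<open>a / b\<close> is a coordinate near the point at infinity.\<close>

lemma affine_curve_at_infinity:
  fixes a b a' b' :: complex
  assumes "b\<^sup>2 = 4 * a ^ 3 - 1" "b'\<^sup>2 = 4 * a' ^ 3 - 1" "cmod a \<ge> 1" "cmod a' \<ge> 1" "a / b = a' / b'"
  shows "a = a'" "b = b'"
proof -
  have nz: "b \<noteq> 0" if "b\<^sup>2 = 4 * a ^ 3 - 1" "cmod a \<ge> 1" for a b :: complex
  proof
    assume "b = 0"
    then have "4 * a ^ 3 = 1" using that(1) by simp
    then have "4 * cmod a ^ 3 = 1" by (metis norm_mult norm_numeral norm_one norm_power)
    moreover have "cmod a ^ 3 \<ge> 1" using that(2) by simp
    ultimately show False by simp
  qed
  have b: "b \<noteq> 0" "b' \<noteq> 0" "a \<noteq> 0" "a' \<noteq> 0" using nz assms by auto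
  have "(a * b')\<^sup>2 = (a' * b)\<^sup>2" using assms(5) b by (simp add: field_simps)
  then have "a\<^sup>2 * (4 * a' ^ 3 - 1) = a'\<^sup>2 * (4 * a ^ 3 - 1)"
    using assms(1,2) by (simp add: power_mult_distrib)
  \<comment> \<open>For |a| and |a'| at least 1 the second factor is dominated by its first summand,
    so only a = a' is possible.\<close>
  then have "(a' - a) * (4 * (a * a')\<^sup>2 + (a + a')) = 0"
    by (simp add: algebra_simps power2_eq_square power3_eq_cube)
  moreover have "4 * (a * a')\<^sup>2 + (a + a') \<noteq> 0"
  proof
    assume "4 * (a * a')\<^sup>2 + (a + a') = 0"
    then have "a + a' = - (4 * (a * a')\<^sup>2)" by (simp only: add_eq_0_iff)
    then have "cmod (a + a') = cmod (4 * (a * a')\<^sup>2)" by (simp only: norm_minus_cancel)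
    then have eq: "4 * (cmod a * cmod a')\<^sup>2 = cmod (a + a')" by (simp add: norm_mult norm_power)
    have "1 \<le> cmod a * cmod a'" using mult_mono[of 1 "cmod a" 1 "cmod a'"] assms(3,4) by simp
    moreover have "cmod a \<le> cmod a * cmod a'" "cmod a' \<le> cmod a * cmod a'"
      using mult_left_mono[of 1 "cmod a'" "cmod a"] mult_right_mono[of 1 "cmod a" "cmod a'"] assms(3,4) by simp_all
    ultimately have "cmod a \<le> (cmod a * cmod a')\<^sup>2" "cmod a' \<le> (cmod a * cmod a')\<^sup>2"
      using self_le_power[of "cmod a * cmod a'" 2] by simp_all
    then have "(cmod a * cmod a')\<^sup>2 \<le> 0" using eq norm_triangle_ineq[of a a'] zero_le_power2[of "cmod a * cmod a'"] by linarith
    then show False using b by simp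
  qed
  ultimately show "a = a'" by simp
  then show "b = b'" using assms(5) b by (simp add: field_simps)
qed

text \<open>The two equations for derivatives say that k dz is the pullback of the invariant
  differential dx / y = dy / (6 x^2). It is used with k = 1 outside the lattice and with k = c phi^2
  on the upper half plane.\<close>

locale curve_chart =
  fixes M :: "complex set" and x y k :: "complex \<Rightarrow> complex"
  assumes M_open: "open M"
    and k_nonzero: "\<And>z. z \<in> M \<Longrightarrow> k z \<noteq> 0"
    and on_curve: "\<And>z. z \<in> M \<Longrightarrow> (y z)\<^sup>2 = 4 * x z ^ 3 - 1"
    and dx: "\<And>z. z \<in> M \<Longrightarrow> (x has_field_derivative k z * y z) (at z)"
    and dy: "\<And>z. z \<in> M \<Longrightarrow> (y has_field_derivative k z * (6 * (x z)\<^sup>2)) (at z)"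
begin

definition F :: "complex \<Rightarrow> complex \<times> complex" where "F z = (x z, y z)"

lemma F_in_curve: "z \<in> M \<Longrightarrow> F z \<in> affine_curve"
  using on_curve by (simp add: F_def affine_curve_def)

lemma x_hol: "x holomorphic_on M" and y_hol: "y holomorphic_on M"
  using dx dy M_open by (auto simp: holomorphic_on_open)

lemma x_cont: "z \<in> M \<Longrightarrow> isCont x z" and y_cont: "z \<in> M \<Longrightarrow> isCont y z"
  using dx dy DERIV_isCont by blast+

lemma F_continuous: "continuous_on M F"
  unfolding F_def by (intro continuous_on_Pair holomorphic_on_imp_continuous_on x_hol y_hol)

lemma local_inverse:
  assumes hol: "f holomorphic_on M" and z: "z0 \<in> M" and nz: "deriv f z0 \<noteq> 0"
  obtains e h r where "e > 0" "r > 0" "ball z0 r \<subseteq> M" "inj_on f (ball z0 r)" "h holomorphic_on ball (f z0) e" "h (f z0) = z0"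
    "\<And>a. a \<in> ball (f z0) e \<Longrightarrow> h a \<in> ball z0 r \<and> f (h a) = a"
proof -
  obtain r where r: "r > 0" "ball z0 r \<subseteq> M" "open (f ` ball z0 r)" "inj_on f (ball z0 r)"
    using has_complex_derivative_locally_invertible[OF hol z M_open nz] by metis
  obtain h where h: "h holomorphic_on f ` ball z0 r" "\<And>z. z \<in> ball z0 r \<Longrightarrow> h (f z) = z"
    using holomorphic_has_inverse[OF holomorphic_on_subset[OF hol r(2)] open_ball r(4)] by metis
  have "f z0 \<in> f ` ball z0 r" using r(1) by simp
  then obtain e where e: "e > 0" "ball (f z0) e \<subseteq> f ` ball z0 r" using r(3) by (meson openE)
  show ?thesis
  proof
    show "h (f z0) = z0" using h(2) r(1) by simp
    fix a assume "a \<in> ball (f z0) e"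
    then obtain z where "z \<in> ball z0 r" "a = f z" using e(2) by blast
    then show "h a \<in> ball z0 r \<and> f (h a) = a" using h(2) by simp
  qed (use e r h holomorphic_on_subset in auto)
qed

text \<open>The curve is smooth: x is a local coordinate where y \<noteq> 0, and where y = 0 one has
  x \<noteq> 0, so that y is one.\<close>

lemma locally_injective:
  assumes z: "z0 \<in> M" obtains r where "r > 0" "ball z0 r \<subseteq> M" "inj_on F (ball z0 r)"
proof (cases "y z0 = 0")
  case False
  then have "deriv x z0 \<noteq> 0" using DERIV_imp_deriv[OF dx[OF z]] k_nonzero[OF z] by simp
  then obtain r where "r > 0" "ball z0 r \<subseteq> M" "inj_on x (ball z0 r)"
    using local_inverse[OF x_hol z] by metis
  then show ?thesis using that by (auto simp: F_def inj_on_def)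
next
  case True
  then have "x z0 \<noteq> 0" using on_curve[OF z] by auto
  then have "deriv y z0 \<noteq> 0" using DERIV_imp_deriv[OF dy[OF z]] k_nonzero[OF z] by simp
  then obtain r where "r > 0" "ball z0 r \<subseteq> M" "inj_on y (ball z0 r)"
    using local_inverse[OF y_hol z] by metis
  then show ?thesis using that by (auto simp: F_def inj_on_def)
qed

text \<open>The section inverts the coordinate \<open>f\<close> that is nondegenerate at the point.
  The other coordinate is then a square or cube root prescribed by the curve, and nearness to the
  base point singles out the right one.\<close>

lemma local_section:
  assumes z: "z0 \<in> M"
  obtains e h f where "e > 0" "f = fst \<or> f = snd" "h holomorphic_on ball (f (F z0)) e" "h (f (F z0)) = z0"
    "\<And>P. P \<in> affine_curve \<Longrightarrow> dist P (F z0) < e \<Longrightarrow> f P \<in> ball (f (F z0)) e \<and> h (f P) \<in> M \<and> F (h (f P)) = P"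
proof (cases "y z0 = 0")
  case False
  then have "deriv x z0 \<noteq> 0" using DERIV_imp_deriv[OF dx[OF z]] k_nonzero[OF z] by simp
  then obtain e h r where e: "e > 0" "r > 0" "ball z0 r \<subseteq> M" "h holomorphic_on ball (x z0) e" "h (x z0) = z0"
    "\<And>a. a \<in> ball (x z0) e \<Longrightarrow> h a \<in> ball z0 r \<and> x (h a) = a"
    using local_inverse[OF x_hol z] by metis
  have hc: "isCont h (x z0)"
    using e(1,4) by (intro field_differentiable_imp_continuous_at holomorphic_on_imp_differentiable_at[of _ "ball (x z0) e"]) auto
  have yhc: "isCont (\<lambda>a. y (h a)) (x z0)"
    using isCont_o2[OF hc] y_cont[OF z] e(5) by simp
  then obtain d where d: "d > 0" "\<And>a. dist a (x z0) < d \<Longrightarrow> dist (y (h a)) (y z0) < cmod (y z0) / 2"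
    using False unfolding continuous_at_eps_delta e(5) by (metis dist_norm half_gt_zero_iff zero_less_norm_iff e(5))
  define m where "m = min (min e d) (cmod (y z0) / 2)"
  have m: "m > 0" "m \<le> e" "m \<le> d" "m \<le> cmod (y z0) / 2" using e(1) d(1) False by (auto simp: m_def)
  show ?thesis
  proof (rule that[of m fst h])
    show "h holomorphic_on ball (fst (F z0)) m" "h (fst (F z0)) = z0"
      using e(4,5) m(2) by (auto simp: F_def elim: holomorphic_on_subset)
    fix P assume P: "P \<in> affine_curve" "dist P (F z0) < m"
    obtain a b where ab: "P = (a, b)" by fastforce
    have da: "dist a (x z0) < m" and db: "dist b (y z0) < m"
      using P(2) dist_fst_le[of P "F z0"] dist_snd_le[of P "F z0"] by (auto simp: F_def ab)
    have a: "a \<in> ball (x z0) e" using da m by (simp add: dist_commute)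
    then have ha: "h a \<in> M" "x (h a) = a" using e by auto
    have "(y (h a))\<^sup>2 = b\<^sup>2" using on_curve[OF ha(1)] ha(2) P(1) by (simp add: affine_curve_def ab)
    moreover have "cmod (y (h a) - y z0) < cmod (y z0) / 2" using d(2)[of a] da m by (simp add: dist_norm)
    moreover have "cmod (b - y z0) < cmod (y z0) / 2" using db m by (simp add: dist_norm)
    ultimately have "y (h a) = b" by (rule square_root_near)
    then show "fst P \<in> ball (fst (F z0)) m \<and> h (fst P) \<in> M \<and> F (h (fst P)) = P"
      using ha da by (simp add: F_def ab dist_commute)
  qed (use m in auto)
next
  case True
  then have x0: "x z0 \<noteq> 0" using on_curve[OF z] by auto
  then have "deriv y z0 \<noteq> 0" using DERIV_imp_deriv[OF dy[OF z]] k_nonzero[OF z] by simp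
  then obtain e h r where e: "e > 0" "r > 0" "ball z0 r \<subseteq> M" "h holomorphic_on ball (y z0) e" "h (y z0) = z0"
    "\<And>a. a \<in> ball (y z0) e \<Longrightarrow> h a \<in> ball z0 r \<and> y (h a) = a"
    using local_inverse[OF y_hol z] by metis
  have hc: "isCont h (y z0)"
    using e(1,4) by (intro field_differentiable_imp_continuous_at holomorphic_on_imp_differentiable_at[of _ "ball (y z0) e"]) auto
  have xhc: "isCont (\<lambda>a. x (h a)) (y z0)"
    using isCont_o2[OF hc] x_cont[OF z] e(5) by simp
  then obtain d where d: "d > 0" "\<And>a. dist a (y z0) < d \<Longrightarrow> dist (x (h a)) (x z0) < cmod (x z0) / 4"
    using x0 unfolding continuous_at_eps_delta e(5) by (metis divide_pos_pos zero_less_numeral zero_less_norm_iff e(5))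
  define m where "m = min (min e d) (cmod (x z0) / 4)"
  have m: "m > 0" "m \<le> e" "m \<le> d" "m \<le> cmod (x z0) / 4" using e(1) d(1) x0 by (auto simp: m_def)
  show ?thesis
  proof (rule that[of m snd h])
    show "h holomorphic_on ball (snd (F z0)) m" "h (snd (F z0)) = z0"
      using e(4,5) m(2) by (auto simp: F_def elim: holomorphic_on_subset)
    fix P assume P: "P \<in> affine_curve" "dist P (F z0) < m"
    obtain a b where ab: "P = (a, b)" by fastforce
    have da: "dist a (x z0) < m" and db: "dist b (y z0) < m"
      using P(2) dist_fst_le[of P "F z0"] dist_snd_le[of P "F z0"] by (auto simp: F_def ab)
    have b: "b \<in> ball (y z0) e" using db m by (simp add: dist_commute)
    then have hb: "h b \<in> M" "y (h b) = b" using e by auto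
    have "x (h b) ^ 3 = a ^ 3" using on_curve[OF hb(1)] hb(2) P(1) by (simp add: affine_curve_def ab)
    moreover have "cmod (x (h b) - x z0) < cmod (x z0) / 4" using d(2)[of b] db m by (simp add: dist_norm)
    moreover have "cmod (a - x z0) < cmod (x z0) / 4" using da m by (simp add: dist_norm)
    ultimately have "x (h b) = a" by (rule cube_root_near)
    then show "snd P \<in> ball (snd (F z0)) m \<and> h (snd P) \<in> M \<and> F (h (snd P)) = P"
      using hb db by (simp add: F_def ab dist_commute)
  qed (use m in auto)
qed

lemma local_section_continuous:
  assumes z: "z0 \<in> M"
  obtains e s where "e > 0" "\<And>P. P \<in> affine_curve \<Longrightarrow> dist P (F z0) < e \<Longrightarrow> s P \<in> M \<and> F (s P) = P"
    "\<And>p. p \<longlonglongrightarrow> F z0 \<Longrightarrow> (\<lambda>n::nat. s (p n)) \<longlonglongrightarrow> z0"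
proof -
  obtain e h f where e: "e > 0" "f = fst \<or> f = snd" "h holomorphic_on ball (f (F z0)) e" "h (f (F z0)) = z0"
    "\<And>P. P \<in> affine_curve \<Longrightarrow> dist P (F z0) < e \<Longrightarrow> f P \<in> ball (f (F z0)) e \<and> h (f P) \<in> M \<and> F (h (f P)) = P"
    by (rule local_section[OF z]) (rule that)
  have hc: "isCont h (f (F z0))"
    using e(1,3) by (intro field_differentiable_imp_continuous_at holomorphic_on_imp_differentiable_at[of _ "ball (f (F z0)) e"]) auto
  show ?thesis
  proof (rule that[OF e(1), of "\<lambda>P. h (f P)"])
    fix p :: "nat \<Rightarrow> complex \<times> complex" assume "p \<longlonglongrightarrow> F z0"
    then have "(\<lambda>n. f (p n)) \<longlonglongrightarrow> f (F z0)" using e(2) by (auto intro: tendsto_fst tendsto_snd)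
    then show "(\<lambda>n. h (f (p n))) \<longlonglongrightarrow> z0" using isCont_tendsto_compose[OF hc] e(4) by simp
  qed (use e(5) in auto)
qed

end

text \<open>\<open>F\<close> maps the quotient of \<open>M\<close> by the symmetries properly to the curve, and it is injective near the point
  at infinity. The image and the set of points with at least two preimages are open and closed in the curve.\<close>

locale curve_cover = curve_chart +
  fixes S :: "(complex \<Rightarrow> complex) set"
  assumes S_id: "\<exists>g\<in>S. \<forall>z\<in>M. g z = z"
    and S_inv: "\<And>g. g \<in> S \<Longrightarrow> \<exists>h\<in>S. \<forall>z\<in>M. h (g z) = z \<and> g (h z) = z"
    and S_comp: "\<And>g h. g \<in> S \<Longrightarrow> h \<in> S \<Longrightarrow> \<exists>f\<in>S. \<forall>z\<in>M. f z = g (h z)"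
    and S_in: "\<And>g z. g \<in> S \<Longrightarrow> z \<in> M \<Longrightarrow> g z \<in> M"
    and S_cont: "\<And>g z. g \<in> S \<Longrightarrow> z \<in> M \<Longrightarrow> isCont g z"
    and S_F: "\<And>g z. g \<in> S \<Longrightarrow> z \<in> M \<Longrightarrow> x (g z) = x z \<and> y (g z) = y z"
    and S_closed: "\<And>p g z z'. (\<And>n::nat. p n \<in> M) \<Longrightarrow> (\<And>n. g n \<in> S) \<Longrightarrow> p \<longlonglongrightarrow> z \<Longrightarrow>
        (\<lambda>n. g n (p n)) \<longlonglongrightarrow> z' \<Longrightarrow> z \<in> M \<Longrightarrow> z' \<in> M \<Longrightarrow> \<exists>h\<in>S. z' = h z"
    and proper: "\<And>B. \<exists>K. compact K \<and> K \<subseteq> M \<and> (\<forall>z\<in>M. cmod (x z) \<le> B \<longrightarrow> (\<exists>g\<in>S. g z \<in> K))"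
    and inj_infinity: "\<exists>B. \<forall>z\<in>M. \<forall>z'\<in>M. cmod (x z) > B \<longrightarrow> x z = x z' \<longrightarrow> y z = y z' \<longrightarrow> (\<exists>g\<in>S. z' = g z)"
    and unbounded: "\<And>B. \<exists>z\<in>M. cmod (x z) > B"
    and curve_connected: "connected affine_curve"
begin

lemma F_S: "g \<in> S \<Longrightarrow> z \<in> M \<Longrightarrow> F (g z) = F z"
  using S_F by (simp add: F_def)

text \<open>Properness for sequences: convergent images are bounded, so symmetries move the points
  into a compact set, where a subsequence converges.\<close>

lemma proper_sequence:
  assumes "\<And>n::nat. z n \<in> M" "(\<lambda>n. F (z n)) \<longlonglongrightarrow> P"
  shows "\<exists>g r w. strict_mono r \<and> (\<forall>n. g n \<in> S) \<and> (\<lambda>n. g (r n) (z (r n))) \<longlonglongrightarrow> w \<and> w \<in> M \<and> F w = P"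
proof -
  have "Bseq (\<lambda>n. F (z n))" using assms(2) by (rule convergent_imp_Bseq[OF convergentI])
  then obtain B where B: "\<And>n. norm (F (z n)) \<le> B" by (auto simp: Bseq_def)
  have "cmod (x (z n)) \<le> B" for n
    using norm_fst_le[of "x (z n)" "y (z n)"] B[of n] by (simp add: F_def)
  moreover obtain K where K: "compact K" "K \<subseteq> M" "\<forall>z\<in>M. cmod (x z) \<le> B \<longrightarrow> (\<exists>g\<in>S. g z \<in> K)"
    using proper[of B] by blast
  ultimately have "\<forall>n. \<exists>g. g \<in> S \<and> g (z n) \<in> K" using assms(1) by blast
  then obtain g where g: "\<And>n. g n \<in> S" "\<And>n. g n (z n) \<in> K" by metis
  obtain w r where w: "w \<in> K" "strict_mono r" "((\<lambda>n. g n (z n)) \<circ> r) \<longlonglongrightarrow> w"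
    using K(1) g(2) unfolding compact_def by metis
  have wM: "w \<in> M" using w(1) K(2) by blast
  have "(\<lambda>n. F (g (r n) (z (r n)))) \<longlonglongrightarrow> F w"
  proof (rule continuous_on_tendsto_compose[OF F_continuous])
    show "(\<lambda>n. g (r n) (z (r n))) \<longlonglongrightarrow> w" using w(3) by (simp add: o_def)
    have "g n (z n) \<in> M" for n using S_in g(1) assms(1) by blast
    then show "\<forall>\<^sub>F n in sequentially. g (r n) (z (r n)) \<in> M" by simp
  qed (rule wM)
  moreover have "(\<lambda>n. F (g (r n) (z (r n)))) \<longlonglongrightarrow> P"
    using LIMSEQ_subseq_LIMSEQ[OF assms(2) w(2)] F_S[OF g(1) assms(1)] by (simp add: o_def)
  ultimately have "F w = P" by (rule LIMSEQ_unique)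
  then show ?thesis using w(2,3) g(1) wM by (intro exI[of _ g] exI[of _ r] exI[of _ w]) (simp add: o_def)
qed

text \<open>Local sections make the image open, and properness makes it closed.\<close>

lemma F_surj: "F ` M = affine_curve"
proof -
  have "openin (top_of_set affine_curve) (F ` M)"
    unfolding openin_euclidean_subtopology_iff
  proof (intro conjI ballI)
    show "F ` M \<subseteq> affine_curve" using F_in_curve by blast
    fix P assume "P \<in> F ` M"
    then obtain z where z: "z \<in> M" "P = F z" by blast
    obtain e s where "e > 0" "\<And>P. P \<in> affine_curve \<Longrightarrow> dist P (F z) < e \<Longrightarrow> s P \<in> M \<and> F (s P) = P"
      "\<And>p. p \<longlonglongrightarrow> F z \<Longrightarrow> (\<lambda>n::nat. s (p n)) \<longlonglongrightarrow> z"
      using local_section_continuous[OF z(1)] by blast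
    then show "\<exists>e>0. \<forall>P'\<in>affine_curve. dist P' P < e \<longrightarrow> P' \<in> F ` M"
      unfolding z(2) by (intro exI[of _ e]) (metis image_eqI)
  qed
  moreover have "closedin (top_of_set affine_curve) (F ` M)"
    unfolding closedin_limpt
  proof (intro conjI allI impI)
    show "F ` M \<subseteq> affine_curve" using F_in_curve by blast
    fix P assume "P islimpt F ` M \<and> P \<in> affine_curve"
    then obtain p where p: "\<And>n::nat. p n \<in> F ` M - {P}" "p \<longlonglongrightarrow> P" unfolding islimpt_sequential by blast
    then have "\<forall>n. \<exists>z. z \<in> M \<and> p n = F z" by blast
    then obtain z where z: "\<And>n. z n \<in> M" "\<And>n. p n = F (z n)" by metis
    then have "(\<lambda>n. F (z n)) \<longlonglongrightarrow> P" using p(2) by (simp add: z(2)[symmetric])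
    from proper_sequence[OF z(1) this] show "P \<in> F ` M" by blast
  qed
  moreover have "F ` M \<noteq> {}" using unbounded by blast
  ultimately show ?thesis using curve_connected unfolding connected_clopen by blast
qed

lemma F_inj:
  assumes "z \<in> M" "z' \<in> M" "F z = F z'"
  obtains g where "g \<in> S" "z' = g z"
proof -
  define eqv where "eqv z z' \<longleftrightarrow> (\<exists>g\<in>S. z' = g z)" for z z'
  have sym: "eqv z' z" if "eqv z z'" "z \<in> M" for z z'
    using that S_inv unfolding eqv_def by metis
  have trans: "eqv z z''" if "eqv z z'" "eqv z' z''" "z \<in> M" for z z' z''
    using that S_comp unfolding eqv_def by metis
  have gz: "eqv z (g z)" if "g \<in> S" for g z using that unfolding eqv_def by blast
  define A where "A = {P. \<exists>z\<in>M. \<exists>z'\<in>M. F z = P \<and> F z' = P \<and> \<not> eqv z z'}"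
  have Asub: "A \<subseteq> affine_curve" unfolding A_def using F_in_curve by blast
  have "openin (top_of_set affine_curve) A"
    unfolding openin_euclidean_subtopology_iff
  proof (intro conjI ballI Asub)
    fix P assume "P \<in> A"
    then obtain z z' where z: "z \<in> M" "F z = P" "z' \<in> M" "F z' = P" "\<not> eqv z z'" by (auto simp: A_def)
    obtain e s where s: "e > 0" "\<And>P'. P' \<in> affine_curve \<Longrightarrow> dist P' P < e \<Longrightarrow> s P' \<in> M \<and> F (s P') = P'"
      "\<And>p. p \<longlonglongrightarrow> P \<Longrightarrow> (\<lambda>n::nat. s (p n)) \<longlonglongrightarrow> z"
      using local_section_continuous[OF z(1)] unfolding z(2) by blast
    obtain e' s' where s': "e' > 0" "\<And>P'. P' \<in> affine_curve \<Longrightarrow> dist P' P < e' \<Longrightarrow> s' P' \<in> M \<and> F (s' P') = P'"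
      "\<And>p. p \<longlonglongrightarrow> P \<Longrightarrow> (\<lambda>n::nat. s' (p n)) \<longlonglongrightarrow> z'"
      using local_section_continuous[OF z(3)] unfolding z(4) by blast
    \<comment> \<open>Otherwise the two local sections would take equivalent values at points
      arbitrarily close to P, and as the equivalence is closed under limits, z and z' would be
      equivalent.\<close>
    show "\<exists>d>0. \<forall>P'\<in>affine_curve. dist P' P < d \<longrightarrow> P' \<in> A"
    proof (rule ccontr)
      assume no: "\<not> ?thesis"
      define d where "d n = min (min e e') (1 / real (Suc n))" for n
      have "d n > 0" for n using s(1) s'(1) by (simp add: d_def)
      with no have "\<forall>n. \<exists>P'\<in>affine_curve. dist P' P < d n \<and> P' \<notin> A" by blast
      then obtain p where p: "\<And>n. p n \<in> affine_curve" "\<And>n. dist (p n) P < d n" "\<And>n. p n \<notin> A" by metis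
      have lim: "p \<longlonglongrightarrow> P"
      proof (rule metric_tendsto_imp_tendsto[of "\<lambda>n. 1 / real (Suc n)" 0])
        show "(\<lambda>n. 1 / real (Suc n)) \<longlonglongrightarrow> 0" using LIMSEQ_inverse_real_of_nat by (simp add: inverse_eq_divide)
        show "\<forall>\<^sub>F n in sequentially. dist (p n) P \<le> dist (1 / real (Suc n)) 0"
          using p(2) by (intro always_eventually allI) (simp add: d_def less_imp_le del: of_nat_Suc)
      qed
      have sp: "s (p n) \<in> M" "F (s (p n)) = p n" "s' (p n) \<in> M" "F (s' (p n)) = p n" for n
        using s(2)[OF p(1), of n] s'(2)[OF p(1), of n] p(2)[of n] by (auto simp: d_def)
      have "eqv (s (p n)) (s' (p n))" for n using p(3)[of n] sp[of n] unfolding A_def by blast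
      then obtain g where g: "\<And>n. g n \<in> S" "\<And>n. s' (p n) = g n (s (p n))" unfolding eqv_def by metis
      have "\<exists>h\<in>S. z' = h z"
        by (rule S_closed[of "\<lambda>n. s (p n)" g]) (use sp(1) g s(3)[OF lim] s'(3)[OF lim] z in auto)
      then show False using z(5) unfolding eqv_def by blast
    qed
  qed
  moreover have "closedin (top_of_set affine_curve) A"
    unfolding closedin_limpt
  proof (intro conjI allI impI Asub)
    fix P assume "P islimpt A \<and> P \<in> affine_curve"
    then obtain p where p: "\<And>n::nat. p n \<in> A" "p \<longlonglongrightarrow> P" unfolding islimpt_sequential by blast
    then have "\<forall>n. \<exists>z z'. z \<in> M \<and> z' \<in> M \<and> F z = p n \<and> F z' = p n \<and> \<not> eqv z z'" by (auto simp: A_def)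
    then obtain z z' where z: "\<And>n. z n \<in> M" "\<And>n. z' n \<in> M" "\<And>n. F (z n) = p n" "\<And>n. F (z' n) = p n"
      "\<And>n. \<not> eqv (z n) (z' n)" by metis
    obtain g r w where w: "strict_mono r" "\<And>n. g n \<in> S" "(\<lambda>n. g (r n) (z (r n))) \<longlonglongrightarrow> w" "w \<in> M" "F w = P"
      using proper_sequence[of z P] z(1) p(2) unfolding z(3) by blast
    have "(\<lambda>n. F (z' (r n))) \<longlonglongrightarrow> P" using LIMSEQ_subseq_LIMSEQ[OF p(2) w(1)] unfolding z(4) by (simp add: o_def)
    then obtain g' r' w' where w': "strict_mono r'" "\<And>n. g' n \<in> S" "(\<lambda>n. g' (r' n) (z' (r (r' n)))) \<longlonglongrightarrow> w'" "w' \<in> M" "F w' = P"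
      using proper_sequence[of "\<lambda>n. z' (r n)" P] z(2) by blast
    define u where "u n = g (r (r' n)) (z (r (r' n)))" for n
    define u' where "u' n = g' (r' n) (z' (r (r' n)))" for n
    have lim: "u \<longlonglongrightarrow> w" "u' \<longlonglongrightarrow> w'"
      using LIMSEQ_subseq_LIMSEQ[OF w(3) w'(1)] w'(3) by (simp_all add: u_def[abs_def] u'_def[abs_def] o_def)
    have uM: "u n \<in> M" "u' n \<in> M" "F (u n) = F (u' n)" for n
      using z w(2) w'(2) S_in F_S by (simp_all add: u_def u'_def)
    have neq: "\<not> eqv (u n) (u' n)" for n
    proof
      let ?m = "r (r' n)"
      assume "eqv (u n) (u' n)"
      then have "eqv (z ?m) (u' n)" using trans[OF gz[OF w(2)]] z(1) unfolding u_def by blast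
      moreover have "eqv (u' n) (z' ?m)" using sym[OF gz[OF w'(2)] z(2)] unfolding u'_def by blast
      ultimately have "eqv (z ?m) (z' ?m)" using trans z(1) by blast
      then show False using z(5) by blast
    qed
    \<comment> \<open>If w' = h w, then h (u n) and u' n both tend to w' and have the same image, so
      local injectivity makes them equal for some n.\<close>
    have "\<not> eqv w w'"
    proof
      assume "eqv w w'"
      then obtain h where h: "h \<in> S" "w' = h w" unfolding eqv_def by blast
      have lim': "(\<lambda>n. h (u n)) \<longlonglongrightarrow> w'"
        unfolding h(2) by (rule isCont_tendsto_compose[OF S_cont[OF h(1) w(4)] lim(1)])
      obtain e where e: "e > 0" "inj_on F (ball w' e)" using locally_injective[OF w'(4)] by metis
      have "\<forall>\<^sub>F n in sequentially. dist (h (u n)) w' < e" "\<forall>\<^sub>F n in sequentially. dist (u' n) w' < e"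
        using tendstoD[OF lim' e(1)] tendstoD[OF lim(2) e(1)] by auto
      then have "\<forall>\<^sub>F n in sequentially. dist (h (u n)) w' < e \<and> dist (u' n) w' < e" by (rule eventually_conj)
      then obtain n where n: "dist (h (u n)) w' < e" "dist (u' n) w' < e" unfolding eventually_sequentially by blast
      then have "h (u n) = u' n"
        using inj_onD[OF e(2), of "h (u n)" "u' n"] F_S[OF h(1) uM(1)] uM(3) by (auto simp: dist_commute)
      then show False using neq[of n] gz[OF h(1), of "u n"] by simp
    qed
    then show "P \<in> A" using w(4,5) w'(4,5) unfolding A_def by blast
  qed
  ultimately have "A = {} \<or> A = affine_curve" using curve_connected unfolding connected_clopen by blast
  moreover have "A \<noteq> affine_curve"
  proof -
    obtain B where B: "\<And>z z'. z \<in> M \<Longrightarrow> z' \<in> M \<Longrightarrow> cmod (x z) > B \<Longrightarrow> x z = x z' \<Longrightarrow> y z = y z' \<Longrightarrow> eqv z z'"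
      using inj_infinity unfolding eqv_def by blast
    obtain z0 where z0: "z0 \<in> M" "cmod (x z0) > B" using unbounded by blast
    have "F z0 \<notin> A" using B z0 by (auto simp: A_def F_def)
    then show ?thesis using F_in_curve[OF z0(1)] by blast
  qed
  ultimately have "A = {}" by blast
  moreover have "F z \<in> A" if "\<not> eqv z z'" unfolding A_def mem_Collect_eq using assms that by metis
  ultimately have "eqv z z'" by blast
  then show ?thesis using that unfolding eqv_def by blast
qed

end

section \<open>The two uniformisations\<close>

context hexagonal begin

definition reduced_set :: "real \<Rightarrow> complex set" where
  "reduced_set r = cball 0 (2 * cmod \<omega>) - (\<Union>w\<in>\<Lambda>. ball w r)"

lemma reduced_set_compact: "compact (reduced_set r)"
  unfolding reduced_set_def by (intro compact_diff compact_cball) auto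

lemma reduced_set_subset: "r > 0 \<Longrightarrow> reduced_set r \<subseteq> - \<Lambda>"
  by (auto simp: reduced_set_def)

lemma lattice_reduce:
  obtains w where "w \<in> \<Lambda>" "z - w \<in> reduced_set r \<or> cmod (z - w) < r"
proof -
  obtain w where w: "w \<in> \<Lambda>" "cmod (z - w) \<le> 2 * cmod \<omega>" by (rule lattice_covering)
  show ?thesis
  proof (cases "z - w \<in> reduced_set r")
    case True then show ?thesis using that w by blast
  next
    case False
    then obtain u where "u \<in> \<Lambda>" "dist u (z - w) < r" using w by (auto simp: reduced_set_def)
    then show ?thesis using that[of "w + u"] w(1) lattice_add
      by (auto simp: dist_norm norm_minus_commute algebra_simps)
  qed
qed

lemma wp_large_near_lattice:
  obtains r where "r > 0" "\<And>z. z \<noteq> 0 \<Longrightarrow> cmod z < r \<Longrightarrow> cmod (wp z) > B"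
proof -
  have "\<forall>\<^sub>F z in at 0. max B 0 + 1 \<le> cmod (wp z)"
    using wp_at_0 unfolding filterlim_at_infinity[of 0, OF order_refl] by (auto simp: add_nonneg_pos)
  then obtain r where "r > 0" "\<And>z. z \<noteq> 0 \<Longrightarrow> dist z 0 < r \<Longrightarrow> max B 0 + 1 \<le> cmod (wp z)"
    unfolding eventually_at by auto
  then show ?thesis using that[of r] by force
qed

end

lemma holomorphic_locally_injective:
  assumes "f holomorphic_on ball z d" "d > 0" "deriv f z \<noteq> 0"
  obtains r where "r > 0" "r \<le> d" "inj_on f (ball z r)" "open (f ` ball z r)"
proof -
  obtain r where r: "r > 0" "ball z r \<subseteq> ball z d" "open (f ` ball z r)" "inj_on f (ball z r)"
    using has_complex_derivative_locally_invertible[OF assms(1) centre_in_ball[THEN iffD2, OF assms(2)] open_ball assms(3)]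
    by metis
  then show ?thesis using that by (auto simp: ball_subset_ball_iff)
qed

locale normalised_hexagonal = hexagonal +
  assumes g3: "weierstrass_g3 \<Lambda> = 1"
begin

lemma wp_curve: "z \<notin> \<Lambda> \<Longrightarrow> (wp' z)\<^sup>2 = 4 * wp z ^ 3 - 1"
  using wp_ode g3 by (simp add: g3_eq)

sublocale W: curve_chart "- \<Lambda>" wp wp' "\<lambda>_. 1"
proof
  show "open (- \<Lambda>)" by (rule lattice_compl_open)
  fix z assume z: "z \<in> - \<Lambda>"
  show "(wp' z)\<^sup>2 = 4 * wp z ^ 3 - 1" using z wp_curve by simp
  show "(wp has_field_derivative 1 * wp' z) (at z)" using wp_has_derivative z by simp
  obtain z0 where z0: "z0 \<notin> \<Lambda>" "wp z0 = 0" by (rule wp_surj)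
  then have "wp' z0 \<noteq> 0" using wp_curve[OF z0(1)] by auto
  then show "(wp' has_field_derivative 1 * (6 * (wp z)\<^sup>2)) (at z)"
    by (intro curve_second_derivative[OF lattice_compl_open lattice_compl_connected wp_holomorphic wp'_holomorphic])
      (use z z0 wp_curve wp_has_derivative in auto)
qed simp

text \<open>\<open>wp\<close> takes every value, and oddness of \<open>wp'\<close> allows either
  sign of the second coordinate.\<close>

lemma W_surj: "W.F ` (- \<Lambda>) = affine_curve"
proof (intro subset_antisym subsetI)
  fix P assume "P \<in> affine_curve"
  then obtain a b where P: "P = (a, b)" "b\<^sup>2 = 4 * a ^ 3 - 1" by (auto simp: affine_curve_def)
  obtain z where z: "z \<notin> \<Lambda>" "wp z = a" by (rule wp_surj)
  then have "(wp' z)\<^sup>2 = b\<^sup>2" using wp_curve P by simp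
  then consider "wp' z = b" | "wp' (- z) = b" using wp'_odd[OF z(1)] by (auto simp: power2_eq_iff)
  then show "P \<in> W.F ` (- \<Lambda>)"
  proof cases
    case 1 then show ?thesis using z P by (intro image_eqI[of _ _ z]) (auto simp: W.F_def)
  next
    case 2 then show ?thesis using z P by (intro image_eqI[of _ _ "- z"]) (auto simp: W.F_def wp_even)
  qed
qed (use W.F_in_curve in auto)

text \<open>The explicit surjection makes the curve an image of a connected set. Both covering
  arguments rest on this.\<close>

lemma affine_curve_connected: "connected affine_curve"
  unfolding W_surj[symmetric]
  by (rule connected_continuous_image[OF W.F_continuous lattice_compl_connected])

text \<open>Near 0, \<open>wp\<close> is n / z^2 with n(0) = 1 and \<open>wp'\<close> is m / z^3
  with m(0) = -2. So their quotient z n / m extends with a simple zero at 0.\<close>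

lemma wp_coordinate_at_0:
  obtains r t where "r > 0" "t holomorphic_on ball 0 r" "t 0 = 0" "deriv t 0 \<noteq> 0" "inj_on t (ball 0 r)" "open (t ` ball 0 r)"
    "ball 0 r \<inter> \<Lambda> = {0}" "\<And>z. z \<in> ball 0 r \<Longrightarrow> z \<noteq> 0 \<Longrightarrow> t z = wp z / wp' z \<and> cmod (wp z) \<ge> 1"
proof -
  obtain d Q where d: "d > 0" "ball 0 d \<inter> \<Lambda> = {0}" and Q: "Q holomorphic_on ball 0 d" "Q 0 = 5 * G 6"
    and w: "\<And>z. z \<in> ball 0 d \<Longrightarrow> z \<noteq> 0 \<Longrightarrow> wp z = 1 / z ^ 2 + z ^ 4 * Q z"
    and w': "\<And>z. z \<in> ball 0 d \<Longrightarrow> z \<noteq> 0 \<Longrightarrow> wp' z = - 2 / z ^ 3 + 4 * z ^ 3 * Q z + z ^ 4 * deriv Q z"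
    by (rule wp_near_0) (rule that)
  define n where "n z = 1 + z ^ 6 * Q z" for z
  define m where "m z = - 2 + 4 * z ^ 6 * Q z + z ^ 7 * deriv Q z" for z
  have hol: "n holomorphic_on ball 0 d" "m holomorphic_on ball 0 d"
    unfolding n_def[abs_def] m_def[abs_def] by (intro holomorphic_intros Q open_ball)+
  have "isCont m 0"
    using hol(2) d(1) by (intro field_differentiable_imp_continuous_at holomorphic_on_imp_differentiable_at[of _ "ball 0 d"]) auto
  moreover have "m 0 \<noteq> 0" by (simp add: m_def)
  ultimately obtain d1 where d1: "d1 > 0" "\<And>z. dist 0 z < d1 \<Longrightarrow> m z \<noteq> 0"
    using continuous_at_avoid by metis
  obtain d2 where d2: "d2 > 0" "\<And>z. z \<noteq> 0 \<Longrightarrow> cmod z < d2 \<Longrightarrow> cmod (wp z) > 1" by (rule wp_large_near_lattice[of 1]) blast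
  define d3 where "d3 = min d (min d1 d2)"
  have d3: "d3 > 0" "ball 0 d3 \<subseteq> ball 0 d" using d(1) d1 d2 by (auto simp: d3_def)
  define t where "t z = z * (n z / m z)" for z
  have t: "t holomorphic_on ball 0 d3"
    unfolding t_def[abs_def]
    using d1(2) d3(2) by (intro holomorphic_intros holomorphic_on_subset[OF hol(1) d3(2)] holomorphic_on_subset[OF hol(2) d3(2)]) (auto simp: d3_def)
  have "((\<lambda>z. n z / m z) has_field_derivative deriv (\<lambda>z. n z / m z) 0) (at 0)"
    using d1(2) d3 by (intro holomorphic_derivI[of _ "ball 0 d3"] holomorphic_intros
      holomorphic_on_subset[OF hol(1) d3(2)] holomorphic_on_subset[OF hol(2) d3(2)]) (auto simp: d3_def)
  from DERIV_mult[OF DERIV_ident this] have "deriv t 0 = n 0 / m 0"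
    unfolding t_def[abs_def] by (simp add: DERIV_imp_deriv)
  then have dt: "deriv t 0 \<noteq> 0" by (simp add: n_def m_def)
  obtain r where r: "r > 0" "r \<le> d3" "inj_on t (ball 0 r)" "open (t ` ball 0 r)"
    by (rule holomorphic_locally_injective[OF t d3(1) dt])
  show ?thesis
  proof
    show "t holomorphic_on ball 0 r" by (rule holomorphic_on_subset[OF t]) (use r in auto)
    show "t 0 = 0" by (simp add: t_def)
    have "ball 0 r \<subseteq> ball 0 d" "0 \<in> ball 0 r" using r d3 by auto
    then show "ball 0 r \<inter> \<Lambda> = {0}" using d(2) by auto
    fix z :: complex assume z: "z \<in> ball 0 r" "z \<noteq> 0"
    have zd: "z \<in> ball 0 d" and mz: "m z \<noteq> 0" and big: "cmod (wp z) > 1"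
      using z r(2) d1(2) d2(2) by (auto simp: d3_def)
    have "wp z = n z / z ^ 2" using w[OF zd z(2)] z(2) by (simp add: n_def field_simps eval_nat_numeral)
    moreover have "wp' z = m z / z ^ 3" using w'[OF zd z(2)] z(2) by (simp add: m_def field_simps eval_nat_numeral)
    ultimately show "t z = wp z / wp' z \<and> cmod (wp z) \<ge> 1"
      using z(2) mz big by (simp add: t_def eval_nat_numeral)
  qed (use r dt in auto)
qed

text \<open>Points with large \<open>wp\<close> can be translated next to 0, where the coordinate of
  \<open>wp_coordinate_at_0\<close> separates them; this gives injectivity near infinity. Properness
  holds because \<open>wp\<close> is large near the lattice.\<close>

sublocale W: curve_cover "- \<Lambda>" wp wp' "\<lambda>_. 1" "{\<lambda>z. z + w | w. w \<in> \<Lambda>}"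
proof
  show "\<exists>g\<in>{\<lambda>z. z + w |w. w \<in> \<Lambda>}. \<forall>z\<in>- \<Lambda>. g z = z" using lattice_0 by force
  show "\<exists>h\<in>{\<lambda>z. z + w |w. w \<in> \<Lambda>}. \<forall>z\<in>- \<Lambda>. h (g z) = z \<and> g (h z) = z" if g: "g \<in> {\<lambda>z. z + w |w. w \<in> \<Lambda>}" for g
  proof -
    obtain w where w: "w \<in> \<Lambda>" "g = (\<lambda>z. z + w)" using g by auto
    then have "(\<lambda>z. z + (- w)) \<in> {\<lambda>z. z + w |w. w \<in> \<Lambda>}" using lattice_minus by blast
    then show ?thesis by (rule bexI[rotated]) (use w in auto)
  qed
  show "\<exists>f\<in>{\<lambda>z. z + w |w. w \<in> \<Lambda>}. \<forall>z\<in>- \<Lambda>. f z = g (h z)"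
    if g: "g \<in> {\<lambda>z. z + w |w. w \<in> \<Lambda>}" and h: "h \<in> {\<lambda>z. z + w |w. w \<in> \<Lambda>}" for g h
  proof -
    obtain w w' where "w \<in> \<Lambda>" "g = (\<lambda>z. z + w)" "w' \<in> \<Lambda>" "h = (\<lambda>z. z + w')" using g h by auto
    then show ?thesis using lattice_add[of w' w] by (intro bexI[of _ "\<lambda>z. z + (w' + w)"]) auto
  qed
  show "g z \<in> - \<Lambda>" if "g \<in> {\<lambda>z. z + w |w. w \<in> \<Lambda>}" "z \<in> - \<Lambda>" for g z
    using that lattice_add_iff by auto
  show "isCont g z" if "g \<in> {\<lambda>z. z + w |w. w \<in> \<Lambda>}" "z \<in> - \<Lambda>" for g z
    using that by auto
  show "wp (g z) = wp z \<and> wp' (g z) = wp' z" if "g \<in> {\<lambda>z. z + w |w. w \<in> \<Lambda>}" "z \<in> - \<Lambda>" for g z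
    using that wp_periodic wp'_periodic by auto
  show "\<exists>h\<in>{\<lambda>z. z + w |w. w \<in> \<Lambda>}. z' = h z"
    if "\<And>n::nat. p n \<in> - \<Lambda>" "\<And>n. g n \<in> {\<lambda>z. z + w |w. w \<in> \<Lambda>}" "p \<longlonglongrightarrow> z" "(\<lambda>n. g n (p n)) \<longlonglongrightarrow> z'" for p g z z'
  proof -
    have lim: "(\<lambda>n. g n (p n) - p n) \<longlonglongrightarrow> z' - z" by (intro tendsto_diff that)
    have "g n (p n) - p n \<in> \<Lambda>" for n using that(2)[of n] by auto
    then have "z' - z \<in> \<Lambda>" by (rule closed_sequentially[OF lattice_closed _ lim])
    then show ?thesis by (intro bexI[of _ "\<lambda>u. u + (z' - z)"]) auto
  qed
  show "\<exists>K. compact K \<and> K \<subseteq> - \<Lambda> \<and> (\<forall>z\<in>- \<Lambda>. cmod (wp z) \<le> B \<longrightarrow> (\<exists>g\<in>{\<lambda>z. z + w |w. w \<in> \<Lambda>}. g z \<in> K))" for B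
  proof -
    obtain r where r: "r > 0" "\<And>z. z \<noteq> 0 \<Longrightarrow> cmod z < r \<Longrightarrow> cmod (wp z) > B" by (rule wp_large_near_lattice[of B]) blast
    have "\<exists>g\<in>{\<lambda>z. z + w |w. w \<in> \<Lambda>}. g z \<in> reduced_set r" if z: "z \<in> - \<Lambda>" "cmod (wp z) \<le> B" for z
    proof -
      obtain w where w: "w \<in> \<Lambda>" "z - w \<in> reduced_set r \<or> cmod (z - w) < r" by (rule lattice_reduce)
      have "wp (z - w) = wp z" using wp_periodic[of z "- w"] z w by simp
      moreover have "z - w \<noteq> 0" using z w by auto
      ultimately have "z - w \<in> reduced_set r" using w(2) r(2)[of "z - w"] z(2) by auto
      moreover have "(\<lambda>z. z + (- w)) \<in> {\<lambda>z. z + w |w. w \<in> \<Lambda>}" using w(1) lattice_minus by blast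
      ultimately show ?thesis by (intro bexI[of _ "\<lambda>z. z + (- w)"]) auto
    qed
    then show ?thesis using reduced_set_compact reduced_set_subset[OF r(1)] by blast
  qed
  show "\<exists>B. \<forall>z\<in>- \<Lambda>. \<forall>z'\<in>- \<Lambda>. cmod (wp z) > B \<longrightarrow> wp z = wp z' \<longrightarrow> wp' z = wp' z' \<longrightarrow> (\<exists>g\<in>{\<lambda>z. z + w |w. w \<in> \<Lambda>}. z' = g z)"
  proof -
    obtain r t where r: "r > 0" "t holomorphic_on ball 0 r" "t 0 = 0" "deriv t 0 \<noteq> 0" "inj_on t (ball 0 r)" "open (t ` ball 0 r)"
      "ball 0 r \<inter> \<Lambda> = {0}" and t: "\<And>z. z \<in> ball 0 r \<Longrightarrow> z \<noteq> 0 \<Longrightarrow> t z = wp z / wp' z \<and> cmod (wp z) \<ge> 1"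
      by (rule wp_coordinate_at_0) (rule that)
    have "compact (wp ` reduced_set r)"
      by (intro compact_continuous_image reduced_set_compact holomorphic_on_imp_continuous_on
          holomorphic_on_subset[OF wp_holomorphic] reduced_set_subset r)
    then obtain B where B: "\<And>z. z \<in> reduced_set r \<Longrightarrow> cmod (wp z) \<le> B"
      using compact_imp_bounded bounded_iff by (metis imageI)
    have "\<exists>g\<in>{\<lambda>z. z + w |w. w \<in> \<Lambda>}. z' = g z"
      if z: "z \<in> - \<Lambda>" "z' \<in> - \<Lambda>" "cmod (wp z) > B" "wp z = wp z'" "wp' z = wp' z'" for z z'
    proof -
      have red: "\<exists>w\<in>\<Lambda>. u - w \<in> ball 0 r \<and> u - w \<noteq> 0 \<and> t (u - w) = wp u / wp' u" if u: "u \<notin> \<Lambda>" "cmod (wp u) > B" for u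
      proof -
        obtain w where w: "w \<in> \<Lambda>" "u - w \<in> reduced_set r \<or> cmod (u - w) < r" by (rule lattice_reduce)
        have eq: "wp (u - w) = wp u" "wp' (u - w) = wp' u" using wp_periodic[of u "- w"] wp'_periodic[of u "- w"] u w by auto
        then have "u - w \<in> ball 0 r" using w(2) B[of "u - w"] u(2) by auto
        moreover have "u - w \<noteq> 0" using u w by auto
        ultimately show ?thesis using t[of "u - w"] eq w(1) by auto
      qed
      obtain w where w: "w \<in> \<Lambda>" "z - w \<in> ball 0 r" "t (z - w) = wp z / wp' z" using red[of z] z by auto
      obtain w' where w': "w' \<in> \<Lambda>" "z' - w' \<in> ball 0 r" "t (z' - w') = wp z' / wp' z'" using red[of z'] z by auto
      have "z - w = z' - w'" using inj_onD[OF r(5) _ w(2) w'(2)] w(3) w'(3) z by simp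
      then have "z' = z + (w' - w)" by (simp add: algebra_simps)
      moreover have "w' - w \<in> \<Lambda>" by (rule lattice_diff[OF w'(1) w(1)])
      ultimately show ?thesis by (intro bexI[of _ "\<lambda>u. u + (w' - w)"]) auto
    qed
    then show ?thesis by blast
  qed
  show "\<exists>z\<in>- \<Lambda>. cmod (wp z) > B" for B
  proof -
    obtain z where "z \<notin> \<Lambda>" "wp z = of_real (max B 0 + 1)" by (rule wp_surj)
    then show ?thesis by (intro bexI[of _ z]) (auto simp: max_def)
  qed
qed (rule affine_curve_connected)

lemma W_inj:
  assumes "z \<notin> \<Lambda>" "z' \<notin> \<Lambda>" "wp z = wp z'" "wp' z = wp' z'"
  shows "z' - z \<in> \<Lambda>"
proof -
  have "z \<in> - \<Lambda>" "z' \<in> - \<Lambda>" "W.F z = W.F z'" using assms by (simp_all add: W.F_def)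
  then obtain g where "g \<in> {\<lambda>z. z + w |w. w \<in> \<Lambda>}" "z' = g z" by (rule W.F_inj)
  then show ?thesis by auto
qed

end
context modular_coordinates begin

lemma x_at_cusp: "filterlim x at_infinity at_cusp"
proof -
  have "filterlim (\<lambda>\<tau>. (cusp_coord 6 \<tau>)\<^sup>2) (at 0) at_cusp"
    unfolding filterlim_at using tendsto_power[OF cusp_coord_tendsto[of 6], of 2] by simp
  then have "filterlim (\<lambda>\<tau>. hx (cusp_coord 1 \<tau>) / (cusp_coord 6 \<tau>)\<^sup>2) at_infinity at_cusp"
    by (intro filterlim_divide_at_infinity[OF tendsto_cusp_coord_compose] hx_holomorphic hx_0) simp_all
  moreover have "\<forall>\<^sub>F \<tau> in at_cusp. hx (cusp_coord 1 \<tau>) / (cusp_coord 6 \<tau>)\<^sup>2 = x \<tau>"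
    unfolding eventually_at_cusp by (intro exI[of _ 0]) (simp add: x_expansion upper_half_plane_def)
  ultimately show ?thesis by (rule filterlim_cong[OF refl refl, THEN iffD1, rotated])
qed

lemma x_large:
  obtains Y where "Y > 0" "\<And>\<tau>. Im \<tau> > Y \<Longrightarrow> cmod (x \<tau>) > B"
proof -
  have "\<forall>\<^sub>F \<tau> in at_cusp. max B 0 + 1 \<le> cmod (x \<tau>)"
    using x_at_cusp unfolding filterlim_at_infinity[of 0, OF order_refl] by (auto simp: add_nonneg_pos)
  then obtain Y where "\<And>\<tau>. Im \<tau> > Y \<Longrightarrow> max B 0 + 1 \<le> cmod (x \<tau>)" unfolding eventually_at_cusp by blast
  then show ?thesis using that[of "max Y 1"] by force
qed

lemma y_nonzero:
  assumes "\<tau> \<in> upper_half_plane" "cmod (x \<tau>) \<ge> 1" shows "y \<tau> \<noteq> 0"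
proof
  assume "y \<tau> = 0"
  then have "4 * x \<tau> ^ 3 = 1" using curve[OF assms(1)] by simp
  then have "4 * cmod (x \<tau>) ^ 3 = 1" by (metis norm_mult norm_numeral norm_one norm_power)
  moreover have "cmod (x \<tau>) ^ 3 \<ge> 1" using assms(2) by simp
  ultimately show False by simp
qed

text \<open>The counterpart of \<open>wp_coordinate_at_0\<close>: x / y is q times a quotient of
  power series in q^6 that does not vanish at 0.\<close>

lemma cusp_coordinate:
  obtains r t where "r > 0" "t holomorphic_on ball 0 r" "t 0 = 0" "deriv t 0 \<noteq> 0" "inj_on t (ball 0 r)"
    "\<And>\<tau>. \<tau> \<in> upper_half_plane \<Longrightarrow> cusp_coord 6 \<tau> \<in> ball 0 r \<Longrightarrow> t (cusp_coord 6 \<tau>) = x \<tau> / y \<tau> \<and> cmod (x \<tau>) \<ge> 1"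
proof -
  obtain Y where Y: "Y > 0" "\<And>\<tau>. Im \<tau> > Y \<Longrightarrow> cmod (x \<tau>) > 1" by (rule x_large[of 1]) blast
  define r0 where "r0 = exp (- (2 * pi * Y / 6))"
  have r0: "r0 > 0" "r0 \<le> 1" using Y(1) by (simp_all add: r0_def)
  have imY: "Im \<tau> > Y" if "cusp_coord 6 \<tau> \<in> ball 0 r0" for \<tau>
  proof -
    have "exp (- (2 * pi * Im \<tau> / 6)) < exp (- (2 * pi * Y / 6))"
      using that by (simp add: norm_cusp_coord r0_def)
    then have "2 * pi * Y < 2 * pi * Im \<tau>" by (simp add: divide_less_cancel)
    then show ?thesis by simp
  qed
  have pow: "(\<lambda>q::complex. q ^ 6) ` ball 0 r0 \<subseteq> ball 0 1"
  proof safe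
    fix q :: complex assume "q \<in> ball 0 r0"
    then have "cmod q < 1" using r0 by simp
    then have "cmod q ^ 6 < 1 ^ 6" by (intro power_strict_mono) auto
    then show "q ^ 6 \<in> ball 0 1" by (simp add: norm_power)
  qed
  have hol0: "(\<lambda>q. f (q ^ 6)) holomorphic_on ball 0 r0" if "f holomorphic_on ball 0 1" for f
    using holomorphic_on_compose_gen[OF _ that pow] by (simp add: o_def holomorphic_intros)
  have hyc: "isCont (\<lambda>q. hy (q ^ 6)) 0"
    using hol0[OF hy_holomorphic] r0 by (intro field_differentiable_imp_continuous_at holomorphic_on_imp_differentiable_at[of _ "ball 0 r0"]) auto
  obtain r1 where r1: "r1 > 0" "\<And>q. dist 0 q < r1 \<Longrightarrow> hy (q ^ 6) \<noteq> 0"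
    using continuous_at_avoid[OF hyc, of 0] hy_0 by auto
  define r2 where "r2 = min r0 r1"
  have r2: "r2 > 0" "ball 0 r2 \<subseteq> ball 0 r0" using r0 r1 by (auto simp: r2_def)
  define t where "t q = q * (hx (q ^ 6) / hy (q ^ 6))" for q
  have hol: "(\<lambda>q. hx (q ^ 6) / hy (q ^ 6)) holomorphic_on ball 0 r2"
    using r1(2) by (intro holomorphic_intros holomorphic_on_subset[OF hol0[OF hx_holomorphic] r2(2)]
       holomorphic_on_subset[OF hol0[OF hy_holomorphic] r2(2)]) (auto simp: r2_def)
  have t: "t holomorphic_on ball 0 r2" unfolding t_def[abs_def] by (intro holomorphic_intros hol)
  have "deriv t 0 = hx 0 / hy 0"
    using DERIV_mult[OF DERIV_ident holomorphic_derivI[OF hol open_ball, of 0]] r2(1)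
    unfolding t_def[abs_def] by (simp add: DERIV_imp_deriv)
  then have dt: "deriv t 0 \<noteq> 0" using hx_0 hy_0 by simp
  obtain r where r: "r > 0" "r \<le> r2" "inj_on t (ball 0 r)" "open (t ` ball 0 r)"
    by (rule holomorphic_locally_injective[OF t r2(1) dt])
  show ?thesis
  proof
    show "t holomorphic_on ball 0 r" by (rule holomorphic_on_subset[OF t]) (use r in auto)
    show "t 0 = 0" by (simp add: t_def)
    fix \<tau> assume \<tau>: "\<tau> \<in> upper_half_plane" "cusp_coord 6 \<tau> \<in> ball 0 r"
    have "cusp_coord 6 \<tau> \<in> ball 0 r0" using \<tau>(2) r(2) by (auto simp: r2_def)
    then have "cmod (x \<tau>) > 1" using Y(2) imY by blast
    moreover have "hy (cusp_coord 6 \<tau> ^ 6) \<noteq> 0" using \<tau>(2) r(2) by (intro r1(2)) (auto simp: r2_def)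
    ultimately show "t (cusp_coord 6 \<tau>) = x \<tau> / y \<tau> \<and> cmod (x \<tau>) \<ge> 1"
      unfolding x_expansion[OF \<tau>(1)] y_expansion[OF \<tau>(1)]
      by (simp add: t_def cusp_coord_6 power2_eq_square power3_eq_cube)
  qed (use r dt in auto)
qed

sublocale H: curve_chart upper_half_plane x y "\<lambda>\<tau>. c * (eta_sq \<tau>)\<^sup>2"
proof
  show "open upper_half_plane" by (rule open_upper_half_plane)
  fix \<tau> assume t: "\<tau> \<in> upper_half_plane"
  show "c * (eta_sq \<tau>)\<^sup>2 \<noteq> 0" using c_nonzero by simp
  show "(y \<tau>)\<^sup>2 = 4 * x \<tau> ^ 3 - 1" by (rule curve[OF t])
  show "(x has_field_derivative c * (eta_sq \<tau>)\<^sup>2 * y \<tau>) (at \<tau>)" by (rule x_derivative[OF t])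
  obtain Y where Y: "Y > 0" "\<And>\<tau>. Im \<tau> > Y \<Longrightarrow> cmod (x \<tau>) > 1" by (rule x_large[of 1]) blast
  define \<tau>0 where "\<tau>0 = \<i> * of_real (Y + 1)"
  have t0: "\<tau>0 \<in> upper_half_plane" "Im \<tau>0 > Y" using Y(1) by (simp_all add: \<tau>0_def upper_half_plane_def)
  show "(y has_field_derivative c * (eta_sq \<tau>)\<^sup>2 * (6 * (x \<tau>)\<^sup>2)) (at \<tau>)"
    by (rule curve_second_derivative[OF open_upper_half_plane connected_upper_half_plane x_holomorphic y_holomorphic _ curve x_derivative
          t0(1) y_nonzero[OF t0(1) less_imp_le[OF Y(2)[OF t0(2)]]] t])
      (auto intro!: holomorphic_intros eta_sq_holomorphic)
qed

lemma H_cover: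
  assumes "connected affine_curve"
  shows "curve_cover upper_half_plane x y (\<lambda>\<tau>. c * (eta_sq \<tau>)\<^sup>2) (moebius ` modular_commutator)"
proof
  note MS = modular_commutator_in_SL2Z
  show "\<exists>g\<in>moebius ` modular_commutator. \<forall>z\<in>upper_half_plane. g z = z"
    using modular_commutator_one by (intro bexI[of _ "moebius (mat 1)"]) auto
  show "\<exists>h\<in>moebius ` modular_commutator. \<forall>z\<in>upper_half_plane. h (g z) = z \<and> g (h z) = z"
    if g: "g \<in> moebius ` modular_commutator" for g
  proof -
    obtain \<gamma> where "\<gamma> \<in> modular_commutator" "g = moebius \<gamma>" using g by blast
    then show ?thesis
      using modular_commutator_inv moebius_inv[OF MS] by (intro bexI[of _ "moebius (inv\<^bsub>SL2Z\<^esub> \<gamma>)"]) auto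
  qed
  show "\<exists>f\<in>moebius ` modular_commutator. \<forall>z\<in>upper_half_plane. f z = g (h z)"
    if g: "g \<in> moebius ` modular_commutator" and h: "h \<in> moebius ` modular_commutator" for g h
  proof -
    obtain \<gamma> \<delta> where gd: "\<gamma> \<in> modular_commutator" "g = moebius \<gamma>" "\<delta> \<in> modular_commutator" "h = moebius \<delta>"
      using g h by blast
    show ?thesis
      using gd moebius_mult[OF MS[OF gd(1)] MS[OF gd(3)]] modular_commutator_mult[OF gd(1) gd(3)]
      by (intro bexI[of _ "moebius (\<gamma> ** \<delta>)"]) (simp_all add: imageI)
  qed
  show "g z \<in> upper_half_plane" if "g \<in> moebius ` modular_commutator" "z \<in> upper_half_plane" for g z
    using that moebius_in[OF MS] by auto
  show "isCont g z" if "g \<in> moebius ` modular_commutator" "z \<in> upper_half_plane" for g z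
    using that DERIV_isCont[OF moebius_has_derivative[OF MS]] by auto
  show "x (g z) = x z \<and> y (g z) = y z" if "g \<in> moebius ` modular_commutator" "z \<in> upper_half_plane" for g z
    using that x_modular y_modular by auto
  show "\<exists>h\<in>moebius ` modular_commutator. z' = h z"
    if p: "\<And>n::nat. p n \<in> upper_half_plane" "\<And>n. g n \<in> moebius ` modular_commutator" "p \<longlonglongrightarrow> z" "(\<lambda>n. g n (p n)) \<longlonglongrightarrow> z'"
      "z \<in> upper_half_plane" "z' \<in> upper_half_plane" for p g z z'
  proof -
    have "\<forall>n. \<exists>\<gamma>. \<gamma> \<in> modular_commutator \<and> g n = moebius \<gamma>" using p(2) by blast
    then obtain \<gamma> where g: "\<And>n. \<gamma> n \<in> modular_commutator" "\<And>n. g n = moebius (\<gamma> n)" by metis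
    have lim: "(\<lambda>n. moebius (\<gamma> n) (p n)) \<longlonglongrightarrow> z'" using p(4) unfolding g(2) .
    obtain \<delta> where "\<delta> \<in> modular_commutator" "z' = moebius \<delta> z" "\<exists>\<^sub>F n in sequentially. \<gamma> n = \<delta>"
      by (rule modular_commutator_closed[OF p(1) g(1) p(3) lim p(5,6)])
    then show ?thesis by blast
  qed
  show "\<exists>K. compact K \<and> K \<subseteq> upper_half_plane \<and> (\<forall>z\<in>upper_half_plane. cmod (x z) \<le> B \<longrightarrow> (\<exists>g\<in>moebius ` modular_commutator. g z \<in> K))" for B
  proof -
    obtain Y where Y: "Y > 0" "\<And>\<tau>. Im \<tau> > Y \<Longrightarrow> cmod (x \<tau>) > B" by (rule x_large[of B]) blast
    have "\<exists>g\<in>moebius ` modular_commutator. g z \<in> fundamental_box Y" if z: "z \<in> upper_half_plane" "cmod (x z) \<le> B" for z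
    proof -
      obtain \<gamma> where g: "\<gamma> \<in> modular_commutator" "moebius \<gamma> z \<in> fundamental_box Y \<or> Im (moebius \<gamma> z) > Y"
        by (rule modular_commutator_reduce_box[OF z(1)])
      then show ?thesis using Y(2)[of "moebius \<gamma> z"] z(2) x_modular[OF g(1) z(1)] by force
    qed
    then show ?thesis using compact_fundamental_box fundamental_box_subset by blast
  qed
  show "\<exists>B. \<forall>z\<in>upper_half_plane. \<forall>z'\<in>upper_half_plane. cmod (x z) > B \<longrightarrow> x z = x z' \<longrightarrow> y z = y z' \<longrightarrow>
      (\<exists>g\<in>moebius ` modular_commutator. z' = g z)"
  proof -
    obtain r t where r: "r > 0" "t holomorphic_on ball 0 r" "t 0 = 0" "deriv t 0 \<noteq> 0" "inj_on t (ball 0 r)"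
      and t: "\<And>\<tau>. \<tau> \<in> upper_half_plane \<Longrightarrow> cusp_coord 6 \<tau> \<in> ball 0 r \<Longrightarrow> t (cusp_coord 6 \<tau>) = x \<tau> / y \<tau> \<and> cmod (x \<tau>) \<ge> 1"
      by (rule cusp_coordinate) (rule that)
    have "\<forall>\<^sub>F \<tau> in at_cusp. dist (cusp_coord 6 \<tau>) 0 < r" by (rule tendstoD[OF cusp_coord_tendsto r(1)]) simp
    then obtain Y where Y: "\<And>\<tau>. Im \<tau> > Y \<Longrightarrow> cusp_coord 6 \<tau> \<in> ball 0 r" by (auto simp: eventually_at_cusp)
    have "compact (x ` fundamental_box Y)"
      by (intro compact_continuous_image compact_fundamental_box holomorphic_on_imp_continuous_on
          holomorphic_on_subset[OF x_holomorphic] fundamental_box_subset)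
    then obtain B where B: "\<And>z. z \<in> fundamental_box Y \<Longrightarrow> cmod (x z) \<le> B"
      using compact_imp_bounded bounded_iff by (metis imageI)
    have red: "\<exists>\<gamma>\<in>modular_commutator. cusp_coord 6 (moebius \<gamma> u) \<in> ball 0 r \<and> t (cusp_coord 6 (moebius \<gamma> u)) = x u / y u"
      if u: "u \<in> upper_half_plane" "cmod (x u) > B" for u
    proof -
      obtain \<gamma> where g: "\<gamma> \<in> modular_commutator" "moebius \<gamma> u \<in> fundamental_box Y \<or> Im (moebius \<gamma> u) > Y"
        by (rule modular_commutator_reduce_box[OF u(1)])
      have inv: "x (moebius \<gamma> u) = x u" "y (moebius \<gamma> u) = y u" using x_modular y_modular g(1) u(1) by auto
      then have "cusp_coord 6 (moebius \<gamma> u) \<in> ball 0 r" using g(2) B[of "moebius \<gamma> u"] u(2) Y by auto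
      then show ?thesis using t[OF moebius_in[OF MS[OF g(1)] u(1)]] inv g(1) by auto
    qed
    have "\<exists>g\<in>moebius ` modular_commutator. z' = g z"
      if z: "z \<in> upper_half_plane" "z' \<in> upper_half_plane" "cmod (x z) > B" "x z = x z'" "y z = y z'" for z z'
    proof -
      obtain \<gamma> where g: "\<gamma> \<in> modular_commutator" "cusp_coord 6 (moebius \<gamma> z) \<in> ball 0 r" "t (cusp_coord 6 (moebius \<gamma> z)) = x z / y z"
        using red[of z] z by auto
      obtain \<gamma>' where g': "\<gamma>' \<in> modular_commutator" "cusp_coord 6 (moebius \<gamma>' z') \<in> ball 0 r" "t (cusp_coord 6 (moebius \<gamma>' z')) = x z' / y z'"
        using red[of z'] z by auto
      \<comment> \<open>Equal values of x / y mean equal parameters q, so the two representatives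
        differ by a multiple of 6, and such translations belong to the action.\<close>
      have "cusp_coord 6 (moebius \<gamma>' z') = cusp_coord 6 (moebius \<gamma> z)"
        using inj_onD[OF r(5) _ g'(2) g(2)] g(3) g'(3) z by simp
      then obtain n :: int where "2 * of_real pi * \<i> * moebius \<gamma>' z' / of_real 6 = 2 * of_real pi * \<i> * moebius \<gamma> z / of_real 6 + (of_int (2 * n) * pi) * \<i>"
        unfolding cusp_coord_def exp_eq by auto
      then have "2 * of_real pi * \<i> * (moebius \<gamma>' z' / 6) = 2 * of_real pi * \<i> * (moebius \<gamma> z / 6 + of_int n)"
        by (simp add: algebra_simps)
      then have "moebius \<gamma>' z' / 6 = moebius \<gamma> z / 6 + of_int n"
        by (subst (asm) mult_cancel_left) auto
      then have shift: "moebius \<gamma>' z' = moebius \<gamma> z + of_int (6 * n)"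
        using arg_cong[of "moebius \<gamma>' z' / 6" _ "\<lambda>u. 6 * u"] by (simp only: ring_distribs) simp
      obtain \<delta> where d: "\<delta> \<in> modular_commutator" "\<forall>\<tau>\<in>upper_half_plane. moebius \<delta> \<tau> = \<tau> + of_int (6 * n)"
        using T6_in_modular_commutator by blast
      have gz: "moebius \<gamma> z \<in> upper_half_plane" using moebius_in MS g(1) z(1) by blast
      have "moebius (inv\<^bsub>SL2Z\<^esub> \<gamma>' ** (\<delta> ** \<gamma>)) z = moebius (inv\<^bsub>SL2Z\<^esub> \<gamma>') (moebius \<delta> (moebius \<gamma> z))"
        using z(1) g(1) g'(1) d(1)
        by (simp only: moebius_mult MS modular_commutator_mult modular_commutator_inv moebius_in)
      also have "moebius \<delta> (moebius \<gamma> z) = moebius \<gamma>' z'" by (simp only: bspec[OF d(2) gz] shift)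
      also have "moebius (inv\<^bsub>SL2Z\<^esub> \<gamma>') \<dots> = z'" by (rule moebius_inv(1)[OF MS[OF g'(1)] z(2)])
      finally show ?thesis
        using g(1) g'(1) d(1) by (intro bexI[of _ "moebius (inv\<^bsub>SL2Z\<^esub> \<gamma>' ** (\<delta> ** \<gamma>))"])
          (auto intro!: imageI modular_commutator_mult modular_commutator_inv)
    qed
    then show ?thesis by blast
  qed
  show "\<exists>z\<in>upper_half_plane. cmod (x z) > B" for B
  proof -
    obtain Y where Y: "Y > 0" "\<And>\<tau>. Im \<tau> > Y \<Longrightarrow> cmod (x \<tau>) > B" by (rule x_large[of B]) blast
    then show ?thesis by (intro bexI[of _ "\<i> * of_real (Y + 1)"]) (auto simp: upper_half_plane_def)
  qed
qed (rule assms)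

end

section \<open>Cusps and growth\<close>

lemma SL2Z_decompose_action:
  assumes "g \<in> carrier SL2Z"
  obtains \<gamma> k where "\<gamma> \<in> modular_commutator" "\<And>\<tau>. \<tau> \<in> upper_half_plane \<Longrightarrow> moebius g \<tau> = moebius \<gamma> (\<tau> + of_int k)"
proof -
  obtain \<gamma> k where g: "\<gamma> \<in> modular_commutator" "g = \<gamma> ** matT k" by (rule SL2Z_decompose[OF assms])
  then show ?thesis using that[of \<gamma> k] by (simp add: moebius_mult modular_commutator_in_SL2Z)
qed

lemma upper_half_plane_plus_int [simp]: "\<tau> + of_int k \<in> upper_half_plane \<longleftrightarrow> \<tau> \<in> upper_half_plane"
  by (simp add: upper_half_plane_def)

lemma cusp_act_mult_infinity:
  assumes "h \<in> carrier SL2Z" "g \<in> carrier SL2Z"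
  shows "cusp_act (h ** g) None = cusp_act h (cusp_act g None)"
proof -
  obtain a b c d where g: "g = mat2 a b c d" "a * d - b * c = 1" by (rule SL2_cases[OF assms(2)])
  obtain a' b' c' d' where h: "h = mat2 a' b' c' d'" "a' * d' - b' * c' = 1" by (rule SL2_cases[OF assms(1)])
  show ?thesis
  proof (cases "c = 0")
    case True
    then have "a \<noteq> 0" using g(2) by auto
    then show ?thesis using True by (simp add: cusp_act_def g h matrix2_mult_nth)
  next
    case False
    have 1: "(of_int c' * (of_int a / of_int c) + of_int d' :: rat) = of_int (c' * a + d' * c) / of_int c"
      "(of_int a' * (of_int a / of_int c) + of_int b' :: rat) = of_int (a' * a + b' * c) / of_int c"
      using False by (simp_all add: add_divide_distrib)
    have 2: "of_int (c' * a + d' * c) / of_int c = (0 :: rat) \<longleftrightarrow> c' * a + d' * c = 0"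
      unfolding divide_eq_0_iff of_int_eq_0_iff using False by simp
    show ?thesis using False
      by (simp add: cusp_act_def g h matrix2_mult_nth 1 2 del: of_int_add of_int_mult times_divide_eq_right times_divide_eq_left)
        (simp add: distrib_right)
  qed
qed

text \<open>Bezout provides a matrix that sends infinity to the given cusp. Translations fix
  infinity, so the coset decomposition replaces the matrix by an element of the commutator
  subgroup.\<close>

lemma cusp_cases:
  obtains \<gamma> where "\<gamma> \<in> modular_commutator" "s = cusp_act \<gamma> None"
proof -
  have "\<exists>g\<in>carrier SL2Z. s = cusp_act g None"
  proof (cases s)
    case None
    then show ?thesis by (intro bexI[of _ "matT 0"] matT_in) (simp add: cusp_act_def matT_def)
  next
    case (Some p)
    obtain a c where ac: "quotient_of p = (a, c)" by fastforce
    have c: "c > 0" "coprime a c" "p = of_int a / of_int c"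
      using quotient_of_denom_pos[OF ac] quotient_of_coprime[OF ac] quotient_of_div[OF ac] by auto
    obtain u v where "u * a + v * c = 1" using bezout_int[of a c] c(2) by auto
    then show ?thesis using c Some
      by (intro bexI[of _ "mat2 a (- v) c u"]) (simp_all add: cusp_act_def mat2_SL2_iff algebra_simps)
  qed
  then obtain g where g: "g \<in> carrier SL2Z" "s = cusp_act g None" by blast
  obtain \<gamma> k where d: "\<gamma> \<in> modular_commutator" "g = \<gamma> ** matT k" by (rule SL2Z_decompose[OF g(1)])
  have "cusp_act (matT k) None = None" by (simp add: cusp_act_def matT_def)
  then show ?thesis using that[OF d(1)] g(2) d cusp_act_mult_infinity[OF modular_commutator_in_SL2Z[OF d(1)] matT_in, of k] by simp
qed

lemma cusp_point_modular_commutator: "cusp_point modular_commutator s = UNIV"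
proof -
  have "s' \<in> cusp_point modular_commutator s" for s'
  proof -
    note MS = modular_commutator_in_SL2Z
    obtain \<gamma> where g: "\<gamma> \<in> modular_commutator" "s = cusp_act \<gamma> None" by (rule cusp_cases)
    obtain \<gamma>' where g': "\<gamma>' \<in> modular_commutator" "s' = cusp_act \<gamma>' None" by (rule cusp_cases)
    let ?d = "\<gamma>' ** inv\<^bsub>SL2Z\<^esub> \<gamma>"
    have d: "?d \<in> modular_commutator" using g(1) g'(1) modular_commutator_mult modular_commutator_inv by simp
    have "?d ** \<gamma> = \<gamma>'" using SL2Z.l_inv[OF MS[OF g(1)]]
      by (simp add: SL2_simps matrix_mul_assoc[symmetric])
    then have "s' = cusp_act ?d s" using cusp_act_mult_infinity[OF MS[OF d] MS[OF g(1)]] g(2) g'(2) by simp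
    then show ?thesis using d unfolding cusp_point_def by blast
  qed
  then show ?thesis by blast
qed

definition cusp_growth :: "(complex \<Rightarrow> 'v::real_normed_vector) \<Rightarrow> bool" where
  "cusp_growth f \<longleftrightarrow> (\<exists>C M Y. \<forall>\<tau>\<in>upper_half_plane. Im \<tau> > Y \<longrightarrow> norm (f \<tau>) \<le> C * exp (M * cmod \<tau>))"

text \<open>There is only one cusp up to the action of the commutator subgroup.\<close>

lemma exponential_growth_all_cusps:
  assumes K: "\<And>\<gamma>. \<gamma> \<in> modular_commutator \<Longrightarrow>
      \<exists>K. \<forall>\<tau>\<in>upper_half_plane. norm (f (moebius \<gamma> \<tau>)) \<le> K * norm (f \<tau>)"
  shows "(\<forall>s. exponential_growth_at s f) \<longleftrightarrow> cusp_growth f"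
proof
  assume "\<forall>s. exponential_growth_at s f"
  then have "exponential_growth_at None f" by blast
  moreover have "mat 1 \<in> carrier SL2Z" "cusp_act (mat 1) None = None"
    using matT_in[of 0] by (simp_all add: matT_0 cusp_act_def mat2_one)
  ultimately obtain C M Y where "\<forall>\<tau>\<in>upper_half_plane. Im (moebius (mat 1) \<tau>) > Y \<longrightarrow>
      norm (f \<tau>) < C * exp (M * cmod (moebius (mat 1) \<tau>))"
    unfolding exponential_growth_at_def by blast
  then show "cusp_growth f" unfolding cusp_growth_def
    by (intro exI[of _ C] exI[of _ M] exI[of _ Y]) (auto intro: less_imp_le)
next
  assume "cusp_growth f"
  then obtain C M Y where C: "\<And>\<tau>. \<tau> \<in> upper_half_plane \<Longrightarrow> Im \<tau> > Y \<Longrightarrow> norm (f \<tau>) \<le> C * exp (M * cmod \<tau>)"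
    unfolding cusp_growth_def by blast
  show "\<forall>s. exponential_growth_at s f"
    unfolding exponential_growth_at_def
  proof (intro allI ballI impI)
    fix s g assume g: "g \<in> carrier SL2Z"
    obtain \<gamma> k where d: "\<gamma> \<in> modular_commutator"
      "\<And>\<tau>. \<tau> \<in> upper_half_plane \<Longrightarrow> moebius (inv\<^bsub>SL2Z\<^esub> g) \<tau> = moebius \<gamma> (\<tau> + of_int k)"
      by (rule SL2Z_decompose_action[OF SL2Z.inv_closed[OF g]]) (rule that)
    obtain K where K': "\<forall>\<tau>\<in>upper_half_plane. norm (f (moebius \<gamma> \<tau>)) \<le> K * norm (f \<tau>)" using K[OF d(1)] by blast
    \<comment> \<open>The summand 1 makes the final inequality strict, as the growth condition
      demands, even when the product vanishes.\<close>
    let ?D = "\<bar>K\<bar> * \<bar>C\<bar> * exp (\<bar>M\<bar> * \<bar>of_int k\<bar>) + 1"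
    show "\<exists>C M Y. \<forall>\<tau>\<in>upper_half_plane. Im (moebius g \<tau>) > Y \<longrightarrow> norm (f \<tau>) < C * exp (M * cmod (moebius g \<tau>))"
    proof (intro exI ballI impI)
      fix \<tau> assume t: "\<tau> \<in> upper_half_plane" "Im (moebius g \<tau>) > Y"
      let ?s = "moebius g \<tau>"
      have s: "?s \<in> upper_half_plane" by (rule moebius_in[OF g t(1)])
      have "f \<tau> = f (moebius \<gamma> (?s + of_int k))" using moebius_inv(1)[OF g t(1)] d(2)[OF s] by simp
      then have "norm (f \<tau>) \<le> K * norm (f (?s + of_int k))" using K' s by simp
      also have "\<dots> \<le> \<bar>K\<bar> * norm (f (?s + of_int k))" by (intro mult_right_mono) auto
      also have "norm (f (?s + of_int k)) \<le> C * exp (M * cmod (?s + of_int k))" using C s t(2) by simp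
      also have "\<dots> \<le> \<bar>C\<bar> * exp (\<bar>M\<bar> * (cmod ?s + \<bar>of_int k\<bar>))"
      proof (intro mult_mono)
        have "M * cmod (?s + of_int k) \<le> \<bar>M\<bar> * cmod (?s + of_int k)" by (intro mult_right_mono) auto
        also have "\<dots> \<le> \<bar>M\<bar> * (cmod ?s + \<bar>of_int k\<bar>)"
          using norm_triangle_ineq[of ?s "of_int k"] by (intro mult_left_mono) auto
        finally show "exp (M * cmod (?s + of_int k)) \<le> exp (\<bar>M\<bar> * (cmod ?s + \<bar>of_int k\<bar>))" by simp
      qed auto
      also have "\<bar>K\<bar> * (\<bar>C\<bar> * exp (\<bar>M\<bar> * (cmod ?s + \<bar>of_int k\<bar>))) < ?D * exp (\<bar>M\<bar> * cmod ?s)"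
        by (simp add: algebra_simps exp_add)
      finally show "norm (f \<tau>) < ?D * exp (\<bar>M\<bar> * cmod ?s)" by (simp add: mult_left_mono)
    qed
  qed
qed

lemma modular_functions_iff:
  "f \<in> modular_functions modular_commutator \<longleftrightarrow>
     (\<forall>\<tau>. \<tau> \<notin> upper_half_plane \<longrightarrow> f \<tau> = 0) \<and> f holomorphic_on upper_half_plane \<and>
     (\<forall>\<gamma>\<in>modular_commutator. \<forall>\<tau>\<in>upper_half_plane. f (moebius \<gamma> \<tau>) = f \<tau>) \<and> cusp_growth f"
proof -
  have "(\<forall>s. exponential_growth_at s f) \<longleftrightarrow> cusp_growth f"
    if "\<forall>\<gamma>\<in>modular_commutator. \<forall>\<tau>\<in>upper_half_plane. f (moebius \<gamma> \<tau>) = f \<tau>"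
    using that by (intro exponential_growth_all_cusps exI[of _ 1]) auto
  then show ?thesis unfolding modular_functions_def by blast
qed

text \<open>The bound on \<open>h\<close> replaces an actual product, so that products of functions
  and scalar multiples of vectors are both covered.\<close>

lemma cusp_growth_mult:
  assumes "cusp_growth (f :: complex \<Rightarrow> complex)" "cusp_growth (g :: complex \<Rightarrow> 'v::real_normed_vector)"
    and h: "\<And>\<tau>. norm (h \<tau> :: 'w::real_normed_vector) \<le> K * (norm (f \<tau>) * norm (g \<tau>))" and K: "K \<ge> 0"
  shows "cusp_growth h"
proof -
  obtain C M Y where C: "\<forall>\<tau>\<in>upper_half_plane. Im \<tau> > Y \<longrightarrow> norm (f \<tau>) \<le> C * exp (M * cmod \<tau>)"
    using assms(1) unfolding cusp_growth_def by blast
  obtain C' M' Y' where C': "\<forall>\<tau>\<in>upper_half_plane. Im \<tau> > Y' \<longrightarrow> norm (g \<tau>) \<le> C' * exp (M' * cmod \<tau>)"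
    using assms(2) unfolding cusp_growth_def by blast
  have "norm (h \<tau>) \<le> (K * C * C') * exp ((M + M') * cmod \<tau>)" if t: "\<tau> \<in> upper_half_plane" "Im \<tau> > max Y Y'" for \<tau>
  proof -
    have 1: "norm (f \<tau>) \<le> C * exp (M * cmod \<tau>)" "norm (g \<tau>) \<le> C' * exp (M' * cmod \<tau>)" using C C' t by auto
    have "norm (f \<tau>) * norm (g \<tau>) \<le> (C * exp (M * cmod \<tau>)) * (C' * exp (M' * cmod \<tau>))"
      using order_trans[OF norm_ge_zero 1(1)] by (intro mult_mono 1) auto
    then have "K * (norm (f \<tau>) * norm (g \<tau>)) \<le> K * ((C * exp (M * cmod \<tau>)) * (C' * exp (M' * cmod \<tau>)))"
      using K by (rule mult_left_mono)
    moreover have "K * ((C * exp (M * cmod \<tau>)) * (C' * exp (M' * cmod \<tau>))) = (K * C * C') * exp ((M + M') * cmod \<tau>)"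
      by (simp add: distrib_right exp_add)
    ultimately show ?thesis using h[of \<tau>] by linarith
  qed
  then show ?thesis unfolding cusp_growth_def by blast
qed

lemma cusp_growth_add:
  assumes "cusp_growth f" "cusp_growth g"
  shows "cusp_growth (\<lambda>\<tau>. f \<tau> + g \<tau>)"
proof -
  obtain C M Y where C: "\<forall>\<tau>\<in>upper_half_plane. Im \<tau> > Y \<longrightarrow> norm (f \<tau>) \<le> C * exp (M * cmod \<tau>)"
    using assms(1) unfolding cusp_growth_def by blast
  obtain C' M' Y' where C': "\<forall>\<tau>\<in>upper_half_plane. Im \<tau> > Y' \<longrightarrow> norm (g \<tau>) \<le> C' * exp (M' * cmod \<tau>)"
    using assms(2) unfolding cusp_growth_def by blast
  have "norm (f \<tau> + g \<tau>) \<le> (\<bar>C\<bar> + \<bar>C'\<bar>) * exp ((\<bar>M\<bar> + \<bar>M'\<bar>) * cmod \<tau>)"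
    if t: "\<tau> \<in> upper_half_plane" "Im \<tau> > max Y Y'" for \<tau>
  proof -
    have "norm (f \<tau>) \<le> C * exp (M * cmod \<tau>)" using C t by auto
    also have "\<dots> \<le> \<bar>C\<bar> * exp ((\<bar>M\<bar> + \<bar>M'\<bar>) * cmod \<tau>)"
      by (intro mult_mono) (auto intro!: mult_right_mono)
    finally have 1: "norm (f \<tau>) \<le> \<bar>C\<bar> * exp ((\<bar>M\<bar> + \<bar>M'\<bar>) * cmod \<tau>)" .
    have "norm (g \<tau>) \<le> C' * exp (M' * cmod \<tau>)" using C' t by auto
    also have "\<dots> \<le> \<bar>C'\<bar> * exp ((\<bar>M\<bar> + \<bar>M'\<bar>) * cmod \<tau>)"
      by (intro mult_mono) (auto intro!: mult_right_mono)
    finally have 2: "norm (g \<tau>) \<le> \<bar>C'\<bar> * exp ((\<bar>M\<bar> + \<bar>M'\<bar>) * cmod \<tau>)" .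
    show ?thesis using norm_triangle_ineq[of "f \<tau>" "g \<tau>"] 1 2 by (simp add: distrib_right)
  qed
  then show ?thesis unfolding cusp_growth_def by blast
qed

lemma cusp_growth_bounded:
  assumes "\<And>\<tau>. \<tau> \<in> upper_half_plane \<Longrightarrow> Im \<tau> > Y \<Longrightarrow> norm (f \<tau>) \<le> C"
  shows "cusp_growth f"
  unfolding cusp_growth_def using assms by (intro exI[of _ C] exI[of _ 0] exI[of _ Y]) simp

lemma cusp_growth_inverse_coord: "cusp_growth (\<lambda>\<tau>. 1 / cusp_coord p \<tau> ^ n)"
proof -
  have "norm (1 / cusp_coord p \<tau> ^ n) \<le> 1 * exp ((n * \<bar>2 * pi / p\<bar>) * cmod \<tau>)" for \<tau>
  proof -
    have "2 * pi * Im \<tau> / p = 2 * pi / p * Im \<tau>" by simp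
    also have "\<dots> \<le> \<bar>2 * pi / p\<bar> * cmod \<tau>"
    proof (rule order_trans[OF abs_ge_self])
      show "\<bar>2 * pi / p * Im \<tau>\<bar> \<le> \<bar>2 * pi / p\<bar> * cmod \<tau>"
        unfolding abs_mult[of _ "Im \<tau>"] by (rule mult_left_mono[OF abs_Im_le_cmod abs_ge_zero])
    qed
    finally have "real n * (2 * pi * Im \<tau> / p) \<le> real n * (\<bar>2 * pi / p\<bar> * cmod \<tau>)" by (rule mult_left_mono) simp
    moreover have "norm (1 / cusp_coord p \<tau> ^ n) = exp (real n * (2 * pi * Im \<tau> / p))"
      unfolding exp_of_nat_mult by (simp add: norm_divide norm_power norm_cusp_coord exp_minus power_inverse inverse_eq_divide power_one_over)
    ultimately show ?thesis by (simp only: mult_1 exp_le_cancel_iff mult.assoc)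
  qed
  then show ?thesis unfolding cusp_growth_def by blast
qed

lemma cusp_growth_expansion:
  assumes h: "h holomorphic_on ball 0 1" and p: "p > 0"
    and f: "\<And>\<tau>. \<tau> \<in> upper_half_plane \<Longrightarrow> f \<tau> = h (cusp_coord p \<tau>) / cusp_coord p' \<tau> ^ n"
    and out: "\<And>\<tau>. \<tau> \<notin> upper_half_plane \<Longrightarrow> f \<tau> = 0"
  shows "cusp_growth f"
proof -
  obtain d where d: "d > 0" "\<And>q. dist q 0 < d \<Longrightarrow> dist (h q) (h 0) < 1"
    using h continuous_on_eq_continuous_at[of "ball 0 1" h] holomorphic_on_imp_continuous_on[OF h]
    unfolding continuous_at_eps_delta by (metis centre_in_ball open_ball zero_less_one)
  have "\<forall>\<^sub>F \<tau> in at_cusp. dist (cusp_coord p \<tau>) 0 < d" using tendstoD[OF cusp_coord_tendsto[OF p] d(1)] .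
  then obtain Y where Y: "\<And>\<tau>. Im \<tau> > Y \<Longrightarrow> dist (cusp_coord p \<tau>) 0 < d" unfolding eventually_at_cusp by blast
  have "cmod (h (cusp_coord p \<tau>)) \<le> cmod (h 0) + 1" if "Im \<tau> > Y" for \<tau>
    using d(2)[OF Y[OF that]] norm_triangle_ineq2[of "h (cusp_coord p \<tau>)" "h 0"] by (simp add: dist_norm)
  then have 1: "cusp_growth (\<lambda>\<tau>. h (cusp_coord p \<tau>))" by (intro cusp_growth_bounded)
  show ?thesis
  proof (rule cusp_growth_mult[OF 1 cusp_growth_inverse_coord])
    show "cmod (f \<tau>) \<le> 1 * (cmod (h (cusp_coord p \<tau>)) * cmod (1 / cusp_coord p' \<tau> ^ n))" for \<tau>
      by (cases "\<tau> \<in> upper_half_plane") (simp_all add: f out norm_divide)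
  qed simp
qed

lemma (in modular_coordinates) x_modular_function: "x \<in> modular_functions modular_commutator"
  and y_modular_function: "y \<in> modular_functions modular_commutator"
  unfolding modular_functions_iff
  using x_holomorphic y_holomorphic x_modular y_modular x_outside y_outside
    cusp_growth_expansion[OF hx_holomorphic zero_less_one x_expansion x_outside]
    cusp_growth_expansion[OF hy_holomorphic zero_less_one y_expansion y_outside]
  by blast+

section \<open>The map to the torus\<close>

locale modular_uniformisation = normalised_hexagonal \<omega> + modular_coordinates x y c hx hy
  for \<omega> :: complex and x y :: "complex \<Rightarrow> complex" and c :: complex and hx hy :: "complex \<Rightarrow> complex"
begin

interpretation H: curve_cover upper_half_plane x y "\<lambda>\<tau>. c * (eta_sq \<tau>)\<^sup>2" "moebius ` modular_commutator"
  by (rule H_cover[OF affine_curve_connected])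

text \<open>The value at an orbit is the whole fibre of (\<open>wp\<close>, \<open>wp'\<close>) over
  the common point (x, y) of that orbit. This fibre is a coset of the lattice, so no lift has to be
  chosen.\<close>

definition torus_map :: "complex set + rat option set \<Rightarrow> complex set" where
  "torus_map P = (case P of
      Inl A \<Rightarrow> {w. w \<notin> \<Lambda> \<and> (\<exists>\<tau>\<in>A \<inter> upper_half_plane. wp w = x \<tau> \<and> wp' w = y \<tau>)}
    | Inr _ \<Rightarrow> \<Lambda>)"

lemma torus_map_orbit:
  assumes "\<tau> \<in> upper_half_plane"
  shows "w \<in> torus_map (Inl (orbit_point modular_commutator \<tau>)) \<longleftrightarrow> w \<notin> \<Lambda> \<and> wp w = x \<tau> \<and> wp' w = y \<tau>"
proof -
  have eq: "x \<sigma> = x \<tau>" "y \<sigma> = y \<tau>" if "\<sigma> \<in> orbit_point modular_commutator \<tau>" for \<sigma>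
    using that x_modular y_modular assms by (auto simp: orbit_point_def)
  have mem: "\<tau> \<in> orbit_point modular_commutator \<tau> \<inter> upper_half_plane"
    using assms unfolding orbit_point_def using modular_commutator_one by (intro IntI CollectI exI[of _ "mat 1"]) simp_all
  have "(\<exists>\<sigma>\<in>orbit_point modular_commutator \<tau> \<inter> upper_half_plane. wp w = x \<sigma> \<and> wp' w = y \<sigma>) \<longleftrightarrow>
      wp w = x \<tau> \<and> wp' w = y \<tau>"
  proof
    assume "\<exists>\<sigma>\<in>orbit_point modular_commutator \<tau> \<inter> upper_half_plane. wp w = x \<sigma> \<and> wp' w = y \<sigma>"
    then obtain \<sigma> where s: "\<sigma> \<in> orbit_point modular_commutator \<tau>" "wp w = x \<sigma> \<and> wp' w = y \<sigma>" by blast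
    show "wp w = x \<tau> \<and> wp' w = y \<tau>" using s(2) unfolding eq[OF s(1)] .
  qed (use mem in blast)
  then show ?thesis unfolding torus_map_def by simp
qed

lemma torus_map_orbit_eq:
  assumes "\<tau> \<in> upper_half_plane" "w \<notin> \<Lambda>" "wp w = x \<tau>" "wp' w = y \<tau>"
  shows "torus_map (Inl (orbit_point modular_commutator \<tau>)) = torus_point \<Lambda> w"
proof (intro equalityI subsetI)
  fix z assume "z \<in> torus_map (Inl (orbit_point modular_commutator \<tau>))"
  then have "z \<notin> \<Lambda>" "wp z = x \<tau>" "wp' z = y \<tau>" unfolding torus_map_orbit[OF assms(1)] by auto
  then have "z - w \<in> \<Lambda>" using W_inj[of w z] assms by simp
  then show "z \<in> torus_point \<Lambda> w" by (simp add: torus_point_def)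
next
  fix z assume "z \<in> torus_point \<Lambda> w"
  then have z: "z - w \<in> \<Lambda>" by (simp add: torus_point_def)
  have "z \<notin> \<Lambda>" using lattice_diff[of z "z - w"] z assms(2) by auto
  moreover have "wp z = wp w" "wp' z = wp' w"
    using wp_periodic[OF assms(2) z] wp'_periodic[OF assms(2) z] by (simp_all add: algebra_simps)
  ultimately show "z \<in> torus_map (Inl (orbit_point modular_commutator \<tau>))"
    using assms by (simp add: torus_map_orbit)
qed

lemma torus_map_cusp: "torus_map (Inr S) = torus_point \<Lambda> 0"
  by (simp add: torus_map_def torus_point_def)

lemma upper_half_plane_lift:
  assumes "\<tau> \<in> upper_half_plane"
  obtains w where "w \<notin> \<Lambda>" "wp w = x \<tau>" "wp' w = y \<tau>"
proof -
  have "H.F \<tau> \<in> W.F ` (- \<Lambda>)" using H.F_in_curve[OF assms] W_surj by simp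
  then show ?thesis using that by (auto simp: H.F_def W.F_def)
qed

text \<open>Both parametrisations are bijective onto the affine curve modulo their symmetries; the
  single cusp is matched with the remaining point 0 of the torus.\<close>

lemma torus_map_bij: "bij_betw torus_map (compactified_curve modular_commutator) (range (torus_point \<Lambda>))"
proof (rule bij_betw_imageI)
  have cusps: "range (cusp_point modular_commutator) = {UNIV}" by (simp add: cusp_point_modular_commutator)
  have ne: "torus_map (Inl (orbit_point modular_commutator \<tau>)) \<noteq> torus_map (Inr UNIV)" if t: "\<tau> \<in> upper_half_plane" for \<tau>
  proof -
    obtain w where "w \<notin> \<Lambda>" "wp w = x \<tau>" "wp' w = y \<tau>" by (rule upper_half_plane_lift[OF t])
    then have "w \<in> torus_map (Inl (orbit_point modular_commutator \<tau>))" "w \<notin> torus_map (Inr UNIV)"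
      using torus_map_orbit[OF t] by (simp_all add: torus_map_cusp torus_point_def)
    then show ?thesis by blast
  qed
  have inj: "orbit_point modular_commutator \<tau> = orbit_point modular_commutator \<sigma>"
    if t: "\<tau> \<in> upper_half_plane" and s: "\<sigma> \<in> upper_half_plane"
      and eq: "torus_map (Inl (orbit_point modular_commutator \<tau>)) = torus_map (Inl (orbit_point modular_commutator \<sigma>))" for \<tau> \<sigma>
  proof -
    obtain w where "w \<notin> \<Lambda>" "wp w = x \<tau>" "wp' w = y \<tau>" by (rule upper_half_plane_lift[OF t])
    then have "w \<in> torus_map (Inl (orbit_point modular_commutator \<sigma>))" "wp w = x \<tau>" "wp' w = y \<tau>"
      using torus_map_orbit[OF t] eq by simp_all
    then have F: "H.F \<tau> = H.F \<sigma>" using torus_map_orbit[OF s] by (simp add: H.F_def)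
    have sub: "orbit_point modular_commutator \<tau> \<subseteq> orbit_point modular_commutator \<sigma>"
      if t: "\<tau> \<in> upper_half_plane" and s: "\<sigma> \<in> upper_half_plane" and F: "H.F \<sigma> = H.F \<tau>" for \<tau> \<sigma>
    proof
      fix z assume "z \<in> orbit_point modular_commutator \<tau>"
      then obtain \<delta> where d: "\<delta> \<in> modular_commutator" "z = moebius \<delta> \<tau>" by (auto simp: orbit_point_def)
      obtain g where "g \<in> moebius ` modular_commutator" "\<tau> = g \<sigma>" by (rule H.F_inj[OF s t F])
      then obtain \<gamma> where g: "\<gamma> \<in> modular_commutator" "\<tau> = moebius \<gamma> \<sigma>" by blast
      have "z = moebius (\<delta> ** \<gamma>) \<sigma>" using d g s by (simp add: moebius_mult modular_commutator_in_SL2Z)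
      then show "z \<in> orbit_point modular_commutator \<sigma>"
        using modular_commutator_mult[OF d(1) g(1)] by (auto simp: orbit_point_def)
    qed
    show ?thesis using sub[OF t s F[symmetric]] sub[OF s t F] by blast
  qed
  show "inj_on torus_map (compactified_curve modular_commutator)"
    unfolding compactified_curve_def cusps inj_on_def using ne inj by (auto; metis)
  show "torus_map ` compactified_curve modular_commutator = range (torus_point \<Lambda>)"
  proof (intro equalityI subsetI)
    fix S assume "S \<in> torus_map ` compactified_curve modular_commutator"
    then consider \<tau> where "\<tau> \<in> upper_half_plane" "S = torus_map (Inl (orbit_point modular_commutator \<tau>))" | "S = torus_map (Inr UNIV)"
      unfolding compactified_curve_def cusps by blast
    then show "S \<in> range (torus_point \<Lambda>)"
    proof cases
      case 1 then show ?thesis by (metis rangeI torus_map_orbit_eq upper_half_plane_lift)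
    qed (simp add: torus_map_cusp)
  next
    fix S assume "S \<in> range (torus_point \<Lambda>)"
    then obtain w where w: "S = torus_point \<Lambda> w" by blast
    show "S \<in> torus_map ` compactified_curve modular_commutator"
    proof (cases "w \<in> \<Lambda>")
      case True
      have "z - w \<in> \<Lambda> \<longleftrightarrow> z - 0 \<in> \<Lambda>" for z using lattice_add[of "z - w" w] lattice_diff[of z w] True by auto
      then have "S = torus_map (Inr UNIV)" unfolding torus_map_cusp w torus_point_def by blast
      then show ?thesis unfolding compactified_curve_def cusps by blast
    next
      case False
      have "W.F w \<in> H.F ` upper_half_plane" using W.F_in_curve[of w] False H.F_surj by simp
      then obtain \<tau> where t: "\<tau> \<in> upper_half_plane" "wp w = x \<tau>" "wp' w = y \<tau>" by (auto simp: H.F_def W.F_def)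
      then have "S = torus_map (Inl (orbit_point modular_commutator \<tau>))" using torus_map_orbit_eq False w by simp
      then show ?thesis using t(1) unfolding compactified_curve_def by blast
    qed
  qed
qed

text \<open>A local section of (\<open>wp\<close>, \<open>wp'\<close>) applied to (x, y). If its
  derivative vanished, so would those of x and y, and then x = y = 0, which is not a point of the
  curve.\<close>

lemma torus_map_chart:
  assumes t0: "\<tau>0 \<in> upper_half_plane"
  shows "\<exists>r>0. \<exists>h. ball \<tau>0 r \<subseteq> upper_half_plane \<and> h holomorphic_on ball \<tau>0 r \<and> deriv h \<tau>0 \<noteq> 0 \<and>
     (\<forall>\<tau>\<in>ball \<tau>0 r. h \<tau> \<in> torus_map (Inl (orbit_point modular_commutator \<tau>)))"
proof -
  obtain w where w: "w \<notin> \<Lambda>" "wp w = x \<tau>0" "wp' w = y \<tau>0" by (rule upper_half_plane_lift[OF t0])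
  have wF: "W.F w = H.F \<tau>0" using w by (simp add: H.F_def W.F_def)
  have "w \<in> - \<Lambda>" using w(1) by simp
  then obtain e h f where e: "e > 0" "f = fst \<or> f = snd" "h holomorphic_on ball (f (H.F \<tau>0)) e"
    "\<And>P. P \<in> affine_curve \<Longrightarrow> dist P (H.F \<tau>0) < e \<Longrightarrow> f P \<in> ball (f (H.F \<tau>0)) e \<and> h (f P) \<in> - \<Lambda> \<and> W.F (h (f P)) = P"
    unfolding wF[symmetric] by (rule W.local_section) blast
  have "isCont H.F \<tau>0" using H.F_continuous t0 open_upper_half_plane continuous_on_eq_continuous_at by blast
  then obtain d where d: "d > 0" "\<And>\<tau>. dist \<tau> \<tau>0 < d \<Longrightarrow> dist (H.F \<tau>) (H.F \<tau>0) < e"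
    unfolding continuous_at_eps_delta using e(1) by blast
  obtain d' where d': "d' > 0" "ball \<tau>0 d' \<subseteq> upper_half_plane" using open_upper_half_plane t0 by (meson openE)
  define r where "r = min d d'"
  have r: "r > 0" "ball \<tau>0 r \<subseteq> upper_half_plane" using d(1) d' by (auto simp: r_def)
  define k where "k \<tau> = h (f (H.F \<tau>))" for \<tau>
  have near: "f (H.F \<tau>) \<in> ball (f (H.F \<tau>0)) e \<and> k \<tau> \<notin> \<Lambda> \<and> wp (k \<tau>) = x \<tau> \<and> wp' (k \<tau>) = y \<tau>" if "\<tau> \<in> ball \<tau>0 r" for \<tau>
    using e(4)[OF H.F_in_curve d(2), of \<tau>] that r(2) by (auto simp: r_def dist_commute k_def H.F_def W.F_def)
  have fhol: "(\<lambda>\<tau>. f (H.F \<tau>)) holomorphic_on ball \<tau>0 r"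
    using e(2) x_holomorphic y_holomorphic holomorphic_on_subset[OF _ r(2)] by (auto simp: H.F_def)
  have khol: "k holomorphic_on ball \<tau>0 r"
    using holomorphic_on_compose_gen[OF fhol e(3)] near unfolding k_def[abs_def] o_def by blast
  have kd: "(k has_field_derivative deriv k \<tau>0) (at \<tau>0)" using holomorphic_derivI[OF khol open_ball] r(1) by simp
  have "deriv k \<tau>0 \<noteq> 0"
  proof
    assume k0: "deriv k \<tau>0 = 0"
    have t0r: "\<tau>0 \<in> ball \<tau>0 r" using r(1) by simp
    have k: "k \<tau>0 \<in> - \<Lambda>" using near[OF t0r] by simp
    have "((\<lambda>\<tau>. wp (k \<tau>)) has_field_derivative 0) (at \<tau>0)" "((\<lambda>\<tau>. wp' (k \<tau>)) has_field_derivative 0) (at \<tau>0)"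
      using DERIV_chain2[OF W.dx[OF k] kd] DERIV_chain2[OF W.dy[OF k] kd] k0 by simp_all
    then have "(x has_field_derivative 0) (at \<tau>0)" "(y has_field_derivative 0) (at \<tau>0)"
      using has_field_derivative_transform_within_open[OF _ open_ball t0r] near by blast+
    then have "c * (eta_sq \<tau>0)\<^sup>2 * y \<tau>0 = 0" "c * (eta_sq \<tau>0)\<^sup>2 * (6 * (x \<tau>0)\<^sup>2) = 0"
      using H.dx[OF t0] H.dy[OF t0] DERIV_unique by blast+
    then have "y \<tau>0 = 0" "x \<tau>0 = 0" using c_nonzero by auto
    then show False using curve[OF t0] by simp
  qed
  moreover have "k \<tau> \<in> torus_map (Inl (orbit_point modular_commutator \<tau>))" if "\<tau> \<in> ball \<tau>0 r" for \<tau>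
    using near[OF that] torus_map_orbit[of \<tau>] that r(2) by auto
  ultimately show ?thesis using r khol by blast
qed

text \<open>Conjugates of the translation by 6 show that 6 is possible. Conversely, a translation by
  n leaves x and y unchanged, and their poles of order 2 and 3 give z^2 = z^3 = 1 for z = exp (2 pi
  i n / 6); so z = 1 and 6 divides n.\<close>

lemma cusp_width_modular_commutator:
  assumes g: "g \<in> carrier SL2Z" shows "cusp_width modular_commutator g = 6"
  unfolding cusp_width_def
proof (rule Least_equality, intro conjI)
  note MS = modular_commutator_in_SL2Z
  obtain \<delta> where d: "\<delta> \<in> modular_commutator" "\<forall>\<tau>\<in>upper_half_plane. moebius \<delta> \<tau> = \<tau> + of_int (6 * 1)"
    using T6_in_modular_commutator by blast
  have "moebius (g ** \<delta> ** inv\<^bsub>SL2Z\<^esub> g) (moebius g \<tau>) = moebius g (\<tau> + of_nat 6)" if t: "\<tau> \<in> upper_half_plane" for \<tau>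
  proof -
    have "moebius (g ** \<delta> ** inv\<^bsub>SL2Z\<^esub> g) (moebius g \<tau>) = moebius g (moebius \<delta> (moebius (inv\<^bsub>SL2Z\<^esub> g) (moebius g \<tau>)))"
      using g d(1) t by (simp add: moebius_mult MS moebius_in SL2Z_mult_in del: moebius_inv)
    then show ?thesis using moebius_inv(1)[OF g t] d(2) t by simp
  qed
  then show "\<exists>\<gamma>\<in>modular_commutator. \<forall>\<tau>\<in>upper_half_plane. moebius \<gamma> (moebius g \<tau>) = moebius g (\<tau> + of_nat 6)"
    using modular_commutator_conj[OF d(1) g] by blast
next
  fix n :: nat
  assume "0 < n \<and> (\<exists>\<gamma>\<in>modular_commutator. \<forall>\<tau>\<in>upper_half_plane. moebius \<gamma> (moebius g \<tau>) = moebius g (\<tau> + of_nat n))"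
  then obtain \<gamma> where n: "n > 0" and \<gamma>: "\<gamma> \<in> modular_commutator"
    "\<And>\<tau>. \<tau> \<in> upper_half_plane \<Longrightarrow> moebius \<gamma> (moebius g \<tau>) = moebius g (\<tau> + of_nat n)" by blast
  obtain \<delta> k where d: "\<delta> \<in> modular_commutator" "\<And>\<tau>. \<tau> \<in> upper_half_plane \<Longrightarrow> moebius g \<tau> = moebius \<delta> (\<tau> + of_int k)"
    by (rule SL2Z_decompose_action[OF g]) (rule that)
  obtain Y where Y: "Y > 0" "\<And>\<tau>. Im \<tau> > Y \<Longrightarrow> cmod (x \<tau>) > 1" by (rule x_large[of 1]) (rule that)
  define \<tau> where "\<tau> = \<i> * of_real (Y + 1)"
  have t: "\<tau> \<in> upper_half_plane" "Im \<tau> > Y" using Y(1) by (simp_all add: \<tau>_def upper_half_plane_def)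
  have tk: "\<tau> - of_int k \<in> upper_half_plane" "\<tau> + of_nat n \<in> upper_half_plane" "\<tau> - of_int k + of_nat n \<in> upper_half_plane"
    using t by (simp_all add: upper_half_plane_def)
  have "moebius \<gamma> (moebius \<delta> \<tau>) = moebius \<delta> (\<tau> + of_nat n)"
    using \<gamma>(2)[OF tk(1)] d(2)[OF tk(1)] d(2)[OF tk(3)] by (simp add: algebra_simps)
  then have "x (\<tau> + of_nat n) = x \<tau>" "y (\<tau> + of_nat n) = y \<tau>"
    using x_modular[OF d(1) tk(2)] y_modular[OF d(1) tk(2)] x_modular[OF d(1) t(1)] y_modular[OF d(1) t(1)]
      x_modular[OF \<gamma>(1) moebius_in[OF modular_commutator_in_SL2Z[OF d(1)] t(1)]]
      y_modular[OF \<gamma>(1) moebius_in[OF modular_commutator_in_SL2Z[OF d(1)] t(1)]] by auto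
  moreover define z where "z = cusp_coord 6 (of_nat n)"
  moreover have "cusp_coord 1 (\<tau> + of_nat n) = cusp_coord 1 \<tau>"
    using cusp_coord_period[of 1 "int n"] by (simp add: cusp_coord_plus)
  ultimately have "x \<tau> / z\<^sup>2 = x \<tau>" "y \<tau> / z ^ 3 = y \<tau>"
    using x_expansion[OF t(1)] y_expansion[OF t(1)] x_expansion[OF tk(2)] y_expansion[OF tk(2)]
    by (simp_all add: cusp_coord_plus power_mult_distrib)
  moreover have "x \<tau> \<noteq> 0" "y \<tau> \<noteq> 0" using Y(2)[OF t(2)] y_nonzero[OF t(1)] by auto
  moreover have "z \<noteq> 0" by (simp add: z_def)
  ultimately have "z\<^sup>2 = 1" "z ^ 3 = 1" by (simp_all add: field_simps)
  then have "z = 1" by (simp add: power3_eq_cube power2_eq_square)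
  then obtain m :: int where "2 * of_real pi * \<i> * of_nat n / of_real 6 = (of_int (2 * m) * of_real pi) * \<i>"
    unfolding z_def cusp_coord_def exp_eq_1 by (auto simp: complex_eq_iff)
  then have "real n = 6 * of_int m" by (simp add: complex_eq_iff field_simps)
  then have "int n = 6 * m" by linarith
  then show "6 \<le> n" using n by presburger
qed simp

text \<open>Both sides carry the coordinate a / b of the curve at infinity, so the chart is the
  inverse of \<open>t1\<close> after \<open>t2\<close>. As \<open>g\<close> is an element of the
  commutator subgroup followed on the right by a translation, q is first multiplied by the root of
  unity \<open>Z\<close>.\<close>

lemma torus_map_cusp_chart:
  assumes g: "g \<in> carrier SL2Z"
  shows "\<exists>r>0. \<exists>h. h holomorphic_on ball 0 r \<and> deriv h 0 \<noteq> 0 \<and>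
        h 0 \<in> torus_map (Inr (cusp_point modular_commutator (cusp_act g None))) \<and>
        (\<forall>\<tau>\<in>upper_half_plane. cusp_coord 6 \<tau> \<in> ball 0 r \<longrightarrow>
           h (cusp_coord 6 \<tau>) \<in> torus_map (Inl (orbit_point modular_commutator (moebius g \<tau>))))"
proof -
  obtain \<delta> k where d: "\<delta> \<in> modular_commutator" "\<And>\<tau>. \<tau> \<in> upper_half_plane \<Longrightarrow> moebius g \<tau> = moebius \<delta> (\<tau> + of_int k)"
    by (rule SL2Z_decompose_action[OF g]) (rule that)
  obtain r1 t1 where t1: "r1 > 0" "t1 holomorphic_on ball 0 r1" "t1 0 = 0" "deriv t1 0 \<noteq> 0" "inj_on t1 (ball 0 r1)" "open (t1 ` ball 0 r1)"
    "ball 0 r1 \<inter> \<Lambda> = {0}" "\<And>z. z \<in> ball 0 r1 \<Longrightarrow> z \<noteq> 0 \<Longrightarrow> t1 z = wp z / wp' z \<and> cmod (wp z) \<ge> 1"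
    by (rule wp_coordinate_at_0) (rule that)
  obtain r2 t2 where t2: "r2 > 0" "t2 holomorphic_on ball 0 r2" "t2 0 = 0" "deriv t2 0 \<noteq> 0" "inj_on t2 (ball 0 r2)"
    "\<And>\<tau>. \<tau> \<in> upper_half_plane \<Longrightarrow> cusp_coord 6 \<tau> \<in> ball 0 r2 \<Longrightarrow> t2 (cusp_coord 6 \<tau>) = x \<tau> / y \<tau> \<and> cmod (x \<tau>) \<ge> 1"
    by (rule cusp_coordinate) (rule that)
  obtain s where s: "s holomorphic_on t1 ` ball 0 r1"
    "\<And>z. z \<in> ball 0 r1 \<Longrightarrow> deriv t1 z * deriv s (t1 z) = 1" "\<And>z. z \<in> ball 0 r1 \<Longrightarrow> s (t1 z) = z"
    by (rule holomorphic_has_inverse[OF t1(2) open_ball t1(5)]) (rule that)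
  define Z where "Z = cusp_coord 6 (of_int k)"
  have Z: "cmod Z = 1" by (simp add: Z_def norm_cusp_coord)
  have Zc: "cusp_coord 6 (\<tau> + of_int k) = Z * cusp_coord 6 \<tau>" for \<tau> by (simp add: cusp_coord_plus Z_def)
  have U: "0 \<in> t1 ` ball 0 r1" using t1(1,3) by force
  have "isCont t2 0"
    using continuous_on_interior[OF holomorphic_on_imp_continuous_on[OF t2(2)], of 0] t2(1) by simp
  then obtain r3 where r3: "r3 > 0" "\<And>q. dist q 0 < r3 \<Longrightarrow> t2 q \<in> t1 ` ball 0 r1"
    using t1(6) U t2(3) unfolding continuous_at_ball open_contains_ball
    by (metis (no_types, lifting) image_subset_iff mem_ball dist_commute subset_eq)
  define r where "r = min r2 r3"
  have r: "r > 0" using t2(1) r3(1) by (simp add: r_def)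
  have Zq: "Z * q \<in> ball 0 r2 \<and> t2 (Z * q) \<in> t1 ` ball 0 r1" if "q \<in> ball 0 r" for q
    using that r3(2)[of "Z * q"] by (auto simp: r_def norm_mult Z)
  define h where "h q = s (t2 (Z * q))" for q
  have hol: "h holomorphic_on ball 0 r"
  proof -
    have "(\<lambda>q. t2 (Z * q)) holomorphic_on ball 0 r"
      using holomorphic_on_compose_gen[OF holomorphic_on_mult[OF holomorphic_on_const holomorphic_on_ident] t2(2), of Z "ball 0 r"] Zq
      unfolding o_def by blast
    from holomorphic_on_compose_gen[OF this s(1)] show ?thesis using Zq unfolding o_def h_def[abs_def] by blast
  qed
  have h0: "h 0 = 0" using s(3)[of 0] t1(1,3) by (simp add: h_def t2(3))
  have "(s has_field_derivative deriv s (t1 0)) (at (t1 0))" using holomorphic_derivI[OF s(1) t1(6)] U t1(3) by simp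
  moreover have "((\<lambda>q. t2 (Z * q)) has_field_derivative deriv t2 (Z * 0) * (Z * 1)) (at 0)"
    using holomorphic_derivI[OF t2(2) open_ball, of "Z * 0"] t2(1)
    by (intro DERIV_chain2[of t2] DERIV_cmult DERIV_ident) auto
  ultimately have "(h has_field_derivative deriv s (t1 0) * (deriv t2 (Z * 0) * (Z * 1))) (at 0)"
    unfolding h_def using t1(3) t2(3) by (intro DERIV_chain2[of s]) auto
  then have "deriv h 0 = deriv s (t1 0) * (deriv t2 (Z * 0) * (Z * 1))" by (rule DERIV_imp_deriv)
  moreover have "deriv s (t1 0) \<noteq> 0" using s(2)[of 0] t1(1) by auto
  ultimately have dh: "deriv h 0 \<noteq> 0" using t2(4) Z by auto
  have "h (cusp_coord 6 \<tau>) \<in> torus_map (Inl (orbit_point modular_commutator (moebius g \<tau>)))"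
    if t: "\<tau> \<in> upper_half_plane" "cusp_coord 6 \<tau> \<in> ball 0 r" for \<tau>
  proof -
    let ?q = "cusp_coord 6 \<tau>"
    have tk: "\<tau> + of_int k \<in> upper_half_plane" using t by simp
    have q: "Z * ?q \<in> ball 0 r2" "t2 (Z * ?q) \<in> t1 ` ball 0 r1" using Zq[OF t(2)] by auto
    obtain w where w: "w \<in> ball 0 r1" "t2 (Z * ?q) = t1 w" using q(2) by blast
    have hw: "h ?q = w" using s(3)[OF w(1)] by (simp add: h_def w(2))
    have "Z * ?q \<noteq> 0" using Z by auto
    then have "t2 (Z * ?q) \<noteq> 0" using inj_onD[OF t2(5) _ q(1), of 0] t2(1,3) by auto
    then have "w \<noteq> 0" using w(2) t1(3) by auto
    then have wL: "w \<notin> \<Lambda>" using t1(7) w(1) by blast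
    have a: "t1 w = wp w / wp' w" "cmod (wp w) \<ge> 1" using t1(8)[OF w(1) \<open>w \<noteq> 0\<close>] by auto
    have b: "t2 (Z * ?q) = x (\<tau> + of_int k) / y (\<tau> + of_int k)" "cmod (x (\<tau> + of_int k)) \<ge> 1"
      using t2(6)[OF tk] q(1) unfolding Zc by auto
    have "wp w = x (\<tau> + of_int k) \<and> wp' w = y (\<tau> + of_int k)"
      using affine_curve_at_infinity[of "wp' w" "wp w" "y (\<tau> + of_int k)" "x (\<tau> + of_int k)"]
        W.F_in_curve[of w] H.F_in_curve[OF tk] wL a b w(2) by (simp add: W.F_def H.F_def affine_curve_def)
    moreover have "x (moebius g \<tau>) = x (\<tau> + of_int k)" "y (moebius g \<tau>) = y (\<tau> + of_int k)"
      unfolding d(2)[OF t(1)] using x_modular[OF d(1) tk] y_modular[OF d(1) tk] by auto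
    ultimately show ?thesis unfolding hw torus_map_orbit[OF moebius_in[OF g t(1)]] using wL by simp
  qed
  then show ?thesis using r hol dh h0 lattice_0 by (intro exI[of _ r] conjI exI[of _ h]) (auto simp: torus_map_def)
qed

theorem biholomorphic_torus_map: "biholomorphic_to_torus modular_commutator \<Lambda> torus_map"
  unfolding biholomorphic_to_torus_def
proof (intro conjI ballI)
  fix g assume g: "g \<in> carrier SL2Z"
  then show "\<exists>r>0. \<exists>h. h holomorphic_on ball 0 r \<and> deriv h 0 \<noteq> 0 \<and>
        h 0 \<in> torus_map (Inr (cusp_point modular_commutator (cusp_act g None))) \<and>
        (\<forall>\<tau>\<in>upper_half_plane. let q = exp (2 * of_real pi * \<i> * \<tau> / of_nat (cusp_width modular_commutator g)) in
           q \<in> ball 0 r \<longrightarrow> h q \<in> torus_map (Inl (orbit_point modular_commutator (moebius g \<tau>))))"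
    using torus_map_cusp_chart[OF g] by (simp add: cusp_width_modular_commutator Let_def cusp_coord_def)
qed (use torus_map_bij torus_map_chart in blast)+

end

section \<open>The ring of modular functions\<close>

text \<open>\<open>n\<close> bounds the order of the pole in the parameter of width 6; the
  generation of the ring is an induction on it.\<close>

definition modular_expansion :: "nat \<Rightarrow> (complex \<Rightarrow> complex) \<Rightarrow> bool" where
  "modular_expansion n f \<longleftrightarrow> f holomorphic_on upper_half_plane \<and>
     (\<forall>\<gamma>\<in>modular_commutator. \<forall>\<tau>\<in>upper_half_plane. f (moebius \<gamma> \<tau>) = f \<tau>) \<and>
     (\<exists>h. h holomorphic_on ball 0 1 \<and> (\<forall>\<tau>\<in>upper_half_plane. f \<tau> = h (cusp_coord 6 \<tau>) / cusp_coord 6 \<tau> ^ n))"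

text \<open>Translating the real part into a bounded range turns growth in |\<tau>| into growth in
  Im \<tau>. For n > |M| the factor q^n compensates it, because 2 pi / 6 > 1, and one more factor q
  gives the limit 0 and thus a removable singularity.\<close>

lemma modular_function_expansion:
  assumes "f \<in> modular_functions modular_commutator"
  shows "\<exists>n. modular_expansion n f"
proof -
  have hol: "f holomorphic_on upper_half_plane" and inv: "\<forall>\<gamma>\<in>modular_commutator. \<forall>\<tau>\<in>upper_half_plane. f (moebius \<gamma> \<tau>) = f \<tau>"
    and "cusp_growth f" using assms by (simp_all add: modular_functions_iff)
  then obtain C M Y where C: "\<And>\<tau>. \<tau> \<in> upper_half_plane \<Longrightarrow> Im \<tau> > Y \<Longrightarrow> cmod (f \<tau>) \<le> C * exp (M * cmod \<tau>)"
    unfolding cusp_growth_def by blast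
  have per: "f (\<tau> + of_int (6 * l)) = f \<tau>" if "\<tau> \<in> upper_half_plane" for \<tau> l
  proof -
    obtain \<delta> where "\<delta> \<in> modular_commutator" "\<forall>\<tau>\<in>upper_half_plane. moebius \<delta> \<tau> = \<tau> + of_int (6 * l)"
      using T6_in_modular_commutator by blast
    then show ?thesis using inv that by metis
  qed
  have bound: "cmod (f \<tau>) \<le> \<bar>C\<bar> * exp (6 * \<bar>M\<bar>) * exp (\<bar>M\<bar> * Im \<tau>)" if t: "\<tau> \<in> upper_half_plane" "Im \<tau> > Y" for \<tau>
  proof -
    define l where "l = \<lfloor>Re \<tau> / 6\<rfloor>"
    define \<sigma> where "\<sigma> = \<tau> + of_int (6 * (- l))"
    have s: "\<sigma> \<in> upper_half_plane" "Im \<sigma> = Im \<tau>" using t by (simp_all add: \<sigma>_def upper_half_plane_def)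
    have "\<bar>Re \<sigma>\<bar> \<le> 6" unfolding \<sigma>_def l_def by (simp; linarith)
    then have "cmod \<sigma> \<le> 6 + Im \<tau>" using cmod_le[of \<sigma>] s t(1) by (simp add: upper_half_plane_def)
    have "cmod (f \<tau>) = cmod (f \<sigma>)" using per[OF t(1), of "- l"] by (simp add: \<sigma>_def)
    also have "\<dots> \<le> C * exp (M * cmod \<sigma>)" using C[OF s(1)] s t by simp
    also have "\<dots> \<le> \<bar>C\<bar> * exp (\<bar>M\<bar> * (6 + Im \<tau>))"
    proof (intro mult_mono)
      have "M * cmod \<sigma> \<le> \<bar>M\<bar> * cmod \<sigma>" by (intro mult_right_mono) auto
      also have "\<dots> \<le> \<bar>M\<bar> * (6 + Im \<tau>)" using \<open>cmod \<sigma> \<le> _\<close> by (intro mult_left_mono) auto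
      finally show "exp (M * cmod \<sigma>) \<le> exp (\<bar>M\<bar> * (6 + Im \<tau>))" by simp
    qed auto
    also have "\<dots> = \<bar>C\<bar> * exp (6 * \<bar>M\<bar>) * exp (\<bar>M\<bar> * Im \<tau>)" by (simp add: distrib_left exp_add mult_ac)
    finally show ?thesis .
  qed
  obtain n :: nat where n: "real n > \<bar>M\<bar>" using reals_Archimedean2 by blast
  define g where "g \<tau> = f \<tau> * cusp_coord 6 \<tau> ^ (n + 1)" for \<tau>
  have "(g \<longlongrightarrow> 0) at_cusp"
  proof (rule Lim_null_comparison)
    show "\<forall>\<^sub>F \<tau> in at_cusp. cmod (g \<tau>) \<le> \<bar>C\<bar> * exp (6 * \<bar>M\<bar>) * cmod (cusp_coord 6 \<tau>)"
      unfolding eventually_at_cusp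
    proof (intro exI[of _ "max Y 0"] allI impI)
      fix \<tau> assume t: "Im \<tau> > max Y 0"
      have "\<bar>M\<bar> * Im \<tau> \<le> real n * (2 * pi * Im \<tau> / 6)"
      proof -
        have "\<bar>M\<bar> * Im \<tau> \<le> real n * Im \<tau>" using n t by (intro mult_right_mono) auto
        also have "\<dots> \<le> real n * (2 * pi * Im \<tau> / 6)"
        proof (rule mult_left_mono)
          have "6 * Im \<tau> \<le> 2 * pi * Im \<tau>" using pi_gt3 t by (intro mult_right_mono) auto
          then show "Im \<tau> \<le> 2 * pi * Im \<tau> / 6" by simp
        qed simp
        finally show ?thesis .
      qed
      then have "exp (\<bar>M\<bar> * Im \<tau>) * exp (- (real n * (2 * pi * Im \<tau> / 6))) \<le> 1"
        unfolding exp_add[symmetric] by simp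
      moreover have "cmod (cusp_coord 6 \<tau>) ^ n = exp (- (real n * (2 * pi * Im \<tau> / 6)))"
        unfolding norm_cusp_coord exp_of_nat_mult[symmetric] by simp
      ultimately have le: "exp (\<bar>M\<bar> * Im \<tau>) * cmod (cusp_coord 6 \<tau>) ^ n \<le> 1" by simp
      have "cmod (g \<tau>) = cmod (f \<tau>) * (cmod (cusp_coord 6 \<tau>) ^ n * cmod (cusp_coord 6 \<tau>))"
        by (simp add: g_def norm_mult norm_power)
      also have "\<dots> \<le> (\<bar>C\<bar> * exp (6 * \<bar>M\<bar>) * exp (\<bar>M\<bar> * Im \<tau>)) * (cmod (cusp_coord 6 \<tau>) ^ n * cmod (cusp_coord 6 \<tau>))"
        using t by (intro mult_right_mono bound) (auto simp: upper_half_plane_def)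
      also have "\<dots> = (\<bar>C\<bar> * exp (6 * \<bar>M\<bar>) * cmod (cusp_coord 6 \<tau>)) * (exp (\<bar>M\<bar> * Im \<tau>) * cmod (cusp_coord 6 \<tau>) ^ n)" by simp
      also have "\<dots> \<le> (\<bar>C\<bar> * exp (6 * \<bar>M\<bar>) * cmod (cusp_coord 6 \<tau>)) * 1" using le by (intro mult_left_mono) auto
      finally show "cmod (g \<tau>) \<le> \<bar>C\<bar> * exp (6 * \<bar>M\<bar>) * cmod (cusp_coord 6 \<tau>)" by simp
    qed
    show "((\<lambda>\<tau>. \<bar>C\<bar> * exp (6 * \<bar>M\<bar>) * cmod (cusp_coord 6 \<tau>)) \<longlongrightarrow> 0) at_cusp"
      using tendsto_mult_right_zero[OF tendsto_norm_zero[OF cusp_coord_tendsto[of 6]]] by simp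
  qed
  moreover have "g holomorphic_on upper_half_plane"
    unfolding g_def[abs_def] cusp_coord_def by (intro holomorphic_intros hol) simp
  moreover have "g (\<tau> + of_real 6) = g \<tau>" if "Im \<tau> > 0" for \<tau>
    using per[of \<tau> 1] cusp_coord_period[of 6 1] that by (simp add: g_def cusp_coord_plus upper_half_plane_def)
  ultimately obtain h where "h holomorphic_on ball 0 1" "\<And>\<tau>. Im \<tau> > 0 \<Longrightarrow> g \<tau> = h (cusp_coord 6 \<tau>)"
    using periodic_expansion_extended[of 6 g 0] by (metis zero_less_numeral)
  moreover have "f \<tau> = g \<tau> / cusp_coord 6 \<tau> ^ (n + 1)" for \<tau> by (simp add: g_def)
  ultimately have "\<exists>h. h holomorphic_on ball 0 1 \<and> (\<forall>\<tau>\<in>upper_half_plane. f \<tau> = h (cusp_coord 6 \<tau>) / cusp_coord 6 \<tau> ^ (n + 1))"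
    by (intro exI[of _ h]) (simp add: upper_half_plane_def)
  then show ?thesis unfolding modular_expansion_def using hol inv by blast
qed

lemma modular_expansion_0:
  assumes "modular_expansion 0 f"
  obtains k where "\<And>\<tau>. \<tau> \<in> upper_half_plane \<Longrightarrow> f \<tau> = k"
proof -
  obtain h where h: "h holomorphic_on ball 0 1" "\<And>\<tau>. \<tau> \<in> upper_half_plane \<Longrightarrow> f \<tau> = h (cusp_coord 6 \<tau>)"
    using assms unfolding modular_expansion_def by auto
  have "((\<lambda>\<tau>. h (cusp_coord 6 \<tau>)) \<longlongrightarrow> h 0) at_cusp" using tendsto_cusp_coord_compose[OF _ h(1)] by simp
  then have "(f \<longlongrightarrow> h 0) at_cusp"
    by (rule Lim_transform_eventually) (auto simp: eventually_at_cusp h(2) upper_half_plane_def intro!: exI[of _ 0])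
  from modular_function_constant[OF _ _ this] assms show ?thesis
    unfolding modular_expansion_def by (intro that) blast
qed

lemma modular_expansion_reduce:
  assumes "f holomorphic_on upper_half_plane"
    and "\<And>\<gamma> \<tau>. \<gamma> \<in> modular_commutator \<Longrightarrow> \<tau> \<in> upper_half_plane \<Longrightarrow> f (moebius \<gamma> \<tau>) = f \<tau>"
    and h: "h holomorphic_on ball 0 1" "h 0 = 0" and "\<And>\<tau>. \<tau> \<in> upper_half_plane \<Longrightarrow> f \<tau> = h (cusp_coord 6 \<tau>) / cusp_coord 6 \<tau> ^ Suc n"
  shows "modular_expansion n f"
proof -
  define k where "k q = (if q = 0 then deriv h 0 else h q / q)" for q
  have "k holomorphic_on ball 0 1"
    using pole_theorem_open_0[OF h(1) open_ball, of 0 k] h(2) by (simp add: k_def)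
  moreover have "f \<tau> = k (cusp_coord 6 \<tau>) / cusp_coord 6 \<tau> ^ n" if "\<tau> \<in> upper_half_plane" for \<tau>
    using assms(5)[OF that] by (simp add: k_def)
  ultimately show ?thesis unfolding modular_expansion_def using assms(1,2) by blast
qed

text \<open>The primitive sixth root of unity by which the translation \<tau> + 1 multiplies
  q.\<close>

definition shift_unit :: complex where "shift_unit = cusp_coord 6 1"

lemma shift_unit: "shift_unit \<noteq> 0" "shift_unit \<noteq> 1" "shift_unit\<^sup>2 \<noteq> 1" "cmod shift_unit = 1"
proof -
  show "shift_unit \<noteq> 0" "cmod shift_unit = 1" by (simp_all add: shift_unit_def norm_cusp_coord)
  show sq: "shift_unit\<^sup>2 \<noteq> 1"
  proof
    assume "shift_unit\<^sup>2 = 1"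
    then have "exp (2 * of_real pi * \<i> / of_real 3) = 1"
      unfolding shift_unit_def cusp_coord_def exp_of_nat_mult[symmetric] by (simp add: mult_ac)
    then obtain m :: int where "2 * pi / 3 = of_int (2 * m) * pi" unfolding exp_eq_1 by auto
    then have "3 * real_of_int m = 1" by (simp add: field_simps)
    then have "3 * m = 1" by linarith
    then show False by presburger
  qed
  then show "shift_unit \<noteq> 1" by auto
qed

lemma cusp_coord_shift: "cusp_coord 6 (\<tau> + 1) = shift_unit * cusp_coord 6 \<tau>" "cusp_coord 1 (\<tau> + 1) = cusp_coord 1 \<tau>"
  using cusp_coord_period[of 1 1] by (simp_all add: cusp_coord_plus shift_unit_def)

text \<open>T normalises the commutator subgroup, so translating an invariant function by 1 keeps it
  invariant.\<close>

lemma shift_invariant: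
  assumes inv: "\<And>\<gamma> \<tau>. \<gamma> \<in> modular_commutator \<Longrightarrow> \<tau> \<in> upper_half_plane \<Longrightarrow> f (moebius \<gamma> \<tau>) = f \<tau>"
    and g: "\<gamma> \<in> modular_commutator" and t: "\<tau> \<in> upper_half_plane"
  shows "f (moebius \<gamma> \<tau> + 1) = f (\<tau> + 1)"
proof -
  note MS = modular_commutator_in_SL2Z[OF g]
  let ?d = "matT 1 ** \<gamma> ** inv\<^bsub>SL2Z\<^esub> (matT 1)"
  have d: "?d \<in> modular_commutator" by (rule modular_commutator_conj[OF g matT_in])
  have t1: "moebius (matT 1) \<tau> \<in> upper_half_plane" by (rule moebius_in[OF matT_in t])
  have "moebius ?d (moebius (matT 1) \<tau>) = moebius (matT 1 ** \<gamma>) (moebius (inv\<^bsub>SL2Z\<^esub> (matT 1)) (moebius (matT 1) \<tau>))"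
    by (intro moebius_mult SL2Z_mult_in matT_in MS SL2Z.inv_closed t1)
  also have "\<dots> = moebius \<gamma> \<tau> + 1"
    unfolding moebius_inv(1)[OF matT_in t] moebius_mult[OF matT_in MS t] by simp
  finally show ?thesis using inv[OF d t1] by (metis moebius_T of_int_1)
qed

section \<open>The ring structure and division by the Weierstrass relation\<close>

lemma
  assumes "f \<in> modular_functions modular_commutator" "g \<in> modular_functions modular_commutator"
  shows modular_functions_add: "(\<lambda>\<tau>. f \<tau> + g \<tau>) \<in> modular_functions modular_commutator"
    and modular_functions_mult: "(\<lambda>\<tau>. f \<tau> * g \<tau>) \<in> modular_functions modular_commutator"
  using assms cusp_growth_add[of f g] cusp_growth_mult[of f g "\<lambda>\<tau>. f \<tau> * g \<tau>" 1]
  unfolding modular_functions_iff by (auto simp: norm_mult intro!: holomorphic_intros)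

lemma modular_functions_const:
  "(\<lambda>\<tau>. if \<tau> \<in> upper_half_plane then k else 0) \<in> modular_functions modular_commutator"
proof -
  have "(\<lambda>\<tau>. if \<tau> \<in> upper_half_plane then k else 0) holomorphic_on upper_half_plane"
    by (rule holomorphic_transform[OF holomorphic_on_const[of k]]) simp
  moreover have "cusp_growth (\<lambda>\<tau>. if \<tau> \<in> upper_half_plane then k else 0)"
    by (rule cusp_growth_bounded[where C = "cmod k"]) simp
  ultimately show ?thesis unfolding modular_functions_iff
    using moebius_in modular_commutator_in_SL2Z by simp
qed

lemma modular_functions_scale:
  assumes "f \<in> modular_functions modular_commutator"
  shows "(\<lambda>\<tau>. k * f \<tau>) \<in> modular_functions modular_commutator"
proof -
  have "(\<lambda>\<tau>. (if \<tau> \<in> upper_half_plane then k else 0) * f \<tau>) = (\<lambda>\<tau>. k * f \<tau>)"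
    using assms by (auto simp: modular_functions_iff fun_eq_iff)
  then show ?thesis using modular_functions_mult[OF modular_functions_const[of k] assms] by simp
qed

lemma ring_modular_functions: "ring (modular_function_ring modular_commutator)"
proof -
  let ?R = "modular_function_ring modular_commutator"
  have car: "carrier ?R = modular_functions modular_commutator" by (simp add: modular_function_ring_def)
  have zero: "(\<lambda>\<tau>. 0) \<in> modular_functions modular_commutator" using modular_functions_const[of 0] by simp
  have neg: "\<exists>g\<in>modular_functions modular_commutator. (\<lambda>\<tau>. f \<tau> + g \<tau>) = (\<lambda>\<tau>. 0)"
    if "f \<in> modular_functions modular_commutator" for f
    using modular_functions_scale[OF that, of "- 1"] by (intro bexI[of _ "\<lambda>\<tau>. - 1 * f \<tau>"]) simp_all
  have out: "(if \<tau> \<in> upper_half_plane then 1 else 0) * f \<tau> = f \<tau>" "f \<tau> * (if \<tau> \<in> upper_half_plane then 1 else 0) = f \<tau>" if "f \<in> modular_functions modular_commutator" for f \<tau>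
    using that by (simp_all add: modular_functions_iff)
  have "abelian_group ?R"
    by (rule abelian_groupI)
      (auto simp: modular_function_ring_def modular_functions_add zero neg add.assoc add.commute)
  moreover have "Group.monoid ?R"
    by (rule monoidI)
      (auto simp: modular_function_ring_def modular_functions_mult modular_functions_const out mult.assoc)
  ultimately show ?thesis
    by (rule ringI) (auto simp: modular_function_ring_def ring_distribs)
qed

text \<open>The divisor is monic of degree two in \<open>poly_Y\<close>, so it can be divided by
  over the ring of polynomials in \<open>poly_X\<close>, with a remainder linear in
  \<open>poly_Y\<close>.\<close>

lemma bivariate_division:
  "\<exists>s A B. p = s * (poly_Y ^ 2 - 4 * poly_X ^ 3 + 1) + [:A, B:]"
proof (induction p)
  case 0
  show ?case by (intro exI[of _ 0]) simp
next
  case (pCons a p)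
  then obtain s A B where p: "p = s * (poly_Y ^ 2 - 4 * poly_X ^ 3 + 1) + [:A, B:]" by blast
  let ?W = "poly_Y ^ 2 - 4 * poly_X ^ 3 + 1 :: complex poly poly"
  have Y2: "[:0, 0, 1:] = ?W + [:4 * [:0, 1:] ^ 3 - 1:]"
    unfolding poly_Y_def poly_X_def by (simp add: power2_eq_square power3_eq_cube numeral_poly one_pCons)
  have "pCons a p = [:a:] + [:0, 1:] * (s * ?W + [:A, B:])" by (simp add: p)
  also have "\<dots> = [:0, 1:] * s * ?W + [:a, A:] + [:B:] * [:0, 0, 1:]" by (simp add: algebra_simps)
  also have "\<dots> = ([:0, 1:] * s + [:B:]) * ?W + ([:a, A:] + [:B * (4 * [:0, 1:] ^ 3 - 1):])"
    unfolding Y2 by (simp add: algebra_simps)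
  also have "[:a, A:] + [:B * (4 * [:0, 1:] ^ 3 - 1):] = [:a + B * (4 * [:0, 1:] ^ 3 - 1), A:]" by simp
  finally show ?case by blast
qed

context modular_uniformisation begin

interpretation H: curve_cover upper_half_plane x y "\<lambda>\<tau>. c * (eta_sq \<tau>)\<^sup>2" "moebius ` modular_commutator"
  by (rule H_cover[OF affine_curve_connected])

lemma curve_point:
  assumes "b\<^sup>2 = 4 * a ^ 3 - 1" obtains \<tau> where "\<tau> \<in> upper_half_plane" "x \<tau> = a" "y \<tau> = b"
proof -
  have "(a, b) \<in> H.F ` upper_half_plane" using assms by (simp add: H.F_surj affine_curve_def)
  then show ?thesis using that by (auto simp: H.F_def)
qed

lemma hx_q_holomorphic: "(\<lambda>q. hx (q ^ 6)) holomorphic_on ball 0 1" and hy_q_holomorphic: "(\<lambda>q. hy (q ^ 6)) holomorphic_on ball 0 1"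
proof -
  have "(\<lambda>q :: complex. q ^ 6) ` ball 0 1 \<subseteq> ball 0 1" by (auto simp: norm_power power_less_one_iff)
  then show "(\<lambda>q. hx (q ^ 6)) holomorphic_on ball 0 1" "(\<lambda>q. hy (q ^ 6)) holomorphic_on ball 0 1"
    using holomorphic_on_compose_gen[OF _ hx_holomorphic, of "\<lambda>q. q ^ 6" "ball 0 1"]
      holomorphic_on_compose_gen[OF _ hy_holomorphic, of "\<lambda>q. q ^ 6" "ball 0 1"]
    unfolding o_def by (simp_all add: holomorphic_on_power)
qed

lemma x_q: "\<tau> \<in> upper_half_plane \<Longrightarrow> x \<tau> = hx (cusp_coord 6 \<tau> ^ 6) / cusp_coord 6 \<tau> ^ 2"
  and y_q: "\<tau> \<in> upper_half_plane \<Longrightarrow> y \<tau> = hy (cusp_coord 6 \<tau> ^ 6) / cusp_coord 6 \<tau> ^ 3"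
  by (simp_all add: x_expansion y_expansion cusp_coord_6)

text \<open>A function with a simple pole at the cusp, normalised to be an eigenfunction of the translation by 1,
  would be a square root of a multiple of \<open>x\<close>, but \<open>x\<close> has simple zeros.\<close>

lemma no_simple_pole:
  assumes f: "f holomorphic_on upper_half_plane"
    and inv: "\<And>\<gamma> \<tau>. \<gamma> \<in> modular_commutator \<Longrightarrow> \<tau> \<in> upper_half_plane \<Longrightarrow> f (moebius \<gamma> \<tau>) = f \<tau>"
    and h: "h holomorphic_on ball 0 1" "\<And>\<tau>. \<tau> \<in> upper_half_plane \<Longrightarrow> f \<tau> = h (cusp_coord 6 \<tau>) / cusp_coord 6 \<tau>"
  shows "h 0 = 0"
proof (rule ccontr)
  assume h0: "h 0 \<noteq> 0"
  note z = shift_unit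
  have up: "\<tau> + 1 \<in> upper_half_plane" if "\<tau> \<in> upper_half_plane" for \<tau>
    using that by (simp add: upper_half_plane_def)
  \<comment> \<open>The leading coefficients at the cusp agree, so the difference has no pole and is
    a constant k. Subtracting k0, the solution of k0 - k0 / shift_unit = k, makes \<open>F\<close>
    an exact eigenfunction of the translation.\<close>
  define g where "g \<tau> = f (\<tau> + 1) - f \<tau> / shift_unit" for \<tau>
  have hz: "(\<lambda>q. h (shift_unit * q)) holomorphic_on ball 0 1"
    using holomorphic_on_compose_gen[OF holomorphic_on_mult[OF holomorphic_on_const holomorphic_on_ident] h(1), of shift_unit "ball 0 1"]
    unfolding o_def by (simp add: image_subset_iff norm_mult z)
  have f1: "(\<lambda>\<tau>. f (\<tau> + 1)) holomorphic_on upper_half_plane"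
    using holomorphic_on_compose_gen[OF holomorphic_on_add[OF holomorphic_on_ident holomorphic_on_const] f, of 1 upper_half_plane] up
    unfolding o_def by auto
  have "modular_expansion 0 g"
  proof (rule modular_expansion_reduce)
    show "g holomorphic_on upper_half_plane" unfolding g_def[abs_def] by (intro holomorphic_intros f f1 z)
    show "g (moebius \<gamma> \<tau>) = g \<tau>" if "\<gamma> \<in> modular_commutator" "\<tau> \<in> upper_half_plane" for \<gamma> \<tau>
      unfolding g_def using inv[OF that] shift_invariant[of f, OF inv that] by simp
    show "(\<lambda>q. (h (shift_unit * q) - h q) / shift_unit) holomorphic_on ball 0 1" by (intro holomorphic_intros hz h z)
    show "g \<tau> = (h (shift_unit * cusp_coord 6 \<tau>) - h (cusp_coord 6 \<tau>)) / shift_unit / cusp_coord 6 \<tau> ^ Suc 0"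
      if "\<tau> \<in> upper_half_plane" for \<tau>
      using h(2)[OF that] h(2)[OF up[OF that]] z(1) by (simp add: g_def cusp_coord_shift diff_divide_distrib mult.commute)
  qed simp
  then obtain k where k: "\<And>\<tau>. \<tau> \<in> upper_half_plane \<Longrightarrow> g \<tau> = k" by (rule modular_expansion_0) (rule that)
  define k0 where "k0 = k / (1 - 1 / shift_unit)"
  define F where "F \<tau> = f \<tau> - k0" for \<tau>
  have "1 - 1 / shift_unit \<noteq> 0" using z(1,2) by simp
  moreover have "k0 - k0 / shift_unit = k0 * (1 - 1 / shift_unit)" by (simp add: algebra_simps)
  ultimately have "k0 - k0 / shift_unit = k" by (simp add: k0_def)
  then have F1: "F (\<tau> + 1) = F \<tau> / shift_unit" if "\<tau> \<in> upper_half_plane" for \<tau>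
    using k[OF that] by (simp add: F_def g_def diff_divide_distrib algebra_simps)
  have Fhol: "F holomorphic_on upper_half_plane" unfolding F_def[abs_def] by (intro holomorphic_intros f)
  have Finv: "F (moebius \<gamma> \<tau>) = F \<tau>" if "\<gamma> \<in> modular_commutator" "\<tau> \<in> upper_half_plane" for \<gamma> \<tau>
    using inv[OF that] by (simp add: F_def)
  define h1 where "h1 q = h q - k0 * q" for q
  have h1: "h1 holomorphic_on ball 0 1" "h1 0 = h 0" unfolding h1_def[abs_def] by (intro holomorphic_intros h) simp
  have Fq: "F \<tau> = h1 (cusp_coord 6 \<tau>) / cusp_coord 6 \<tau>" if "\<tau> \<in> upper_half_plane" for \<tau>
    using h(2)[OF that] by (simp add: F_def h1_def diff_divide_distrib)
  \<comment> \<open>The constants \<open>a\<close> and \<open>b\<close> remove the poles of order 2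
    and 1 from F^2, so that F^2 = a x + b F + m with a constant m.\<close>
  define a where "a = (h 0)\<^sup>2 / hx 0"
  have a: "a \<noteq> 0" using h0 hx_0 by (simp add: a_def)
  have "modular_expansion 1 (\<lambda>\<tau>. (F \<tau>)\<^sup>2 - a * x \<tau>)"
  proof (rule modular_expansion_reduce)
    show "(\<lambda>\<tau>. (F \<tau>)\<^sup>2 - a * x \<tau>) holomorphic_on upper_half_plane" by (intro holomorphic_intros Fhol x_holomorphic)
    show "(\<lambda>q. (h1 q)\<^sup>2 - a * hx (q ^ 6)) holomorphic_on ball 0 1" by (intro holomorphic_intros h1 hx_q_holomorphic)
    show "(h1 0)\<^sup>2 - a * hx (0 ^ 6) = 0" using hx_0 by (simp add: h1 a_def)
  qed (simp_all add: Finv x_modular Fq x_q diff_divide_distrib power_divide power2_eq_square)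
  then obtain h2 where h2: "h2 holomorphic_on ball 0 1"
    "\<And>\<tau>. \<tau> \<in> upper_half_plane \<Longrightarrow> (F \<tau>)\<^sup>2 - a * x \<tau> = h2 (cusp_coord 6 \<tau>) / cusp_coord 6 \<tau>"
    unfolding modular_expansion_def by auto
  define b where "b = h2 0 / h 0"
  have "modular_expansion 0 (\<lambda>\<tau>. (F \<tau>)\<^sup>2 - a * x \<tau> - b * F \<tau>)"
  proof (rule modular_expansion_reduce)
    show "(\<lambda>\<tau>. (F \<tau>)\<^sup>2 - a * x \<tau> - b * F \<tau>) holomorphic_on upper_half_plane" by (intro holomorphic_intros Fhol x_holomorphic)
    show "(\<lambda>q. h2 q - b * h1 q) holomorphic_on ball 0 1" by (intro holomorphic_intros h1 h2)
    show "h2 0 - b * h1 0 = 0" using h0 by (simp add: h1 b_def)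
    show "(F \<tau>)\<^sup>2 - a * x \<tau> - b * F \<tau> = (h2 (cusp_coord 6 \<tau>) - b * h1 (cusp_coord 6 \<tau>)) / cusp_coord 6 \<tau> ^ Suc 0"
      if "\<tau> \<in> upper_half_plane" for \<tau>
      using h2(2)[OF that] Fq[OF that] by (simp add: diff_divide_distrib)
  qed (simp_all add: Finv x_modular)
  then obtain m where "\<And>\<tau>. \<tau> \<in> upper_half_plane \<Longrightarrow> (F \<tau>)\<^sup>2 - a * x \<tau> - b * F \<tau> = m"
    by (rule modular_expansion_0) (rule that)
  then have m: "(F \<tau>)\<^sup>2 = a * x \<tau> + b * F \<tau> + m" if "\<tau> \<in> upper_half_plane" for \<tau>
    using that by (simp add: algebra_simps)
  have x1: "x (\<tau> + 1) = x \<tau> / shift_unit\<^sup>2" if "\<tau> \<in> upper_half_plane" for \<tau>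
    using x_expansion[OF that] x_expansion[OF up[OF that]] by (simp add: cusp_coord_shift power_mult_distrib mult.commute)
  \<comment> \<open>F^2 and x have the same eigenvalue under the translation, while F and constants
    have others. Comparing the relation at \<tau> and \<tau> + 1 isolates these terms: b \<noteq> 0
    would make F and hence x constant, and then m = 0 follows.\<close>
  have eq: "b * F \<tau> * (shift_unit - 1) + m * (shift_unit\<^sup>2 - 1) = 0" if t: "\<tau> \<in> upper_half_plane" for \<tau>
  proof -
    have "(F \<tau> / shift_unit)\<^sup>2 = a * (x \<tau> / shift_unit\<^sup>2) + b * (F \<tau> / shift_unit) + m"
      using m[OF up[OF t]] by (simp only: F1[OF t] x1[OF t])
    then have "(F \<tau>)\<^sup>2 = a * x \<tau> + b * F \<tau> * shift_unit + m * shift_unit\<^sup>2"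
      using z(1) by (simp add: field_simps power2_eq_square)
    then show ?thesis using m[OF t] by (simp add: algebra_simps)
  qed
  have b0: "b = 0"
  proof (rule ccontr)
    assume b: "b \<noteq> 0"
    define K where "K = - m * (shift_unit\<^sup>2 - 1) / (b * (shift_unit - 1))"
    have FK: "F \<tau> = K" if "\<tau> \<in> upper_half_plane" for \<tau>
      using eq[OF that] b z(2) by (simp add: K_def field_simps add_eq_0_iff)
    have xK: "x \<tau> = (K\<^sup>2 - b * K - m) / a" if "\<tau> \<in> upper_half_plane" for \<tau>
      using m[OF that] a by (simp add: FK[OF that] field_simps)
    obtain Y where Y: "Y > 0" "\<And>\<tau>. Im \<tau> > Y \<Longrightarrow> cmod (x \<tau>) > cmod ((K\<^sup>2 - b * K - m) / a)"
      by (rule x_large) (rule that)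
    have "\<i> * of_real (Y + 1) \<in> upper_half_plane" "Im (\<i> * of_real (Y + 1)) > Y" using Y(1) by (simp_all add: upper_half_plane_def)
    then show False using Y(2) xK by (metis less_irrefl)
  qed
  have "\<i> * 1 \<in> upper_half_plane" by (simp add: upper_half_plane_def)
  from eq[OF this] have "m = 0" using b0 z(3) by simp
  with b0 have sq: "(F \<tau>)\<^sup>2 = a * x \<tau>" if "\<tau> \<in> upper_half_plane" for \<tau> using m[OF that] by simp
  \<comment> \<open>Where x = 0 one has y \<noteq> 0, so the derivative of x does not vanish; that
    of F^2 does, because F vanishes there.\<close>
  obtain \<tau> where t: "\<tau> \<in> upper_half_plane" "x \<tau> = 0" "y \<tau> = \<i>" by (rule curve_point[of \<i> 0]) auto
  have F0: "F \<tau> = 0" using sq[OF t(1)] t(2) by simp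
  have "(F has_field_derivative deriv F \<tau>) (at \<tau>)" using holomorphic_derivI[OF Fhol open_upper_half_plane t(1)] .
  from DERIV_power[OF this, of 2] have "((\<lambda>\<tau>. (F \<tau>)\<^sup>2) has_field_derivative 0) (at \<tau>)" by (simp add: F0)
  then have "((\<lambda>\<tau>. a * x \<tau>) has_field_derivative 0) (at \<tau>)"
    by (rule has_field_derivative_transform_within_open[OF _ open_upper_half_plane t(1)]) (simp add: sq)
  moreover have "((\<lambda>\<tau>. a * x \<tau>) has_field_derivative a * (c * (eta_sq \<tau>)\<^sup>2 * y \<tau>)) (at \<tau>)"
    by (intro DERIV_cmult x_derivative t)
  ultimately have "a * (c * (eta_sq \<tau>)\<^sup>2 * y \<tau>) = 0" using DERIV_unique by blast
  then show False using a c_nonzero t(3) by simp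
qed


text \<open>Every n \<ge> 2 has the form 2 i + 3 j, so a multiple of x^i y^j cancels the leading
  pole. Order 1 is excluded by \<open>no_simple_pole\<close>, and order 0 leaves a constant.\<close>

lemma modular_function_eval:
  "modular_expansion n f \<Longrightarrow> (\<And>\<tau>. \<tau> \<notin> upper_half_plane \<Longrightarrow> f \<tau> = 0) \<Longrightarrow> \<exists>p. f = eval_xy x y p"
proof (induction n arbitrary: f rule: less_induct)
  case (less n f)
  show ?case
  proof (cases "n = 0")
    case True
    then obtain k where "\<And>\<tau>. \<tau> \<in> upper_half_plane \<Longrightarrow> f \<tau> = k" using less.prems modular_expansion_0 by metis
    then show ?thesis using less.prems(2) by (intro exI[of _ "[:[:k:]:]"]) (auto simp: eval_xy_def)
  next
    case False
    then obtain m where m: "n = Suc m" using not0_implies_Suc by blast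
    have hol: "f holomorphic_on upper_half_plane"
      and inv: "\<And>\<gamma> \<tau>. \<gamma> \<in> modular_commutator \<Longrightarrow> \<tau> \<in> upper_half_plane \<Longrightarrow> f (moebius \<gamma> \<tau>) = f \<tau>"
      using less.prems(1) unfolding modular_expansion_def by auto
    obtain h where h: "h holomorphic_on ball 0 1" "\<And>\<tau>. \<tau> \<in> upper_half_plane \<Longrightarrow> f \<tau> = h (cusp_coord 6 \<tau>) / cusp_coord 6 \<tau> ^ n"
      using less.prems(1) unfolding modular_expansion_def by blast
    show ?thesis
    proof (cases "m = 0")
      case True
      have "h 0 = 0" using no_simple_pole[OF hol inv h(1)] h(2) m True by simp
      then have "modular_expansion m f" using modular_expansion_reduce[OF hol inv h(1)] h(2) m by blast
      then show ?thesis using less.IH[of m f] less.prems(2) m by simp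
    next
      case False
      have "\<exists>i j. n = 2 * i + 3 * j"
      proof (cases "even n")
        case True then show ?thesis by (intro exI[of _ "n div 2"] exI[of _ 0]) simp
      next
        case odd: False
        then obtain k where "n = 2 * k + 1" by (rule oddE)
        then show ?thesis using m False by (intro exI[of _ "k - 1"] exI[of _ 1]) simp
      qed
      then obtain i j where ij: "n = 2 * i + 3 * j" by blast
      define a where "a = h 0 / (hx 0 ^ i * hy 0 ^ j)"
      define g where "g \<tau> = f \<tau> - a * (x \<tau> ^ i * y \<tau> ^ j) * (if \<tau> \<in> upper_half_plane then 1 else 0)" for \<tau>
      have g: "g \<tau> = f \<tau> - a * (x \<tau> ^ i * y \<tau> ^ j)" if "\<tau> \<in> upper_half_plane" for \<tau> using that by (simp add: g_def)
      have "modular_expansion m g"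
      proof (rule modular_expansion_reduce)
        have "(\<lambda>\<tau>. f \<tau> - a * (x \<tau> ^ i * y \<tau> ^ j)) holomorphic_on upper_half_plane"
          by (intro holomorphic_intros hol x_holomorphic y_holomorphic)
        then show "g holomorphic_on upper_half_plane" by (rule holomorphic_transform) (simp add: g)
        show "g (moebius \<gamma> \<tau>) = g \<tau>" if "\<gamma> \<in> modular_commutator" "\<tau> \<in> upper_half_plane" for \<gamma> \<tau>
          using inv[OF that] x_modular[OF that] y_modular[OF that] that(2)
            moebius_in[OF modular_commutator_in_SL2Z[OF that(1)] that(2)] by (simp add: g_def)
        show "(\<lambda>q. h q - a * (hx (q ^ 6) ^ i * hy (q ^ 6) ^ j)) holomorphic_on ball 0 1"
          by (intro holomorphic_intros h hx_q_holomorphic hy_q_holomorphic)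
        show "h 0 - a * (hx (0 ^ 6) ^ i * hy (0 ^ 6) ^ j) = 0" using hx_0 hy_0 by (simp add: a_def)
        show "g \<tau> = (h (cusp_coord 6 \<tau>) - a * (hx (cusp_coord 6 \<tau> ^ 6) ^ i * hy (cusp_coord 6 \<tau> ^ 6) ^ j)) / cusp_coord 6 \<tau> ^ Suc m"
          if "\<tau> \<in> upper_half_plane" for \<tau>
        proof -
          have "x \<tau> ^ i * y \<tau> ^ j = hx (cusp_coord 6 \<tau> ^ 6) ^ i * hy (cusp_coord 6 \<tau> ^ 6) ^ j / cusp_coord 6 \<tau> ^ n"
            unfolding x_q[OF that] y_q[OF that] ij by (simp add: power_divide power_mult power_add)
          then show ?thesis using h(2)[OF that] that unfolding m[symmetric] by (simp add: g diff_divide_distrib)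
        qed
      qed
      moreover have "g \<tau> = 0" if "\<tau> \<notin> upper_half_plane" for \<tau> using that less.prems(2) by (simp add: g_def)
      ultimately obtain p where p: "g = eval_xy x y p" using less.IH[of m g] m by auto
      have "f \<tau> = eval_xy x y (p + [:[:a:]:] * (poly_X ^ i * poly_Y ^ j)) \<tau>" for \<tau>
        using fun_cong[OF p, of \<tau>] less.prems(2)
        by (cases "\<tau> \<in> upper_half_plane") (simp_all add: eval_xy_def g_def poly_X_def poly_Y_def diff_eq_eq)
      then show ?thesis by blast
    qed
  qed
qed

section \<open>Evaluation of polynomials and its kernel\<close>

lemma eval_xy_add: "eval_xy x y (p + q) = (\<lambda>\<tau>. eval_xy x y p \<tau> + eval_xy x y q \<tau>)"
  and eval_xy_mult: "eval_xy x y (p * q) = (\<lambda>\<tau>. eval_xy x y p \<tau> * eval_xy x y q \<tau>)"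
  by (auto simp: eval_xy_def)

lemma eval_xy_in: "eval_xy x y p \<in> modular_functions modular_commutator"
proof (induction p)
  case 0
  then show ?case using modular_functions_const[of 0] by (simp add: eval_xy_def cong: if_cong)
next
  case (pCons a p)
  have "(\<lambda>\<tau>. if \<tau> \<in> upper_half_plane then poly a (x \<tau>) else 0) \<in> modular_functions modular_commutator"
  proof (induction a)
    case 0
    then show ?case using modular_functions_const[of 0] by (simp cong: if_cong)
  next
    case (pCons b a)
    have "(\<lambda>\<tau>. if \<tau> \<in> upper_half_plane then poly (pCons b a) (x \<tau>) else 0) =
        (\<lambda>\<tau>. (if \<tau> \<in> upper_half_plane then b else 0) + x \<tau> * (if \<tau> \<in> upper_half_plane then poly a (x \<tau>) else 0))" by auto
    then show ?case using modular_functions_add[OF modular_functions_const modular_functions_mult[OF x_modular_function pCons(2)]] by simp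
  qed
  moreover have "eval_xy x y (pCons a p) =
      (\<lambda>\<tau>. (if \<tau> \<in> upper_half_plane then poly a (x \<tau>) else 0) + y \<tau> * eval_xy x y p \<tau>)"
    by (auto simp: eval_xy_def)
  ultimately show ?case using modular_functions_add[OF _ modular_functions_mult[OF y_modular_function pCons(2)]] by simp
qed

lemma eval_xy_weierstrass: "eval_xy x y (poly_Y ^ 2 - 4 * poly_X ^ 3 + 1) = (\<lambda>\<tau>. 0)"
  using curve by (auto simp: eval_xy_def poly_X_def poly_Y_def fun_eq_iff)

text \<open>Every point of the curve is attained, and with (a, b) also (a, - b) lies on it. So A(a)
  and b B(a) vanish separately, for every a.\<close>

lemma eval_xy_linear_eq_0:
  assumes "eval_xy x y [:A, B:] = (\<lambda>\<tau>. 0)" shows "A = 0" "B = 0"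
proof -
  have eq: "poly A a + b * poly B a = 0" if ab: "b\<^sup>2 = 4 * a ^ 3 - 1" for a b
  proof -
    obtain \<tau> where "\<tau> \<in> upper_half_plane" "x \<tau> = a" "y \<tau> = b" by (rule curve_point[OF ab])
    then show ?thesis using fun_cong[OF assms, of \<tau>] by (simp add: eval_xy_def)
  qed
  have AB: "poly A a = 0 \<and> (4 * a ^ 3 - 1) * poly B a = 0" for a
  proof -
    define b where "b = csqrt (4 * a ^ 3 - 1)"
    have b: "b\<^sup>2 = 4 * a ^ 3 - 1" "(- b)\<^sup>2 = 4 * a ^ 3 - 1" by (simp_all add: b_def)
    have 1: "poly A a + b * poly B a = 0" and 2: "poly A a = b * poly B a" using eq[OF b(1)] eq[OF b(2)] by simp_all
    then have A: "poly A a = 0" by simp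
    then have "b\<^sup>2 * poly B a = 0" using 2 by (simp add: power2_eq_square)
    then show ?thesis using A unfolding b(1) by simp
  qed
  have "A = 0" using AB poly_all_0_iff_0[of A] by blast
  moreover have "\<forall>a. poly ([:-1, 0, 0, 4:] * B) a = 0" using AB by (simp add: power3_eq_cube algebra_simps)
  then have "[:-1, 0, 0, 4:] * B = 0" using poly_all_0_iff_0 by blast
  then have "B = 0" unfolding mult_eq_0_iff by simp
  ultimately show "A = 0" "B = 0" by auto
qed

text \<open>Modulo the relation a polynomial is linear in \<open>poly_Y\<close>, and by
  \<open>eval_xy_linear_eq_0\<close> such a remainder evaluates to 0 only if it is 0.\<close>

lemma eval_xy_kernel: "eval_xy x y p = (\<lambda>\<tau>. 0) \<longleftrightarrow> p \<in> weierstrass_ideal"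
proof -
  let ?W = "poly_Y ^ 2 - 4 * poly_X ^ 3 + 1 :: complex poly poly"
  have ideal: "weierstrass_ideal = {s * ?W | s. True}"
    by (simp add: weierstrass_ideal_def cgenideal_def ring_of_type_algebra_def)
  obtain s A B where p: "p = s * ?W + [:A, B:]" using bivariate_division[of p] by blast
  show ?thesis
  proof
    assume 0: "eval_xy x y p = (\<lambda>\<tau>. 0)"
    have "eval_xy x y p = eval_xy x y [:A, B:]"
      unfolding p eval_xy_add[of "s * ?W"] eval_xy_mult[of s] eval_xy_weierstrass by simp
    with 0 have "A = 0" "B = 0" using eval_xy_linear_eq_0[of A B] by simp_all
    then show "p \<in> weierstrass_ideal" using p by (auto simp: ideal)
  next
    assume "p \<in> weierstrass_ideal"
    then show "eval_xy x y p = (\<lambda>\<tau>. 0)" by (auto simp: ideal eval_xy_mult[of _ ?W] eval_xy_weierstrass)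
  qed
qed

theorem coordinate_ring_iso:
  "\<exists>\<psi>. \<psi> \<in> ring_iso weierstrass_coordinate_ring (modular_function_ring modular_commutator) \<and>
     (\<forall>p. \<psi> (weierstrass_ideal +>\<^bsub>ring_of_type_algebra\<^esub> p) = eval_xy x y p)"
proof -
  let ?R = "ring_of_type_algebra :: complex poly poly ring" and ?S = "modular_function_ring modular_commutator"
  have "eval_xy x y \<in> ring_hom ?R ?S"
    by (rule ring_hom_memI) (auto simp: ring_of_type_algebra_def modular_function_ring_def eval_xy_in
        eval_xy_add eval_xy_mult eval_xy_def[of x y 1])
  then interpret E: ring_hom_ring ?R ?S "eval_xy x y"
    by (intro ring_hom_ringI2 ring_from_type_algebra ring_modular_functions)
  have ker: "a_kernel ?R ?S (eval_xy x y) = weierstrass_ideal"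
    unfolding a_kernel_def' using eval_xy_kernel by (auto simp: ring_of_type_algebra_def modular_function_ring_def)
  have "eval_xy x y ` carrier ?R = carrier ?S"
    using eval_xy_in modular_function_eval modular_function_expansion modular_functions_iff
    by (auto simp: ring_of_type_algebra_def modular_function_ring_def) (metis rangeI)
  from E.FactRing_iso_set[OF this] E.the_elem_simp show ?thesis
    unfolding ker weierstrass_coordinate_ring_def
    by (intro exI[of _ "\<lambda>P. the_elem (eval_xy x y ` P)"]) (simp add: ring_of_type_algebra_def)
qed

end

section \<open>Finite-dimensional normed spaces\<close>

lemma (in complex_normed_space) bounded_bilinear_smul: "bounded_bilinear smul"
proof
  show "smul (r *\<^sub>R a) b = r *\<^sub>R smul a b" for r a b
    by (simp add: scaleR_conv_of_real smul_of_real[symmetric])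
  show "smul a (r *\<^sub>R b) = r *\<^sub>R smul a b" for r a b
    by (simp add: smul_of_real[symmetric] mult.commute)
  show "\<exists>K. \<forall>a b. norm (smul a b) \<le> norm a * norm b * K" by (intro exI[of _ 1]) (simp add: norm_smul)
qed (simp_all add: scale_left_distrib scale_right_distrib)

text \<open>Comparison of norms, by induction on the basis. The new vector has positive distance
  from the span of the others: by the induction hypothesis, coefficients of combinations converging
  to it would form Cauchy sequences, and it would lie in the span.\<close>

lemma (in complex_normed_space) independent_coefficient_bound:
  assumes "finite B" "independent B"
  shows "\<exists>K\<ge>0. \<forall>c. \<forall>b\<in>B. cmod (c b) \<le> K * norm (\<Sum>b\<in>B. smul (c b) b)"
  using assms
proof (induction B rule: finite_induct)
  case empty
  then show ?case by auto
next
  case (insert b0 B)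
  define s where "s c = (\<Sum>b\<in>B. smul (c b) b)" for c
  have B: "independent B" "b0 \<notin> span B" using insert.prems insert.hyps by (simp_all add: independent_insert)
  then obtain K where K: "K \<ge> 0" "\<And>c b. b \<in> B \<Longrightarrow> cmod (c b) \<le> K * norm (s c)"
    using insert.IH unfolding s_def by blast
  have s_span: "s c \<in> span B" for c unfolding s_def by (intro span_sum span_scale span_base)
  have s_diff: "s c - s d = s (\<lambda>b. c b - d b)" for c d
    by (simp add: s_def sum_subtractf scale_left_diff_distrib)
  have "\<exists>\<delta>>0. \<forall>c. \<delta> \<le> norm (b0 - s c)"
  proof (rule ccontr)
    assume no: "\<not> ?thesis"
    have "\<forall>n::nat. \<exists>c. norm (b0 - s c) < 1 / real (Suc n)" using no by (meson not_le of_nat_0_less_iff zero_less_Suc zero_less_divide_1_iff)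
    then obtain c where c: "\<And>n. norm (b0 - s (c n)) < 1 / real (Suc n)" by metis
    have lim: "(\<lambda>n. s (c n)) \<longlonglongrightarrow> b0"
    proof (rule metric_tendsto_imp_tendsto[of "\<lambda>n. 1 / real (Suc n)" 0])
      show "(\<lambda>n. 1 / real (Suc n)) \<longlonglongrightarrow> 0" using LIMSEQ_inverse_real_of_nat by (simp add: inverse_eq_divide)
      show "\<forall>\<^sub>F n in sequentially. dist (s (c n)) b0 \<le> dist (1 / real (Suc n)) 0"
        using c by (intro always_eventually allI) (simp add: dist_norm norm_minus_commute less_imp_le)
    qed
    have "\<exists>l. (\<lambda>n. c n b) \<longlonglongrightarrow> l" if b: "b \<in> B" for b
    proof -
      have "Cauchy (\<lambda>n. s (c n))" using lim by (intro convergent_Cauchy) (auto simp: convergent_def)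
      have "Cauchy (\<lambda>n. c n b)"
      proof (rule metric_CauchyI)
        fix e :: real assume e: "e > 0"
        then obtain N where N: "\<And>m n. m \<ge> N \<Longrightarrow> n \<ge> N \<Longrightarrow> dist (s (c m)) (s (c n)) < e / (K + 1)"
          using metric_CauchyD[OF \<open>Cauchy (\<lambda>n. s (c n))\<close>, of "e / (K + 1)"] K(1) by auto
        have "dist (c m b) (c n b) < e" if "m \<ge> N" "n \<ge> N" for m n
        proof -
          have "dist (c m b) (c n b) \<le> K * norm (s (c m) - s (c n))"
            unfolding s_diff dist_norm by (rule K(2)[OF b])
          also have "\<dots> \<le> K * (e / (K + 1))" using N[OF that] K(1) by (intro mult_left_mono) (auto simp: dist_norm)
          also have "\<dots> < e" using e K(1) by (simp add: field_simps)
          finally show ?thesis .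
        qed
        then show "\<exists>N. \<forall>m\<ge>N. \<forall>n\<ge>N. dist (c m b) (c n b) < e" by blast
      qed
      then show ?thesis by (simp add: Cauchy_convergent_iff convergent_def)
    qed
    then obtain l where l: "\<And>b. b \<in> B \<Longrightarrow> (\<lambda>n. c n b) \<longlonglongrightarrow> l b" by metis
    have "(\<lambda>n. s (c n)) \<longlonglongrightarrow> s l"
      unfolding s_def by (intro tendsto_sum bounded_bilinear.tendsto[OF bounded_bilinear_smul] l tendsto_const)
    then have "b0 = s l" using lim LIMSEQ_unique by blast
    then show False using s_span B(2) by metis
  qed
  then obtain \<delta> where d: "\<delta> > 0" "\<And>c. \<delta> \<le> norm (b0 - s c)" by blast
  \<comment> \<open>The coefficient of \<open>b0\<close> is at most norm v / \<delta>. The remaining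
    part of v has norm at most (1 + norm b0 / \<delta>) norm v, and the induction hypothesis applies
    to it.\<close>
  define K' where "K' = 1 / \<delta> + K * (1 + norm b0 / \<delta>)"
  have "cmod (c b) \<le> K' * norm (\<Sum>b\<in>insert b0 B. smul (c b) b)" if b: "b \<in> insert b0 B" for c b
  proof -
    define v where "v = smul (c b0) b0 + s c"
    have v: "(\<Sum>b\<in>insert b0 B. smul (c b) b) = v" using insert.hyps by (simp add: v_def s_def)
    have c0: "cmod (c b0) \<le> norm v / \<delta>"
    proof (cases "c b0 = 0")
      case False
      have "smul (c b0) (s (\<lambda>b. - c b / c b0)) = - s c"
        unfolding s_def scale_sum_right sum_negf[symmetric] using False by (intro sum.cong) simp_all
      then have "v = smul (c b0) (b0 - s (\<lambda>b. - c b / c b0))" by (simp add: v_def scale_right_diff_distrib)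
      then have "cmod (c b0) * \<delta> \<le> norm v" using d(2) by (simp add: norm_smul mult_left_mono)
      then show ?thesis using d(1) by (simp add: field_simps)
    qed (use d(1) in simp)
    have s: "norm (s c) \<le> (1 + norm b0 / \<delta>) * norm v"
    proof -
      have "norm (s c) \<le> norm v + cmod (c b0) * norm b0"
        using norm_triangle_ineq4[of v "smul (c b0) b0"] by (simp add: v_def norm_smul)
      also have "\<dots> \<le> norm v + norm v / \<delta> * norm b0" using c0 by (intro add_left_mono mult_right_mono) auto
      finally show ?thesis by (simp add: field_simps)
    qed
    have nn: "0 \<le> K * ((1 + norm b0 / \<delta>) * norm v)" "0 \<le> norm v / \<delta>" using K(1) d(1) by simp_all
    have eq: "K' * norm v = norm v / \<delta> + K * ((1 + norm b0 / \<delta>) * norm v)" by (simp add: K'_def distrib_right)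
    show ?thesis
    proof (cases "b = b0")
      case True then show ?thesis unfolding v eq using c0 nn by simp
    next
      case False
      then have "cmod (c b) \<le> K * norm (s c)" using b K(2) by simp
      also have "\<dots> \<le> K * ((1 + norm b0 / \<delta>) * norm v)" using s K(1) by (intro mult_left_mono) auto
      finally show ?thesis unfolding v eq using nn by simp
    qed
  qed
  moreover have "K' \<ge> 0" using K(1) d(1) by (simp add: K'_def)
  ultimately show ?case by blast
qed

context fd_complex_lie_algebra begin

definition lbasis :: "'g set" where
  "lbasis = (SOME B. finite B \<and> independent B \<and> span B = UNIV)"

lemma lbasis: "finite lbasis" "independent lbasis" "span lbasis = UNIV"
proof -
  obtain A where A: "finite A" "span A = UNIV" using finite_dim by blast
  obtain B where "B \<subseteq> A" "independent B" "A \<subseteq> span B" by (rule maximal_independent_subset)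
  then have "finite B \<and> independent B \<and> span B = UNIV"
    using A finite_subset span_mono[of A "span B"] by (auto simp: span_span)
  then have "finite lbasis \<and> independent lbasis \<and> span lbasis = UNIV" unfolding lbasis_def by (rule someI)
  then show "finite lbasis" "independent lbasis" "span lbasis = UNIV" by auto
qed

definition lcoord :: "'g \<Rightarrow> 'g \<Rightarrow> complex" where "lcoord b v = representation lbasis v b"

lemma lcoord_sum: "(\<Sum>b\<in>lbasis. smul (lcoord b v) b) = v"
  unfolding lcoord_def using lbasis by (intro sum_representation_eq) auto

lemma lcoord_add: "lcoord b (u + v) = lcoord b u + lcoord b v"
  and lcoord_smul: "lcoord b (smul k v) = k * lcoord b v"
  unfolding lcoord_def using lbasis by (simp_all add: representation_add representation_scale)

lemma lcoord_bound: "\<exists>K\<ge>0. \<forall>b\<in>lbasis. \<forall>v. cmod (lcoord b v) \<le> K * norm v"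
proof -
  obtain K where "K \<ge> 0" "\<And>c b. b \<in> lbasis \<Longrightarrow> cmod (c b) \<le> K * norm (\<Sum>b\<in>lbasis. smul (c b) b)"
    using independent_coefficient_bound[OF lbasis(1,2)] by blast
  moreover have "cmod (lcoord b v) \<le> K * norm v" if "b \<in> lbasis" for b v
    using calculation(2)[OF that, of "\<lambda>b. lcoord b v"] unfolding lcoord_sum .
  ultimately show ?thesis by blast
qed

lemma lcoord_bounded_linear: "b \<in> lbasis \<Longrightarrow> bounded_linear (lcoord b)"
proof -
  assume b: "b \<in> lbasis"
  obtain K where "\<And>v. cmod (lcoord b v) \<le> K * norm v" using lcoord_bound b by blast
  then show ?thesis
    by (intro bounded_linear_intro[of _ K])
      (simp_all add: lcoord_add smul_of_real[symmetric] lcoord_smul scaleR_conv_of_real mult.commute)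
qed

text \<open>The constant is chosen before the quantified \<open>T\<close>, so that one bound serves
  a whole family of linear maps.\<close>

lemma linear_map_bound:
  assumes M: "M \<ge> 0" "\<And>b. b \<in> lbasis \<Longrightarrow> norm (T b) \<le> M"
  shows "\<exists>K\<ge>0. \<forall>T. (\<forall>u v. T (u + v) = T u + T v) \<longrightarrow> (\<forall>c v. T (smul c v) = smul c (T v)) \<longrightarrow>
     (\<forall>b\<in>lbasis. norm (T b) \<le> M) \<longrightarrow> (\<forall>v. norm (T v :: 'g) \<le> K * norm v)"
proof -
  obtain K where K: "K \<ge> 0" "\<And>b v. b \<in> lbasis \<Longrightarrow> cmod (lcoord b v) \<le> K * norm v" using lcoord_bound by blast
  have "norm (T v) \<le> (card lbasis * (K * M)) * norm v"
    if T: "\<And>u v. T (u + v) = T u + T v" "\<And>c v. T (smul c v) = smul c (T v)" "\<And>b. b \<in> lbasis \<Longrightarrow> norm (T b) \<le> M"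
    for T :: "'g \<Rightarrow> 'g" and v
  proof -
    have T0: "T 0 = 0" using T(2)[of 0 0] by simp
    have Tsum: "T (sum g A) = (\<Sum>a\<in>A. T (g a))" for g and A :: "'g set"
      by (induction A rule: infinite_finite_induct) (simp_all add: T T0)
    have "T v = T (\<Sum>b\<in>lbasis. smul (lcoord b v) b)" by (simp only: lcoord_sum)
    also have "\<dots> = (\<Sum>b\<in>lbasis. smul (lcoord b v) (T b))" by (simp only: Tsum T(2))
    also have "norm \<dots> \<le> (\<Sum>b\<in>lbasis. (K * norm v) * M)"
      using T(3) K M(1) by (intro sum_norm_le) (auto simp: norm_smul intro!: mult_mono)
    finally show ?thesis by (simp add: algebra_simps)
  qed
  then show ?thesis using K(1) M by (intro exI[of _ "card lbasis * (K * M)"]) simp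
qed

section \<open>Complex differentiability of vector-valued functions\<close>

lemma complex_differentiable_lcoord:
  assumes f: "complex_differentiable_at (*) smul f \<tau>" and b: "b \<in> lbasis"
  shows "(\<lambda>\<tau>. lcoord b (f \<tau>)) field_differentiable at \<tau>"
proof -
  obtain D where D: "(f has_derivative D) (at \<tau>)" "\<And>c h. D (c * h) = smul c (D h)"
    using f unfolding complex_differentiable_at_def by blast
  have "((\<lambda>\<tau>. lcoord b (f \<tau>)) has_derivative (\<lambda>h. lcoord b (D h))) (at \<tau>)"
    by (rule bounded_linear.has_derivative[OF lcoord_bounded_linear[OF b] D(1)])
  moreover have "(\<lambda>h. lcoord b (D h)) = (*) (lcoord b (D 1))"
  proof
    show "lcoord b (D h) = lcoord b (D 1) * h" for h using D(2)[of h 1] by (simp add: lcoord_smul)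
  qed
  ultimately have "((\<lambda>\<tau>. lcoord b (f \<tau>)) has_field_derivative lcoord b (D 1)) (at \<tau>)"
    unfolding has_field_derivative_def by simp
  then show ?thesis unfolding field_differentiable_def by blast
qed

lemma complex_differentiable_smul:
  assumes g: "g field_differentiable at \<tau>" and f: "complex_differentiable_at (*) smul f \<tau>"
  shows "complex_differentiable_at (*) smul (\<lambda>\<tau>. smul (g \<tau>) (f \<tau>)) \<tau>"
proof -
  obtain D where D: "(f has_derivative D) (at \<tau>)" "\<And>c h. D (c * h) = smul c (D h)"
    using f unfolding complex_differentiable_at_def by blast
  obtain g' where g': "(g has_derivative (\<lambda>h. g' * h)) (at \<tau>)"
    using g unfolding field_differentiable_def has_field_derivative_def by blast
  have "((\<lambda>\<tau>. smul (g \<tau>) (f \<tau>)) has_derivative (\<lambda>h. smul (g \<tau>) (D h) + smul (g' * h) (f \<tau>))) (at \<tau>)"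
    by (rule bounded_bilinear.FDERIV[OF bounded_bilinear_smul g' D(1)])
  then show ?thesis unfolding complex_differentiable_at_def
    by (intro exI conjI allI) (auto simp: D(2) scale_right_distrib mult_ac)
qed

lemma complex_differentiable_zero: "complex_differentiable_at (*) smul (\<lambda>_. 0) \<tau>"
  unfolding complex_differentiable_at_def by (intro exI[of _ "\<lambda>_. 0"]) simp

lemma complex_differentiable_add:
  assumes "complex_differentiable_at (*) smul f \<tau>" "complex_differentiable_at (*) smul g \<tau>"
  shows "complex_differentiable_at (*) smul (\<lambda>\<tau>. f \<tau> + g \<tau>) \<tau>"
proof -
  obtain D D' where D: "(f has_derivative D) (at \<tau>)" "\<And>c h. D (c * h) = smul c (D h)"
    "(g has_derivative D') (at \<tau>)" "\<And>c h. D' (c * h) = smul c (D' h)"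
    using assms unfolding complex_differentiable_at_def by blast
  then show ?thesis unfolding complex_differentiable_at_def
    by (intro exI[of _ "\<lambda>h. D h + D' h"] conjI has_derivative_add) (simp_all add: scale_right_distrib)
qed

lemma complex_differentiable_sum:
  "(\<And>i. i \<in> I \<Longrightarrow> complex_differentiable_at (*) smul (f i) \<tau>) \<Longrightarrow>
     complex_differentiable_at (*) smul (\<lambda>\<tau>. \<Sum>i\<in>I. f i \<tau>) \<tau>"
  by (induction I rule: infinite_finite_induct)
    (simp_all add: complex_differentiable_zero complex_differentiable_add)

end

lemma bounded_linear_mat2:
  "bounded_linear (\<lambda>(a, b, c, d). mat2 a b c (d :: complex))"
proof -
  have "linear (\<lambda>(a, b, c, d). mat2 a b c (d :: complex))"
    by (rule linearI) (auto simp: mat2_eq_iff)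
  then show ?thesis using linear_conv_bounded_linear by blast
qed

lemma isCont_mat2:
  assumes "isCont a z" "isCont b z" "isCont c z" "isCont (d :: 'a::t2_space \<Rightarrow> complex) z"
  shows "isCont (\<lambda>z. mat2 (a z) (b z) (c z) (d z)) z"
  using bounded_linear.isCont[OF bounded_linear_mat2 isCont_Pair[OF assms(1) isCont_Pair[OF assms(2) isCont_Pair[OF assms(3,4)]]]] by simp

lemma mat2_has_derivative:
  assumes "(a has_field_derivative a') (at \<tau>)" "(b has_field_derivative b') (at \<tau>)"
    "(c has_field_derivative c') (at \<tau>)" "(d has_field_derivative d') (at (\<tau> :: complex))"
  shows "((\<lambda>\<tau>. mat2 (a \<tau>) (b \<tau>) (c \<tau>) (d \<tau>)) has_derivative (\<lambda>h. mat2 (a' * h) (b' * h) (c' * h) (d' * h))) (at \<tau>)"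
  using bounded_linear.has_derivative[OF bounded_linear_mat2 has_derivative_Pair[OF assms(1)[unfolded has_field_derivative_def]
    has_derivative_Pair[OF assms(2)[unfolded has_field_derivative_def]
    has_derivative_Pair[OF assms(3,4)[unfolded has_field_derivative_def]]]]] by simp

section \<open>Holomorphic actions of the special linear group\<close>

locale holomorphic_lie_action = fd_complex_lie_algebra smul bracket
  for smul :: "complex \<Rightarrow> 'g::real_normed_vector \<Rightarrow> 'g" and bracket :: "'g \<Rightarrow> 'g \<Rightarrow> 'g" +
  fixes r :: "complex ^ 2 ^ 2 \<Rightarrow> 'g \<Rightarrow> 'g"
  assumes r_hom: "r \<in> hom SL2C (lie_aut_group smul bracket)"
    and r_holomorphic: "holomorphic_on_SL2C smul r"
begin

abbreviation "SL \<equiv> carrier SL2C"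

lemma r_aut: "A \<in> SL \<Longrightarrow> r A \<in> carrier (lie_aut_group smul bracket)"
  using r_hom by (rule hom_in_carrier)

lemma r_add: "A \<in> SL \<Longrightarrow> r A (u + v) = r A u + r A v"
  and r_smul: "A \<in> SL \<Longrightarrow> r A (smul k v) = smul k (r A v)"
  and r_bracket: "A \<in> SL \<Longrightarrow> r A (bracket u v) = bracket (r A u) (r A v)"
  and r_bij: "A \<in> SL \<Longrightarrow> bij (r A)"
  using r_aut[of A] by (simp_all add: lie_aut_group_def)

lemma r_mult: "A \<in> SL \<Longrightarrow> B \<in> SL \<Longrightarrow> r (A ** B) v = r A (r B v)"
  using hom_mult[OF r_hom, of A B] by (simp add: SL2_def lie_aut_group_def)

lemma r_one: "r (mat 1) v = v"
proof -
  have one: "mat 1 \<in> SL" by (simp add: mat2_one mat2_SL2_iff)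
  have "r (mat 1) (r (mat 1) v) = r (mat 1) v" using r_mult[OF one one, of v] by simp
  then show ?thesis using bij_is_inj[OF r_bij[OF one]] by (simp add: inj_eq)
qed

lemma r_zero: "A \<in> SL \<Longrightarrow> r A 0 = 0" using r_smul[of A 0 0] by simp

lemma r_sum: "A \<in> SL \<Longrightarrow> r A (sum g I) = (\<Sum>i\<in>I. r A (g i))"
  by (induction I rule: infinite_finite_induct) (simp_all add: r_add r_zero)

lemma r_extension:
  assumes "A \<in> SL"
  obtains U F where "open U" "A \<in> U" "\<And>Z. Z \<in> U \<Longrightarrow> complex_differentiable_at (\<lambda>c. map_matrix ((*) c)) smul F Z"
    "\<And>Z. Z \<in> U \<Longrightarrow> Z \<in> SL \<Longrightarrow> F Z = r Z v"
  using r_holomorphic assms unfolding holomorphic_on_SL2C_def by (metis IntI)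

lemma r_continuous: "continuous_on SL (\<lambda>A. r A v)"
  unfolding continuous_on_eq_continuous_within
proof
  fix A assume A: "A \<in> SL"
  obtain U F where U: "open U" "A \<in> U" "\<And>Z. Z \<in> U \<Longrightarrow> complex_differentiable_at (\<lambda>c. map_matrix ((*) c)) smul F Z"
    "\<And>Z. Z \<in> U \<Longrightarrow> Z \<in> SL \<Longrightarrow> F Z = r Z v" by (rule r_extension[OF A]) (rule that)
  obtain D where "(F has_derivative D) (at A)" using U(3)[OF U(2)] unfolding complex_differentiable_at_def by blast
  from has_derivative_continuous[OF this] have "(F \<longlongrightarrow> F A) (at A within SL)"
    unfolding continuous_within by (rule tendsto_within_subset) simp
  moreover have "\<forall>\<^sub>F Z in at A within SL. F Z = r Z v"
    unfolding eventually_at_topological using U by blast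
  ultimately show "continuous (at A within SL) (\<lambda>A. r A v)"
    unfolding continuous_within U(4)[OF U(2) A, symmetric] by (rule Lim_transform_eventually)
qed

text \<open>The orbit maps of the finitely many basis vectors are continuous, hence bounded on
  \<open>K\<close>, and \<open>linear_map_bound\<close> makes the bound uniform.\<close>

lemma r_compact_bound:
  assumes "compact K" "K \<subseteq> SL"
  shows "\<exists>B\<ge>1. \<forall>A\<in>K. \<forall>v. norm (r A v) \<le> B * norm v"
proof -
  have "\<exists>M. \<forall>A\<in>K. norm (r A b) \<le> M" for b
    using compact_imp_bounded[OF compact_continuous_image[OF continuous_on_subset[OF r_continuous[of b] assms(2)] assms(1)]]
    unfolding bounded_iff by blast
  then obtain M where M: "\<And>b A. A \<in> K \<Longrightarrow> norm (r A b) \<le> M b" by metis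
  define M' where "M' = (\<Sum>b\<in>lbasis. \<bar>M b\<bar>)"
  have "\<bar>M b\<bar> \<le> M'" if "b \<in> lbasis" for b unfolding M'_def by (rule member_le_sum[OF that _ lbasis(1)]) simp
  then have M': "norm (r A b) \<le> M'" if "A \<in> K" "b \<in> lbasis" for A b using M[OF that(1), of b] that(2) by fastforce
  have "M' \<ge> 0" unfolding M'_def by (intro sum_nonneg) simp
  then obtain C where C: "\<forall>T. (\<forall>u v. T (u + v) = T u + T v) \<longrightarrow> (\<forall>c v. T (smul c v) = smul c (T v)) \<longrightarrow>
     (\<forall>b\<in>lbasis. norm (T b) \<le> M') \<longrightarrow> (\<forall>v. norm (T v :: 'g) \<le> C * norm v)"
    using linear_map_bound[of M' "\<lambda>_. 0"] by auto
  have "norm (r A v) \<le> max 1 C * norm v" if A: "A \<in> K" for A v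
  proof -
    have "norm (r A v) \<le> C * norm v" using C M'[OF A] r_add r_smul A assms(2) by blast
    also have "\<dots> \<le> max 1 C * norm v" by (intro mult_right_mono) auto
    finally show ?thesis .
  qed
  then show ?thesis by (intro exI[of _ "max 1 C"]) simp
qed

text \<open>A compact ball gives a bound B \<ge> 1 for arguments of modulus at most 1. A general w
  is reached in n equal steps of that size with n \<le> |w| + 2, each costing a factor B.\<close>

lemma one_parameter_bound:
  assumes p: "\<And>w. p w \<in> SL" "\<And>w z. p (w + z) = p w ** p z" "p 0 = mat 1" "\<And>w. isCont p (w :: complex)"
  shows "\<exists>M\<ge>0. \<forall>w v. norm (r (p w) v) \<le> exp (M * (cmod w + 2)) * norm v"
proof -
  have "compact (p ` cball 0 1)"
    using p(4) by (intro compact_continuous_image compact_cball continuous_at_imp_continuous_on) blast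
  moreover have "p ` cball 0 1 \<subseteq> SL" using p(1) by blast
  ultimately obtain B where B: "B \<ge> 1" and "\<forall>A\<in>p ` cball 0 1. \<forall>v. norm (r A v) \<le> B * norm v"
    using r_compact_bound by blast
  then have B: "B \<ge> 1" "\<And>w v. cmod w \<le> 1 \<Longrightarrow> norm (r (p w) v) \<le> B * norm v" by auto
  have iter: "norm (r (p (of_nat n * z)) v) \<le> B ^ n * norm v" if "cmod z \<le> 1" for n z v
  proof (induction n)
    case 0
    then show ?case by (simp add: p(3) r_one)
  next
    case (Suc n)
    have "norm (r (p (of_nat (Suc n) * z)) v) = norm (r (p z) (r (p (of_nat n * z)) v))"
      using p(2)[of z "of_nat n * z"] by (simp add: distrib_right r_mult p(1))
    also have "\<dots> \<le> B * (B ^ n * norm v)" using B(2)[OF that] Suc B(1) by (meson order_trans mult_left_mono zero_le_one)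
    finally show ?case by simp
  qed
  have "norm (r (p w) v) \<le> exp (ln B * (cmod w + 2)) * norm v" for w v
  proof -
    define n where "n = nat \<lceil>cmod w\<rceil> + 1"
    have "real n = of_int \<lceil>cmod w\<rceil> + 1" by (simp add: n_def)
    then have n: "real n \<ge> cmod w" "real n \<le> cmod w + 2" "n > 0" using ceiling_correct[of "cmod w"]
      by (linarith, linarith, simp add: n_def)
    have "cmod (w / of_nat n) \<le> 1" using n by (simp add: norm_divide)
    from iter[OF this, of n v] have "norm (r (p w) v) \<le> B ^ n * norm v" using n(3) by simp
    also have "B ^ n = exp (ln B * real n)" using B(1) by (simp add: exp_of_nat2_mult)
    also have "\<dots> * norm v \<le> exp (ln B * (cmod w + 2)) * norm v"
      using n(2) B(1) by (intro mult_right_mono) (auto intro!: mult_left_mono)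
    finally show ?thesis .
  qed
  then show ?thesis using B(1) by (intro exI[of _ "ln B"]) simp
qed

text \<open>The chain rule applies to a local holomorphic extension of r to an open set of matrices,
  and the result transfers because the curve of matrices stays in the group.\<close>

lemma complex_differentiable_r:
  assumes hol: "a holomorphic_on upper_half_plane" "b holomorphic_on upper_half_plane"
      "c holomorphic_on upper_half_plane" "d holomorphic_on upper_half_plane"
    and SL: "\<And>\<tau>. mat2 (a \<tau>) (b \<tau>) (c \<tau>) (d \<tau>) \<in> SL" and t: "\<tau> \<in> upper_half_plane"
  shows "complex_differentiable_at (*) smul (\<lambda>\<tau>. r (mat2 (a \<tau>) (b \<tau>) (c \<tau>) (d \<tau>)) v) \<tau>"
proof -
  let ?P = "\<lambda>\<tau>. mat2 (a \<tau>) (b \<tau>) (c \<tau>) (d \<tau>)"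
  let ?D = "\<lambda>h. mat2 (deriv a \<tau> * h) (deriv b \<tau> * h) (deriv c \<tau> * h) (deriv d \<tau> * h)"
  have P: "(?P has_derivative ?D) (at \<tau>)"
    by (intro mat2_has_derivative holomorphic_derivI[OF _ open_upper_half_plane t] hol)
  obtain U F where U: "open U" "?P \<tau> \<in> U" "\<And>Z. Z \<in> U \<Longrightarrow> complex_differentiable_at (\<lambda>c. map_matrix ((*) c)) smul F Z"
    "\<And>Z. Z \<in> U \<Longrightarrow> Z \<in> SL \<Longrightarrow> F Z = r Z v" by (rule r_extension[OF SL]) (rule that)
  obtain E where E: "(F has_derivative E) (at (?P \<tau>))" "\<And>k h. E (map_matrix ((*) k) h) = smul k (E h)"
    using U(3)[OF U(2)] unfolding complex_differentiable_at_def by blast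
  have "((\<lambda>\<tau>. F (?P \<tau>)) has_derivative (\<lambda>h. E (?D h))) (at \<tau>)" by (rule has_derivative_compose[OF P E(1)])
  moreover have "\<forall>\<^sub>F z in at \<tau>. ?P z \<in> U"
    using has_derivative_continuous[OF P] U(1,2) unfolding continuous_within by (rule topological_tendstoD)
  then have "\<forall>\<^sub>F z in at \<tau>. F (?P z) = r (?P z) v" by eventually_elim (rule U(4)[OF _ SL])
  ultimately have "((\<lambda>\<tau>. r (?P \<tau>) v) has_derivative (\<lambda>h. E (?D h))) (at \<tau>)"
    by (rule has_derivative_transform_eventually) (simp_all add: U(4)[OF U(2) SL])
  moreover have "E (?D (k * h)) = smul k (E (?D h))" for k h
  proof -
    have "?D (k * h) = map_matrix ((*) k) (?D h)" by (simp add: mat2_eq_iff mult_ac)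
    then show ?thesis by (simp only: E(2))
  qed
  ultimately show ?thesis unfolding complex_differentiable_at_def by blast
qed

end

section \<open>Trivialisation of the equivariant functions\<close>

definition modular_frame :: "complex \<Rightarrow> complex ^ 2 ^ 2" where
  "modular_frame \<tau> = mat2 (\<tau> * eta_sq \<tau>) (- ((1 + \<tau> * eta_log_deriv \<tau>) / eta_sq \<tau>)) (eta_sq \<tau>) (- (eta_log_deriv \<tau> / eta_sq \<tau>))"

definition modular_coframe :: "complex \<Rightarrow> complex ^ 2 ^ 2" where
  "modular_coframe \<tau> = mat2 (- (eta_log_deriv \<tau> / eta_sq \<tau>)) ((1 + \<tau> * eta_log_deriv \<tau>) / eta_sq \<tau>) (- eta_sq \<tau>) (\<tau> * eta_sq \<tau>)"

lemma modular_frame_SL2: "modular_frame \<tau> \<in> carrier SL2C" "modular_coframe \<tau> \<in> carrier SL2C"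
  by (simp_all add: modular_frame_def modular_coframe_def mat2_SL2_iff)

lemma modular_frame_inverse:
  "modular_frame \<tau> ** modular_coframe \<tau> = mat 1" "modular_coframe \<tau> ** modular_frame \<tau> = mat 1"
  by (simp_all add: modular_frame_def modular_coframe_def mat2_mult mat2_one)

text \<open>For the first column this is the weight one law of \<open>eta_sq\<close>. For the second
  it is the law of \<open>eta_log_deriv\<close>, whose inhomogeneous term c j combines with a d - b
  c = 1.\<close>

lemma modular_frame_modular:
  assumes g: "\<gamma> \<in> modular_commutator" and t: "\<tau> \<in> upper_half_plane"
  shows "modular_frame (moebius \<gamma> \<tau>) = map_matrix of_int \<gamma> ** modular_frame \<tau>"
proof -
  note gS = modular_commutator_in_SL2Z[OF g]
  obtain a b c d where \<gamma>: "\<gamma> = mat2 a b c d" "a * d - b * c = 1" by (rule SL2_cases[OF gS])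
  define j where "j = automorphy \<gamma> \<tau>"
  define L where "L = eta_log_deriv \<tau>"
  define p where "p = eta_sq \<tau>"
  have j: "j \<noteq> 0" "j = of_int c * \<tau> + of_int d" using automorphy_nonzero[OF gS t] by (simp_all add: j_def automorphy_def \<gamma>)
  have p: "p \<noteq> 0" by (simp add: p_def)
  have m: "moebius \<gamma> \<tau> = (of_int a * \<tau> + of_int b) / j" by (simp add: moebius_automorphy j_def \<gamma>)
  have s: "eta_sq (moebius \<gamma> \<tau>) = j * p" using eta_sq_modular[OF g t] by (simp add: j_def p_def)
  have l: "eta_log_deriv (moebius \<gamma> \<tau>) = j\<^sup>2 * L + of_int c * j" using eta_log_deriv_modular[OF g t] by (simp add: j_def L_def \<gamma>)
  have "complex_of_int a * of_int d - of_int b * of_int c = 1" using arg_cong[OF \<gamma>(2), of complex_of_int] by simp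
  then have det: "of_int a * j = 1 + of_int c * (of_int a * \<tau> + of_int b)" unfolding j(2) by (simp add: algebra_simps)
  have gm: "map_matrix of_int \<gamma> = mat2 (of_int a) (of_int b) (of_int c) (of_int d :: complex)"
    by (simp add: mat2_eq_iff \<gamma>)
  have 1: "(of_int a * \<tau> + of_int b) / j * (j * p) = of_int a * (\<tau> * p) + of_int b * p" using j(1) by (simp add: field_simps)
  have "1 + (of_int a * \<tau> + of_int b) / j * (j\<^sup>2 * L + of_int c * j) = 1 + (of_int a * \<tau> + of_int b) * (j * L + of_int c)"
    using j(1) by (simp add: field_simps power2_eq_square)
  also have "\<dots> = j * (of_int a + (of_int a * \<tau> + of_int b) * L)" using det by (simp add: algebra_simps)
  finally have "(1 + (of_int a * \<tau> + of_int b) / j * (j\<^sup>2 * L + of_int c * j)) / (j * p) = (of_int a + (of_int a * \<tau> + of_int b) * L) / p"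
    using j(1) by simp
  also have "\<dots> = of_int a * ((1 + \<tau> * L) / p) + of_int b * (L / p)" by (simp add: add_divide_distrib algebra_simps)
  finally have 2: "(1 + (of_int a * \<tau> + of_int b) / j * (j\<^sup>2 * L + of_int c * j)) / (j * p) =
      of_int a * ((1 + \<tau> * L) / p) + of_int b * (L / p)" .
  have "(j\<^sup>2 * L + of_int c * j) / (j * p) = (of_int c + j * L) / p" using j(1) p by (simp add: field_simps power2_eq_square)
  also have "\<dots> = of_int c * ((1 + \<tau> * L) / p) + of_int d * (L / p)" unfolding j(2) by (simp add: add_divide_distrib algebra_simps)
  finally have 3: "(j\<^sup>2 * L + of_int c * j) / (j * p) = of_int c * ((1 + \<tau> * L) / p) + of_int d * (L / p)" .
  show ?thesis
    unfolding modular_frame_def gm mat2_mult s l L_def[symmetric] p_def[symmetric] mat2_inject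
    unfolding m 1 2 3 by (simp add: j(2) algebra_simps)
qed

definition unipotent :: "complex \<Rightarrow> complex ^ 2 ^ 2" where "unipotent w = mat2 1 w 0 1"

definition torus_element :: "complex \<Rightarrow> complex ^ 2 ^ 2" where "torus_element w = mat2 (exp w) 0 0 (exp (- w))"

text \<open>A Bruhat decomposition. Apart from a constant matrix, the factors are values of
  one-parameter subgroups. Of their arguments, \<tau> and the logarithm of \<open>eta_sq\<close>
  grow at most linearly at the cusp, and \<open>eta_log_deriv\<close> stays bounded.\<close>

lemma modular_frame_factors:
  "modular_frame \<tau> = unipotent \<tau> ** (mat2 0 (- 1) 1 0 ** (unipotent (- eta_log_deriv \<tau>) ** torus_element (eta_sq_log \<tau>)))"
  "modular_coframe \<tau> = torus_element (- eta_sq_log \<tau>) ** (unipotent (eta_log_deriv \<tau>) ** (mat2 0 1 (- 1) 0 ** unipotent (- \<tau>)))"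
  by (simp_all add: modular_frame_def modular_coframe_def unipotent_def torus_element_def mat2_mult eta_sq_def exp_minus field_simps)

lemma eta_log_deriv_bounded:
  assumes "Im \<tau> > 1" shows "cmod (eta_log_deriv \<tau>) \<le> 2"
proof -
  have "cmod (eta_log_deriv \<tau> - 2 * of_real pi * \<i> / 12) \<le> pi / (6 * (Im \<tau>)\<^sup>2)" using assms by (intro eta_log_deriv_bound) simp
  also have "\<dots> \<le> pi / (6 * 1)" using assms by (intro divide_left_mono mult_left_mono) (simp_all add: one_le_power)
  finally have "cmod (eta_log_deriv \<tau>) \<le> pi / 6 + cmod (2 * of_real pi * \<i> / 12)"
    using norm_triangle_sub[of "eta_log_deriv \<tau>" "2 * of_real pi * \<i> / 12"] by simp
  also have "cmod (2 * of_real pi * \<i> / 12) = pi / 6" by (simp add: norm_mult norm_divide)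
  finally show ?thesis using pi_less_4 by simp
qed

lemma eta_sq_log_bound:
  obtains C D Y where "C \<ge> 0" "D \<ge> 0" "\<And>\<tau>. Im \<tau> > Y \<Longrightarrow> cmod (eta_sq_log \<tau>) \<le> C * cmod \<tau> + D"
proof -
  have "((\<lambda>\<tau>. eta_v (cusp_coord 1 \<tau>)) \<longlongrightarrow> eta_v 0) at_cusp"
    by (rule tendsto_cusp_coord_compose[OF zero_less_one eta_v_holomorphic])
  from tendstoD[OF this zero_less_one] obtain Y where Y: "\<And>\<tau>. Im \<tau> > Y \<Longrightarrow> dist (eta_v (cusp_coord 1 \<tau>)) (eta_v 0) < 1"
    unfolding eventually_at_cusp by blast
  have "cmod (eta_sq_log \<tau>) \<le> cmod eta_rate * cmod \<tau> + (cmod (eta_v 0) + 1)" if "Im \<tau> > Y" for \<tau>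
    using Y[OF that] norm_triangle_ineq[of "eta_rate * \<tau>" "eta_v (cusp_coord 1 \<tau>)"]
      norm_triangle_ineq2[of "eta_v (cusp_coord 1 \<tau>)" "eta_v 0"]
    by (simp add: eta_sq_log_def norm_mult dist_norm)
  then show ?thesis by (intro that[of "cmod eta_rate" "cmod (eta_v 0) + 1" Y]) simp_all
qed

context holomorphic_lie_action begin

lemma unipotent_bound: "\<exists>M\<ge>0. \<forall>w v. norm (r (unipotent w) v) \<le> exp (M * (cmod w + 2)) * norm v"
  unfolding unipotent_def
  by (rule one_parameter_bound) (auto simp: mat2_SL2_iff mat2_mult mat2_one add.commute intro!: isCont_mat2)

lemma torus_element_bound: "\<exists>M\<ge>0. \<forall>w v. norm (r (torus_element w) v) \<le> exp (M * (cmod w + 2)) * norm v"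
  unfolding torus_element_def
  by (rule one_parameter_bound) (auto simp: mat2_SL2_iff mat2_mult mat2_one exp_add[symmetric] intro!: isCont_mat2)

lemma r_bounded: "A \<in> SL \<Longrightarrow> \<exists>B\<ge>1. \<forall>v. norm (r A v) \<le> B * norm v"
  using r_compact_bound[of "{A}"] by simp

lemma modular_frame_bound:
  "\<exists>C M Y. C \<ge> 0 \<and> (\<forall>\<tau>. Im \<tau> > Y \<longrightarrow> (\<forall>v. norm (r (modular_frame \<tau>) v) \<le> C * exp (M * cmod \<tau>) * norm v \<and>
     norm (r (modular_coframe \<tau>) v) \<le> C * exp (M * cmod \<tau>) * norm v))"
proof -
  obtain M1 where M1: "M1 \<ge> 0" "\<And>w v. norm (r (unipotent w) v) \<le> exp (M1 * (cmod w + 2)) * norm v" using unipotent_bound by blast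
  obtain M2 where M2: "M2 \<ge> 0" "\<And>w v. norm (r (torus_element w) v) \<le> exp (M2 * (cmod w + 2)) * norm v" using torus_element_bound by blast
  define S S' where "S = mat2 0 (- 1) 1 (0 :: complex)" and "S' = mat2 0 1 (- 1) (0 :: complex)"
  have S: "S \<in> SL" "S' \<in> SL" by (simp_all add: S_def S'_def mat2_SL2_iff)
  obtain B B' where B: "B \<ge> 1" "\<And>v. norm (r S v) \<le> B * norm v" "B' \<ge> 1" "\<And>v. norm (r S' v) \<le> B' * norm v"
    using r_bounded[OF S(1)] r_bounded[OF S(2)] by blast
  obtain C D Y where C: "C \<ge> 0" "D \<ge> 0" "\<And>\<tau>. Im \<tau> > Y \<Longrightarrow> cmod (eta_sq_log \<tau>) \<le> C * cmod \<tau> + D"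
    by (rule eta_sq_log_bound) (rule that)
  have U: "unipotent w \<in> SL" "torus_element w \<in> SL" for w
    by (simp_all add: unipotent_def torus_element_def mat2_SL2_iff exp_minus)
  have SL_mult: "A ** A' \<in> SL" if "A \<in> SL" "A' \<in> SL" for A A' using that by (simp add: SL2_def det_mul)
  \<comment> \<open>One constant for the frame and the coframe, hence the sum of the bounds for the
    two constant matrices. The exponent 4 is 2 plus the bound 2 for
    \<open>eta_log_deriv\<close>.\<close>
  define K where "K = exp (M1 * 2) * (B + B') * exp (M1 * 4) * exp (M2 * (D + 2))"
  define M where "M = M1 + M2 * C"
  have step: "norm w \<le> exp a * x" if "norm w \<le> exp a' * norm v" "a' \<le> a" "norm v \<le> x" for w v :: 'g and a a' x :: real
  proof -
    have "exp a' * norm v \<le> exp a * x" using that by (intro mult_mono) (auto intro: order_trans[OF norm_ge_zero])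
    with that(1) show ?thesis by linarith
  qed
  have main: "norm (r (modular_frame \<tau>) v) \<le> K * exp (M * cmod \<tau>) * norm v \<and> norm (r (modular_coframe \<tau>) v) \<le> K * exp (M * cmod \<tau>) * norm v"
    if t: "Im \<tau> > max Y 1" for \<tau> v
  proof -
    let ?L = "eta_log_deriv \<tau>" and ?w = "eta_sq_log \<tau>"
    have L: "M1 * (cmod ?L + 2) \<le> M1 * 4" using eta_log_deriv_bounded[of \<tau>] t M1(1) by (intro mult_left_mono) auto
    have w: "M2 * (cmod ?w + 2) \<le> M2 * (C * cmod \<tau> + D + 2)" using C(3)[of \<tau>] t M2(1) by (intro mult_left_mono) auto
    have 1: "norm (r (torus_element ?w) v) \<le> exp (M2 * (C * cmod \<tau> + D + 2)) * norm v" for v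
      by (rule step[OF M2(2) w]) simp
    have 2: "norm (r (unipotent (- ?L)) u) \<le> exp (M1 * 4) * norm u" for u
      by (rule step[OF M1(2)]) (use L in simp_all)
    have 3: "norm (r (unipotent \<tau>) u) \<le> exp (M1 * (cmod \<tau> + 2)) * norm u" for u by (rule M1(2))
    have chain: "norm x4 \<le> K * exp (M * cmod \<tau>) * norm x0"
      if "norm x1 \<le> a1 * norm x0" "norm x2 \<le> a2 * norm x1" "norm x3 \<le> a3 * norm x2" "norm x4 \<le> a4 * norm x3"
        "0 \<le> a1" "0 \<le> a2" "0 \<le> a3" "0 \<le> a4" "a4 * (a3 * (a2 * a1)) \<le> K * exp (M * cmod \<tau>)"
      for x0 x1 x2 x3 x4 :: 'g and a1 a2 a3 a4 :: real
    proof -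
      have "norm x4 \<le> a4 * (a3 * (a2 * (a1 * norm x0)))"
        using that by (meson order_trans mult_left_mono)
      also have "\<dots> = a4 * (a3 * (a2 * a1)) * norm x0" by simp
      also have "\<dots> \<le> K * exp (M * cmod \<tau>) * norm x0" using that(9) by (rule mult_right_mono) simp
      finally show ?thesis .
    qed
    have eq: "exp (M1 * (cmod \<tau> + 2)) * ((B + B') * (exp (M1 * 4) * exp (M2 * (C * cmod \<tau> + D + 2)))) = K * exp (M * cmod \<tau>)"
      by (simp add: K_def M_def exp_add[symmetric] algebra_simps)
    have "norm (r (unipotent \<tau>) (r S (r (unipotent (- ?L)) (r (torus_element ?w) v)))) \<le> K * exp (M * cmod \<tau>) * norm v"
    proof (rule chain[OF 1 2 _ 3])
      show "norm (r S u) \<le> (B + B') * norm u" for u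
        using B(2)[of u] B(3) mult_right_mono[of B "B + B'" "norm u"] by auto
      show "exp (M1 * (cmod \<tau> + 2)) * ((B + B') * (exp (M1 * 4) * exp (M2 * (C * cmod \<tau> + D + 2)))) \<le> K * exp (M * cmod \<tau>)"
        using eq by simp
    qed (use B in auto)
    moreover have "norm (r (torus_element (- ?w)) (r (unipotent ?L) (r S' (r (unipotent (- \<tau>)) v)))) \<le> K * exp (M * cmod \<tau>) * norm v"
    proof (rule chain)
      show "norm (r (unipotent (- \<tau>)) v) \<le> exp (M1 * (cmod \<tau> + 2)) * norm v" using M1(2)[of "- \<tau>"] by simp
      show "norm (r S' u) \<le> (B + B') * norm u" for u
        using B(4)[of u] B(1) mult_right_mono[of B' "B + B'" "norm u"] by auto
      show "norm (r (unipotent ?L) u) \<le> exp (M1 * 4) * norm u" for u by (rule step[OF M1(2) L]) simp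
      show "norm (r (torus_element (- ?w)) u) \<le> exp (M2 * (C * cmod \<tau> + D + 2)) * norm u" for u
        by (rule step[OF M2(2)]) (use w in simp_all)
      show "exp (M2 * (C * cmod \<tau> + D + 2)) * (exp (M1 * 4) * ((B + B') * exp (M1 * (cmod \<tau> + 2)))) \<le> K * exp (M * cmod \<tau>)"
        using eq by (simp add: mult_ac)
    qed (use B in auto)
    ultimately show ?thesis
      unfolding modular_frame_factors S_def[symmetric] S'_def[symmetric] by (simp add: r_mult U S SL_mult)
  qed
  have "K \<ge> 0" using B by (simp add: K_def)
  then show ?thesis using main by blast
qed

lemma modular_frame_growth:
  assumes "cusp_growth f"
  shows "cusp_growth (\<lambda>\<tau>. r (modular_frame \<tau>) (f \<tau>))" "cusp_growth (\<lambda>\<tau>. r (modular_coframe \<tau>) (f \<tau>))"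
proof -
  obtain C M Y where C: "C \<ge> 0" "\<And>\<tau> v. Im \<tau> > Y \<Longrightarrow> norm (r (modular_frame \<tau>) v) \<le> C * exp (M * cmod \<tau>) * norm v \<and>
     norm (r (modular_coframe \<tau>) v) \<le> C * exp (M * cmod \<tau>) * norm v"
    using modular_frame_bound by blast
  obtain C' M' Y' where C': "\<And>\<tau>. \<tau> \<in> upper_half_plane \<Longrightarrow> Im \<tau> > Y' \<Longrightarrow> norm (f \<tau>) \<le> C' * exp (M' * cmod \<tau>)"
    using assms unfolding cusp_growth_def by blast
  have "norm (r (modular_frame \<tau>) (f \<tau>)) \<le> (C * C') * exp ((M + M') * cmod \<tau>) \<and>
      norm (r (modular_coframe \<tau>) (f \<tau>)) \<le> (C * C') * exp ((M + M') * cmod \<tau>)"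
    if t: "\<tau> \<in> upper_half_plane" "Im \<tau> > max Y Y'" for \<tau>
  proof -
    have "C * exp (M * cmod \<tau>) * norm (f \<tau>) \<le> C * exp (M * cmod \<tau>) * (C' * exp (M' * cmod \<tau>))"
      using C'[OF t(1)] t(2) C(1) by (intro mult_left_mono) auto
    also have "\<dots> = (C * C') * exp ((M + M') * cmod \<tau>)" by (simp add: exp_add distrib_right)
    finally show ?thesis using C(2)[of \<tau> "f \<tau>"] t(2) by auto
  qed
  then show "cusp_growth (\<lambda>\<tau>. r (modular_frame \<tau>) (f \<tau>))" "cusp_growth (\<lambda>\<tau>. r (modular_coframe \<tau>) (f \<tau>))"
    unfolding cusp_growth_def by blast+
qed

lemma complex_differentiable_modular_frame:
  assumes t: "\<tau> \<in> upper_half_plane"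
  shows "complex_differentiable_at (*) smul (\<lambda>\<tau>. r (modular_frame \<tau>) v) \<tau>"
    "complex_differentiable_at (*) smul (\<lambda>\<tau>. r (modular_coframe \<tau>) v) \<tau>"
proof -
  note hol = eta_sq_holomorphic eta_log_deriv_holomorphic
  show "complex_differentiable_at (*) smul (\<lambda>\<tau>. r (modular_frame \<tau>) v) \<tau>"
    unfolding modular_frame_def
    by (intro complex_differentiable_r holomorphic_intros hol modular_frame_SL2(1)[unfolded modular_frame_def] t) simp_all
  show "complex_differentiable_at (*) smul (\<lambda>\<tau>. r (modular_coframe \<tau>) v) \<tau>"
    unfolding modular_coframe_def
    by (intro complex_differentiable_r holomorphic_intros hol modular_frame_SL2(2)[unfolded modular_coframe_def] t) simp_all
qed

lemma r_frame_inverse: "r (modular_coframe \<tau>) (r (modular_frame \<tau>) v) = v" "r (modular_frame \<tau>) (r (modular_coframe \<tau>) v) = v"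
  using r_mult[OF modular_frame_SL2(2,1), of \<tau> \<tau> v] r_mult[OF modular_frame_SL2, of \<tau> \<tau> v]
  by (simp_all add: modular_frame_inverse r_one)

lemma map_matrix_SL: "\<gamma> \<in> modular_commutator \<Longrightarrow> map_matrix of_int \<gamma> \<in> SL"
proof -
  assume "\<gamma> \<in> modular_commutator"
  then obtain a b c d where \<gamma>: "\<gamma> = mat2 a b c d" "a * d - b * c = 1" using SL2_cases modular_commutator_in_SL2Z by blast
  have "map_matrix of_int \<gamma> = mat2 (of_int a) (of_int b) (of_int c) (of_int d :: complex)" by (simp add: mat2_eq_iff \<gamma>)
  then show ?thesis using arg_cong[OF \<gamma>(2), of complex_of_int] by (simp add: mat2_SL2_iff)
qed

lemma r_frame_modular:
  assumes "\<gamma> \<in> modular_commutator" "\<tau> \<in> upper_half_plane"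
  shows "r (modular_frame (moebius \<gamma> \<tau>)) v = r (map_matrix of_int \<gamma>) (r (modular_frame \<tau>) v)"
    "r (modular_coframe (moebius \<gamma> \<tau>)) (r (map_matrix of_int \<gamma>) v) = r (modular_coframe \<tau>) v"
proof -
  show eq: "r (modular_frame (moebius \<gamma> \<tau>)) v = r (map_matrix of_int \<gamma>) (r (modular_frame \<tau>) v)" for v
    unfolding modular_frame_modular[OF assms] by (rule r_mult[OF map_matrix_SL[OF assms(1)] modular_frame_SL2(1)])
  show "r (modular_coframe (moebius \<gamma> \<tau>)) (r (map_matrix of_int \<gamma>) v) = r (modular_coframe \<tau>) v"
    using r_frame_inverse(1)[of "moebius \<gamma> \<tau>" "r (modular_coframe \<tau>) v"] by (simp add: eq r_frame_inverse)
qed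

end

section \<open>The tensor product\<close>

lemma lookup_scale [simp]: "Poly_Mapping.lookup (Poly_Mapping.map ((*) c) F) p = c * Poly_Mapping.lookup F p" for c :: complex
  by (simp add: Poly_Mapping.map.rep_eq when_def)

lemma module_poly_mapping: "Modules.module (\<lambda>c F :: 'a \<Rightarrow>\<^sub>0 complex. Poly_Mapping.map ((*) c) F)"
  by unfold_locales (auto intro!: poly_mapping_eqI simp: lookup_add algebra_simps)

lemma keys_scale_subset: "Poly_Mapping.keys (Poly_Mapping.map ((*) c) F) \<subseteq> Poly_Mapping.keys F" for c :: complex
  by (auto simp: in_keys_iff)

lemma sum_singles: "(\<Sum>p\<in>Poly_Mapping.keys F. Poly_Mapping.single p (Poly_Mapping.lookup F p)) = F"
  by (intro poly_mapping_eqI) (simp add: lookup_sum lookup_single when_def in_keys_iff)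

context complex_normed_space begin

text \<open>The linear extension of \<open>e\<close> to the free vector space.\<close>

definition lin :: "('a \<Rightarrow> 'g) \<Rightarrow> ('a \<Rightarrow>\<^sub>0 complex) \<Rightarrow> 'g" where
  "lin e F = (\<Sum>p\<in>Poly_Mapping.keys F. smul (Poly_Mapping.lookup F p) (e p))"

lemma lin_superset:
  "finite S \<Longrightarrow> Poly_Mapping.keys F \<subseteq> S \<Longrightarrow> lin e F = (\<Sum>p\<in>S. smul (Poly_Mapping.lookup F p) (e p))"
  unfolding lin_def by (rule sum.mono_neutral_left) (auto simp: in_keys_iff)

lemma lin_add: "lin e (F + G) = lin e F + lin e G"
proof -
  let ?S = "Poly_Mapping.keys F \<union> Poly_Mapping.keys G"
  have "lin e (F + G) = (\<Sum>p\<in>?S. smul (Poly_Mapping.lookup (F + G) p) (e p))" by (rule lin_superset) (simp_all add: keys_add)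
  also have "\<dots> = (\<Sum>p\<in>?S. smul (Poly_Mapping.lookup F p) (e p)) + (\<Sum>p\<in>?S. smul (Poly_Mapping.lookup G p) (e p))"
    by (simp add: lookup_add scale_left_distrib sum.distrib)
  also have "\<dots> = lin e F + lin e G" by (simp add: lin_superset[of ?S])
  finally show ?thesis .
qed

lemma lin_scale: "lin e (Poly_Mapping.map ((*) c) F) = smul c (lin e F)"
  by (subst lin_superset[OF finite_keys keys_scale_subset]) (simp add: lin_def scale_sum_right)

lemma lin_diff: "lin e (F - G) = lin e F - lin e G"
  using lin_add[of e "F - G" G] by simp

lemma lin_single: "lin e (Poly_Mapping.single p c) = smul c (e p)"
  by (cases "c = 0") (simp_all add: lin_def)

lemma lin_sum: "lin e (\<Sum>i\<in>I. F i) = (\<Sum>i\<in>I. lin e (F i))"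
proof -
  have "lin e 0 = 0" by (simp add: lin_def)
  then show ?thesis by (induction I rule: infinite_finite_induct) (simp_all add: lin_add)
qed

end

lemma modular_functions_zero: "0 \<in> modular_functions modular_commutator"
  using modular_functions_const[of 0] by (simp add: zero_fun_def)

lemma cusp_growth_sum: "(\<And>i. i \<in> I \<Longrightarrow> cusp_growth (f i)) \<Longrightarrow> cusp_growth (\<lambda>\<tau>. \<Sum>i\<in>I. f i \<tau>)"
proof (induction I rule: infinite_finite_induct)
  case (insert i I)
  then show ?case using cusp_growth_add[of "f i"] by simp
qed (simp_all add: cusp_growth_bounded[of 0 _ 0])

lemma cusp_growth_linear:
  assumes "cusp_growth g" "\<And>\<tau>. norm (h \<tau>) \<le> K * norm (g \<tau>)" "K \<ge> 0"
  shows "cusp_growth h"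
  using cusp_growth_mult[OF cusp_growth_bounded[of 0 "\<lambda>_. 1" 1] assms(1), of h K] assms(2,3) by simp

context holomorphic_lie_action begin

abbreviation "MF \<equiv> modular_functions modular_commutator"
abbreviation "fscale \<equiv> (\<lambda>c (f :: complex \<Rightarrow> complex) \<tau>. c * f \<tau>)"
abbreviation "relators \<equiv> tensor_relators smul fscale MF"
abbreviation "TV \<equiv> {F :: ('g \<times> (complex \<Rightarrow> complex)) \<Rightarrow>\<^sub>0 complex. Poly_Mapping.keys F \<subseteq> UNIV \<times> MF}"

interpretation P: Modules.module "\<lambda>c F :: ('g \<times> (complex \<Rightarrow> complex)) \<Rightarrow>\<^sub>0 complex. Poly_Mapping.map ((*) c) F"
  by (rule module_poly_mapping)

text \<open>The tensor of u and f is sent to the function with value f(\<tau>) times the image of u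
  under the frame at \<tau>. This is the inverse of the isomorphism to be constructed, on the level
  of representatives.\<close>

definition tensor_eval :: "(('g \<times> (complex \<Rightarrow> complex)) \<Rightarrow>\<^sub>0 complex) \<Rightarrow> complex \<Rightarrow> 'g" where
  "tensor_eval F \<tau> = lin (\<lambda>p. smul (snd p \<tau>) (r (modular_frame \<tau>) (fst p))) F"

lemma TV_subspace: "P.subspace TV"
proof -
  have "Poly_Mapping.keys (F + G) \<subseteq> Poly_Mapping.keys F \<union> Poly_Mapping.keys G" for F G :: "('g \<times> (complex \<Rightarrow> complex)) \<Rightarrow>\<^sub>0 complex"
    by (rule keys_add)
  then show ?thesis unfolding P.subspace_def using keys_scale_subset by fastforce
qed

lemma single_in_TV: "f \<in> MF \<Longrightarrow> Poly_Mapping.single (u, f) c \<in> TV"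
  by (cases "c = 0") simp_all

lemma relators_in_TV: "P.span relators \<subseteq> TV"
proof (rule P.span_minimal[OF _ TV_subspace])
  have add: "f + g \<in> MF" if "f \<in> MF" "g \<in> MF" for f g using modular_functions_add[OF that] by (simp add: plus_fun_def)
  show "relators \<subseteq> TV"
  proof
    fix F assume "F \<in> relators"
    then show "F \<in> TV" unfolding tensor_relators_def
      by (elim UnE CollectE exE conjE)
        (simp_all only: P.subspace_diff[OF TV_subspace] single_in_TV add modular_functions_scale)
  qed
qed

lemma tensor_eval_relators: "F \<in> P.span relators \<Longrightarrow> tensor_eval F \<tau> = 0"
proof -
  have "relators \<subseteq> {F. \<forall>\<tau>. tensor_eval F \<tau> = 0}"
    unfolding tensor_relators_def tensor_eval_def
    by (auto simp: lin_diff lin_single r_add r_smul modular_frame_SL2 scale_right_distrib scale_left_distrib mult_ac)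
  moreover have "P.subspace {F. \<forall>\<tau>. tensor_eval F \<tau> = 0}"
    unfolding P.subspace_def tensor_eval_def by (auto simp: lin_add lin_scale) (simp add: lin_def)
  ultimately show "F \<in> P.span relators \<Longrightarrow> tensor_eval F \<tau> = 0" using P.span_minimal by blast
qed

text \<open>Equality in the tensor product, as a relation between representatives.\<close>

definition trel :: "(('g \<times> (complex \<Rightarrow> complex)) \<Rightarrow>\<^sub>0 complex) \<Rightarrow> (('g \<times> (complex \<Rightarrow> complex)) \<Rightarrow>\<^sub>0 complex) \<Rightarrow> bool" where
  "trel F G \<longleftrightarrow> F - G \<in> P.span relators"

lemma trel_refl: "trel F F" by (simp add: trel_def P.span_zero)
lemma trel_sym: "trel F G \<Longrightarrow> trel G F" unfolding trel_def using P.span_neg[of "F - G"] by simp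
lemma trel_trans: "trel F G \<Longrightarrow> trel G H \<Longrightarrow> trel F H"
  unfolding trel_def using P.span_add[of "F - G" _ "G - H"] by simp
lemma trel_add: "trel F G \<Longrightarrow> trel F' G' \<Longrightarrow> trel (F + F') (G + G')"
  unfolding trel_def using P.span_add[of "F - G" _ "F' - G'"] by (simp add: algebra_simps)
lemma trel_sum: "(\<And>i. i \<in> I \<Longrightarrow> trel (F i) (G i)) \<Longrightarrow> trel (\<Sum>i\<in>I. F i) (\<Sum>i\<in>I. G i)"
  by (induction I rule: infinite_finite_induct) (simp_all add: trel_refl trel_add)

lemma
  assumes f: "f \<in> MF"
  shows trel_add_left: "trel (Poly_Mapping.single (u + v, f) 1) (Poly_Mapping.single (u, f) 1 + Poly_Mapping.single (v, f) 1)"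
    and trel_add_right: "g \<in> MF \<Longrightarrow> trel (Poly_Mapping.single (u, f + g) 1) (Poly_Mapping.single (u, f) 1 + Poly_Mapping.single (u, g) 1)"
    and trel_scale_left: "trel (Poly_Mapping.single (smul c u, f) 1) (Poly_Mapping.single (u, f) c)"
    and trel_scale_right: "trel (Poly_Mapping.single (u, fscale c f) 1) (Poly_Mapping.single (u, f) c)"
  unfolding trel_def diff_diff_eq[symmetric] using f
  by (intro P.span_base; unfold tensor_relators_def; blast)+

lemma trel_zero_right: "trel (Poly_Mapping.single (u, 0) 1) 0"
  using trel_scale_right[OF modular_functions_zero, of u 0] by (simp add: zero_fun_def)

lemma trel_expand_left:
  assumes f: "f \<in> MF" and "finite S"
  shows "trel (Poly_Mapping.single (\<Sum>b\<in>S. smul (k b) b, f) 1) (\<Sum>b\<in>S. Poly_Mapping.single (b, fscale (k b) f) 1)"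
  using assms(2)
proof (induction S rule: finite_induct)
  case empty
  show ?case using trel_scale_left[OF f, of 0 0] by simp
next
  case (insert b S)
  have "trel (Poly_Mapping.single (smul (k b) b, f) 1) (Poly_Mapping.single (b, fscale (k b) f) 1)"
    using trel_trans[OF trel_scale_left[OF f] trel_sym[OF trel_scale_right[OF f]]] .
  then show ?case using trel_trans[OF trel_add_left[OF f] trel_add[OF _ insert.IH]] insert.hyps by simp
qed

text \<open>Vectors are expanded in the basis and the coefficients are moved to the functions, so
  that one modular function is left for each basis vector.\<close>

lemma tensor_normal_form:
  assumes "F \<in> TV"
  shows "\<exists>g. (\<forall>b. g b \<in> MF) \<and> trel F (\<Sum>b\<in>lbasis. Poly_Mapping.single (b, g b) 1)"
proof -
  define Q where "Q F \<longleftrightarrow> (\<exists>g. (\<forall>b. g b \<in> MF) \<and> trel F (\<Sum>b\<in>lbasis. Poly_Mapping.single (b, g b) 1))"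
    for F :: "('g \<times> (complex \<Rightarrow> complex)) \<Rightarrow>\<^sub>0 complex"
  have Q0: "Q 0" unfolding Q_def
    using trel_sym[OF trel_sum[of lbasis "\<lambda>b. Poly_Mapping.single (b, 0) 1" "\<lambda>_. 0"]] trel_zero_right modular_functions_zero
    by (intro exI[of _ "\<lambda>_. 0"]) simp
  have Q_add: "Q (F + G)" if FG: "Q F" "Q G" for F G
  proof -
    obtain g where g: "\<And>b. g b \<in> MF" "trel F (\<Sum>b\<in>lbasis. Poly_Mapping.single (b, g b) 1)" using FG(1) Q_def by blast
    obtain h where h: "\<And>b. h b \<in> MF" "trel G (\<Sum>b\<in>lbasis. Poly_Mapping.single (b, h b) 1)" using FG(2) Q_def by blast
    have "trel (\<Sum>b\<in>lbasis. Poly_Mapping.single (b, g b + h b) 1) (\<Sum>b\<in>lbasis. Poly_Mapping.single (b, g b) 1 + Poly_Mapping.single (b, h b) 1)"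
      by (intro trel_sum trel_add_right g h)
    then have "trel (F + G) (\<Sum>b\<in>lbasis. Poly_Mapping.single (b, g b + h b) 1)"
      using trel_trans[OF trel_add[OF g(2) h(2)]] trel_sym by (simp add: sum.distrib)
    moreover have "g b + h b \<in> MF" for b using modular_functions_add[OF g(1) h(1)] by (simp add: plus_fun_def)
    ultimately show ?thesis unfolding Q_def by (intro exI[of _ "\<lambda>b. g b + h b"]) simp
  qed
  have Q_single: "Q (Poly_Mapping.single (u, f) c)" if f: "f \<in> MF" for u f c
  proof -
    have cf: "fscale c f \<in> MF" by (rule modular_functions_scale[OF f])
    have "trel (Poly_Mapping.single (u, f) c) (Poly_Mapping.single (u, fscale c f) 1)"
      by (rule trel_sym[OF trel_scale_right[OF f]])
    from trel_trans[OF this] trel_expand_left[OF cf lbasis(1), of "\<lambda>b. lcoord b u"]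
    have "trel (Poly_Mapping.single (u, f) c) (\<Sum>b\<in>lbasis. Poly_Mapping.single (b, fscale (lcoord b u) (fscale c f)) 1)"
      unfolding lcoord_sum by blast
    then show ?thesis unfolding Q_def using modular_functions_scale[OF cf]
      by (intro exI[of _ "\<lambda>b. fscale (lcoord b u) (fscale c f)"]) simp
  qed
  have "Q (\<Sum>p\<in>I. Poly_Mapping.single p (Poly_Mapping.lookup F p))" if "I \<subseteq> UNIV \<times> MF" for I
    using that by (induction I rule: infinite_finite_induct) (auto simp: Q0 intro!: Q_add Q_single)
  from this[of "Poly_Mapping.keys F"] assms show ?thesis
    unfolding Q_def by (simp add: sum_singles)
qed

text \<open>In normal form, the evaluation is the frame applied to the combination of basis vectors
  with coefficients g_b(\<tau>). The frame is invertible and the basis independent, so every g_b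
  vanishes.\<close>

lemma tensor_eval_kernel:
  assumes F: "F \<in> TV" and 0: "\<And>\<tau>. tensor_eval F \<tau> = 0"
  shows "F \<in> P.span relators"
proof -
  obtain g where g: "\<And>b. g b \<in> MF" "trel F (\<Sum>b\<in>lbasis. Poly_Mapping.single (b, g b) 1)" using tensor_normal_form[OF F] by blast
  have "g b \<tau> = 0" if b: "b \<in> lbasis" for b \<tau>
  proof -
    have "0 = tensor_eval (\<Sum>b\<in>lbasis. Poly_Mapping.single (b, g b) 1) \<tau>"
      using tensor_eval_relators[OF g(2)[unfolded trel_def], of \<tau>] 0[of \<tau>] by (simp add: tensor_eval_def lin_diff)
    also have "\<dots> = r (modular_frame \<tau>) (\<Sum>b\<in>lbasis. smul (g b \<tau>) b)"
      by (simp add: tensor_eval_def lin_sum lin_single r_sum r_smul modular_frame_SL2)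
    finally have "(\<Sum>b\<in>lbasis. smul (g b \<tau>) b) = 0"
      using r_frame_inverse(1)[of \<tau> "\<Sum>b\<in>lbasis. smul (g b \<tau>) b"] r_zero[OF modular_frame_SL2(2)] by simp
    then show ?thesis using independentD[OF lbasis(2) lbasis(1) subset_refl _ b, of "\<lambda>b. g b \<tau>"] by simp
  qed
  then have "g b = 0" if "b \<in> lbasis" for b using that by (auto simp: fun_eq_iff)
  then have "trel (\<Sum>b\<in>lbasis. Poly_Mapping.single (b, g b) 1) 0"
    using trel_sum[of lbasis "\<lambda>b. Poly_Mapping.single (b, g b) 1" "\<lambda>_. 0"] trel_zero_right by simp
  from trel_trans[OF g(2) this] show ?thesis by (simp add: trel_def)
qed

text \<open>Classes of tensors are fibres of the evaluation, so operations on classes can be checked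
  on functions.\<close>

lemma tensor_class_eval:
  assumes "F \<in> TV"
  shows "tensor_class smul fscale MF F = {G \<in> TV. tensor_eval G = tensor_eval F}"
proof (intro equalityI subsetI)
  fix G assume "G \<in> tensor_class smul fscale MF F"
  then have s: "G - F \<in> P.span relators" by (simp add: tensor_class_def)
  then have "G - F \<in> TV" using relators_in_TV by blast
  then have "G \<in> TV" using P.subspace_add[OF TV_subspace _ assms] by fastforce
  moreover have "tensor_eval G \<tau> = tensor_eval F \<tau>" for \<tau>
    using tensor_eval_relators[OF s, of \<tau>] by (simp add: tensor_eval_def lin_diff)
  ultimately show "G \<in> {G \<in> TV. tensor_eval G = tensor_eval F}" by auto
next
  fix G assume G: "G \<in> {G \<in> TV. tensor_eval G = tensor_eval F}"
  then have "G - F \<in> TV" using P.subspace_diff[OF TV_subspace _ assms] by blast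
  moreover have "tensor_eval (G - F) \<tau> = 0" for \<tau>
  proof -
    have "tensor_eval G \<tau> = tensor_eval F \<tau>" using G by simp
    then show ?thesis by (simp add: tensor_eval_def lin_diff)
  qed
  ultimately have "G - F \<in> P.span relators" by (rule tensor_eval_kernel)
  then show "G \<in> tensor_class smul fscale MF F" by (simp add: tensor_class_def)
qed

lemma bracket_zero: "bracket 0 v = 0" "bracket v 0 = 0"
  using bracket_smul_left[of 0 0 v] bracket_smul_right[of v 0 0] by simp_all

lemma bracket_sum: "bracket (\<Sum>i\<in>I. f i) (\<Sum>j\<in>J. g j) = (\<Sum>i\<in>I. \<Sum>j\<in>J. bracket (f i) (g j))"
proof -
  have L: "bracket (\<Sum>i\<in>I. f i) v = (\<Sum>i\<in>I. bracket (f i) v)" for v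
    by (induction I rule: infinite_finite_induct) (simp_all add: bracket_zero bracket_add_left)
  have R: "bracket u (\<Sum>j\<in>J. g j) = (\<Sum>j\<in>J. bracket u (g j))" for u
    by (induction J rule: infinite_finite_induct) (simp_all add: bracket_zero bracket_add_right)
  show ?thesis unfolding L unfolding R ..
qed

text \<open>The frame acts by automorphisms of the Lie algebra, so it commutes with the pointwise
  bracket.\<close>

lemma free_bracket_eval: "tensor_eval (free_bracket bracket F G) \<tau> = bracket (tensor_eval F \<tau>) (tensor_eval G \<tau>)"
  unfolding tensor_eval_def free_bracket_def lin_sum lin_single lin_def[of _ F] lin_def[of _ G] bracket_sum
  by (intro sum.cong refl) (simp add: bracket_smul_left bracket_smul_right r_bracket modular_frame_SL2 mult_ac)

lemma free_bracket_in: "F \<in> TV \<Longrightarrow> G \<in> TV \<Longrightarrow> free_bracket bracket F G \<in> TV"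
proof -
  have mult: "f * g \<in> MF" if "f \<in> MF" "g \<in> MF" for f g using modular_functions_mult[OF that] by (simp add: times_fun_def)
  have "snd p * snd q \<in> MF" if "F \<in> TV" "G \<in> TV" "p \<in> Poly_Mapping.keys F" "q \<in> Poly_Mapping.keys G" for p q
  proof -
    have "p \<in> UNIV \<times> MF" "q \<in> UNIV \<times> MF" using that by blast+
    then show ?thesis by (simp add: mem_Times_iff mult)
  qed
  then show "F \<in> TV \<Longrightarrow> G \<in> TV \<Longrightarrow> free_bracket bracket F G \<in> TV"
    unfolding free_bracket_def by (intro P.subspace_sum[OF TV_subspace] single_in_TV) blast
qed

section \<open>The isomorphism of Lie algebras\<close>

lemma equivariant_carrier:
  assumes rho: "\<forall>\<gamma>\<in>modular_commutator. \<rho> \<gamma> = r (map_matrix of_int \<gamma>)"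
  shows "f \<in> carrier (equivariant_lie_algebra smul bracket modular_commutator \<rho>) \<longleftrightarrow>
     (\<forall>\<tau>. \<tau> \<notin> upper_half_plane \<longrightarrow> f \<tau> = 0) \<and>
     (\<forall>\<tau>\<in>upper_half_plane. complex_differentiable_at (*) smul f \<tau>) \<and>
     (\<forall>\<gamma>\<in>modular_commutator. \<forall>\<tau>\<in>upper_half_plane. f (moebius \<gamma> \<tau>) = r (map_matrix of_int \<gamma>) (f \<tau>)) \<and> cusp_growth f"
proof -
  have "(\<forall>s. exponential_growth_at s f) \<longleftrightarrow> cusp_growth f"
    if "\<forall>\<gamma>\<in>modular_commutator. \<forall>\<tau>\<in>upper_half_plane. f (moebius \<gamma> \<tau>) = r (map_matrix of_int \<gamma>) (f \<tau>)"
  proof (rule exponential_growth_all_cusps)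
    \<comment> \<open>A single automorphism is a bounded operator, so equivariance distorts norms by
      at most a constant factor for each \<gamma>.\<close>
    fix \<gamma> assume g: "\<gamma> \<in> modular_commutator"
    then show "\<exists>K. \<forall>\<tau>\<in>upper_half_plane. norm (f (moebius \<gamma> \<tau>)) \<le> K * norm (f \<tau>)"
      using that r_bounded[OF map_matrix_SL[OF g]] by fastforce
  qed
  then show ?thesis using rho unfolding equivariant_lie_algebra_def by auto
qed

theorem lie_algebra_iso:
  assumes rho: "\<forall>\<gamma>\<in>modular_commutator. \<rho> \<gamma> = r (map_matrix of_int \<gamma>)"
  shows "\<exists>\<phi>. \<phi> \<in> lie_iso (equivariant_lie_algebra smul bracket modular_commutator \<rho>)
           (tensor_lie_algebra smul bracket fscale MF)"
proof -
  let ?E = "equivariant_lie_algebra smul bracket modular_commutator \<rho>"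
  have ev_in: "tensor_eval F \<in> carrier ?E" if F: "F \<in> TV" for F
    unfolding equivariant_carrier[OF rho]
  proof (intro conjI allI ballI impI)
    have key: "snd p \<in> MF" if "p \<in> Poly_Mapping.keys F" for p using that F by auto
    show "tensor_eval F \<tau> = 0" if "\<tau> \<notin> upper_half_plane" for \<tau>
      unfolding tensor_eval_def lin_def using key that by (intro sum.neutral) (simp add: modular_functions_iff)
    show "complex_differentiable_at (*) smul (tensor_eval F) \<tau>" if t: "\<tau> \<in> upper_half_plane" for \<tau>
      unfolding tensor_eval_def[abs_def] lin_def
    proof (intro complex_differentiable_sum complex_differentiable_smul complex_differentiable_modular_frame t field_differentiable_const)
      fix p assume "p \<in> Poly_Mapping.keys F"
      then show "snd p field_differentiable at \<tau>"
        using key[of p] t open_upper_half_plane unfolding modular_functions_iff by (meson holomorphic_on_imp_differentiable_at)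
    qed
    show "tensor_eval F (moebius \<gamma> \<tau>) = r (map_matrix of_int \<gamma>) (tensor_eval F \<tau>)"
      if g: "\<gamma> \<in> modular_commutator" and t: "\<tau> \<in> upper_half_plane" for \<gamma> \<tau>
      unfolding tensor_eval_def lin_def using key g t
      by (simp add: r_sum map_matrix_SL r_smul r_frame_modular modular_functions_iff)
    have "cusp_growth (\<lambda>\<tau>. smul (Poly_Mapping.lookup F p) (smul (snd p \<tau>) (r (modular_frame \<tau>) (fst p))))"
      if p: "p \<in> Poly_Mapping.keys F" for p
    proof -
      have "cusp_growth (snd p)" using key[OF p] by (simp add: modular_functions_iff)
      moreover have "cusp_growth (\<lambda>\<tau>. r (modular_frame \<tau>) (fst p))"
        using modular_frame_growth(1)[of "\<lambda>_. fst p"] cusp_growth_bounded[of 0 "\<lambda>_. fst p"] by blast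
      ultimately show ?thesis
        by (rule cusp_growth_mult[where K = "cmod (Poly_Mapping.lookup F p)"]) (simp_all add: norm_smul norm_mult)
    qed
    then show "cusp_growth (tensor_eval F)" unfolding tensor_eval_def[abs_def] lin_def by (rule cusp_growth_sum)
  qed
  have ev_surj: "\<exists>F\<in>TV. tensor_eval F = f" if f: "f \<in> carrier ?E" for f
  proof -
    note f = f[unfolded equivariant_carrier[OF rho]]
    \<comment> \<open>Undoing the frame makes f invariant, so the coordinates of \<open>h\<close> in
      the basis are modular functions.\<close>
    define h where "h \<tau> = r (modular_coframe \<tau>) (f \<tau>)" for \<tau>
    define g where "g b \<tau> = lcoord b (h \<tau>)" for b \<tau>
    have h_eq: "h = (\<lambda>\<tau>. \<Sum>b\<in>lbasis. smul (lcoord b (f \<tau>)) (r (modular_coframe \<tau>) b))"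
    proof
      fix \<tau>
      have "h \<tau> = r (modular_coframe \<tau>) (\<Sum>b\<in>lbasis. smul (lcoord b (f \<tau>)) b)" unfolding lcoord_sum h_def ..
      then show "h \<tau> = (\<Sum>b\<in>lbasis. smul (lcoord b (f \<tau>)) (r (modular_coframe \<tau>) b))"
        by (simp add: r_sum r_smul modular_frame_SL2)
    qed
    have h_diff: "complex_differentiable_at (*) smul h \<tau>" if "\<tau> \<in> upper_half_plane" for \<tau>
      unfolding h_eq using that f
      by (intro complex_differentiable_sum complex_differentiable_smul complex_differentiable_modular_frame
          complex_differentiable_lcoord) auto
    have "cusp_growth h" unfolding h_def[abs_def] using f by (intro modular_frame_growth) auto
    obtain K where K: "K \<ge> 0" "\<And>b v. b \<in> lbasis \<Longrightarrow> cmod (lcoord b v) \<le> K * norm v" using lcoord_bound by blast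
    have g: "g b \<in> MF" if b: "b \<in> lbasis" for b
      unfolding modular_functions_iff
    proof (intro conjI allI ballI impI)
      show "g b \<tau> = 0" if "\<tau> \<notin> upper_half_plane" for \<tau>
        using f that lcoord_smul[of b 0 0] by (simp add: g_def h_def r_zero modular_frame_SL2)
      show "g b holomorphic_on upper_half_plane"
        unfolding g_def[abs_def] holomorphic_on_def
        using complex_differentiable_lcoord[OF h_diff b] field_differentiable_at_within by blast
      show "g b (moebius \<gamma> \<tau>) = g b \<tau>" if "\<gamma> \<in> modular_commutator" "\<tau> \<in> upper_half_plane" for \<gamma> \<tau>
        using f that by (simp add: g_def h_def r_frame_modular)
      show "cusp_growth (g b)"
        by (rule cusp_growth_linear[OF \<open>cusp_growth h\<close>, of _ K]) (simp_all add: g_def K b)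
    qed
    have "tensor_eval (\<Sum>b\<in>lbasis. Poly_Mapping.single (b, g b) 1) \<tau> = f \<tau>" for \<tau>
    proof -
      have "tensor_eval (\<Sum>b\<in>lbasis. Poly_Mapping.single (b, g b) 1) \<tau> = r (modular_frame \<tau>) (\<Sum>b\<in>lbasis. smul (lcoord b (h \<tau>)) b)"
        by (simp add: tensor_eval_def lin_sum lin_single r_sum r_smul modular_frame_SL2 g_def)
      then show ?thesis unfolding lcoord_sum by (simp add: h_def r_frame_inverse)
    qed
    moreover have "(\<Sum>b\<in>lbasis. Poly_Mapping.single (b, g b) 1) \<in> TV"
      by (intro P.subspace_sum[OF TV_subspace] single_in_TV g)
    ultimately show ?thesis by blast
  qed
  define \<phi> where "\<phi> f = {G \<in> TV. tensor_eval G = f}" for f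
  have cls: "tensor_class smul fscale MF F = \<phi> (tensor_eval F)" if "F \<in> TV" for F
    using tensor_class_eval[OF that] by (simp add: \<phi>_def)
  \<comment> \<open>The operations on tensors are unions over all representatives. All the classes
    in such a union coincide, and surjectivity of the evaluation shows that the union is not
    empty.\<close>
  have union: "(\<Union>F\<in>\<phi> f. \<Union>G\<in>\<phi> g. tensor_class smul fscale MF (op F G)) = \<phi> k"
    if fg: "f \<in> carrier ?E" "g \<in> carrier ?E" and op: "\<And>F G. F \<in> TV \<Longrightarrow> G \<in> TV \<Longrightarrow> op F G \<in> TV"
      "\<And>F G. tensor_eval F = f \<Longrightarrow> tensor_eval G = g \<Longrightarrow> tensor_eval (op F G) = k" for f g k op
  proof -
    have "tensor_class smul fscale MF (op F G) = \<phi> k" if FG: "F \<in> \<phi> f" "G \<in> \<phi> g" for F G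
    proof -
      have "F \<in> TV" "G \<in> TV" "tensor_eval F = f" "tensor_eval G = g" using FG by (simp_all add: \<phi>_def)
      then show ?thesis using cls[OF op(1)] op(2) by simp
    qed
    moreover have "\<phi> f \<noteq> {}" "\<phi> g \<noteq> {}" using ev_surj[OF fg(1)] ev_surj[OF fg(2)] unfolding \<phi>_def by blast+
    ultimately show ?thesis by simp
  qed
  have "\<phi> \<in> lie_iso ?E (tensor_lie_algebra smul bracket fscale MF)"
    unfolding lie_iso_def
  proof (intro CollectI conjI ballI allI)
    show "bij_betw \<phi> (carrier ?E) (carrier (tensor_lie_algebra smul bracket fscale MF))"
    proof (rule bij_betw_imageI)
      show "inj_on \<phi> (carrier ?E)"
      proof (rule inj_onI)
        fix f g assume f: "f \<in> carrier ?E" and eq: "\<phi> f = \<phi> g"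
        obtain F where "F \<in> TV" "tensor_eval F = f" using ev_surj[OF f] by blast
        then have "F \<in> \<phi> g" using eq[symmetric] by (simp add: \<phi>_def)
        with \<open>tensor_eval F = f\<close> show "f = g" by (simp add: \<phi>_def)
      qed
      have "carrier (tensor_lie_algebra smul bracket fscale MF) = \<phi> ` tensor_eval ` TV"
        unfolding tensor_lie_algebra_def partial_object.simps image_image by (rule image_cong[OF refl cls])
      moreover have "tensor_eval ` TV = carrier ?E" using ev_in ev_surj by blast
      ultimately show "\<phi> ` carrier ?E = carrier (tensor_lie_algebra smul bracket fscale MF)" by simp
    qed
    fix f g assume fg: "f \<in> carrier ?E" "g \<in> carrier ?E"
    show "\<phi> (lie_add ?E f g) = lie_add (tensor_lie_algebra smul bracket fscale MF) (\<phi> f) (\<phi> g)"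
      unfolding equivariant_lie_algebra_def tensor_lie_algebra_def lie_structure.simps
    proof (rule union[OF fg, symmetric])
      show "F + G \<in> TV" if "F \<in> TV" "G \<in> TV" for F G using that by (rule P.subspace_add[OF TV_subspace])
    qed (auto simp: tensor_eval_def[abs_def] lin_add)
    show "\<phi> (lie_bracket ?E f g) = lie_bracket (tensor_lie_algebra smul bracket fscale MF) (\<phi> f) (\<phi> g)"
      unfolding equivariant_lie_algebra_def tensor_lie_algebra_def lie_structure.simps
    proof (rule union[OF fg, symmetric])
      show "free_bracket bracket F G \<in> TV" if "F \<in> TV" "G \<in> TV" for F G using that by (rule free_bracket_in)
    qed (auto simp: free_bracket_eval)
  next
    fix c f assume f: "f \<in> carrier ?E"
    have "\<phi> f \<noteq> {}" using ev_surj f unfolding \<phi>_def by blast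
    moreover have "tensor_class smul fscale MF (Poly_Mapping.map ((*) c) F) = \<phi> (\<lambda>\<tau>. smul c (f \<tau>))" if "F \<in> \<phi> f" for F
    proof -
      have F: "F \<in> TV" "tensor_eval F = f" using that by (simp_all add: \<phi>_def)
      have "tensor_eval (Poly_Mapping.map ((*) c) F) = (\<lambda>\<tau>. smul c (f \<tau>))"
        unfolding F(2)[symmetric] by (simp add: tensor_eval_def[abs_def] lin_scale)
      then show ?thesis using cls[OF P.subspace_scale[OF TV_subspace F(1)]] by simp
    qed
    ultimately show "\<phi> (lie_scale ?E c f) = lie_scale (tensor_lie_algebra smul bracket fscale MF) c (\<phi> f)"
      by (simp add: equivariant_lie_algebra_def tensor_lie_algebra_def)
  qed
  then show ?thesis by blast
qed

end

theorem theorem8p3: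
  fixes smul :: "complex \<Rightarrow> 'g::real_normed_vector \<Rightarrow> 'g"
    and bracket :: "'g \<Rightarrow> 'g \<Rightarrow> 'g"
    and \<rho> :: "int ^ 2 ^ 2 \<Rightarrow> 'g \<Rightarrow> 'g"
    and \<rho>bar :: "complex ^ 2 ^ 2 \<Rightarrow> 'g \<Rightarrow> 'g"
  assumes "simple_fd_complex_lie_algebra smul bracket"
    and "\<rho>bar \<in> hom SL2C (lie_aut_group smul bracket)"
    and "holomorphic_on_SL2C smul \<rho>bar"
    and "\<forall>\<gamma>\<in>modular_commutator. \<rho> \<gamma> = \<rho>bar (map_matrix of_int \<gamma>)"
  shows "(\<exists>\<phi>. \<phi> \<in> lie_iso (equivariant_lie_algebra smul bracket modular_commutator \<rho>)
                   (tensor_lie_algebra smul bracket (\<lambda>c f \<tau>. c * f \<tau>)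
                      (modular_functions modular_commutator))) \<and>
    (\<exists>\<omega> \<Lambda> \<Phi> x y \<psi>.
       \<omega> \<noteq> 0 \<and> \<Lambda> = hexagonal_lattice \<omega> \<and> weierstrass_g2 \<Lambda> = 0 \<and> weierstrass_g3 \<Lambda> = 1 \<and>
       (\<forall>s. cusp_point modular_commutator s = UNIV) \<and>
       biholomorphic_to_torus modular_commutator \<Lambda> \<Phi> \<and>
       \<Phi> (Inr (cusp_point modular_commutator None)) = torus_point \<Lambda> 0 \<and>
       x \<in> modular_functions modular_commutator \<and> y \<in> modular_functions modular_commutator \<and>
       (\<forall>\<tau>\<in>upper_half_plane. \<forall>z\<in>\<Phi> (Inl (orbit_point modular_commutator \<tau>)).
          x \<tau> = weierstrass_p \<Lambda> z \<and> y \<tau> = deriv (weierstrass_p \<Lambda>) z) \<and>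
       \<psi> \<in> ring_iso weierstrass_coordinate_ring (modular_function_ring modular_commutator) \<and>
       (\<forall>p. \<psi> (weierstrass_ideal +>\<^bsub>ring_of_type_algebra\<^esub> p) = eval_xy x y p))"
proof
  interpret simple_fd_complex_lie_algebra smul bracket by (rule assms(1))
  interpret holomorphic_lie_action smul bracket \<rho>bar
    by unfold_locales (rule assms(2), rule assms(3))
  show "\<exists>\<phi>. \<phi> \<in> lie_iso (equivariant_lie_algebra smul bracket modular_commutator \<rho>)
      (tensor_lie_algebra smul bracket (\<lambda>c f \<tau>. c * f \<tau>) (modular_functions modular_commutator))"
    by (rule lie_algebra_iso[OF assms(4)])
next
  obtain \<omega> where w: "\<omega> \<noteq> 0" "weierstrass_g3 (hexagonal_lattice \<omega>) = 1"
    using hexagonal_lattice_normalised by blast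
  obtain x y c hx hy where "modular_coordinates x y c hx hy" using modular_coordinates_exist by blast
  then interpret modular_uniformisation \<omega> x y c hx hy
    using w by (intro modular_uniformisation.intro normalised_hexagonal.intro hexagonal.intro normalised_hexagonal_axioms.intro)
  obtain \<psi> where \<psi>: "\<psi> \<in> ring_iso weierstrass_coordinate_ring (modular_function_ring modular_commutator)"
    "\<forall>p. \<psi> (weierstrass_ideal +>\<^bsub>ring_of_type_algebra\<^esub> p) = eval_xy x y p"
    using coordinate_ring_iso by blast
  have cusps: "\<forall>s. cusp_point modular_commutator s = UNIV" by (simp add: cusp_point_modular_commutator)
  have coords: "\<forall>\<tau>\<in>upper_half_plane. \<forall>z\<in>torus_map (Inl (orbit_point modular_commutator \<tau>)).
      x \<tau> = wp z \<and> y \<tau> = wp' z"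
    using torus_map_orbit by simp
  show "\<exists>\<omega> \<Lambda> \<Phi> x y \<psi>.
       \<omega> \<noteq> 0 \<and> \<Lambda> = hexagonal_lattice \<omega> \<and> weierstrass_g2 \<Lambda> = 0 \<and> weierstrass_g3 \<Lambda> = 1 \<and>
       (\<forall>s. cusp_point modular_commutator s = UNIV) \<and>
       biholomorphic_to_torus modular_commutator \<Lambda> \<Phi> \<and>
       \<Phi> (Inr (cusp_point modular_commutator None)) = torus_point \<Lambda> 0 \<and>
       x \<in> modular_functions modular_commutator \<and> y \<in> modular_functions modular_commutator \<and>
       (\<forall>\<tau>\<in>upper_half_plane. \<forall>z\<in>\<Phi> (Inl (orbit_point modular_commutator \<tau>)).
          x \<tau> = weierstrass_p \<Lambda> z \<and> y \<tau> = deriv (weierstrass_p \<Lambda>) z) \<and>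
       \<psi> \<in> ring_iso weierstrass_coordinate_ring (modular_function_ring modular_commutator) \<and>
       (\<forall>p. \<psi> (weierstrass_ideal +>\<^bsub>ring_of_type_algebra\<^esub> p) = eval_xy x y p)"
    by (intro exI[of _ \<omega>] exI[of _ \<Lambda>] exI[of _ torus_map] exI[of _ x] exI[of _ y] exI[of _ \<psi>] conjI
        w refl g2_eq cusps biholomorphic_torus_map torus_map_cusp x_modular_function y_modular_function coords \<psi>)
qed

end
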